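(* The problem C-$\langle \mathcal{W}_r \rightarrow \mathcal{T}_s \rangle$ is in $\mathsf{P}$: when the virtual graph is a wheel and the substrate graph is a tree, a minimum-cost feasible mapping (or the fact that none exists) can be computed in time $\mathcal{O}(n_r^2 n_s)$.
   Context: Uniform-demand Virtual Network Embedding (uniVNE). An instance consists of a virtual graph $\mathcal{G}_r=(V_r,E_r)$ (undirected, simple, connected, $n_r=|V_r|$ nodes) and a substrate graph $\mathcal{G}_s=(V_s,E_s)$ (undirected, simple, connected, $n_s=|V_s|$ nodes) with capacities $c(u)\in\mathbb{N}^+$ for $u\in V_s$ and $c(e)\in\mathbb{N}^+$ for $e\in E_s$. A mapping is a pair $m=(m_V,m_E)$ where $m_V:V_r\to V_s$ and $m_E$ assigns to each virtual edge $(\bar u,\bar v)\in E_r$ a loop-free path of $\mathcal{G}_s$ connecting $m_V(\bar u)$ and $m_V(\bar v)$ (the empty path if these coincide). The mapping is feasible if every $u\in V_s$ satisfies $|m_V^{-1}(u)|\le c(u)$ and every $e\in E_s$ belongs to at most $c(e)$ of the paths $m_E(\bar e)$. In C-uniVNE one is additionally given nonnegative integer costs $w(u)$, $u\in V_s$, and $w(e)$, $e\in E_s$ (and a budget $\Gamma$); the cost of $m$ is $\sum_{\bar u\in V_r} w(m_V(\bar u))+\sum_{\bar e\in E_r}\sum_{e\in m_E(\bar e)} w(e)$, and the task is to decide whether a feasible mapping of cost at most $\Gamma$ exists, equivalently to find a minimum-cost feasible mapping. A wheel consists of a cycle $\bar u_1,\dots,\bar u_n$ together with a center node $\bar u_c$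 adjacent to every $\bar u_i$. *)

theory Defs
  imports Main "HOL-Library.Discrete_Functions"
begin

section \<open>Undirected graphs\<close>

record 'a ugraph =
  verts :: "'a set"
  edges :: "'a set set"

definition simple_graph :: "'a ugraph \<Rightarrow> bool" where
  "simple_graph G \<longleftrightarrow> finite (verts G) \<and> (\<forall>e\<in>edges G. e \<subseteq> verts G \<and> card e = 2)"

definition path_edges :: "'a list \<Rightarrow> 'a set set" where
  "path_edges p = (\<lambda>(u, v). {u, v}) ` set (zip p (tl p))"

text \<open>Loop-free paths are given by their node sequence; a one-element list is the path without edges.\<close>

definition is_path :: "'a ugraph \<Rightarrow> 'a list \<Rightarrow> bool" where
  "is_path G p \<longleftrightarrow> p \<noteq> [] \<and> distinct p \<and> set p \<subseteq> verts G \<and> path_edges p \<subseteq> edges G"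

definition connected_graph :: "'a ugraph \<Rightarrow> bool" where
  "connected_graph G \<longleftrightarrow> verts G \<noteq> {} \<and>
     (\<forall>u\<in>verts G. \<forall>v\<in>verts G. \<exists>p. is_path G p \<and> hd p = u \<and> last p = v)"

definition cycle_edges :: "'a list \<Rightarrow> 'a set set" where
  "cycle_edges us = path_edges (us @ [hd us])"

definition acyclic_graph :: "'a ugraph \<Rightarrow> bool" where
  "acyclic_graph G \<longleftrightarrow> \<not> (\<exists>us. 3 \<le> length us \<and> distinct us \<and> cycle_edges us \<subseteq> edges G)"

definition is_tree :: "'a ugraph \<Rightarrow> bool" where
  "is_tree G \<longleftrightarrow> simple_graph G \<and> connected_graph G \<and> acyclic_graph G"

definition is_wheel :: "'a ugraph \<Rightarrow> bool" where
  "is_wheel G \<longleftrightarrow> (\<exists>c us. 3 \<le> length us \<and> distinct us \<and> c \<notin> set us \<and>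
     verts G = insert c (set us) \<and>
     edges G = cycle_edges us \<union> (\<lambda>u. {c, u}) ` set us)"


section \<open>Uniform-demand virtual network embedding with costs\<close>

record ('r, 's) univne =
  virtual :: "'r ugraph"
  substrate :: "'s ugraph"
  node_cap :: "'s \<Rightarrow> nat"
  edge_cap :: "'s set \<Rightarrow> nat"
  node_cost :: "'s \<Rightarrow> nat"
  edge_cost :: "'s set \<Rightarrow> nat"

definition valid_univne :: "('r, 's) univne \<Rightarrow> bool" where
  "valid_univne I \<longleftrightarrow>
     simple_graph (virtual I) \<and> connected_graph (virtual I) \<and>
     simple_graph (substrate I) \<and> connected_graph (substrate I) \<and>
     (\<forall>u\<in>verts (substrate I). 1 \<le> node_cap I u) \<and>
     (\<forall>e\<in>edges (substrate I). 1 \<le> edge_cap I e)"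

type_synonym ('r, 's) mapping = "('r \<Rightarrow> 's) \<times> ('r set \<Rightarrow> 's list)"

text \<open>For a virtual edge whose end nodes are mapped to the same substrate node \<open>x\<close>, the last
  condition and loop-freeness leave \<open>[x]\<close> as the only path.\<close>

definition is_mapping :: "('r, 's) univne \<Rightarrow> ('r, 's) mapping \<Rightarrow> bool" where
  "is_mapping I = (\<lambda>(mV, mE).
     mV ` verts (virtual I) \<subseteq> verts (substrate I) \<and>
     (\<forall>d\<in>edges (virtual I). is_path (substrate I) (mE d) \<and> {hd (mE d), last (mE d)} = mV ` d))"

definition feasible :: "('r, 's) univne \<Rightarrow> ('r, 's) mapping \<Rightarrow> bool" where
  "feasible I = (\<lambda>(mV, mE). is_mapping I (mV, mE) \<and>
     (\<forall>u\<in>verts (substrate I). card {v \<in> verts (virtual I). mV v = u} \<le> node_cap I u) \<and>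
     (\<forall>e\<in>edges (substrate I). card {d \<in> edges (virtual I). e \<in> path_edges (mE d)} \<le> edge_cap I e))"

definition mapping_cost :: "('r, 's) univne \<Rightarrow> ('r, 's) mapping \<Rightarrow> nat" where
  "mapping_cost I = (\<lambda>(mV, mE).
     (\<Sum>v\<in>verts (virtual I). node_cost I (mV v)) +
     (\<Sum>d\<in>edges (virtual I). \<Sum>e\<in>path_edges (mE d). edge_cost I e))"

definition min_cost_feasible :: "('r, 's) univne \<Rightarrow> ('r, 's) mapping \<Rightarrow> bool" where
  "min_cost_feasible I m \<longleftrightarrow>
     feasible I m \<and> (\<forall>m'. feasible I m' \<longrightarrow> mapping_cost I m \<le> mapping_cost I m')"


section \<open>Machine model\<close>

text \<open>Programs of a random access machine over the natural numbers, with addition and truncated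
  subtraction as the only arithmetic, written with structured control flow. The memory is a family
  of arrays. A program names finitely many of them, so that they can be interleaved in a single
  memory; a scalar variable is cell 0 of an array. Multiplication is left out so that the unit-cost
  measure remains polynomially related to bit complexity.\<close>

type_synonym memory = "nat \<Rightarrow> nat \<Rightarrow> nat"

datatype aexp = Const nat | Cell nat aexp | Plus aexp aexp | Minus aexp aexp

datatype bexp = Less aexp aexp | Not bexp | And bexp bexp

datatype com =
    Skip
  | Assign nat aexp aexp
  | Seq com com
  | If bexp com com
  | While bexp com

fun aval :: "aexp \<Rightarrow> memory \<Rightarrow> nat" where
  "aval (Const n) s = n"
| "aval (Cell x a) s = s x (aval a s)"
| "aval (Plus a b) s = aval a s + aval b s"
| "aval (Minus a b) s = aval a s - aval b s"

fun bval :: "bexp \<Rightarrow> memory \<Rightarrow> bool" where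
  "bval (Less a b) s \<longleftrightarrow> aval a s < aval b s"
| "bval (Not b) s \<longleftrightarrow> \<not> bval b s"
| "bval (And b c) s \<longleftrightarrow> bval b s \<and> bval c s"

text \<open>The parameter \<open>\<mu>\<close> is the charge for handling a number: constantly 1 for the uniform cost
  criterion, the bit length for the logarithmic cost criterion. Every subexpression, array indices
  included, is charged for its value.\<close>

fun atime :: "(nat \<Rightarrow> nat) \<Rightarrow> aexp \<Rightarrow> memory \<Rightarrow> nat" where
  "atime \<mu> (Const n) s = \<mu> n"
| "atime \<mu> (Cell x a) s = atime \<mu> a s + \<mu> (aval (Cell x a) s)"
| "atime \<mu> (Plus a b) s = atime \<mu> a s + atime \<mu> b s + \<mu> (aval (Plus a b) s)"
| "atime \<mu> (Minus a b) s = atime \<mu> a s + atime \<mu> b s + \<mu> (aval (Minus a b) s)"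

fun btime :: "(nat \<Rightarrow> nat) \<Rightarrow> bexp \<Rightarrow> memory \<Rightarrow> nat" where
  "btime \<mu> (Less a b) s = atime \<mu> a s + atime \<mu> b s + 1"
| "btime \<mu> (Not b) s = btime \<mu> b s + 1"
| "btime \<mu> (And b c) s = btime \<mu> b s + btime \<mu> c s + 1"

text \<open>\<open>exec \<mu> c s t s'\<close>: started in memory \<open>s\<close>, \<open>c\<close> halts after time \<open>t\<close> in memory \<open>s'\<close>.\<close>

inductive exec :: "(nat \<Rightarrow> nat) \<Rightarrow> com \<Rightarrow> memory \<Rightarrow> nat \<Rightarrow> memory \<Rightarrow> bool" for \<mu> where
  Skip: "exec \<mu> Skip s 1 s"
| Assign: "exec \<mu> (Assign x i a) s (atime \<mu> i s + atime \<mu> a s + 1)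
     (s(x := (s x)(aval i s := aval a s)))"
| Seq: "exec \<mu> c s t s' \<Longrightarrow> exec \<mu> d s' t' s'' \<Longrightarrow> exec \<mu> (Seq c d) s (t + t') s''"
| IfTrue: "bval b s \<Longrightarrow> exec \<mu> c s t s' \<Longrightarrow> exec \<mu> (If b c d) s (btime \<mu> b s + t) s'"
| IfFalse: "\<not> bval b s \<Longrightarrow> exec \<mu> d s t s' \<Longrightarrow> exec \<mu> (If b c d) s (btime \<mu> b s + t) s'"
| WhileFalse: "\<not> bval b s \<Longrightarrow> exec \<mu> (While b c) s (btime \<mu> b s) s"
| WhileTrue: "bval b s \<Longrightarrow> exec \<mu> c s t s' \<Longrightarrow> exec \<mu> (While b c) s' t' s'' \<Longrightarrow>
     exec \<mu> (While b c) s (btime \<mu> b s + t + t') s''"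

inductive_cases SkipE: "exec \<mu> Skip s t s'"
inductive_cases AssignE: "exec \<mu> (Assign x i a) s t s'"
inductive_cases SeqE: "exec \<mu> (Seq c d) s t s'"
inductive_cases IfE: "exec \<mu> (If b c d) s t s'"
inductive_cases WhileE: "exec \<mu> (While b c) s t s'"

lemma exec_deterministic:
  "exec \<mu> c s t s' \<Longrightarrow> exec \<mu> c s u s'' \<Longrightarrow> u = t \<and> s'' = s'"
proof (induction arbitrary: u s'' rule: exec.induct)
  case Skip then show ?case by (auto elim: SkipE)
next
  case Assign then show ?case by (auto elim: AssignE)
next
  case Seq from Seq.prems show ?case by (rule SeqE) (use Seq.IH in blast)
next
  case IfTrue from IfTrue.prems show ?case by (rule IfE) (use IfTrue.IH IfTrue.hyps in blast)+
next
  case IfFalse from IfFalse.prems show ?case by (rule IfE) (use IfFalse.IH IfFalse.hyps in blast)+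
next
  case WhileFalse from WhileFalse.prems show ?case
    by (rule WhileE) (use WhileFalse.hyps in blast)+
next
  case WhileTrue from WhileTrue.prems show ?case
    by (rule WhileE) (use WhileTrue.IH WhileTrue.hyps in blast)+
qed

text \<open>Input and output are lists, stored in array 0 with their length in cell 0 of array 1.\<close>

definition input_memory :: "nat list \<Rightarrow> memory" where
  "input_memory xs = (\<lambda>x i.
     if x = 0 \<and> i < length xs then xs ! i
     else if x = 1 \<and> i = 0 then length xs
     else 0)"

definition output_list :: "memory \<Rightarrow> nat list" where
  "output_list s = map (s 0) [0..<s 1 0]"

definition computes_in :: "(nat \<Rightarrow> nat) \<Rightarrow> com \<Rightarrow> nat list \<Rightarrow> nat list \<Rightarrow> nat \<Rightarrow> bool" where
  "computes_in \<mu> c xs ys t \<longleftrightarrow> (\<exists>s. exec \<mu> c (input_memory xs) t s \<and> output_list s = ys)"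

definition unit_cost :: "nat \<Rightarrow> nat" where
  "unit_cost n = 1"

definition bit_length :: "nat \<Rightarrow> nat" where
  "bit_length n = floor_log n + 1"

definition input_size :: "nat list \<Rightarrow> nat" where
  "input_size xs = sum_list (map bit_length xs)"

text \<open>Languages over the natural numbers written in binary. Under the logarithmic cost criterion
  the machines above and Turing machines simulate each other with polynomial overhead.\<close>

definition in_P :: "nat list set \<Rightarrow> bool" where
  "in_P L \<longleftrightarrow> (\<exists>c k. \<forall>xs. \<exists>t \<le> k * input_size xs ^ k + k.
     computes_in bit_length c xs (if xs \<in> L then [1] else [0]) t)"


section \<open>Encodings\<close>

definition lists_edges :: "(nat \<times> nat) list \<Rightarrow> nat set set \<Rightarrow> bool" where
  "lists_edges es E \<longleftrightarrow>
     distinct (map (\<lambda>(u, v). {u, v}) es) \<and> set (map (\<lambda>(u, v). {u, v}) es) = E"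

text \<open>\<open>encodable I er es\<close>: the nodes of both graphs are numbered from 0, and \<open>er\<close> and \<open>es\<close> list the
  virtual and the substrate edges, in any order and orientation.\<close>

definition encodable ::
  "(nat, nat) univne \<Rightarrow> (nat \<times> nat) list \<Rightarrow> (nat \<times> nat) list \<Rightarrow> bool" where
  "encodable I er es \<longleftrightarrow>
     verts (virtual I) = {..<card (verts (virtual I))} \<and> lists_edges er (edges (virtual I)) \<and>
     verts (substrate I) = {..<card (verts (substrate I))} \<and> lists_edges es (edges (substrate I))"

definition encode_univne ::
  "(nat, nat) univne \<Rightarrow> (nat \<times> nat) list \<Rightarrow> (nat \<times> nat) list \<Rightarrow> nat list" where
  "encode_univne I er es =
     [card (verts (virtual I)), length er] @
     concat (map (\<lambda>(u, v). [u, v]) er) @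
     [card (verts (substrate I)), length es] @
     concat (map (\<lambda>u. [node_cap I u, node_cost I u]) [0..<card (verts (substrate I))]) @
     concat (map (\<lambda>(u, v). [u, v, edge_cap I {u, v}, edge_cost I {u, v}]) es)"

text \<open>A mapping is output as the images of the virtual nodes, followed by the paths of the virtual
  edges in input order, each preceded by its number of nodes.\<close>

definition encode_mapping ::
  "(nat, nat) univne \<Rightarrow> (nat \<times> nat) list \<Rightarrow> (nat, nat) mapping \<Rightarrow> nat list" where
  "encode_mapping I er = (\<lambda>(mV, mE).
     map mV [0..<card (verts (virtual I))] @
     concat (map (\<lambda>(u, v). length (mE {u, v}) # mE {u, v}) er))"

text \<open>An answer is \<open>1\<close> followed by an optimal mapping, or just \<open>0\<close> if no feasible mapping exists.\<close>

definition correct_answer :: "(nat, nat) univne \<Rightarrow> (nat \<times> nat) list \<Rightarrow> nat list \<Rightarrow> bool" where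
  "correct_answer I er ys \<longleftrightarrow>
     (if \<exists>m. feasible I m
      then \<exists>m. min_cost_feasible I m \<and> ys = 1 # encode_mapping I er m
      else ys = [0])"

text \<open>The decision problem \<open>C-\<langle>R \<rightarrow> S\<rangle>\<close>, with virtual graphs restricted to the class \<open>R\<close> and
  substrate graphs to the class \<open>S\<close>, as the language of its encoded yes-instances; the last
  number is the budget.\<close>

definition C_uniVNE :: "(nat ugraph \<Rightarrow> bool) \<Rightarrow> (nat ugraph \<Rightarrow> bool) \<Rightarrow> nat list set" where
  "C_uniVNE R S = {encode_univne I er es @ [\<Gamma>] | I er es \<Gamma>.
     valid_univne I \<and> R (virtual I) \<and> S (substrate I) \<and> encodable I er es \<and>
     (\<exists>m. feasible I m \<and> mapping_cost I m \<le> \<Gamma>)}"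

end

theory Submission
  imports Defs
begin

text \<open>Paths in a tree are unique, so a mapping uses a tree edge exactly for the virtual edges with ends
  on both sides. If one side holds \<open>k\<close> of the \<open>n\<close> rim nodes and not the centre, these are at least \<open>k + 2\<close>
  edges if \<open>0 < k < n\<close> and exactly \<open>k\<close> edges otherwise. Placing the rim in the order of a traversal of the tree makes
  the rim nodes on each side of each edge an arc, so all these bounds are attained simultaneously, and only the
  number of rim nodes at each node and the position of the centre matter. An optimal choice is
  found by a knapsack computation that eliminates the leaves of the tree one after the other and merges
  the table of each leaf, with \<open>O(n)\<close> entries, into that of its neighbour in time \<open>O(n\<^sup>2)\<close>. The centre is one item of
  weight \<open>2 * Suc n\<close>, so that no separate table is needed.

  For membership in P, the numbers grow by at most one bit per step in the absence of multiplication, so a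
  polynomial unit-cost bound yields a polynomial bit-cost bound.\<close>

section \<open>Counting-loop programs\<close>

text \<open>The decision problem needs a correct answer also on lists that encode nothing. All
  programs are therefore built from loops whose number of passes is fixed at entry: they halt on
  every memory, so centre, rim and elimination order can be computed blindly and verified
  afterwards, provided that the announced sizes have first been compared with the length of the
  input.

  The lack of multiplication also shapes the data. Row offsets and multiples of edge costs are
  tabulated by repeated addition, and adjacency lists give way to sums over the neighbours or over
  the incident edges of a node, from which a single unknown term is recovered by subtraction.

  Concerning \<open>2 * Suc n\<close>: rim counts occupy \<open>0..n\<close>, demands with the
  centre \<open>2 * Suc n..2 * Suc n + n\<close>. Two rim counts add up to at most
  \<open>2 * n\<close>, which is below the second range, and two centres exceed it. Hence valid
  demands with a valid sum add their counts and at most one of them has the centre, and a row of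
  \<open>3 * Suc n\<close> entries holds every valid demand.\<close>

datatype prog =
    Nop
  | Asg nat aexp aexp
  | Sq prog prog  (infixr ";;" 60)
  | Cond bexp prog prog
  | For nat nat prog

abbreviation scalar :: "nat \<Rightarrow> aexp" where "scalar x \<equiv> Cell x (Const 0)"

fun compile :: "prog \<Rightarrow> com" where
  "compile Nop = Skip"
| "compile (Asg x i a) = Assign x i a"
| "compile (p ;; q) = Seq (compile p) (compile q)"
| "compile (Cond b p q) = If b (compile p) (compile q)"
| "compile (For v b p) =
     Seq (Assign v (Const 0) (Const 0))
       (While (Less (scalar v) (scalar b))
         (Seq (compile p) (Assign v (Const 0) (Plus (scalar v) (Const 1)))))"

definition upd :: "nat \<Rightarrow> nat \<Rightarrow> nat \<Rightarrow> memory \<Rightarrow> memory" where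
  "upd x i a s = s(x := (s x)(i := a))"

lemma upd_other [simp]: "y \<noteq> x \<Longrightarrow> upd x i a s y = s y"
  and upd_same [simp]: "upd x i a s x = (s x)(i := a)"
  by (simp_all add: upd_def)

text \<open>A total semantics: the number of passes is read once, at loop entry. It agrees with the
  compiled while loop only under \<open>wf_prog\<close>, where the body changes neither the counter
  nor the bound.\<close>

fun run :: "prog \<Rightarrow> memory \<Rightarrow> memory" where
  "run Nop s = s"
| "run (Asg x i a) s = upd x (aval i s) (aval a s) s"
| "run (p ;; q) s = run q (run p s)"
| "run (Cond b p q) s = (if bval b s then run p s else run q s)"
| "run (For v b p) s = upd v 0 (s b 0) (fold (\<lambda>k s. run p (upd v 0 k s)) [0..<s b 0] s)"

declare run.simps(5) [simp del]

fun writes :: "prog \<Rightarrow> nat set" where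
  "writes Nop = {}"
| "writes (Asg x i a) = {x}"
| "writes (p ;; q) = writes p \<union> writes q"
| "writes (Cond b p q) = writes p \<union> writes q"
| "writes (For v b p) = insert v (writes p)"

fun wf_prog :: "prog \<Rightarrow> bool" where
  "wf_prog (p ;; q) \<longleftrightarrow> wf_prog p \<and> wf_prog q"
| "wf_prog (Cond b p q) \<longleftrightarrow> wf_prog p \<and> wf_prog q"
| "wf_prog (For v b p) \<longleftrightarrow> v \<noteq> b \<and> v \<notin> writes p \<and> b \<notin> writes p \<and> wf_prog p"
| "wf_prog _ \<longleftrightarrow> True"

lemma fold_frame:
  assumes "\<And>k s. f k s x = s x"
  shows "fold f ks s x = s x"
  using assms by (induction ks arbitrary: s) auto

lemma run_frame: "x \<notin> writes p \<Longrightarrow> run p s x = s x"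
  by (induction p arbitrary: s) (auto simp: run.simps(5) fold_frame)

text \<open>The step receives the frame condition for free, so an invariant has to speak only of the
  arrays that the body writes.\<close>

lemma run_For_rule:
  assumes start: "P 0 s"
    and step: "\<And>k s'. k < s b 0 \<Longrightarrow> P k s' \<Longrightarrow> (\<And>x. x \<notin> insert v (writes p) \<Longrightarrow> s' x = s x)
      \<Longrightarrow> P (Suc k) (run p (upd v 0 k s'))"
    and stop: "\<And>s'. P (s b 0) s' \<Longrightarrow> (\<And>x. x \<notin> insert v (writes p) \<Longrightarrow> s' x = s x)
      \<Longrightarrow> Q (upd v 0 (s b 0) s')"
  shows "Q (run (For v b p) s)"
proof -
  let ?f = "\<lambda>m. fold (\<lambda>k s. run p (upd v 0 k s)) [0..<m] s"
  have frame: "?f m x = s x" if "x \<notin> insert v (writes p)" for m x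
    using that by (intro fold_frame) (auto simp: run_frame)
  have "m \<le> s b 0 \<Longrightarrow> P m (?f m)" for m
  proof (induction m)
    case 0 then show ?case using start by simp
  next
    case (Suc m)
    then show ?case using step[of m "?f m"] frame by simp
  qed
  from stop[OF this[OF order_refl] frame] show ?thesis by (simp add: run.simps(5))
qed

fun asize :: "aexp \<Rightarrow> nat" where
  "asize (Const n) = 1"
| "asize (Cell x a) = asize a + 1"
| "asize (Plus a b) = asize a + asize b + 1"
| "asize (Minus a b) = asize a + asize b + 1"

fun bsize :: "bexp \<Rightarrow> nat" where
  "bsize (Less a b) = asize a + asize b + 1"
| "bsize (Not b) = bsize b + 1"
| "bsize (And b c) = bsize b + bsize c + 1"

lemma atime_unit: "atime unit_cost a s = asize a"
  by (induction a) (auto simp: unit_cost_def)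

lemma btime_unit: "btime unit_cost b s = bsize b"
  by (induction b) (auto simp: atime_unit)

text \<open>For a loop, 8 is 3 for resetting the counter plus 5 for the failing test; 11 is 5 for a
  successful test plus 6 for the increment. \<open>B\<close> gives the values of the loop
  bounds.\<close>

fun time_bound :: "prog \<Rightarrow> (nat \<Rightarrow> nat) \<Rightarrow> nat" where
  "time_bound Nop B = 1"
| "time_bound (Asg x i a) B = asize i + asize a + 1"
| "time_bound (p ;; q) B = time_bound p B + time_bound q B"
| "time_bound (Cond b p q) B = bsize b + time_bound p B + time_bound q B"
| "time_bound (For v b p) B = 8 + B b * (time_bound p B + 11)"

fun loop_bounds :: "prog \<Rightarrow> nat set" where
  "loop_bounds (p ;; q) = loop_bounds p \<union> loop_bounds q"
| "loop_bounds (Cond b p q) = loop_bounds p \<union> loop_bounds q"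
| "loop_bounds (For v b p) = insert b (loop_bounds p)"
| "loop_bounds _ = {}"

text \<open>\<open>f k\<close> is the memory at test number \<open>k\<close> of the guard. The
  induction descends from the failing test because a derivation for a while loop is built from its
  end.\<close>

lemma exec_While_count:
  assumes body: "\<And>k. k < n \<Longrightarrow> \<exists>t \<le> T. exec unit_cost c (f k) t (f (Suc k))"
    and cond: "\<And>k. k < n \<Longrightarrow> bval b (f k)" "\<not> bval b (f n)"
    and "m \<le> n"
  shows "\<exists>t \<le> bsize b + (n - m) * (T + bsize b). exec unit_cost (While b c) (f m) t (f n)"
  using \<open>m \<le> n\<close>
proof (induction rule: inc_induct)
  case base
  show ?case using exec.WhileFalse[OF cond(2), of unit_cost c] by (auto simp: btime_unit)
next
  case (step k)
  then obtain t u where t: "t \<le> T" "exec unit_cost c (f k) t (f (Suc k))"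
    and u: "u \<le> bsize b + (n - Suc k) * (T + bsize b)" "exec unit_cost (While b c) (f (Suc k)) u (f n)"
    using body[OF \<open>k < n\<close>] by blast
  have "exec unit_cost (While b c) (f k) (bsize b + t + u) (f n)"
    using WhileTrue[OF cond(1)[OF \<open>k < n\<close>] t(2) u(2)] by (simp add: btime_unit)
  moreover have "n - k = Suc (n - Suc k)" using \<open>k < n\<close> by simp
  ultimately show ?case using t(1) u(1) by (intro exI[of _ "bsize b + t + u"]) simp
qed

text \<open>No loop bound is ever written, so all bounds can be evaluated in the initial memory,
  inner loops included. This makes the time of a loop nest a plain product.\<close>

theorem exec_compile:
  assumes "wf_prog p" and "loop_bounds p \<inter> writes p = {}"
  shows "\<exists>t \<le> time_bound p (\<lambda>x. s x 0). exec unit_cost (compile p) s t (run p s)"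
  using assms
proof (induction p arbitrary: s)
  case Nop
  then show ?case using exec.Skip by (intro exI[of _ 1]) (simp add: exec.Skip)
next
  case (Asg x i a)
  show ?case using exec.Assign[of unit_cost x i a s]
    by (intro exI[of _ "asize i + asize a + 1"]) (simp add: atime_unit upd_def fun_upd_def)
next
  case (Sq p q)
  then obtain t where t: "t \<le> time_bound p (\<lambda>x. s x 0)" "exec unit_cost (compile p) s t (run p s)"
    by fastforce
  obtain u where u: "u \<le> time_bound q (\<lambda>x. run p s x 0)"
    "exec unit_cost (compile q) (run p s) u (run q (run p s))"
    using Sq by fastforce
  have tb: "time_bound q B = time_bound q B'" if "\<And>x. x \<in> loop_bounds q \<Longrightarrow> B x = B' x" for B B'
    using that by (induction q) auto
  have "time_bound q (\<lambda>x. run p s x 0) = time_bound q (\<lambda>x. s x 0)"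
  proof (rule tb)
    fix x assume "x \<in> loop_bounds q"
    then have "x \<notin> writes p" using Sq.prems(2) by auto
    then show "run p s x 0 = s x 0" by (simp add: run_frame)
  qed
  then show ?case using t u exec.Seq[OF t(2) u(2)] by (intro exI[of _ "t + u"]) simp
next
  case (Cond b p q)
  show ?case
  proof (cases "bval b s")
    case True
    obtain t where "t \<le> time_bound p (\<lambda>x. s x 0)" "exec unit_cost (compile p) s t (run p s)"
      using Cond by fastforce
    then show ?thesis using exec.IfTrue[where \<mu> = unit_cost, OF True, of "compile p" t "run p s" "compile q"] True
      by (intro exI[of _ "bsize b + t"]) (simp add: btime_unit)
  next
    case False
    obtain t where "t \<le> time_bound q (\<lambda>x. s x 0)" "exec unit_cost (compile q) s t (run q s)"
      using Cond by fastforce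
    then show ?thesis using exec.IfFalse[where \<mu> = unit_cost, OF False, of "compile q" t "run q s" "compile p"] False
      by (intro exI[of _ "bsize b + t"]) (simp add: btime_unit)
  qed
next
  case (For v b p)
  let ?n = "s b 0"
  let ?b = "Less (scalar v) (scalar b)"
  let ?inc = "Assign v (Const 0) (Plus (scalar v) (Const 1))"
  \<comment> \<open>\<open>g m\<close> is the memory after \<open>m\<close> passes;
    \<open>f m\<close> differs only in the counter and is the memory at which the guard is
    tested.\<close>
  define g where "g m = fold (\<lambda>k s. run p (upd v 0 k s)) [0..<m] s" for m
  define f where "f m = upd v 0 m (g m)" for m
  have wf: "wf_prog p" "v \<noteq> b" "v \<notin> writes p" "b \<notin> writes p" using For.prems by auto
  have dj: "loop_bounds p \<inter> writes p = {}" "v \<notin> loop_bounds p" "v \<noteq> b" using For.prems by auto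
  have fr: "g m x = s x" if "x \<notin> insert v (writes p)" for m x
    unfolding g_def using that by (intro fold_frame) (auto simp: run_frame)
  have tb: "time_bound p B = time_bound p B'" if "\<And>x. x \<in> loop_bounds p \<Longrightarrow> B x = B' x" for B B'
    using that by (induction p) auto
  have fb: "f m b = s b" for m using wf fr by (simp add: f_def)
  have fv: "f m v 0 = m" for m by (simp add: f_def)
  have gS: "g (Suc m) = run p (f m)" for m by (simp add: g_def f_def)
  have body: "\<exists>t \<le> time_bound p (\<lambda>x. s x 0) + 6. exec unit_cost (Seq (compile p) ?inc) (f k) t (f (Suc k))" for k
  proof -
    obtain t where t: "t \<le> time_bound p (\<lambda>x. f k x 0)" "exec unit_cost (compile p) (f k) t (run p (f k))"
      using For.IH[OF wf(1) dj(1)] by blast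
    have "time_bound p (\<lambda>x. f k x 0) = time_bound p (\<lambda>x. s x 0)"
    proof (rule tb)
      fix x assume "x \<in> loop_bounds p"
      then have "x \<noteq> v" "x \<notin> insert v (writes p)" using dj by auto
      then show "f k x 0 = s x 0" using fr by (simp add: f_def)
    qed
    moreover have "exec unit_cost ?inc (run p (f k)) 6 (f (Suc k))"
    proof -
      have "run p (f k) v 0 = k" using run_frame[OF wf(3)] fv by simp
      then have "f (Suc k) = (run p (f k))(v := (run p (f k) v)(0 := Suc k))"
        unfolding f_def[of "Suc k"] gS by (simp add: upd_def)
      then show ?thesis
        using exec.Assign[of unit_cost v "Const 0" "Plus (scalar v) (Const 1)" "run p (f k)"]
          \<open>run p (f k) v 0 = k\<close> by (simp add: unit_cost_def numeral_eq_Suc)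
    qed
    ultimately show ?thesis using t exec.Seq[OF t(2)] by (intro exI[of _ "t + 6"]) auto
  qed
  have "\<exists>t \<le> bsize ?b + (?n - 0) * (time_bound p (\<lambda>x. s x 0) + 6 + bsize ?b).
     exec unit_cost (While ?b (Seq (compile p) ?inc)) (f 0) t (f ?n)"
    by (rule exec_While_count[where n = ?n]) (use body fb fv in auto)
  then obtain t where t: "t \<le> 5 + ?n * (time_bound p (\<lambda>x. s x 0) + 11)"
    "exec unit_cost (While ?b (Seq (compile p) ?inc)) (f 0) t (f ?n)" by (auto simp: numeral_eq_Suc)
  have "exec unit_cost (Assign v (Const 0) (Const 0)) s 3 (f 0)"
    using exec.Assign[of unit_cost v "Const 0" "Const 0" s] by (simp add: f_def g_def upd_def unit_cost_def numeral_3_eq_3)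
  from exec.Seq[OF this t(2)] t(1) show ?case
    by (intro exI[of _ "3 + t"]) (simp add: f_def g_def run.simps(5))
qed

section \<open>Time bounds from the nesting of loops\<close>

fun const_size :: "prog \<Rightarrow> nat" where
  "const_size Nop = 1"
| "const_size (Asg x i a) = asize i + asize a + 1"
| "const_size (p ;; q) = const_size p + const_size q"
| "const_size (Cond b p q) = bsize b + const_size p + const_size q"
| "const_size (For v b p) = 8 + 3 * (const_size p + 11)"

text \<open>\<open>nest X Y p i j\<close>: along every loop nest of \<open>p\<close>, at most \<open>i\<close> loops are bounded by scalars in \<open>X\<close>
  and at most \<open>j\<close> by scalars in \<open>Y\<close>.\<close>

fun nest :: "nat set \<Rightarrow> nat set \<Rightarrow> prog \<Rightarrow> nat \<Rightarrow> nat \<Rightarrow> bool" where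
  "nest X Y (p ;; q) i j \<longleftrightarrow> nest X Y p i j \<and> nest X Y q i j"
| "nest X Y (Cond b p q) i j \<longleftrightarrow> nest X Y p i j \<and> nest X Y q i j"
| "nest X Y (For v b p) i j \<longleftrightarrow>
     b \<in> X \<and> 0 < i \<and> nest X Y p (i - 1) j \<or> b \<in> Y \<and> 0 < j \<and> nest X Y p i (j - 1)"
| "nest X Y _ i j \<longleftrightarrow> True"

text \<open>Each loop takes one factor \<open>a\<close> or \<open>b\<close> out of the monomial and
  leaves the rest to its body. The monomial is at least 1 and so absorbs additive constants. The
  factor 3 allows for loop bounds such as the row length \<open>3 * Suc n\<close> and the numbers of
  edges.\<close>

lemma time_bound_nest:
  assumes "\<And>x. x \<in> X \<Longrightarrow> B x \<le> 3 * a" "\<And>x. x \<in> Y \<Longrightarrow> B x \<le> 3 * b" "1 \<le> a" "1 \<le> b"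
    and "nest X Y p i j"
  shows "time_bound p B \<le> const_size p * (a ^ i * b ^ j)"
  using assms(5)
proof (induction p arbitrary: i j)
  case (For v y p)
  have pos: "1 \<le> a ^ i' * b ^ j'" for i' j' using assms(3,4) by (simp add: Suc_le_eq)
  \<comment> \<open>\<open>c\<close> stands for the one of \<open>a\<close> and \<open>b\<close>
    that pays for this loop, \<open>w\<close> for the monomial left to the body.\<close>
  have core: "8 + B y * (time_bound p B + 11) \<le> const_size (For v y p) * (c * w)"
    if "B y \<le> 3 * c" "time_bound p B \<le> const_size p * w" "1 \<le> w" "1 \<le> c" for c w
  proof -
    have "B y * (time_bound p B + 11) \<le> (3 * c) * (const_size p * w + 11 * w)"
      using that by (intro mult_mono add_mono) auto
    moreover have "8 \<le> 8 * (c * w)" using that by (simp add: Suc_le_eq)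
    moreover have "const_size (For v y p) * (c * w) = 8 * (c * w) + (3 * c) * (const_size p * w + 11 * w)"
      by (simp add: algebra_simps)
    ultimately show ?thesis by linarith
  qed
  from For.prems consider "y \<in> X" "0 < i" "nest X Y p (i - 1) j" | "y \<in> Y" "0 < j" "nest X Y p i (j - 1)"
    by auto
  then show ?case
  proof cases
    case 1
    then obtain i' where i: "i = Suc i'" by (cases i) auto
    show ?thesis using core[of a "a ^ i' * b ^ j"] 1 For.IH[of i' j] assms pos[of i' j] by (simp add: i mult.assoc)
  next
    case 2
    then obtain j' where j: "j = Suc j'" by (cases j) auto
    show ?thesis using core[of b "a ^ i * b ^ j'"] 2 For.IH[of i j'] assms pos[of i j']
      by (simp add: j mult.assoc mult.left_commute)
  qed
next
  case (Sq p q)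
  then have "time_bound p B + time_bound q B \<le> const_size p * (a ^ i * b ^ j) + const_size q * (a ^ i * b ^ j)"
    by (intro add_mono) auto
  then show ?case by (simp add: algebra_simps)
next
  case (Cond c p q)
  then have "time_bound p B + time_bound q B \<le> const_size p * (a ^ i * b ^ j) + const_size q * (a ^ i * b ^ j)"
    by (intro add_mono) auto
  moreover have "1 \<le> a ^ i * b ^ j" using assms(3,4) by (simp add: Suc_le_eq)
  from mult_le_mono2[OF this, of "bsize c"] have "bsize c \<le> bsize c * (a ^ i * b ^ j)" by simp
  moreover have "const_size (Cond c p q) * (a ^ i * b ^ j) = bsize c * (a ^ i * b ^ j) +
      (const_size p * (a ^ i * b ^ j) + const_size q * (a ^ i * b ^ j))" by (simp add: algebra_simps)
  ultimately show ?case unfolding time_bound.simps by linarith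
next
  case Nop
  then show ?case using assms(3,4) by (simp add: Suc_le_eq)
next
  case (Asg x e f)
  have "1 \<le> a ^ i * b ^ j" using assms(3,4) by (simp add: Suc_le_eq)
  from mult_le_mono2[OF this, of "asize e + asize f + 1"]
  have "asize e + asize f + 1 \<le> (asize e + asize f + 1) * (a ^ i * b ^ j)" by simp
  then show ?case by (simp only: time_bound.simps const_size.simps)
qed


section \<open>From unit cost to bit cost\<close>

lemma less_power_bit_length: "n < 2 ^ bit_length n"
  unfolding bit_length_def using floor_log_exp2_gt[of n] by simp

lemma bit_length_le: "n < 2 ^ k \<Longrightarrow> 1 \<le> k \<Longrightarrow> bit_length n \<le> k"
proof (cases "n = 0")
  case False
  assume "n < 2 ^ k" "1 \<le> k"
  have "(2::nat) ^ floor_log n \<le> n" using False by (simp add: floor_log_exp2_le)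
  then have "(2::nat) ^ floor_log n < 2 ^ k" using \<open>n < 2 ^ k\<close> by (rule le_less_trans)
  then have "floor_log n < k" by simp
  then show ?thesis by (simp add: bit_length_def)
qed (simp add: bit_length_def)

text \<open>Constants in the code are the only source of numbers besides the memory, so the bit
  length of all values is controlled by these two.\<close>

fun amax :: "aexp \<Rightarrow> nat" where
  "amax (Const n) = n"
| "amax (Cell x a) = amax a"
| "amax (Plus a b) = max (amax a) (amax b)"
| "amax (Minus a b) = max (amax a) (amax b)"

fun bmax :: "bexp \<Rightarrow> nat" where
  "bmax (Less a b) = max (amax a) (amax b)"
| "bmax (Not b) = bmax b"
| "bmax (And b c) = max (bmax b) (bmax c)"

fun cmax :: "com \<Rightarrow> nat" where
  "cmax Skip = 0"
| "cmax (Assign x i a) = max (amax i) (amax a)"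
| "cmax (Seq c d) = max (cmax c) (cmax d)"
| "cmax (If b c d) = max (bmax b) (max (cmax c) (cmax d))"
| "cmax (While b c) = max (bmax b) (cmax c)"

text \<open>Addition at most doubles, so \<open>t\<close> unit-cost steps lengthen the numbers by at most \<open>t\<close> bits.\<close>

lemma aval_less:
  assumes "\<And>x i. s x i < 2 ^ B" "amax a < 2 ^ B"
  shows "aval a s < 2 ^ (B + asize a)"
  using assms(2)
proof (induction a)
  case (Const n)
  then have "n < 2 ^ B" by simp
  also have "(2::nat) ^ B \<le> 2 ^ (B + 1)" by simp
  finally show ?case by simp
next
  case (Cell x a)
  have "s x (aval a s) < 2 ^ B" by (rule assms)
  also have "(2::nat) ^ B \<le> 2 ^ (B + asize (Cell x a))" by (rule power_increasing) auto
  finally show ?case by simp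
next
  case (Plus a b)
  then have "aval a s < 2 ^ (B + asize a)" "aval b s < 2 ^ (B + asize b)" by auto
  moreover have "(2::nat) ^ (B + asize a) \<le> 2 ^ (B + asize a + asize b)"
    "(2::nat) ^ (B + asize b) \<le> 2 ^ (B + asize a + asize b)" by (auto intro: power_increasing)
  ultimately have "aval a s + aval b s < 2 * 2 ^ (B + asize a + asize b)" by linarith
  then show ?case by (simp add: add.assoc)
next
  case (Minus a b)
  then have "aval a s < 2 ^ (B + asize a)" by simp
  also have "(2::nat) ^ (B + asize a) \<le> 2 ^ (B + asize (Minus a b))" by (rule power_increasing) auto
  finally show ?case by simp
qed

text \<open>Each of the \<open>asize a\<close> charged values belongs to a subexpression and
  therefore has at most \<open>B + asize a\<close> bits.\<close>

lemma atime_bit: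
  assumes "\<And>x i. s x i < 2 ^ B" "amax a < 2 ^ B"
  shows "atime bit_length a s \<le> asize a * (B + asize a)"
  using assms(2)
proof (induction a)
  case (Const n)
  then show ?case using bit_length_le[of n "B + 1"] by simp
next
  case (Cell x a)
  have "bit_length (aval (Cell x a) s) \<le> B + asize (Cell x a)"
    using aval_less[OF assms(1) Cell.prems] by (intro bit_length_le) auto
  with Cell show ?case by (auto simp: algebra_simps)
next
  case (Plus a b)
  have "bit_length (aval (Plus a b) s) \<le> B + asize (Plus a b)"
    using aval_less[OF assms(1) Plus.prems] by (intro bit_length_le) auto
  moreover have "atime bit_length a s \<le> asize a * (B + asize a)"
    "atime bit_length b s \<le> asize b * (B + asize b)" using Plus by auto
  ultimately have "atime bit_length (Plus a b) s \<le>
    asize a * (B + asize a) + asize b * (B + asize b) + (B + asize (Plus a b))" by simp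
  also have "\<dots> \<le> asize (Plus a b) * (B + asize (Plus a b))" by (simp add: algebra_simps)
  finally show ?case .
next
  case (Minus a b)
  have "bit_length (aval (Minus a b) s) \<le> B + asize (Minus a b)"
    using aval_less[OF assms(1) Minus.prems] by (intro bit_length_le) auto
  moreover have "atime bit_length a s \<le> asize a * (B + asize a)"
    "atime bit_length b s \<le> asize b * (B + asize b)" using Minus by auto
  ultimately have "atime bit_length (Minus a b) s \<le>
    asize a * (B + asize a) + asize b * (B + asize b) + (B + asize (Minus a b))" by simp
  also have "\<dots> \<le> asize (Minus a b) * (B + asize (Minus a b))" by (simp add: algebra_simps)
  finally show ?case .
qed

lemma btime_bit:
  assumes "\<And>x i. s x i < 2 ^ B" "bmax b < 2 ^ B"
  shows "btime bit_length b s \<le> bsize b * (B + bsize b)"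
  using assms(2)
proof (induction b)
  case (Less a b)
  then have "atime bit_length a s \<le> asize a * (B + asize a)"
    "atime bit_length b s \<le> asize b * (B + asize b)" using atime_bit[OF assms(1)] by auto
  then have "btime bit_length (Less a b) s \<le> asize a * (B + asize a) + asize b * (B + asize b) + 1" by simp
  also have "\<dots> \<le> bsize (Less a b) * (B + bsize (Less a b))" by (simp add: algebra_simps)
  finally show ?case .
next
  case (And b c)
  then have "btime bit_length (And b c) s \<le> bsize b * (B + bsize b) + bsize c * (B + bsize c) + 1" by simp
  also have "\<dots> \<le> bsize (And b c) * (B + bsize (And b c))" by (simp add: algebra_simps)
  finally show ?case .
qed (auto simp: algebra_simps)

text \<open>Time and growth have to be proved together: the second part of a sequence starts with
  numbers that the first has lengthened by up to \<open>t\<close> bits, so its induction hypothesis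
  is used at \<open>B + t\<close>.\<close>

lemma exec_bit:
  assumes "exec unit_cost c s t s'" "\<And>x i. s x i < 2 ^ B" "cmax c < 2 ^ B"
  shows "(\<exists>u \<le> t * (B + t). exec bit_length c s u s') \<and> (\<forall>x i. s' x i < 2 ^ (B + t))"
  using assms
proof (induction arbitrary: B rule: exec.induct)
  case (Skip s)
  have "s x i < 2 ^ (B + 1)" for x i
    using Skip(1)[of x i] by (rule less_le_trans) (rule power_increasing, auto)
  then show ?case using exec.Skip[of bit_length s] by (auto intro!: exI[of _ 1])
next
  case (Assign x i a s)
  have mono: "(2::nat) ^ B \<le> 2 ^ (B + (asize i + asize a + 1))"
    "(2::nat) ^ (B + asize a) \<le> 2 ^ (B + (asize i + asize a + 1))"
    by (rule power_increasing; simp)+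
  have "atime bit_length i s \<le> asize i * (B + asize i)" "atime bit_length a s \<le> asize a * (B + asize a)"
    using Assign by (auto intro: atime_bit)
  then have "atime bit_length i s + atime bit_length a s + 1
      \<le> (asize i + asize a + 1) * (B + (asize i + asize a + 1))"
    by (simp add: algebra_simps)
  moreover have "(s(x := (s x)(aval i s := aval a s))) y j < (2::nat) ^ (B + (asize i + asize a + 1))" for y j
    using less_le_trans[OF Assign.prems(1) mono(1)] less_le_trans[OF aval_less[OF Assign.prems(1), of a] mono(2)]
      Assign.prems(2) by (auto simp: fun_upd_def)
  ultimately show ?case using exec.Assign[of bit_length x i a s] unfolding atime_unit by blast
next
  case (Seq c s t s' d t' s'')
  have "cmax c < 2 ^ B" "cmax d < 2 ^ B" using Seq.prems by auto
  then obtain u where u: "u \<le> t * (B + t)" "exec bit_length c s u s'" and s': "\<And>x i. s' x i < 2 ^ (B + t)"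
    using Seq.IH(1) Seq.prems by blast
  have "(2::nat) ^ B \<le> 2 ^ (B + t)" by simp
  then have "cmax d < 2 ^ (B + t)" using \<open>cmax d < 2 ^ B\<close> by linarith
  then obtain u' where u': "u' \<le> t' * (B + t + t')" "exec bit_length d s' u' s''"
    and s'': "\<And>x i. s'' x i < 2 ^ (B + t + t')"
    using Seq.IH(2)[OF s'] by blast
  have "u + u' \<le> (t + t') * (B + (t + t'))" using u u' by (simp add: algebra_simps)
  then show ?case using exec.Seq[OF u(2) u'(2)] s'' by (auto simp: add.assoc)
next
  case (IfTrue b s c t s' d)
  let ?b = "bsize b"
  have m: "(2::nat) ^ (B + t) \<le> 2 ^ (B + (?b + t))" by (rule power_increasing) auto
  from IfTrue obtain u where u: "u \<le> t * (B + t)" "exec bit_length c s u s'"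
    and s': "\<And>x i. s' x i < 2 ^ (B + t)" by force
  have "btime bit_length b s \<le> ?b * (B + ?b)" using IfTrue.prems by (intro btime_bit) auto
  then have "btime bit_length b s + u \<le> (?b + t) * (B + (?b + t))" using u by (simp add: algebra_simps)
  then show ?case using exec.IfTrue[OF IfTrue.hyps(1) u(2)] less_le_trans[OF s' m]
    by (auto simp: btime_unit)
next
  case (IfFalse b s d t s' c)
  let ?b = "bsize b"
  have m: "(2::nat) ^ (B + t) \<le> 2 ^ (B + (?b + t))" by (rule power_increasing) auto
  from IfFalse obtain u where u: "u \<le> t * (B + t)" "exec bit_length d s u s'"
    and s': "\<And>x i. s' x i < 2 ^ (B + t)" by force
  have "btime bit_length b s \<le> ?b * (B + ?b)" using IfFalse.prems by (intro btime_bit) auto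
  then have "btime bit_length b s + u \<le> (?b + t) * (B + (?b + t))" using u by (simp add: algebra_simps)
  then show ?case using exec.IfFalse[OF IfFalse.hyps(1) u(2)] less_le_trans[OF s' m]
    by (auto simp: btime_unit)
next
  case (WhileFalse b s c)
  let ?b = "bsize b"
  have m: "(2::nat) ^ B \<le> 2 ^ (B + ?b)" by (rule power_increasing) auto
  have "btime bit_length b s \<le> ?b * (B + ?b)" using WhileFalse.prems by (intro btime_bit) auto
  then show ?case using exec.WhileFalse[OF WhileFalse.hyps(1)] less_le_trans[OF WhileFalse.prems(1) m]
    by (auto simp: btime_unit)
next
  case (WhileTrue b s c t s' t' s'')
  let ?b = "bsize b"
  have m: "(2::nat) ^ (B + t + t') \<le> 2 ^ (B + (?b + t + t'))" by (rule power_increasing) auto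
  have "cmax c < 2 ^ B" "bmax b < 2 ^ B" using WhileTrue.prems by auto
  then obtain u where u: "u \<le> t * (B + t)" "exec bit_length c s u s'" and s': "\<And>x i. s' x i < 2 ^ (B + t)"
    using WhileTrue.IH(1) WhileTrue.prems by blast
  have "(2::nat) ^ B \<le> 2 ^ (B + t)" by simp
  then have "cmax (While b c) < 2 ^ (B + t)" using WhileTrue.prems(2) by linarith
  then obtain u' where u': "u' \<le> t' * (B + t + t')" "exec bit_length (While b c) s' u' s''"
    and s'': "\<And>x i. s'' x i < 2 ^ (B + t + t')"
    using WhileTrue.IH(2)[OF s'] by blast
  have "btime bit_length b s \<le> ?b * (B + ?b)" using WhileTrue.prems by (intro btime_bit) auto
  also have "\<dots> \<le> ?b * (B + (?b + t + t'))" by (intro mult_le_mono2) simp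
  finally have "btime bit_length b s \<le> ?b * (B + (?b + t + t'))" .
  moreover have "u \<le> t * (B + (?b + t + t'))" by (rule le_trans[OF u(1)]) (intro mult_le_mono2, simp)
  moreover have "u' \<le> t' * (B + (?b + t + t'))" by (rule le_trans[OF u'(1)]) (intro mult_le_mono2, simp)
  ultimately have b: "btime bit_length b s + u + u' \<le> (?b + t + t') * (B + (?b + t + t'))"
    unfolding add_mult_distrib by (intro add_mono)
  have e: "exec bit_length (While b c) s (btime bit_length b s + u + u') s''"
    by (rule exec.WhileTrue[OF WhileTrue.hyps(1) u(2) u'(2)])
  show ?case unfolding btime_unit
  proof (intro conjI allI)
    show "\<exists>u \<le> (?b + t + t') * (B + (?b + t + t')). exec bit_length (While b c) s u s''"
      using b e by blast
    show "s'' x i < 2 ^ (B + (?b + t + t'))" for x i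
      by (rule less_le_trans[OF s'' m])
  qed
qed

section \<open>Paths and cuts\<close>

lemma path_edges_simps [simp]:
  "path_edges [] = {}" "path_edges [x] = {}"
  "path_edges (x # y # q) = insert {x, y} (path_edges (y # q))"
  by (simp_all add: path_edges_def)

lemma path_edges_Pow: "path_edges q \<subseteq> Pow (set q)"
  by (induction q rule: induct_list012) auto

lemma path_edges_append:
  "path_edges (q @ x # r) = path_edges (q @ [x]) \<union> path_edges (x # r)"
  by (induction q rule: induct_list012) auto

lemma path_edges_nth: "path_edges q = {{q ! i, q ! Suc i} | i. Suc i < length q}"
proof (induction q rule: induct_list012)
  case (3 x y q)
  have "{{(x # y # q) ! i, (x # y # q) ! Suc i} | i. Suc i < length (x # y # q)}
    = insert {x, y} {{(y # q) ! i, (y # q) ! Suc i} | i. Suc i < length (y # q)}" (is "?L = ?R")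
  proof (intro equalityI subsetI)
    fix e assume "e \<in> ?L"
    then obtain i where i: "e = {(x # y # q) ! i, (x # y # q) ! Suc i}" "Suc i < length (x # y # q)" by blast
    then show "e \<in> ?R" by (cases i) auto
  next
    fix e assume "e \<in> ?R"
    then consider "e = {x, y}" | i where "e = {(y # q) ! i, (y # q) ! Suc i}" "Suc i < length (y # q)" by blast
    then show "e \<in> ?L"
    proof cases
      case 1 then show ?thesis by (auto intro!: exI[of _ 0])
    next
      case (2 i) then show ?thesis by (auto intro!: exI[of _ "Suc i"])
    qed
  qed
  then show ?case using 3 by simp
qed auto

lemma cycle_edges_nth:
  assumes "us \<noteq> []"
  shows "cycle_edges us = (\<lambda>i. {us ! i, us ! (Suc i mod length us)}) ` {..<length us}"
proof -
  have "(us @ [hd us]) ! Suc i = us ! (Suc i mod length us)" if "i < length us" for i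
    using that assms by (cases "Suc i = length us") (auto simp: nth_append hd_conv_nth)
  moreover have "(us @ [hd us]) ! i = us ! i" if "i < length us" for i
    using that by (simp add: nth_append)
  moreover have "cycle_edges us = (\<lambda>i. {(us @ [hd us]) ! i, (us @ [hd us]) ! Suc i}) ` {..<length us}"
    unfolding cycle_edges_def path_edges_nth by auto
  ultimately show ?thesis by (simp cong: image_cong_simp)
qed

text \<open>Only \<open>{a, b}\<close> leads from one side to the other, and a path without repeated
  nodes takes it at most once. It is thus taken exactly if the ends lie on different sides.\<close>

lemma path_crosses_bridge:
  assumes "distinct q" "q \<noteq> []" "a \<in> S" "b \<notin> S"
    and "\<And>d. d \<in> path_edges q \<Longrightarrow> d \<noteq> {a, b} \<Longrightarrow> d \<subseteq> S \<or> d \<inter> S = {}"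
  shows "{a, b} \<in> path_edges q \<longleftrightarrow> (hd q \<in> S) \<noteq> (last q \<in> S)"
  using assms(1,2,5)
proof (induction q rule: induct_list012)
  case (3 x y q)
  have IH: "{a, b} \<in> path_edges (y # q) \<longleftrightarrow> (y \<in> S) \<noteq> (last (y # q) \<in> S)"
    using 3 by auto
  show ?case
  proof (cases "{x, y} = {a, b}")
    case True
    \<comment> \<open>\<open>x\<close> does not recur on a distinct list, so the edge is not taken a
      second time.\<close>
    have "{a, b} \<notin> path_edges (y # q)"
      using path_edges_Pow[of "y # q"] True 3(3) by auto
    moreover have "(x \<in> S) \<noteq> (y \<in> S)" using True assms(3,4) by (auto simp: doubleton_eq_iff)
    ultimately show ?thesis using IH True by auto
  next
    case False
    then have "(x \<in> S) = (y \<in> S)" using 3(5)[of "{x, y}"] by auto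
    then show ?thesis using IH False by auto
  qed
qed auto

text \<open>A discrete intermediate value argument; it turns connectivity by paths into connectivity
  by cuts.\<close>

lemma path_leaves_set:
  assumes "q \<noteq> []" "hd q \<in> S" "last q \<notin> S"
  shows "\<exists>x y. {x, y} \<in> path_edges q \<and> x \<in> S \<and> y \<notin> S"
  using assms by (induction q rule: induct_list012) (auto split: if_splits)


section \<open>Elimination orders\<close>

text \<open>At stage \<open>i\<close> the leaf \<open>v i\<close> of the remaining tree is merged into its only remaining neighbour \<open>p i\<close>.\<close>

locale elimination =
  fixes N :: nat and v p :: "nat \<Rightarrow> nat"
  assumes N_pos: "0 < N" and order: "bij_betw v {..<N} {..<N}"
    and later: "\<And>i. Suc i < N \<Longrightarrow> \<exists>k. i < k \<and> k < N \<and> p i = v k"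
begin

lemma v_inj: "i < N \<Longrightarrow> j < N \<Longrightarrow> v i = v j \<longleftrightarrow> i = j"
  using order by (auto simp: bij_betw_def inj_on_def)

lemma v_less: "i < N \<Longrightarrow> v i < N"
  using order by (auto simp: bij_betw_def)

lemma v_surj: "w < N \<Longrightarrow> \<exists>i<N. w = v i"
  using order by (auto simp: bij_betw_def)

lemma p_less: "Suc i < N \<Longrightarrow> p i < N"
  using later[of i] v_less by auto

lemma p_neq_v: "Suc i < N \<Longrightarrow> p i \<noteq> v i"
  using later[of i] v_inj by (metis Suc_lessD less_irrefl)

definition remaining :: "nat \<Rightarrow> nat set" where
  "remaining i = v ` {i..<N}"

lemma remaining_0: "remaining 0 = {..<N}"
  using order by (simp add: remaining_def bij_betw_def lessThan_atLeast0)

lemma remaining_last: "remaining (N - Suc 0) = {v (N - Suc 0)}"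
proof -
  have "{N - Suc 0..<N} = {N - Suc 0}" using N_pos by auto
  then show ?thesis by (simp add: remaining_def)
qed

lemma remaining_Suc:
  assumes "Suc i < N"
  shows "remaining i = insert (v i) (remaining (Suc i))" "v i \<notin> remaining (Suc i)"
    "p i \<in> remaining (Suc i)" "p i \<in> remaining i" "v i \<in> remaining i"
proof -
  have "{i..<N} = insert i {Suc i..<N}" using assms by auto
  then show *: "remaining i = insert (v i) (remaining (Suc i))" by (simp add: remaining_def)
  show "v i \<notin> remaining (Suc i)" using assms v_inj by (auto simp: remaining_def)
  show "p i \<in> remaining (Suc i)" using later[OF assms] by (auto simp: remaining_def)
  then show "p i \<in> remaining i" "v i \<in> remaining i" using * by auto
qed

lemma remaining_mono: "i \<le> j \<Longrightarrow> remaining j \<subseteq> remaining i"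
  by (auto simp: remaining_def)

lemma remaining_less: "u \<in> remaining i \<Longrightarrow> u < N"
  using v_less by (auto simp: remaining_def)

lemma finite_remaining [simp]: "finite (remaining i)"
  by (simp add: remaining_def)

text \<open>The node of the remaining tree into which \<open>w\<close> has been merged during the
  first \<open>i\<close> stages.\<close>

fun rep :: "nat \<Rightarrow> nat \<Rightarrow> nat" where
  "rep 0 w = w"
| "rep (Suc i) w = (if rep i w = v i then p i else rep i w)"

lemma rep_remaining: "w < N \<Longrightarrow> i < N \<Longrightarrow> rep i w \<in> remaining i"
proof (induction i)
  case 0 then show ?case by (simp add: remaining_0)
next
  case (Suc i)
  then show ?case using remaining_Suc[of i] by auto
qed

lemma rep_self: "u \<in> remaining i \<Longrightarrow> rep i u = u"
proof (induction i)
  case (Suc i)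
  show ?case
  proof (cases "Suc i < N")
    case True
    then show ?thesis using Suc remaining_Suc[of i] by auto
  next
    case False then show ?thesis using Suc by (simp add: remaining_def)
  qed
qed simp

text \<open>The component of \<open>v i\<close> in the tree without the edge
  \<open>{v i, p i}\<close>: a node is on this side exactly if it has been merged into
  \<open>v i\<close> by the time that \<open>v i\<close> is eliminated.\<close>

definition cut :: "nat \<Rightarrow> nat set" where
  "cut i = {w. w < N \<and> rep i w = v i}"

lemma cut_self: "Suc i < N \<Longrightarrow> v i \<in> cut i" "Suc i < N \<Longrightarrow> p i \<notin> cut i"
  using rep_self[of "v i" i] rep_self[of "p i" i] remaining_Suc[of i] v_less p_neq_v
  by (auto simp: cut_def)

text \<open>The edge of an earlier stage is already contracted at stage \<open>i\<close>, so its
  ends have the same representative. The edge of a later stage joins two nodes that represent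
  themselves and differ from \<open>v i\<close>.\<close>

lemma cut_other:
  assumes "Suc i < N" "Suc j < N" "j \<noteq> i"
  shows "v j \<in> cut i \<longleftrightarrow> p j \<in> cut i"
proof (cases "j < i")
  case True
  have "rep m (v j) = rep m (p j)" if "Suc j \<le> m" for m
    using that
  proof (induction rule: dec_induct)
    case base
    then show ?case using rep_self[of "v j" j] rep_self[of "p j" j] remaining_Suc[OF assms(2)] p_neq_v[OF assms(2)]
      by simp
  qed simp
  then show ?thesis using True assms v_less[of j] p_less[of j] by (simp add: cut_def)
next
  case False
  then have "Suc i \<le> j" using assms by simp
  then have "v j \<in> remaining (Suc i)" "p j \<in> remaining (Suc i)"
    using remaining_Suc(4,5)[OF assms(2)] remaining_mono by blast+
  moreover from this have "rep i (v j) = v j" "rep i (p j) = p j"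
    using rep_self remaining_Suc(1)[OF assms(1)] by blast+
  moreover have "v i \<notin> remaining (Suc i)" by (rule remaining_Suc(2)[OF assms(1)])
  ultimately have "rep i (v j) \<noteq> v i" "rep i (p j) \<noteq> v i" by metis+
  then show ?thesis by (simp add: cut_def)
qed

definition tree_edges :: "nat set set" where
  "tree_edges = {{v i, p i} | i. Suc i < N}"

lemma tree_edges_cut:
  assumes "Suc i < N" "d \<in> tree_edges" "d \<noteq> {v i, p i}"
  shows "d \<subseteq> cut i \<or> d \<inter> cut i = {}"
proof -
  obtain j where "Suc j < N" "d = {v j, p j}" using assms(2) by (auto simp: tree_edges_def)
  moreover from this have "j \<noteq> i" using assms(3) by auto
  ultimately show ?thesis using cut_other[OF assms(1), of j] by auto
qed

text \<open>The edge of stage \<open>i\<close> is the only one that crosses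
  \<open>cut i\<close>.\<close>

lemma tree_edge_inj: 
  assumes "Suc i < N" "Suc j < N" "{v i, p i} = {v j, p j}"
  shows "i = j"
proof (rule ccontr)
  assume "i \<noteq> j"
  from cut_other[OF assms(1,2)] this cut_self[OF assms(1)] assms(3) show False
    by (auto simp: doubleton_eq_iff)
qed

text \<open>Uniqueness of tree paths in the form needed later: the edges of a path are determined by
  its ends.\<close>

lemma path_uses_edge:
  assumes "distinct q" "q \<noteq> []" "path_edges q \<subseteq> tree_edges" "Suc i < N"
  shows "{v i, p i} \<in> path_edges q \<longleftrightarrow> (hd q \<in> cut i) \<noteq> (last q \<in> cut i)"
  using assms cut_self tree_edges_cut by (intro path_crosses_bridge) blast+

section \<open>Tree paths along the elimination order\<close>

fun walk_step :: "nat \<Rightarrow> nat list \<times> nat \<times> nat \<times> nat list \<Rightarrow> nat list \<times> nat \<times> nat \<times> nat list" where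
  "walk_step i (A, a, b, B) =
     (if a = b then (A, a, b, B)
      else if a = v i then (A @ [a], p i, b, B)
      else if b = v i then (A, a, p i, b # B)
      else (A, a, b, B))"

text \<open>In a state \<open>(A, a, b, B)\<close>, the list \<open>A\<close> followed by
  \<open>a\<close> begins the path and \<open>b\<close> followed by \<open>B\<close> ends it. A
  single pass over the stages suffices, since an end has to move exactly when it is eliminated, and
  its parent is eliminated later.\<close>

definition walk :: "nat \<Rightarrow> nat \<Rightarrow> nat \<Rightarrow> nat list \<times> nat \<times> nat \<times> nat list" where
  "walk i a b = fold walk_step [0..<i] ([], a, b, [])"

text \<open>While the ends differ, both still remain in the tree and all nodes passed so far are
  eliminated. This separates the two halves from the ends and makes the final path distinct.\<close>

definition walk_inv :: "nat \<Rightarrow> nat \<Rightarrow> nat \<Rightarrow> nat list \<times> nat \<times> nat \<times> nat list \<Rightarrow> bool" where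
  "walk_inv a0 b0 i = (\<lambda>(A, a, b, B).
     hd (A @ [a]) = a0 \<and> last (b # B) = b0 \<and> path_edges (A @ [a]) \<subseteq> tree_edges \<and> path_edges (b # B) \<subseteq> tree_edges \<and>
     distinct (A @ B) \<and> a \<notin> set A \<union> set B \<and> b \<notin> set A \<union> set B \<and>
     a < N \<and> b < N \<and> set A \<union> set B \<subseteq> {..<N} \<and>
     (a \<noteq> b \<longrightarrow> a \<in> remaining i \<and> b \<in> remaining i \<and> (set A \<union> set B) \<inter> remaining i = {}))"

lemma walk_inv_step:
  assumes "Suc i < N" "walk_inv a0 b0 i (A, a, b, B)"
  shows "walk_inv a0 b0 (Suc i) (walk_step i (A, a, b, B))"
proof -
  note R = remaining_Suc[OF assms(1)] and less = v_less[of i] p_less[OF assms(1)]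
  have e: "{v i, p i} \<in> tree_edges" using assms(1) by (auto simp: tree_edges_def)
  consider "a = b" | "a \<noteq> b" "a = v i" | "a \<noteq> b" "a \<noteq> v i" "b = v i" | "a \<noteq> b" "a \<noteq> v i" "b \<noteq> v i" by blast
  then show ?thesis
  proof cases
    case 1 then show ?thesis using assms(2) by (auto simp: walk_inv_def)
  next
    case 2
    have "path_edges (A @ [a, p i]) = path_edges (A @ [a]) \<union> {{v i, p i}}"
      using 2 path_edges_append[of A a "[p i]"] by simp
    moreover have "hd (A @ [a, p i]) = hd (A @ [a])" by (cases A) auto
    ultimately show ?thesis using 2 assms R e less by (auto simp: walk_inv_def)
  next
    case 3
    have "path_edges (p i # b # B) = insert {v i, p i} (path_edges (b # B))"
      using 3 by (simp add: insert_commute)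
    then show ?thesis using 3 assms R e less by (auto simp: walk_inv_def)
  next
    case 4 then show ?thesis using assms R by (auto simp: walk_inv_def)
  qed
qed

lemma walk_Suc: "walk (Suc i) a b = walk_step i (walk i a b)"
  by (simp add: walk_def)

lemma walk_invariant:
  assumes "a < N" "b < N" "i < N"
  shows "walk_inv a b i (walk i a b)"
  using assms(3)
proof (induction i)
  case 0
  then show ?case using assms by (auto simp: walk_def walk_inv_def remaining_0)
next
  case (Suc i)
  then show ?case using walk_inv_step[of i] by (cases "walk i a b") (auto simp: walk_Suc simp del: walk_step.simps)
qed

definition tree_path :: "nat \<Rightarrow> nat \<Rightarrow> nat list" where
  "tree_path a b = (case walk (N - 1) a b of (A, x, y, B) \<Rightarrow> A @ [x] @ B)"

text \<open>At stage \<open>N - 1\<close> a single node remains, so the ends have met. The length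
  bound lets the program print each half in a loop with \<open>N\<close> passes.\<close>

lemma walk_end:
  assumes "a < N" "b < N" "walk (N - 1) a b = (A, x, y, B)"
  shows "x = y" "walk_inv a b (N - 1) (A, x, x, B)" "length A + length B < N"
proof -
  have inv: "walk_inv a b (N - 1) (A, x, y, B)" using walk_invariant[OF assms(1,2), of "N - 1"] assms(3) N_pos by simp
  then show "x = y" by (auto simp: walk_inv_def remaining_last)
  then show inv': "walk_inv a b (N - 1) (A, x, x, B)" using inv by simp
  have "distinct (A @ x # B)" "set (A @ x # B) \<subseteq> {..<N}" using inv' by (auto simp: walk_inv_def)
  then have "length (A @ x # B) \<le> N" by (metis card_lessThan card_mono distinct_card finite_lessThan)
  then show "length A + length B < N" by simp
qed

lemma tree_path:
  assumes "a < N" "b < N"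
  shows "distinct (tree_path a b)" "tree_path a b \<noteq> []" "hd (tree_path a b) = a" "last (tree_path a b) = b"
    "path_edges (tree_path a b) \<subseteq> tree_edges" "set (tree_path a b) \<subseteq> {..<N}"
proof -
  obtain A x y B where w: "walk (N - 1) a b = (A, x, y, B)" by (cases "walk (N - 1) a b") auto
  note W = walk_end[OF assms w]
  have tp: "tree_path a b = A @ x # B" using w by (simp add: tree_path_def)
  have "hd (A @ x # B) = hd (A @ [x])" by (cases A) auto
  then show "distinct (tree_path a b)" "tree_path a b \<noteq> []" "hd (tree_path a b) = a" "last (tree_path a b) = b"
    "path_edges (tree_path a b) \<subseteq> tree_edges" "set (tree_path a b) \<subseteq> {..<N}"
    unfolding tp using W(2) path_edges_append[of A x B] by (auto simp: walk_inv_def)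
qed

text \<open>An elimination order is a certificate for being a tree; the decision procedure verifies
  it instead of testing for connectivity and cycles.\<close>

lemma is_tree_elimination:
  assumes "verts G = {..<N}" "edges G = tree_edges"
  shows "is_tree G"
  unfolding is_tree_def
proof (intro conjI)
  show "simple_graph G"
    using assms p_neq_v p_less v_less
    by (auto simp: simple_graph_def tree_edges_def card_insert_if) (metis p_neq_v)
  show "connected_graph G"
    unfolding connected_graph_def
  proof (intro conjI ballI)
    show "verts G \<noteq> {}" using assms N_pos by auto
    fix a b assume "a \<in> verts G" "b \<in> verts G"
    then show "\<exists>q. is_path G q \<and> hd q = a \<and> last q = b"
      using assms tree_path[of a b] by (intro exI[of _ "tree_path a b"]) (simp add: is_path_def)
  qed
  show "acyclic_graph G"
    unfolding acyclic_graph_def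
  proof
    assume "\<exists>us. 3 \<le> length us \<and> distinct us \<and> cycle_edges us \<subseteq> edges G"
    then obtain x y z us where d: "distinct (x # y # z # us)" and e: "cycle_edges (x # y # z # us) \<subseteq> edges G"
      by (metis Suc_le_length_iff numeral_3_eq_3)
    let ?q = "x # y # z # us"
    have ce: "cycle_edges ?q = path_edges ?q \<union> {{last ?q, x}}"
    proof -
      have "?q = butlast ?q @ [last ?q]" by simp
      then have "cycle_edges ?q = path_edges (butlast ?q @ last ?q # [x])"
        unfolding cycle_edges_def by (metis append.assoc append_Cons append_Nil list.sel(1))
      then show ?thesis using path_edges_append[of "butlast ?q" "last ?q" "[x]"] by simp
    qed
    then have "{last ?q, x} \<in> cycle_edges ?q" by simp
    then have "{last ?q, x} \<in> tree_edges" using e assms(2) by (metis subsetD)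
    then obtain i where i: "Suc i < N" "{last ?q, x} = {v i, p i}"
      unfolding tree_edges_def by blast
    \<comment> \<open>Without its closing edge the cycle is a path whose ends are separated by the
      cut of that edge, so it would have to use the closing edge once more.\<close>
    have "(x \<in> cut i) \<noteq> (last ?q \<in> cut i)"
      using i(2) cut_self[OF i(1)] by (auto simp: doubleton_eq_iff)
    then have "{v i, p i} \<in> path_edges ?q"
      using path_uses_edge[OF d _ _ i(1)] e[unfolded ce assms(2)] by simp
    then have "{last ?q, x} \<in> path_edges ?q" using i(2) by simp
    moreover have "{last ?q, x} \<notin> path_edges (y # z # us)"
      using path_edges_Pow[of "y # z # us"] d by auto
    ultimately have "{last ?q, x} = {x, y}" by auto
    then have "last (z # us) = y" using d by (auto simp: doubleton_eq_iff)
    moreover have "last (z # us) \<in> set (z # us)" by (rule last_in_set) simp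
    ultimately show False using d by auto
  qed
qed

end

section \<open>Edge lists\<close>

definition edge_list :: "nat \<Rightarrow> (nat \<Rightarrow> nat) \<Rightarrow> (nat \<Rightarrow> nat) \<Rightarrow> nat set set \<Rightarrow> bool" where
  "edge_list m eu ev E \<longleftrightarrow> inj_on (\<lambda>j. {eu j, ev j}) {..<m} \<and> (\<lambda>j. {eu j, ev j}) ` {..<m} = E"

definition neighbours :: "nat set set \<Rightarrow> nat \<Rightarrow> nat set" where
  "neighbours E x = {y. {x, y} \<in> E}"

text \<open>Without loops and repeated edges, passing to the other end is a bijection. Counters and
  sums accumulated along the edge list are therefore degrees and sums of neighbours.\<close>

lemma edge_list_neighbours:
  assumes "edge_list m eu ev E" "\<And>e. e \<in> E \<Longrightarrow> card e = 2"
  shows "bij_betw (\<lambda>j. if eu j = x then ev j else eu j) {j. j < m \<and> (eu j = x \<or> ev j = x)} (neighbours E x)"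
    (is "bij_betw ?f ?J _")
proof -
  have e: "{x, ?f j} = {eu j, ev j}" if "j \<in> ?J" for j using that by auto
  have "inj_on ?f ?J"
  proof (rule inj_onI)
    fix i j assume ij: "i \<in> ?J" "j \<in> ?J" "?f i = ?f j"
    then have "{eu i, ev i} = {eu j, ev j}"
      using e[OF ij(1)] e[OF ij(2)] unfolding ij(3) by (rule_tac trans[OF sym])
    then show "i = j" using assms(1) ij by (auto simp: edge_list_def inj_on_def)
  qed
  moreover have "?f ` ?J = neighbours E x"
  proof (intro equalityI subsetI)
    fix y assume "y \<in> ?f ` ?J"
    then show "y \<in> neighbours E x" using e assms(1) by (force simp: neighbours_def edge_list_def)
  next
    fix y assume "y \<in> neighbours E x"
    then have y: "{x, y} \<in> E" by (simp add: neighbours_def)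
    then obtain j where j: "j < m" "{x, y} = {eu j, ev j}" using assms(1) by (auto simp: edge_list_def)
    moreover have "x \<noteq> y" using assms(2)[OF y] by auto
    ultimately show "y \<in> ?f ` ?J" by (intro image_eqI[of _ _ j]) (auto simp: doubleton_eq_iff)
  qed
  ultimately show ?thesis by (simp add: bij_betw_def)
qed

lemma edge_list_degree:
  assumes "edge_list m eu ev E" "\<And>e. e \<in> E \<Longrightarrow> card e = 2"
  shows "card {j. j < m \<and> (eu j = x \<or> ev j = x)} = card (neighbours E x)"
  using edge_list_neighbours[OF assms] by (rule bij_betw_same_card)

lemma edge_list_neighbour_sum:
  assumes "edge_list m eu ev E" "\<And>e. e \<in> E \<Longrightarrow> card e = 2"
  shows "(\<Sum>j | j < m \<and> (eu j = x \<or> ev j = x). if eu j = x then ev j else eu j) = \<Sum>(neighbours E x)"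
  using sum.reindex_bij_betw[OF edge_list_neighbours[OF assms], of "\<lambda>x. x"] by simp


section \<open>Peeling the leaves of a tree\<close>

definition incident :: "nat \<Rightarrow> (nat \<Rightarrow> nat) \<Rightarrow> (nat \<Rightarrow> nat) \<Rightarrow> nat set \<Rightarrow> nat \<Rightarrow> nat set" where
  "incident m eu ev W u = {j. j < m \<and> (eu j = u \<or> ev j = u) \<and> eu j \<in> W \<and> ev j \<in> W}"

lemma finite_incident [simp]: "finite (incident m eu ev W u)"
  by (simp add: incident_def)

text \<open>Connectivity of the graph induced by \<open>W\<close>, phrased by cuts: in this form the
  removal of a leaf is handled by adjusting a cut, without rerouting paths.\<close>

definition cut_connected :: "nat \<Rightarrow> (nat \<Rightarrow> nat) \<Rightarrow> (nat \<Rightarrow> nat) \<Rightarrow> nat set \<Rightarrow> bool" where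
  "cut_connected m eu ev W \<longleftrightarrow>
     (\<forall>A. A \<noteq> {} \<and> A \<subset> W \<longrightarrow> (\<exists>j<m. eu j \<in> W \<and> ev j \<in> W \<and> (eu j \<in> A) \<noteq> (ev j \<in> A)))"

lemma cut_connectedE:
  assumes "cut_connected m eu ev W" "A \<noteq> {}" "A \<subset> W"
  obtains j where "j < m" "eu j \<in> W" "ev j \<in> W" "(eu j \<in> A) \<noteq> (ev j \<in> A)"
  using assms unfolding cut_connected_def by auto

lemma connected_cut_connected:
  assumes "connected_graph G" "edge_list m eu ev (edges G)" "simple_graph G"
  shows "cut_connected m eu ev (verts G)"
  unfolding cut_connected_def
proof (intro allI impI)
  fix A assume A: "A \<noteq> {} \<and> A \<subset> verts G"
  then obtain a b where ab: "a \<in> A" "b \<in> verts G" "b \<notin> A" by blast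
  then obtain q where q: "is_path G q" "hd q = a" "last q = b"
    using A assms(1) unfolding connected_graph_def by blast
  obtain x y where xy: "{x, y} \<in> path_edges q" "x \<in> A" "y \<notin> A"
    using path_leaves_set[of q A] q ab by (auto simp: is_path_def)
  then have "{x, y} \<in> edges G" using q by (auto simp: is_path_def)
  then obtain j where j: "j < m" "{x, y} = {eu j, ev j}" using assms(2) by (auto simp: edge_list_def)
  moreover have "{x, y} \<subseteq> verts G" using \<open>{x, y} \<in> edges G\<close> assms(3) by (auto simp: simple_graph_def)
  ultimately show "\<exists>j<m. eu j \<in> verts G \<and> ev j \<in> verts G \<and> (eu j \<in> A) \<noteq> (ev j \<in> A)"
    using xy by (intro exI[of _ j]) (auto simp: doubleton_eq_iff)
qed

text \<open>An end of a longest path in the graph induced by \<open>W\<close> has no second neighbour.\<close>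

lemma acyclic_low_degree:
  assumes "acyclic_graph G" "edge_list m eu ev (edges G)" "simple_graph G" "finite W" "W \<noteq> {}"
  shows "\<exists>u\<in>W. card (incident m eu ev W u) \<le> 1"
proof (rule ccontr)
  assume "\<not> ?thesis"
  then have deg: "2 \<le> card (incident m eu ev W u)" if "u \<in> W" for u using that by force
  define good where "good q \<longleftrightarrow> q \<noteq> [] \<and> distinct q \<and> set q \<subseteq> W \<and> path_edges q \<subseteq> edges G" for q
  have bound: "length q \<le> card W" if "good q" for q
    using that assms(4) by (metis good_def card_mono distinct_card)
  obtain w where "w \<in> W" using assms(5) by blast
  then have "good [w]" by (simp add: good_def)
  then obtain q where q: "good q" and max: "\<And>q'. good q' \<Longrightarrow> length q' \<le> length q"
    using ex_has_greatest_nat[of good "[w]" length "card W"] bound by force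
  obtain x r where qx: "q = x # r" using q by (cases q) (auto simp: good_def)
  have xW: "x \<in> W" using q qx by (auto simp: good_def)
  have nb: "\<exists>y. j < m \<and> {eu j, ev j} = {x, y} \<and> y \<in> W" if "j \<in> incident m eu ev W x" for j
    using that by (auto simp: incident_def insert_commute)
  have inr: "y \<in> set r" if "{x, y} \<in> edges G" "y \<in> W" for y
  proof (rule ccontr)
    assume "y \<notin> set r"
    moreover have "y \<noteq> x" using that(1) assms(3) by (auto simp: simple_graph_def)
    ultimately have "good (y # q)" using q qx that by (auto simp: good_def insert_commute)
    from max[OF this] show False by simp
  qed
  obtain i j where ij: "i \<in> incident m eu ev W x" "j \<in> incident m eu ev W x" "i \<noteq> j"
  proof -
    have "\<not> card (incident m eu ev W x) \<le> Suc 0" using deg[OF xW] by simp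
    then show ?thesis using that unfolding card_le_Suc0_iff_eq[OF finite_incident] by blast
  qed
  obtain y z where yz: "{eu i, ev i} = {x, y}" "y \<in> W" "{eu j, ev j} = {x, z}" "z \<in> W" "i < m" "j < m"
    using nb[OF ij(1)] nb[OF ij(2)] by blast
  have "y \<noteq> z"
  proof
    assume "y = z"
    then have "{eu i, ev i} = {eu j, ev j}" using yz by simp
    moreover have "inj_on (\<lambda>j. {eu j, ev j}) {..<m}" using assms(2) by (simp add: edge_list_def)
    ultimately have "i = j" using yz by (auto dest: inj_onD)
    then show False using ij by simp
  qed
  have "{eu i, ev i} \<in> edges G" "{eu j, ev j} \<in> edges G" using yz(5,6) assms(2) by (auto simp: edge_list_def)
  then have E: "{x, y} \<in> edges G" "{x, z} \<in> edges G" using yz by simp_all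
  then have r: "y \<in> set r" "z \<in> set r" using inr yz by auto
  obtain b r' where b: "r = b # r'" using r by (cases r) auto
  \<comment> \<open>\<open>y\<close> and \<open>z\<close> differ, so one of them is not the
    successor \<open>b\<close> of \<open>x\<close>. The path from \<open>x\<close> up to that
    neighbour closes to a cycle with at least three nodes.\<close>
  obtain t where t: "t \<in> set r'" "{x, t} \<in> edges G" using r b E \<open>y \<noteq> z\<close> by auto
  obtain r1 r2 where r12: "r' = r1 @ t # r2" using t by (meson split_list)
  let ?c = "x # b # r1 @ [t]"
  have "path_edges (x # b # r1 @ t # r2) = path_edges ?c \<union> path_edges (t # r2)"
    using path_edges_append[of "x # b # r1" t r2] by simp
  then have "path_edges ?c \<subseteq> edges G" using q qx b r12 by (auto simp: good_def)
  moreover have "cycle_edges ?c = path_edges ?c \<union> {{t, x}}"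
    using path_edges_append[of "x # b # r1" t "[x]"] by (simp add: cycle_edges_def)
  ultimately have "cycle_edges ?c \<subseteq> edges G" using t by (auto simp: insert_commute)
  moreover have "distinct ?c" using q qx b r12 by (auto simp: good_def)
  moreover have "3 \<le> length ?c" by simp
  ultimately show False using assms(1) unfolding acyclic_graph_def by blast
qed

text \<open>The neighbour of the leaf is written as \<open>eu j + ev j - x\<close>, which holds for
  both orientations of the edge and is what the program computes.\<close>

lemma peel_leaf:
  assumes "cut_connected m eu ev W" "x \<in> W" "incident m eu ev W x = {j}" "\<And>k. k < m \<Longrightarrow> eu k \<noteq> ev k"
  defines "q \<equiv> eu j + ev j - x"
  shows "q \<in> W" "q \<noteq> x" "j < m" "{eu j, ev j} = {x, q}" "cut_connected m eu ev (W - {x})"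
    "incident m eu ev (W - {x}) w = incident m eu ev W w - {j}"
    "j \<in> incident m eu ev W w \<longleftrightarrow> w = x \<or> w = q"
    "{k. k < m \<and> eu k \<in> W - {x} \<and> ev k \<in> W - {x}} = {k. k < m \<and> eu k \<in> W \<and> ev k \<in> W} - {j}"
proof -
  have j: "j < m" "eu j = x \<or> ev j = x" "eu j \<in> W" "ev j \<in> W" "eu j \<noteq> ev j"
    using assms(3,4) by (auto simp: incident_def)
  have only: "k = j" if "k < m" "eu k = x \<or> ev k = x" "eu k \<in> W" "ev k \<in> W" for k
    using assms(3) that by (auto simp: incident_def)
  have e: "eu j = x \<and> ev j = q \<or> ev j = x \<and> eu j = q" using j by (auto simp: q_def)
  show "q \<in> W" "q \<noteq> x" "j < m" "{eu j, ev j} = {x, q}" using e j by auto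
  show "incident m eu ev (W - {x}) w = incident m eu ev W w - {j}"
    unfolding incident_def using only j by blast
  show "j \<in> incident m eu ev W w \<longleftrightarrow> w = x \<or> w = q" using j e by (auto simp: incident_def)
  show "{k. k < m \<and> eu k \<in> W - {x} \<and> ev k \<in> W - {x}} = {k. k < m \<and> eu k \<in> W \<and> ev k \<in> W} - {j}"
    using only j by blast
  show "cut_connected m eu ev (W - {x})"
    unfolding cut_connected_def
  proof (intro allI impI)
    fix A assume A: "A \<noteq> {} \<and> A \<subset> W - {x}"
    \<comment> \<open>The leaf is put on the side of its neighbour. The edge \<open>j\<close> then
      does not cross the cut, so the crossing edge survives in \<open>W - {x}\<close>.\<close>
    let ?B = "if q \<in> A then insert x A else A"
    have "?B \<noteq> {}" "?B \<subset> W" using A assms(2) by auto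
    then obtain k where k: "k < m" "eu k \<in> W" "ev k \<in> W" "(eu k \<in> ?B) \<noteq> (ev k \<in> ?B)"
      using cut_connectedE[OF assms(1)] by blast
    have "k \<noteq> j" using k e A by (auto split: if_splits)
    then have "eu k \<noteq> x" "ev k \<noteq> x" using only[OF k(1) _ k(2,3)] by blast+
    then show "\<exists>j<m. eu j \<in> W - {x} \<and> ev j \<in> W - {x} \<and> (eu j \<in> A) \<noteq> (ev j \<in> A)"
      using k by (intro exI[of _ k]) (auto split: if_splits)
  qed
qed

text \<open>State of the peeling loop after \<open>i\<close> removals: \<open>Q\<close> is the queue with \<open>qn\<close> entries, \<open>D\<close> the
  degrees and \<open>S\<close> the sums of the indices of the incident edges in the remaining tree.\<close>

definition peeling :: "nat \<Rightarrow> nat \<Rightarrow> (nat \<Rightarrow> nat) \<Rightarrow> (nat \<Rightarrow> nat) \<Rightarrow> nat \<Rightarrow> (nat \<Rightarrow> nat) \<Rightarrow> nat \<Rightarrow>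
    (nat \<Rightarrow> nat) \<Rightarrow> (nat \<Rightarrow> nat) \<Rightarrow> (nat \<Rightarrow> nat) \<Rightarrow> (nat \<Rightarrow> nat) \<Rightarrow> bool" where
  "peeling N m eu ev i Q qn D S P J \<longleftrightarrow> (let W = {..<N} - Q ` {..<i} in
     i < N \<and> card W = N - i \<and> cut_connected m eu ev W \<and> inj_on Q {..<qn} \<and>
     Q ` {..<qn} = {u. u < N \<and> card (incident m eu ev W u) \<le> 1} \<and>
     (\<forall>u. D u = card (incident m eu ev W u)) \<and> (\<forall>u. S u = \<Sum>(incident m eu ev W u)) \<and>
     (\<forall>k<i. P k \<in> {..<N} - Q ` {..<Suc k} \<and> J k < m \<and> {eu (J k), ev (J k)} = {Q k, P k}) \<and>
     {k. k < m \<and> eu k \<in> W \<and> ev k \<in> W} = {..<m} - J ` {..<i} \<and> i \<le> qn)"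

lemma peeling_start:
  assumes "is_tree G" "verts G = {..<N}" "edge_list m eu ev (edges G)"
    "inj_on Q {..<qn}" "Q ` {..<qn} = {u. u < N \<and> card {j. j < m \<and> (eu j = u \<or> ev j = u)} \<le> 1}"
    "\<And>u. D u = card {j. j < m \<and> (eu j = u \<or> ev j = u)}"
    "\<And>u. S u = \<Sum>{j. j < m \<and> (eu j = u \<or> ev j = u)}"
  shows "peeling N m eu ev 0 Q qn D S P J"
proof -
  have "{eu j, ev j} \<in> edges G" if "j < m" for j using that assms(3) by (auto simp: edge_list_def)
  moreover have "e \<subseteq> {..<N}" if "e \<in> edges G" for e
    using that assms(1,2) by (auto simp: is_tree_def simple_graph_def)
  ultimately have "{eu j, ev j} \<subseteq> {..<N}" if "j < m" for j using that by blast
  then have r: "eu j < N" "ev j < N" if "j < m" for j using that by auto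
  then have inc: "incident m eu ev {..<N} u = {j. j < m \<and> (eu j = u \<or> ev j = u)}" for u
    by (auto simp: incident_def)
  have "0 < N" using assms(1,2) by (auto simp: is_tree_def connected_graph_def)
  moreover have "cut_connected m eu ev {..<N}"
    using connected_cut_connected[of G m eu ev] assms by (auto simp: is_tree_def)
  ultimately show ?thesis using assms(4-) r by (auto simp: peeling_def inc)
qed

text \<open>As long as two nodes remain, acyclicity provides a node of degree at most 1, so the
  queue is not exhausted; connectivity makes the degree of the next entry exactly 1, so its sum of
  incident indices is the index of its only edge. Removed nodes have degree 0 and stay in the queue
  without harm.\<close>

lemma peeling_step:
  assumes G: "is_tree G" "verts G = {..<N}" "edge_list m eu ev (edges G)"
    and inv: "peeling N m eu ev i Q qn D S P J" and "Suc i < N"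
  defines "x \<equiv> Q i"
  defines "j \<equiv> S x"
  defines "q \<equiv> eu j + ev j - x"
  defines "D' \<equiv> D(x := D x - 1, q := D q - 1)"
  defines "S' \<equiv> S(x := S x - j, q := S q - j)"
  shows "x \<noteq> q"
    and "peeling N m eu ev (Suc i) (if D' q = 1 then Q(qn := q) else Q) (if D' q = 1 then Suc qn else qn)
      D' S' (P(i := q)) (J(i := j))"
proof -
  define W where "W = {..<N} - Q ` {..<i}"
  note inv = inv[unfolded peeling_def Let_def, folded W_def]
  have loop: "eu k \<noteq> ev k" if "k < m" for k
  proof -
    have "card {eu k, ev k} = 2" using that G by (auto simp: is_tree_def simple_graph_def edge_list_def)
    then show ?thesis by auto
  qed
  have cW: "2 \<le> card W" "finite W" using inv \<open>Suc i < N\<close> by (auto simp: W_def)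
  then have "W \<noteq> {}" by auto
  obtain u where u: "u \<in> W" "card (incident m eu ev W u) \<le> 1"
    using acyclic_low_degree[of G m eu ev W] G cW(2) \<open>W \<noteq> {}\<close> by (auto simp: is_tree_def)
  \<comment> \<open>The dequeued entries all lie outside \<open>W\<close>, whereas \<open>u\<close>
    has low degree and lies in \<open>W\<close>; it must occupy a later position of the
    queue.\<close>
  have "i < qn"
  proof (rule ccontr)
    assume "\<not> i < qn"
    then have "Q ` {..<qn} \<subseteq> Q ` {..<i}" by auto
    then show False using u inv by (auto simp: W_def)
  qed
  then have "x \<in> Q ` {..<qn}" by (auto simp: x_def)
  then have x: "x < N" "card (incident m eu ev W x) \<le> 1" using inv by auto
  have "x \<notin> Q ` {..<i}"
  proof
    assume "x \<in> Q ` {..<i}"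
    then obtain k where k: "k < i" "Q i = Q k" by (auto simp: x_def)
    moreover have "inj_on Q {..<qn}" using inv by simp
    ultimately show False using \<open>i < qn\<close> by (auto dest: inj_onD)
  qed
  then have xW: "x \<in> W" using x by (auto simp: W_def)
  have "incident m eu ev W x \<noteq> {}"
  proof -
    have "cut_connected m eu ev W" "{x} \<noteq> {}" "{x} \<subset> W" using xW cW inv by auto
    then obtain k where "k < m" "eu k \<in> W" "ev k \<in> W" "(eu k \<in> {x}) \<noteq> (ev k \<in> {x})"
      by (rule cut_connectedE)
    then show ?thesis by (auto simp: incident_def)
  qed
  then have "card (incident m eu ev W x) = 1" using x by (metis One_nat_def card_0_eq finite_incident le_SucE le_zero_eq)
  then obtain j' where j': "incident m eu ev W x = {j'}" by (auto simp: card_1_singleton_iff)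
  then have jj: "j' = j" using inv by (simp add: j_def)
  have conn: "cut_connected m eu ev W" using inv by auto
  note P = peel_leaf[OF conn xW j'[unfolded jj] loop, folded q_def]
  show "x \<noteq> q" using P(2) by simp
  let ?Q = "if D' q = 1 then Q(qn := q) else Q"
  let ?qn = "if D' q = 1 then Suc qn else qn"
  have QQ: "?Q k = Q k" if "k < qn" for k using that by simp
  have W': "{..<N} - ?Q ` {..<Suc i} = W - {x}"
  proof -
    have "?Q ` {..<Suc i} = Q ` {..<Suc i}" using QQ \<open>i < qn\<close> by (intro image_cong) auto
    then show ?thesis by (auto simp: W_def x_def lessThan_Suc)
  qed
  have inc: "card (incident m eu ev (W - {x}) w) = D' w" "\<Sum>(incident m eu ev (W - {x}) w) = S' w" for w
    using P(2) P(6,7)[of w] inv by (auto simp: D'_def S'_def sum_diff1_nat)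
  \<comment> \<open>Only \<open>q\<close> can be new, namely if its degree falls from 2 to 1. If it
    falls from 1 to 0, \<open>q\<close> was queued before.\<close>
  have "{u. u < N \<and> D' u \<le> 1} = (if D' q = 1 then insert q (Q ` {..<qn}) else Q ` {..<qn})"
  proof -
    have Q: "Q ` {..<qn} = {u. u < N \<and> D u \<le> 1}" using inv by simp
    have "D x = 1" using inv \<open>card (incident m eu ev W x) = 1\<close> by simp
    have "q < N" using P(1) by (auto simp: W_def)
    have "1 \<le> D q"
    proof -
      have "j \<in> incident m eu ev W q" using P(7) by auto
      then have "0 < card (incident m eu ev W q)" by (auto simp: card_gt_0_iff)
      moreover have "D q = card (incident m eu ev W q)" using inv by blast
      ultimately show ?thesis by linarith
    qed
    then show ?thesis unfolding Q using \<open>D x = 1\<close> \<open>q < N\<close> by (auto simp: D'_def split: if_splits)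
  qed
  moreover have "?Q ` {..<?qn} = (if D' q = 1 then insert q (Q ` {..<qn}) else Q ` {..<qn})"
    by (auto simp: lessThan_Suc)
  ultimately have im: "?Q ` {..<?qn} = {u. u < N \<and> D' u \<le> 1}" by simp
  have inj: "inj_on ?Q {..<?qn}"
  proof (cases "D' q = 1")
    case True
    have "1 \<le> D q" "D q \<noteq> 1" using True by (auto simp: D'_def)
    then have "q \<notin> Q ` {..<qn}" using inv by auto
    moreover have "inj_on Q {..<qn}" using inv by simp
    ultimately show ?thesis using True by (auto simp: inj_on_def less_Suc_eq)
  qed (use inv in simp)
  have hist: "(P(i := q)) k \<in> {..<N} - ?Q ` {..<Suc k} \<and> (J(i := j)) k < m \<and>
      {eu ((J(i := j)) k), ev ((J(i := j)) k)} = {?Q k, (P(i := q)) k}" if "k < Suc i" for k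
  proof -
    have im: "?Q ` {..<Suc k} = Q ` {..<Suc k}" and Qk: "?Q k = Q k"
      using QQ that \<open>i < qn\<close> by (auto intro!: image_cong)
    show ?thesis
    proof (cases "k = i")
      case True
      have "q \<notin> Q ` {..<Suc i}" using P(1,2) by (auto simp: W_def x_def lessThan_Suc)
      then show ?thesis using P(1,3,4) True unfolding im Qk by (auto simp: W_def x_def)
    next
      case False
      then show ?thesis using inv that unfolding im Qk by auto
    qed
  qed
  have "{..<m} - (J(i := j)) ` {..<Suc i} = {..<m} - J ` {..<i} - {j}"
    by (auto simp: lessThan_Suc)
  then have E: "{k. k < m \<and> eu k \<in> W - {x} \<and> ev k \<in> W - {x}} = {..<m} - (J(i := j)) ` {..<Suc i}"
    using P(8) inv by simp
  have "card (W - {x}) = N - Suc i" using xW cW inv by simp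
  then show "peeling N m eu ev (Suc i) ?Q ?qn D' S' (P(i := q)) (J(i := j))"
    unfolding peeling_def Let_def W' inc
    using \<open>Suc i < N\<close> P(5) inj im E hist \<open>i < qn\<close> by auto
qed

text \<open>A single remaining node carries no edge, so every degree is 0 and the queue lists all
  nodes. A recorded parent is not among the nodes eliminated so far and hence occurs later in the
  queue.\<close>

lemma peeling_end:
  assumes "peeling N m eu ev (N - 1) Q qn D S P J" "\<And>k. k < m \<Longrightarrow> eu k \<noteq> ev k" "inj_on (\<lambda>j. {eu j, ev j}) {..<m}"
  shows "elimination N Q P" "bij_betw J {..<N - 1} {..<m}"
    "\<And>i. Suc i < N \<Longrightarrow> {eu (J i), ev (J i)} = {Q i, P i}"
proof -
  define W where "W = {..<N} - Q ` {..<N - 1}"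
  note inv = assms(1)[unfolded peeling_def Let_def, folded W_def]
  have "card W = 1" using inv by auto
  then obtain w where w: "W = {w}" by (auto simp: card_1_singleton_iff)
  have "\<not> (eu k \<in> W \<and> ev k \<in> W)" if "k < m" for k using assms(2)[OF that] w by simp
  then have none: "incident m eu ev W u = {}" for u by (auto simp: incident_def)
  then have im: "Q ` {..<qn} = {..<N}" using inv by auto
  moreover have inj: "inj_on Q {..<qn}" using inv by simp
  ultimately have "qn = N" by (metis card_image card_lessThan)
  then have bij: "bij_betw Q {..<N} {..<N}" using im inj by (simp add: bij_betw_def)
  show "elimination N Q P"
  proof
    show "0 < N" using inv by simp
    show "bij_betw Q {..<N} {..<N}" by (rule bij)
    fix i assume "Suc i < N"
    then have P: "P i \<in> {..<N} - Q ` {..<Suc i}" using inv by simp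
    then obtain k where k: "k < N" "P i = Q k" using bij by (auto simp: bij_betw_def)
    then have "\<not> k < Suc i" using P by auto
    then show "\<exists>k. i < k \<and> k < N \<and> P i = Q k" using k by (intro exI[of _ k]) simp
  qed
  then interpret elimination N Q P .
  show e: "{eu (J i), ev (J i)} = {Q i, P i}" if "Suc i < N" for i using inv that by simp
  have "{k. k < m \<and> eu k \<in> W \<and> ev k \<in> W} = {}" using none by (auto simp: incident_def)
  then have "{..<m} \<subseteq> J ` {..<N - 1}" using inv by auto
  moreover have "J ` {..<N - 1} \<subseteq> {..<m}" using inv by auto
  moreover have "inj_on J {..<N - 1}"
    using e tree_edge_inj by (intro inj_onI) (metis Suc_eq_plus1 lessThan_iff less_diff_conv)
  ultimately show "bij_betw J {..<N - 1} {..<m}" by (auto simp: bij_betw_def)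
qed

section \<open>Wheels\<close>

text \<open>For the indicator \<open>\<chi>\<close> of a set along the rim, with
  \<open>\<chi> n = \<chi> 0\<close>, this is the number of rim edges that leave the set.\<close>

definition turns :: "nat \<Rightarrow> (nat \<Rightarrow> bool) \<Rightarrow> nat" where
  "turns n \<chi> = card {i. i < n \<and> \<chi> i \<noteq> \<chi> (Suc i)}"

lemma turns_constant: "(\<And>i. i \<le> n \<Longrightarrow> \<chi> i = b) \<Longrightarrow> turns n \<chi> = 0"
  by (auto simp: turns_def)

lemma constant_if_no_step:
  assumes "\<And>i. i < n \<Longrightarrow> \<chi> i \<Longrightarrow> \<chi> (Suc i)" "\<chi> n = \<chi> 0" "j < n" "\<chi> j" "k \<le> n"
  shows "\<chi> k"
proof -
  have up: "\<chi> k" if "i \<le> k" "k \<le> n" "\<chi> i" for i k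
    using that
  proof (induction rule: dec_induct)
    case (step m) then show ?case using assms(1)[of m] by simp
  qed
  from up[of j n] assms have "\<chi> 0" by simp
  from up[of 0 k] this assms show ?thesis by simp
qed

text \<open>A cyclic sequence with both values switches once in each direction, necessarily at
  different positions.\<close>

lemma turns_ge_2:
  assumes "\<chi> n = \<chi> 0" "j < n" "\<chi> j" "k < n" "\<not> \<chi> k"
  shows "2 \<le> turns n \<chi>"
proof -
  obtain a where a: "a < n" "\<chi> a" "\<not> \<chi> (Suc a)"
    using constant_if_no_step[of n \<chi> j k] assms by auto
  obtain b where b: "b < n" "\<not> \<chi> b" "\<chi> (Suc b)"
    using constant_if_no_step[of n "\<lambda>i. \<not> \<chi> i" k j] assms by auto
  have "{a, b} \<subseteq> {i. i < n \<and> \<chi> i \<noteq> \<chi> (Suc i)}" using a b by auto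
  then have "card {a, b} \<le> turns n \<chi>" unfolding turns_def by (intro card_mono) auto
  moreover have "a \<noteq> b" using a b by auto
  ultimately show ?thesis by simp
qed

lemma turns_interval:
  assumes "\<chi> n = \<chi> 0" "\<And>i. i < n \<Longrightarrow> \<chi> i \<longleftrightarrow> a \<le> i \<and> i < b" "b \<le> n" "0 < n"
  shows "turns n \<chi> \<le> 2"
proof -
  \<comment> \<open>The indicator changes only on entering the interval, at the cyclic predecessor
    of \<open>a\<close>, and on leaving it, at \<open>b - 1\<close>.\<close>
  have "{i. i < n \<and> \<chi> i \<noteq> \<chi> (Suc i)} \<subseteq> {if a = 0 then n - 1 else a - 1, b - 1}"
  proof
    fix i assume "i \<in> {i. i < n \<and> \<chi> i \<noteq> \<chi> (Suc i)}"
    then have i: "i < n" "\<chi> i \<noteq> \<chi> (Suc i)" by auto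
    show "i \<in> {if a = 0 then n - 1 else a - 1, b - 1}"
    proof (cases "Suc i < n")
      case True
      then show ?thesis using i assms(2)[of i] assms(2)[of "Suc i"] by auto
    next
      case False
      then have "Suc i = n" using i by simp
      then have "(a \<le> i \<and> i < b) \<noteq> (a \<le> 0 \<and> 0 < b)"
        using i assms(1) assms(2)[of i] assms(2)[of 0] assms(4) by simp
      then show ?thesis using \<open>Suc i = n\<close> assms(3) by auto
    qed
  qed
  then have "turns n \<chi> \<le> card {if a = 0 then n - 1 else a - 1, b - 1}"
    unfolding turns_def by (intro card_mono) auto
  also have "\<dots> \<le> 2" by (simp add: card_insert_if)
  finally show ?thesis .
qed

text \<open>The number of edges leaving an arc of \<open>k\<close> rim nodes.\<close>

definition arc_cut :: "nat \<Rightarrow> nat \<Rightarrow> nat" where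
  "arc_cut n k = (if k = 0 \<or> k = n then k else k + 2)"

text \<open>The rim is indexed up to \<open>n\<close> with \<open>r n = r 0\<close>, which keeps the
  modulus out of the rim edges. The array \<open>US\<close> of the program has this form.\<close>

locale wheel =
  fixes n c :: nat and r :: "nat \<Rightarrow> nat"
  assumes n3: "3 \<le> n" and r_inj: "inj_on r {..<n}" and r_period: "r n = r 0" and c_r: "c \<notin> r ` {..<n}"
begin

definition V :: "nat set" where "V = insert c (r ` {..<n})"

definition E :: "nat set set" where
  "E = (\<lambda>i. {r i, r (Suc i)}) ` {..<n} \<union> (\<lambda>i. {c, r i}) ` {..<n}"

lemma r_eq: "i < n \<Longrightarrow> j < n \<Longrightarrow> r i = r j \<longleftrightarrow> i = j"
  using r_inj by (auto simp: inj_on_def)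

lemma r_c: "i \<le> n \<Longrightarrow> r i \<noteq> c" "i \<le> n \<Longrightarrow> c \<noteq> r i"
  using c_r r_period n3 by (cases "i = n"; force)+

lemma r_Suc_eq: "i < n \<Longrightarrow> j < n \<Longrightarrow> r (Suc i) = r j \<longleftrightarrow> j = (if Suc i = n then 0 else Suc i)"
  using r_eq[of "Suc i" j] r_eq[of 0 j] r_period n3 by auto

lemma card_V: "card V = Suc n"
  using c_r r_inj by (simp add: V_def card_image)

text \<open>Here \<open>n \<ge> 3\<close> is essential: on a rim of two nodes each is the successor
  of the other and the two rim edges coincide.\<close>

lemma rim_inj: "inj_on (\<lambda>i. {r i, r (Suc i)}) {..<n}"
proof (rule inj_onI)
  fix i j assume ij: "i \<in> {..<n}" "j \<in> {..<n}" "{r i, r (Suc i)} = {r j, r (Suc j)}"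
  then consider "r i = r j" | "r (Suc j) = r i" "r (Suc i) = r j" by (auto simp: doubleton_eq_iff)
  then show "i = j"
  proof cases
    case 1 then show ?thesis using ij r_eq by auto
  next
    case 2
    have "j = (if Suc i = n then 0 else Suc i)" using r_Suc_eq[of i j] 2(2) ij by simp
    moreover have "i = (if Suc j = n then 0 else Suc j)" using r_Suc_eq[of j i] 2(1) ij by simp
    ultimately show ?thesis using n3 by presburger
  qed
qed

lemma spoke_inj: "inj_on (\<lambda>i. {c, r i}) {..<n}"
proof (rule inj_onI)
  fix i j assume ij: "i \<in> {..<n}" "j \<in> {..<n}" "{c, r i} = {c, r j}"
  then have "r i = r j" by (auto simp: doubleton_eq_iff)
  then show "i = j" using ij r_eq by simp
qed

lemma rim_spoke_disjoint: "i < n \<Longrightarrow> j < n \<Longrightarrow> {r i, r (Suc i)} \<noteq> {c, r j}"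
  using r_c[of i] r_c[of "Suc i"] by (auto simp: doubleton_eq_iff)

lemma finite_E [simp]: "finite E" and finite_V [simp]: "finite V"
  by (simp_all add: E_def V_def)

lemma card_E: "card E = 2 * n"
proof -
  have "card E = card ((\<lambda>i. {r i, r (Suc i)}) ` {..<n}) + card ((\<lambda>i. {c, r i}) ` {..<n})"
    unfolding E_def using rim_spoke_disjoint by (intro card_Un_disjoint) auto
  then show ?thesis using rim_inj spoke_inj by (simp add: card_image)
qed

lemma r_V: "i \<le> n \<Longrightarrow> r i \<in> V" and c_V: "c \<in> V"
  using r_period n3 by (cases "i = n"; force simp: V_def) (simp add: V_def)

lemma E_edges: "e \<in> E \<Longrightarrow> e \<subseteq> V \<and> card e = 2"
proof -
  assume "e \<in> E"
  then consider i where "i < n" "e = {r i, r (Suc i)}" | i where "i < n" "e = {c, r i}" by (auto simp: E_def)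
  then show ?thesis
  proof cases
    case (1 i)
    have "r (Suc i) \<noteq> r i" unfolding r_Suc_eq[OF 1(1) 1(1)] using n3 1(1) by presburger
    then have "card {r i, r (Suc i)} = 2" by (simp add: card_insert_if)
    moreover have "r i \<in> V" "r (Suc i) \<in> V" using 1(1) by (auto intro: r_V)
    ultimately show ?thesis unfolding 1(2) by simp
  next
    case (2 i)
    then have "r i \<in> V" "c \<noteq> r i" using r_c[of i] by (auto intro: r_V)
    then show ?thesis unfolding 2(2) using c_V by simp
  qed
qed

definition crossing :: "nat set \<Rightarrow> nat set set" where
  "crossing S = {d \<in> E. d \<inter> S \<noteq> {} \<and> \<not> d \<subseteq> S}"

text \<open>The number of crossing spokes, that is, of rim nodes separated from the centre. It is
  the same for \<open>S\<close> and for its complement.\<close>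

definition far_side :: "nat set \<Rightarrow> nat" where
  "far_side S = card {i. i < n \<and> (r i \<in> S) \<noteq> (c \<in> S)}"

lemma card_crossing:
  "card (crossing S) = turns n (\<lambda>i. r i \<in> S) + far_side S"
proof -
  let ?A = "{i. i < n \<and> (r i \<in> S) \<noteq> (r (Suc i) \<in> S)}"
  let ?B = "{i. i < n \<and> (r i \<in> S) \<noteq> (c \<in> S)}"
  let ?f = "\<lambda>i. {r i, r (Suc i)}" and ?g = "\<lambda>i. {c, r i}"
  have "crossing S = ?f ` ?A \<union> ?g ` ?B"
    unfolding crossing_def E_def by auto
  moreover have "?f ` ?A \<inter> ?g ` ?B = {}" using rim_spoke_disjoint by auto
  moreover have "inj_on ?f ?A" "inj_on ?g ?B"
    using rim_inj spoke_inj by (auto intro: inj_on_subset)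
  ultimately have "card (crossing S) = card ?A + card ?B"
    by (simp add: card_Un_disjoint card_image)
  then show ?thesis by (simp add: turns_def far_side_def)
qed

lemma far_side: "far_side S = (if c \<in> S then n - card {i. i < n \<and> r i \<in> S} else card {i. i < n \<and> r i \<in> S})"
proof -
  have "{i. i < n \<and> r i \<notin> S} = {..<n} - {i. i < n \<and> r i \<in> S}" by auto
  then have "card {i. i < n \<and> r i \<notin> S} = n - card {i. i < n \<and> r i \<in> S}"
    by (simp add: card_Diff_subset subset_eq)
  then show ?thesis by (simp add: far_side_def)
qed

lemma far_side_cases:
  shows "far_side S = 0 \<Longrightarrow> i < n \<Longrightarrow> r i \<in> S \<longleftrightarrow> c \<in> S"
    and "far_side S = n \<Longrightarrow> i < n \<Longrightarrow> r i \<in> S \<longleftrightarrow> c \<notin> S"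
    and "far_side S \<noteq> 0 \<Longrightarrow> \<exists>i<n. (r i \<in> S) \<noteq> (c \<in> S)"
    and "far_side S \<noteq> n \<Longrightarrow> \<exists>i<n. (r i \<in> S) = (c \<in> S)"
proof -
  let ?B = "{i. i < n \<and> (r i \<in> S) \<noteq> (c \<in> S)}"
  have fin: "finite ?B" by simp
  show "far_side S = 0 \<Longrightarrow> i < n \<Longrightarrow> r i \<in> S \<longleftrightarrow> c \<in> S"
    unfolding far_side_def card_0_eq[OF fin] by blast
  show "far_side S \<noteq> 0 \<Longrightarrow> \<exists>i<n. (r i \<in> S) \<noteq> (c \<in> S)"
    unfolding far_side_def card_0_eq[OF fin] by blast
  have eq: "?B = {..<n}" if "far_side S = n"
    using that card_subset_eq[of "{..<n}" ?B] by (auto simp: far_side_def)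
  show "far_side S = n \<Longrightarrow> i < n \<Longrightarrow> r i \<in> S \<longleftrightarrow> c \<notin> S"
    using eq by blast
  show "\<exists>i<n. (r i \<in> S) = (c \<in> S)" if "far_side S \<noteq> n"
  proof (rule ccontr)
    assume "\<not> ?thesis"
    then have "?B = {..<n}" by auto
    then have "far_side S = n" unfolding far_side_def by simp
    then show False using that by simp
  qed
qed

lemma turns_extreme:
  assumes "far_side S = 0 \<or> far_side S = n"
  shows "turns n (\<lambda>i. r i \<in> S) = 0"
proof (rule turns_constant)
  fix i assume "i \<le> n"
  then have "r i = r (if i = n then 0 else i)" "(if i = n then 0 else i) < n" using r_period n3 by auto
  then obtain j where j: "j < n" "r i = r j" by blast
  show "r i \<in> S \<longleftrightarrow> (if far_side S = 0 then c \<in> S else c \<notin> S)"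
    using assms far_side_cases(1,2)[OF _ j(1)] j(2) by auto
qed

text \<open>If the rim is split, at least two rim edges cross in addition to the spokes. The bound
  sees the cut only through the number of rim nodes and the place of the centre, which is what makes
  a knapsack computation possible.\<close>

lemma crossing_ge: "arc_cut n (far_side S) \<le> card (crossing S)"
proof (cases "far_side S = 0 \<or> far_side S = n")
  case True
  then show ?thesis by (auto simp: arc_cut_def card_crossing)
next
  case False
  then obtain i j where "i < n" "(r i \<in> S) \<noteq> (c \<in> S)" "j < n" "(r j \<in> S) = (c \<in> S)"
    using far_side_cases(3,4) by blast
  then have "2 \<le> turns n (\<lambda>i. r i \<in> S)"
    using turns_ge_2[of "\<lambda>i. r i \<in> S" n i j] turns_ge_2[of "\<lambda>i. r i \<in> S" n j i] r_period
    by (cases "c \<in> S") auto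
  then show ?thesis using False by (auto simp: arc_cut_def card_crossing)
qed

text \<open>The interval hypothesis says nothing about the centre. If the centre lies in
  \<open>S\<close>, the rim nodes separated from it form the complementary arc, and two rim edges
  still suffice.\<close>

lemma crossing_interval:
  assumes "\<And>i. i < n \<Longrightarrow> r i \<in> S \<longleftrightarrow> a \<le> i \<and> i < b" "b \<le> n"
  shows "card (crossing S) = arc_cut n (far_side S)"
proof (cases "far_side S = 0 \<or> far_side S = n")
  case True
  then show ?thesis using turns_extreme[OF True] by (auto simp: arc_cut_def card_crossing)
next
  case False
  have "turns n (\<lambda>i. r i \<in> S) \<le> 2"
    using assms r_period n3 by (intro turns_interval[where a = a and b = b]) auto
  then show ?thesis using False crossing_ge[of S] by (auto simp: arc_cut_def card_crossing)
qed

lemma is_wheel_VE: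
  assumes "verts G = V" "edges G = E"
  shows "is_wheel G"
proof -
  let ?us = "map r [0..<n]"
  have "?us ! (Suc i mod n) = r (Suc i)" if "i < n" for i
    using that r_period n3 by (cases "Suc i = n") auto
  then have "cycle_edges ?us = (\<lambda>i. {r i, r (Suc i)}) ` {..<n}"
    using n3 by (subst cycle_edges_nth) auto
  moreover have "set ?us = r ` {..<n}" by (simp add: lessThan_atLeast0)
  ultimately show ?thesis
    unfolding is_wheel_def
    using assms n3 r_inj c_r
    by (intro exI[of _ c] exI[of _ ?us])
      (auto simp: V_def E_def distinct_map lessThan_atLeast0 image_image)
qed

lemma connected_VE:
  assumes "verts G = V" "edges G = E"
  shows "simple_graph G" "connected_graph G"
proof -
  show "simple_graph G" using E_edges assms by (auto simp: simple_graph_def)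
  have spoke: "{c, x} \<in> edges G" if "x \<in> V" "x \<noteq> c" for x
    using that assms by (auto simp: V_def E_def)
  show "connected_graph G"
    unfolding connected_graph_def
  proof (intro conjI ballI)
    show "verts G \<noteq> {}" using assms by (auto simp: V_def)
    fix a b assume ab: "a \<in> verts G" "b \<in> verts G"
    then have V: "a \<in> V" "b \<in> V" using assms by auto
    consider "a = b" | "a \<noteq> b" "a = c" | "a \<noteq> b" "b = c" | "a \<noteq> b" "a \<noteq> c" "b \<noteq> c" by blast
    then show "\<exists>q. is_path G q \<and> hd q = a \<and> last q = b"
    proof cases
      case 1
      then show ?thesis using ab by (intro exI[of _ "[a]"]) (simp add: is_path_def)
    next
      case 2
      then show ?thesis using ab spoke[OF V(2)] by (intro exI[of _ "[a, b]"]) (simp add: is_path_def)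
    next
      case 3
      then show ?thesis using ab spoke[OF V(1)]
        by (intro exI[of _ "[a, b]"]) (simp add: is_path_def insert_commute)
    next
      case 4
      then show ?thesis using ab spoke[OF V(1)] spoke[OF V(2)] c_V assms
        by (intro exI[of _ "[a, c, b]"]) (simp add: is_path_def insert_commute)
    qed
  qed
qed

end

section \<open>Symmetries of the wheel\<close>

text \<open>Indexing the rim by the integers makes rotations and reflections of the wheel trivial.\<close>

definition periodic_wheel :: "nat \<Rightarrow> nat \<Rightarrow> (int \<Rightarrow> nat) \<Rightarrow> nat set \<Rightarrow> nat set set \<Rightarrow> bool" where
  "periodic_wheel n c \<rho> V E \<longleftrightarrow> 3 \<le> n \<and> (\<forall>i j. \<rho> i = \<rho> j \<longleftrightarrow> i mod int n = j mod int n) \<and>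
     (\<forall>i. \<rho> i \<noteq> c) \<and> V = insert c (range \<rho>) \<and>
     E = range (\<lambda>i. {\<rho> i, \<rho> (i + 1)}) \<union> range (\<lambda>i. {c, \<rho> i})"

lemma range_periodic:
  fixes f :: "int \<Rightarrow> 'a"
  assumes "\<And>i. f (i mod int n) = f i" "0 < n"
  shows "range f = (\<lambda>i. f (int i)) ` {..<n}"
proof (intro equalityI subsetI)
  fix x assume "x \<in> range f"
  then obtain i where "x = f i" by blast
  then have "x = f (int (nat (i mod int n)))" using assms by simp
  moreover have "nat (i mod int n) < n" using assms(2) by (simp add: nat_less_iff)
  ultimately show "x \<in> (\<lambda>i. f (int i)) ` {..<n}" by blast
qed auto

lemma periodic_wheel_wheel:
  assumes "periodic_wheel n c \<rho> V E" "\<And>i. i \<le> n \<Longrightarrow> r i = \<rho> (int i)"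
  shows "wheel n c r" "wheel.V n c r = V" "wheel.E n c r = E"
proof -
  have n: "3 \<le> n" and eq: "\<And>i j. \<rho> i = \<rho> j \<longleftrightarrow> i mod int n = j mod int n" and c: "\<And>i. \<rho> i \<noteq> c"
    using assms(1) by (auto simp: periodic_wheel_def)
  show w: "wheel n c r"
  proof
    show "inj_on r {..<n}" using assms(2) eq by (auto simp: inj_on_def)
    show "r n = r 0" using assms(2) eq[of "int n" 0] by simp
    show "c \<notin> r ` {..<n}" using assms(2) c by auto
  qed (rule n)
  have m: "\<rho> (i mod int n) = \<rho> i" "\<rho> (i mod int n + 1) = \<rho> (i + 1)" for i
    by (simp_all add: eq mod_simps)
  have "(\<lambda>i. \<rho> (int i)) ` {..<n} = r ` {..<n}" using assms(2) by (intro image_cong) auto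
  then show "wheel.V n c r = V" using n assms(1) range_periodic[of \<rho> n] m unfolding wheel.V_def[OF w] periodic_wheel_def by auto
  have "(\<lambda>i. {\<rho> (int i), \<rho> (int i + 1)}) ` {..<n} = (\<lambda>i. {r i, r (Suc i)}) ` {..<n}"
    using assms(2) by (intro image_cong) (auto simp: add.commute)
  moreover have "(\<lambda>i. {c, \<rho> (int i)}) ` {..<n} = (\<lambda>i. {c, r i}) ` {..<n}"
    using assms(2) by (intro image_cong) auto
  ultimately show "wheel.E n c r = E"
    using n assms(1) range_periodic[of "\<lambda>i. {\<rho> i, \<rho> (i + 1)}" n] range_periodic[of "\<lambda>i. {c, \<rho> i}" n] m
    unfolding wheel.E_def[OF w] periodic_wheel_def by simp
qed

lemma is_wheel_periodic:
  assumes "is_wheel G"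
  shows "\<exists>n c \<rho>. periodic_wheel n c \<rho> (verts G) (edges G)"
proof -
  obtain c us where w: "3 \<le> length us" "distinct us" "c \<notin> set us" "verts G = insert c (set us)"
    "edges G = cycle_edges us \<union> (\<lambda>u. {c, u}) ` set us"
    using assms by (auto simp: is_wheel_def)
  let ?n = "length us"
  have n0: "0 < int ?n" using w(1) by linarith
  define \<rho> where "\<rho> i = us ! nat (i mod int ?n)" for i
  have lt: "nat (i mod int ?n) < ?n" for i using n0 by (simp add: nat_less_iff)
  have eq: "\<rho> i = \<rho> j \<longleftrightarrow> i mod int ?n = j mod int ?n" for i j
    unfolding \<rho>_def using nth_eq_iff_index_eq[OF w(2) lt lt, of i j] n0 by (simp add: eq_nat_nat_iff)
  have small: "\<rho> (int i) = us ! (i mod ?n)" for i by (simp add: \<rho>_def flip: zmod_int)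
  have m: "\<rho> (i mod int ?n) = \<rho> i" "\<rho> (i mod int ?n + 1) = \<rho> (i + 1)" for i
    by (simp_all add: eq mod_simps)
  have R: "range \<rho> = set us"
  proof -
    have "range \<rho> = (\<lambda>i. \<rho> (int i)) ` {..<?n}" using m w(1) by (intro range_periodic) auto
    also have "\<dots> = (\<lambda>i. us ! i) ` {..<?n}" using small by (intro image_cong) auto
    also have "\<dots> = set us" by (auto simp: set_conv_nth)
    finally show ?thesis .
  qed
  have C: "range (\<lambda>i. {\<rho> i, \<rho> (i + 1)}) = cycle_edges us"
  proof -
    have "\<rho> (int i + 1) = us ! (Suc i mod ?n)" for i using small[of "Suc i"] by (simp add: add.commute)
    moreover have "\<rho> (int i) = us ! i" if "i < ?n" for i using small[of i] that by simp
    moreover have "us \<noteq> []" using w(1) by auto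
    ultimately show ?thesis
      using range_periodic[of "\<lambda>i. {\<rho> i, \<rho> (i + 1)}" ?n] m w(1) by (simp add: cycle_edges_nth)
  qed
  have "range (\<lambda>i. {c, \<rho> i}) = (\<lambda>u. {c, u}) ` set us" using R by auto
  then have "periodic_wheel ?n c \<rho> (verts G) (edges G)"
    unfolding periodic_wheel_def using w eq R C by auto
  then show ?thesis by blast
qed

lemma periodic_wheel_rotate:
  assumes "periodic_wheel n c \<rho> V E"
  shows "periodic_wheel n c (\<lambda>i. \<rho> (i + k)) V E"
proof -
  have ra: "range (\<lambda>i. f (i + k)) = range f" for f :: "int \<Rightarrow> 'a"
  proof -
    have "range (\<lambda>i. i + k) = UNIV" by (rule surjI[of _ "\<lambda>i. i - k"]) simp
    then show ?thesis by (metis image_image)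
  qed
  have "(i + k) mod int n = (j + k) mod int n \<longleftrightarrow> i mod int n = j mod int n" for i j
    by (simp add: mod_eq_dvd_iff)
  then show ?thesis using assms ra[of \<rho>] ra[of "\<lambda>i. {\<rho> i, \<rho> (i + 1)}"] ra[of "\<lambda>i. {c, \<rho> i}"]
    unfolding periodic_wheel_def by (simp add: ac_simps)
qed

lemma periodic_wheel_reflect:
  assumes "periodic_wheel n c \<rho> V E"
  shows "periodic_wheel n c (\<lambda>i. \<rho> (- i)) V E"
proof -
  have "surj (\<lambda>i::int. - i)" by (rule surjI[of _ "\<lambda>i. - i"]) simp
  then have ra: "range (\<lambda>i. f (- i)) = range f" for f :: "int \<Rightarrow> 'a"
    by (metis image_image)
  \<comment> \<open>The reflected rim edge at position \<open>i\<close> is the original one at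
    position \<open>- i - 1\<close>.\<close>
  have s: "surj (\<lambda>i::int. - i - 1)" by (rule surjI[of _ "\<lambda>i. - i - 1"]) simp
  have "(\<lambda>i. {\<rho> (- i), \<rho> (- (i + 1))}) = (\<lambda>i. {\<rho> i, \<rho> (i + 1)}) \<circ> (\<lambda>i. - i - 1)"
    by (auto simp: fun_eq_iff)
  then have "range (\<lambda>i. {\<rho> (- i), \<rho> (- (i + 1))}) = range (\<lambda>i. {\<rho> i, \<rho> (i + 1)})"
    unfolding image_comp[symmetric] s by (simp only: image_comp[symmetric] s)
  moreover have "(- i) mod int n = (- j) mod int n \<longleftrightarrow> i mod int n = j mod int n" for i j
    by (simp add: mod_eq_dvd_iff) (metis dvd_minus_iff minus_diff_eq)
  ultimately show ?thesis using assms ra[of \<rho>] ra[of "\<lambda>i. {c, \<rho> i}"]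
    unfolding periodic_wheel_def by simp
qed

text \<open>Distinctness turns the sum over the neighbour set of a rim node into a sum of three
  terms, two of which are known when the rim is walked.\<close>

lemma periodic_wheel_neighbours:
  assumes "periodic_wheel n c \<rho> V E"
  shows "neighbours E c = range \<rho>" "neighbours E (\<rho> i) = {c, \<rho> (i - 1), \<rho> (i + 1)}"
    "distinct [c, \<rho> (i - 1), \<rho> (i + 1)]" "card (range \<rho>) = n"
proof -
  have n: "3 \<le> n" and eq: "\<And>i j. \<rho> i = \<rho> j \<longleftrightarrow> i mod int n = j mod int n" and c: "\<And>i. \<rho> i \<noteq> c" "\<And>i. c \<noteq> \<rho> i"
    and E: "E = range (\<lambda>i. {\<rho> i, \<rho> (i + 1)}) \<union> range (\<lambda>i. {c, \<rho> i})"
    using assms by (auto simp: periodic_wheel_def)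
  show "neighbours E c = range \<rho>" using c by (auto simp: neighbours_def E doubleton_eq_iff)
  show "neighbours E (\<rho> i) = {c, \<rho> (i - 1), \<rho> (i + 1)}"
  proof (intro equalityI subsetI)
    fix y assume "y \<in> neighbours E (\<rho> i)"
    then consider j where "{\<rho> i, y} = {\<rho> j, \<rho> (j + 1)}" | j where "{\<rho> i, y} = {c, \<rho> j}"
      by (auto simp: neighbours_def E)
    then show "y \<in> {c, \<rho> (i - 1), \<rho> (i + 1)}"
    proof cases
      case (1 j)
      then consider "\<rho> i = \<rho> j" "y = \<rho> (j + 1)" | "\<rho> i = \<rho> (j + 1)" "y = \<rho> j" by (auto simp: doubleton_eq_iff)
      then show ?thesis
      proof cases
        case 1
        then have "\<rho> (j + 1) = \<rho> (i + 1)" unfolding eq by (metis mod_add_left_eq)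
        then show ?thesis using 1 by simp
      next
        case 2
        then have "\<rho> j = \<rho> (i - 1)" unfolding eq by (metis add_diff_cancel_right' mod_diff_left_eq)
        then show ?thesis using 2 by simp
      qed
    next
      case (2 j) then show ?thesis using c by (auto simp: doubleton_eq_iff)
    qed
  next
    fix y assume "y \<in> {c, \<rho> (i - 1), \<rho> (i + 1)}"
    moreover have "{\<rho> (i - 1), \<rho> (i - 1 + 1)} \<in> E" "{\<rho> i, \<rho> (i + 1)} \<in> E" "{c, \<rho> i} \<in> E"
      unfolding E by blast+
    ultimately show "y \<in> neighbours E (\<rho> i)" by (auto simp: neighbours_def insert_commute)
  qed
  have "\<rho> (i - 1) \<noteq> \<rho> (i + 1)"
  proof
    assume "\<rho> (i - 1) = \<rho> (i + 1)"
    then have "int n dvd 2" by (simp add: eq mod_eq_dvd_iff)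
    then show False using n zdvd_imp_le[of "int n" 2] by simp
  qed
  then show "distinct [c, \<rho> (i - 1), \<rho> (i + 1)]" using c by simp
  have "range \<rho> = (\<lambda>i. \<rho> (int i)) ` {..<n}" using n eq by (intro range_periodic) auto
  moreover have "inj_on (\<lambda>i. \<rho> (int i)) {..<n}" using eq by (auto simp: inj_on_def)
  ultimately show "card (range \<rho>) = n" by (simp add: card_image)
qed

text \<open>Only in the wheel with three rim nodes, the complete graph, can a rim node have full degree.\<close>

lemma periodic_wheel_centre:
  assumes "periodic_wheel n c \<rho> V E" "c' \<in> V" "card (neighbours E c') = n"
  shows "\<exists>\<rho>'. periodic_wheel n c' \<rho>' V E"
proof (cases "c' = c")
  case False
  then obtain k where k: "c' = \<rho> k" using assms(1,2) by (auto simp: periodic_wheel_def)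
  have "card {c, \<rho> (k - 1), \<rho> (k + 1)} = 3"
    using periodic_wheel_neighbours(3)[OF assms(1), of k] by (simp add: card_insert_if)
  then have n: "n = 3" using periodic_wheel_neighbours(2)[OF assms(1), of k] assms(3) k by simp
  define \<sigma> where "\<sigma> i = \<rho> (i + k)" for i
  have W: "periodic_wheel 3 c \<sigma> V E" and c': "c' = \<sigma> 0"
    using periodic_wheel_rotate[OF assms(1), of k] k n by (simp_all add: \<sigma>_def[abs_def])
  have eq: "\<And>i j. \<sigma> i = \<sigma> j \<longleftrightarrow> i mod 3 = j mod 3" and c: "\<And>i. \<sigma> i \<noteq> c" "\<And>i. c \<noteq> \<sigma> i"
    using W by (auto simp: periodic_wheel_def)
  have range3: "range f = {f 0, f 1, f 2}" if "\<And>i. f (i mod 3) = f i" for f :: "int \<Rightarrow> 'z"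
    using range_periodic[of f 3] that by (simp add: lessThan_Suc numeral_3_eq_3 insert_commute)
  have m: "(i mod 3 + 1) mod 3 = (i + 1) mod 3" for i :: int by (simp add: mod_simps)
  have s3: "\<sigma> 3 = \<sigma> 0" by (simp add: eq)
  have sm: "\<sigma> (i mod 3) = \<sigma> i" "\<sigma> (i mod 3 + 1) = \<sigma> (i + 1)" for i by (simp_all add: eq mod_simps)
  have R: "range \<sigma> = {\<sigma> 0, \<sigma> 1, \<sigma> 2}" "range (\<lambda>i. {\<sigma> i, \<sigma> (i + 1)}) = {{\<sigma> 0, \<sigma> 1}, {\<sigma> 1, \<sigma> 2}, {\<sigma> 2, \<sigma> 0}}"
    "range (\<lambda>i. {c, \<sigma> i}) = {{c, \<sigma> 0}, {c, \<sigma> 1}, {c, \<sigma> 2}}"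
    using range3[of \<sigma>] range3[of "\<lambda>i. {\<sigma> i, \<sigma> (i + 1)}"] range3[of "\<lambda>i. {c, \<sigma> i}"] sm s3 by simp_all
  \<comment> \<open>The old centre takes over the rim position of the node that becomes the new
    centre.\<close>
  define \<tau> where "\<tau> i = (if i mod 3 = 0 then c else \<sigma> i)" for i
  have t: "\<tau> 0 = c" "\<tau> 1 = \<sigma> 1" "\<tau> 2 = \<sigma> 2" "\<tau> 3 = c" by (simp_all add: \<tau>_def)
  have tm: "\<tau> (i mod 3) = \<tau> i" "\<tau> (i mod 3 + 1) = \<tau> (i + 1)" for i by (simp_all add: \<tau>_def sm m)
  have T: "range \<tau> = {c, \<sigma> 1, \<sigma> 2}" "range (\<lambda>i. {\<tau> i, \<tau> (i + 1)}) = {{c, \<sigma> 1}, {\<sigma> 1, \<sigma> 2}, {\<sigma> 2, c}}"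
    "range (\<lambda>i. {c', \<tau> i}) = {{\<sigma> 0, c}, {\<sigma> 0, \<sigma> 1}, {\<sigma> 0, \<sigma> 2}}"
    using range3[of \<tau>] range3[of "\<lambda>i. {\<tau> i, \<tau> (i + 1)}"] range3[of "\<lambda>i. {c', \<tau> i}"] tm t c' by simp_all
  have "periodic_wheel n c' \<tau> V E"
    unfolding periodic_wheel_def T n
  proof (intro conjI allI)
    fix i j
    show "\<tau> i = \<tau> j \<longleftrightarrow> i mod int 3 = j mod int 3" using c eq by (auto simp: \<tau>_def)
    show "\<tau> i \<noteq> c'" using c[of 0] eq[of i 0] by (auto simp: \<tau>_def c')
  next
    show "V = insert c' {c, \<sigma> 1, \<sigma> 2}" using W unfolding periodic_wheel_def R c' by auto
    have "E = {{\<sigma> 0, \<sigma> 1}, {\<sigma> 1, \<sigma> 2}, {\<sigma> 2, \<sigma> 0}} \<union> {{c, \<sigma> 0}, {c, \<sigma> 1}, {c, \<sigma> 2}}"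
      using W unfolding periodic_wheel_def R by simp
    then show "E = {{c, \<sigma> 1}, {\<sigma> 1, \<sigma> 2}, {\<sigma> 2, c}} \<union> {{\<sigma> 0, c}, {\<sigma> 0, \<sigma> 1}, {\<sigma> 0, \<sigma> 2}}"
      by (simp add: insert_commute) 
  qed simp
  then show ?thesis by blast
qed (use assms in blast)

text \<open>The program may start with any rim edge in any orientation: a rotation brings it to the
  front and a reflection turns it around.\<close>

lemma periodic_wheel_start:
  assumes "periodic_wheel n c \<rho> V E" "{a, b} \<in> E" "a \<noteq> c" "b \<noteq> c"
  shows "\<exists>\<sigma>. periodic_wheel n c \<sigma> V E \<and> \<sigma> 0 = a \<and> \<sigma> 1 = b"
proof -
  obtain i where "{a, b} = {\<rho> i, \<rho> (i + 1)}"
    using assms by (auto simp: periodic_wheel_def doubleton_eq_iff)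
  then consider "a = \<rho> i" "b = \<rho> (i + 1)" | "b = \<rho> i" "a = \<rho> (i + 1)" by (auto simp: doubleton_eq_iff)
  then show ?thesis
  proof cases
    case 1
    then show ?thesis using periodic_wheel_rotate[OF assms(1), of i]
      by (intro exI[of _ "\<lambda>j. \<rho> (j + i)"]) (simp add: add.commute)
  next
    case 2
    then show ?thesis using periodic_wheel_reflect[OF periodic_wheel_rotate[OF assms(1), of "i + 1"]]
      by (intro exI[of _ "\<lambda>j. \<rho> (- j + (i + 1))"]) simp
  qed
qed

section \<open>Knapsack tables along an elimination order\<close>

text \<open>Table entries are 0 for infeasible and cost plus one otherwise.\<close>

definition join :: "nat \<Rightarrow> nat \<Rightarrow> nat" where
  "join a b = (if a = 0 \<or> b = 0 then 0 else a + b - 1)"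

lemma join_pos: "join a b \<noteq> 0 \<longleftrightarrow> 0 < a \<and> 0 < b" "0 < join a b \<longleftrightarrow> 0 < a \<and> 0 < b"
  by (auto simp: join_def)

text \<open>The min-plus convolution of \<open>f\<close> and \<open>g\<close> at \<open>d\<close>,
  with \<open>ch d\<close> as a minimiser: the first half says that a positive entry is attained,
  the second that it is minimal and positive whenever a split is feasible. Invalid demands have
  entry 0.\<close>

definition merged :: "(nat \<Rightarrow> bool) \<Rightarrow> (nat \<Rightarrow> nat) \<Rightarrow> (nat \<Rightarrow> nat) \<Rightarrow> (nat \<Rightarrow> nat) \<Rightarrow> (nat \<Rightarrow> nat) \<Rightarrow> nat \<Rightarrow> bool" where
  "merged valid f g h ch d \<longleftrightarrow>
     (0 < h d \<longrightarrow> valid d \<and> ch d \<le> d \<and> h d = join (f (d - ch d)) (g (ch d))) \<and>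
     (valid d \<longrightarrow> (\<forall>q\<le>d. 0 < join (f (d - q)) (g q) \<longrightarrow> 0 < h d \<and> h d \<le> join (f (d - q)) (g q)))"

context elimination
begin

text \<open>The effect of the merges on plain numbers: if \<open>x\<close> tells what is placed on
  each node, this is what a remaining node has gathered before stage \<open>i\<close>.\<close>

fun acc :: "(nat \<Rightarrow> nat) \<Rightarrow> nat \<Rightarrow> nat \<Rightarrow> nat" where
  "acc x 0 = x"
| "acc x (Suc i) = (acc x i)(p i := acc x i (p i) + acc x i (v i))"

lemma acc_sum: "i < N \<Longrightarrow> u \<in> remaining i \<Longrightarrow> acc x i u = (\<Sum>w | w < N \<and> rep i w = u. x w)"
proof (induction i arbitrary: u)
  case 0
  then have "{w. w < N \<and> w = u} = {u}" by (auto simp: remaining_0)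
  then show ?case by simp
next
  case (Suc i)
  note R = remaining_Suc[OF Suc.prems(1)]
  have i: "i < N" using Suc.prems by simp
  show ?case
  proof (cases "u = p i")
    case True
    have "{w. w < N \<and> rep (Suc i) w = u} = {w. w < N \<and> rep i w = p i} \<union> {w. w < N \<and> rep i w = v i}"
      using True by auto
    moreover have "{w. w < N \<and> rep i w = p i} \<inter> {w. w < N \<and> rep i w = v i} = {}"
      using p_neq_v[OF Suc.prems(1)] by auto
    ultimately have "(\<Sum>w | w < N \<and> rep (Suc i) w = u. x w) =
        (\<Sum>w | w < N \<and> rep i w = p i. x w) + (\<Sum>w | w < N \<and> rep i w = v i. x w)"
      by (simp add: sum.union_disjoint)
    then show ?thesis using Suc.IH[OF i R(4)] Suc.IH[OF i R(5)] True by simp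
  next
    case False
    have "u \<noteq> v i" using Suc.prems R(2) by auto
    then have "{w. w < N \<and> rep (Suc i) w = u} = {w. w < N \<and> rep i w = u}" using False by auto
    moreover have "u \<in> remaining i" using Suc.prems R(1) by simp
    ultimately show ?thesis using Suc.IH[OF i, of u] False by simp
  qed
qed

text \<open>Agreement up to \<open>d\<close> suffices because a split of \<open>d\<close> looks no
  further. Arrays represent the tables only within a row.\<close>

lemma merged_cong:
  assumes "merged valid f g h ch d" "\<And>x. x \<le> d \<Longrightarrow> f x = f' x" "\<And>x. x \<le> d \<Longrightarrow> g x = g' x" "h d = h' d" "ch d = ch' d"
  shows "merged valid f' g' h' ch' d"
  using assms unfolding merged_def by auto

text \<open>The whole history of the computation: \<open>F i u\<close> is the row of
  \<open>u\<close> before stage \<open>i\<close>. The program keeps only the current rows, but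
  optimality of the final entry is an argument about all stages.\<close>

definition tables :: "nat \<Rightarrow> (nat \<Rightarrow> bool) \<Rightarrow> (nat \<Rightarrow> nat \<Rightarrow> nat) \<Rightarrow> (nat \<Rightarrow> nat \<Rightarrow> nat) \<Rightarrow>
    (nat \<Rightarrow> nat \<Rightarrow> nat \<Rightarrow> nat) \<Rightarrow> (nat \<Rightarrow> nat \<Rightarrow> nat) \<Rightarrow> nat \<Rightarrow> bool" where
  "tables R valid nc ec F ch k \<longleftrightarrow>
     (\<forall>u<N. \<forall>d<R. F 0 u d = nc u d) \<and>
     (\<forall>i<k. (\<forall>u<N. \<forall>d<R. u \<noteq> p i \<longrightarrow> F (Suc i) u d = F i u d) \<and>
       (\<forall>d<R. merged valid (F i (p i)) (\<lambda>q. join (F i (v i) q) (ec i q)) (F (Suc i) (p i)) (ch i) d))"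

lemma sum_remaining_Suc:
  assumes "Suc i < N"
  shows "(\<Sum>u\<in>remaining i. f u) = (\<Sum>u\<in>remaining (Suc i) - {p i}. f u) + f (p i) + f (v i)"
    and "(\<Sum>u\<in>remaining (Suc i). f u) = (\<Sum>u\<in>remaining (Suc i) - {p i}. f u) + f (p i)"
  using remaining_Suc[OF assms] by (simp_all add: sum.remove[of "remaining (Suc i)" "p i"] add.commute)

text \<open>A concrete distribution \<open>x\<close> supplies one candidate split at every merge, so
  the minimum there does not exceed its cost. The inductive measure is the cost stored in the
  remaining rows; each merge charges the cost of one tree edge.\<close>

lemma tables_lower:
  assumes T: "tables R valid nc ec F ch (N - 1)"
    and R: "\<And>d. valid d \<Longrightarrow> d < R"
    and x: "\<And>u. u < N \<Longrightarrow> 0 < nc u (x u)"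
    and e: "\<And>i. Suc i < N \<Longrightarrow> 0 < ec i (acc x i (v i))"
    and val: "\<And>i u. i < N \<Longrightarrow> u \<in> remaining i \<Longrightarrow> valid (acc x i u)"
    and "k < N"
  shows "(\<forall>u\<in>remaining k. 0 < F k u (acc x k u)) \<and>
    (\<Sum>u\<in>remaining k. F k u (acc x k u) - 1) \<le> (\<Sum>u<N. nc u (x u) - 1) + (\<Sum>j<k. ec j (acc x j (v j)) - 1)"
  using \<open>k < N\<close>
proof (induction k)
  case 0
  have "F 0 u (x u) = nc u (x u)" if "u < N" for u
    using T R[OF val[of 0 u]] that N_pos by (simp add: tables_def remaining_0)
  then show ?case using x N_pos by (simp add: remaining_0)
next
  case (Suc i)
  note RS = remaining_Suc[OF Suc.prems]
  have IH: "\<forall>u\<in>remaining i. 0 < F i u (acc x i u)"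
    "(\<Sum>u\<in>remaining i. F i u (acc x i u) - 1) \<le> (\<Sum>u<N. nc u (x u) - 1) + (\<Sum>j<i. ec j (acc x j (v j)) - 1)"
    using Suc by auto
  let ?a = "acc x i (p i)" and ?b = "acc x i (v i)"
  have valid: "valid (?a + ?b)" using val[OF Suc.prems RS(3)] by simp
  have same: "F (Suc i) u (acc x (Suc i) u) = F i u (acc x i u)" if "u \<in> remaining (Suc i)" "u \<noteq> p i" for u
  proof -
    have "u \<in> remaining i" using that RS by simp
    then have "acc x i u < R" "u < N" using R[OF val[of i u]] Suc.prems remaining_less by auto
    then show ?thesis using T Suc.prems that by (simp add: tables_def)
  qed
  have "merged valid (F i (p i)) (\<lambda>q. join (F i (v i) q) (ec i q)) (F (Suc i) (p i)) (ch i) (?a + ?b)"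
    using T Suc.prems R[OF valid] by (simp add: tables_def)
  moreover have pos: "0 < F i (p i) ?a" "0 < F i (v i) ?b" "0 < ec i ?b" using IH RS e[OF Suc.prems] by auto
  ultimately have m: "0 < F (Suc i) (p i) (?a + ?b)"
    "F (Suc i) (p i) (?a + ?b) \<le> join (F i (p i) ?a) (join (F i (v i) ?b) (ec i ?b))"
    unfolding merged_def using valid
    by (metis add_diff_cancel_right' join_pos(2) le_add2)+
  \<comment> \<open>Subtracting 1 converts entries into costs. All entries involved are positive, so
    truncation does no harm.\<close>
  then have m': "F (Suc i) (p i) (?a + ?b) - 1 \<le> (F i (p i) ?a - 1) + (F i (v i) ?b - 1) + (ec i ?b - 1)"
    using pos by (simp add: join_def)
  have "\<forall>u\<in>remaining (Suc i). 0 < F (Suc i) u (acc x (Suc i) u)"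
  proof
    fix u assume "u \<in> remaining (Suc i)"
    then show "0 < F (Suc i) u (acc x (Suc i) u)"
      using same[of u] IH(1) RS(1) m(1) by (cases "u = p i") auto
  qed
  moreover have "(\<Sum>u\<in>remaining (Suc i) - {p i}. F (Suc i) u (acc x (Suc i) u) - 1)
     = (\<Sum>u\<in>remaining (Suc i) - {p i}. F i u (acc x i u) - 1)"
  proof (rule sum.cong)
    fix u assume "u \<in> remaining (Suc i) - {p i}"
    then show "F (Suc i) u (acc x (Suc i) u) - 1 = F i u (acc x i u) - 1" using same[of u] by auto
  qed simp
  ultimately show ?case
    using IH(2) m' unfolding sum_remaining_Suc[OF Suc.prems] by simp
qed

text \<open>The merges run backwards: beginning with \<open>D\<close> at the last node, the recorded
  choice of each stage divides the demand of the parent between parent and leaf. Stages down to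
  \<open>k\<close> have been treated.\<close>

definition traced :: "(nat \<Rightarrow> nat \<Rightarrow> nat) \<Rightarrow> nat \<Rightarrow> (nat \<Rightarrow> nat \<Rightarrow> nat) \<Rightarrow> nat \<Rightarrow> bool" where
  "traced ch D dem k \<longleftrightarrow> dem (N - 1) (v (N - 1)) = D \<and>
     (\<forall>i. k \<le> i \<longrightarrow> Suc i < N \<longrightarrow>
        dem i (v i) = ch i (dem (Suc i) (p i)) \<and>
        dem i (p i) = dem (Suc i) (p i) - ch i (dem (Suc i) (p i)) \<and>
        (\<forall>u<N. u \<noteq> v i \<longrightarrow> u \<noteq> p i \<longrightarrow> dem i u = dem (Suc i) u))"

text \<open>Besides its use in the backward pass, this guarantees that the arc cut of a demand with
  a positive entry stays within the table of multiples.\<close>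

lemma tables_valid:
  assumes "tables R valid nc ec F ch k" "\<And>u d. 0 < nc u d \<Longrightarrow> valid d"
    and "i \<le> k" "u < N" "d < R" "0 < F i u d"
  shows "valid d"
  using assms(3-)
proof (induction i arbitrary: u)
  case 0
  then have "0 < nc u d" using assms(1) by (simp add: tables_def)
  then show ?case by (rule assms(2))
next
  case (Suc i)
  show ?case
  proof (cases "u = p i")
    case True
    then have "merged valid (F i (p i)) (\<lambda>q. join (F i (v i) q) (ec i q)) (F (Suc i) (p i)) (ch i) d"
      using assms(1) Suc.prems by (simp add: tables_def)
    then show ?thesis using Suc.prems True by (simp add: merged_def)
  next
    case False
    then have "F (Suc i) u d = F i u d" using assms(1) Suc.prems by (simp add: tables_def)
    then show ?thesis using Suc by simp
  qed
qed

text \<open>Going back one stage replaces the entry of the parent by the three entries of which it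
  is the join. The total cost is therefore the same at every stage.\<close>

lemma tables_upper:
  assumes T: "tables R valid nc ec F ch (N - 1)"
    and R: "\<And>d. valid d \<Longrightarrow> d < R" and nc: "\<And>u d. 0 < nc u d \<Longrightarrow> valid d"
    and dem: "traced ch D dem 0" and D: "D < R" "0 < F (N - 1) (v (N - 1)) D"
    and "i \<le> N - 1"
  shows "(\<forall>u\<in>remaining i. 0 < F i u (dem i u) \<and> valid (dem i u)) \<and>
    (\<forall>j\<in>{i..<N - 1}. 0 < ec j (dem j (v j)) \<and> dem (Suc j) (p j) = dem j (p j) + dem j (v j)) \<and>
    (\<Sum>u\<in>remaining i. F i u (dem i u) - 1) + (\<Sum>j\<in>{i..<N - 1}. ec j (dem j (v j)) - 1)
      = F (N - 1) (v (N - 1)) D - 1"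
  using \<open>i \<le> N - 1\<close>
proof (induction rule: inc_induct)
  case base
  have "dem (N - 1) (v (N - 1)) = D" using dem by (simp add: traced_def)
  moreover have "valid D" using tables_valid[OF T nc, where i = "N - 1" and u = "v (N - 1)" and d = D] D N_pos v_less by simp
  ultimately show ?case using D remaining_last by simp
next
  case (step i)
  have i: "Suc i < N" using step by simp
  note RS = remaining_Suc[OF i]
  let ?d = "dem (Suc i) (p i)"
  let ?q = "ch i ?d"
  have dm: "dem i (v i) = ?q" "dem i (p i) = ?d - ?q" "\<And>u. u < N \<Longrightarrow> u \<noteq> v i \<Longrightarrow> u \<noteq> p i \<Longrightarrow> dem i u = dem (Suc i) u"
    using dem i by (auto simp: traced_def)
  have d: "0 < F (Suc i) (p i) ?d" "valid ?d" using step.IH RS by auto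
  then have "merged valid (F i (p i)) (\<lambda>q. join (F i (v i) q) (ec i q)) (F (Suc i) (p i)) (ch i) ?d"
    using T i R by (simp add: tables_def)
  then have m: "?q \<le> ?d" "F (Suc i) (p i) ?d = join (F i (p i) (?d - ?q)) (join (F i (v i) ?q) (ec i ?q))"
    using d by (auto simp: merged_def)
  then have pos: "0 < F i (p i) (dem i (p i))" "0 < F i (v i) (dem i (v i))" "0 < ec i (dem i (v i))"
    using d(1) join_pos(2) dm by simp_all
  have "F (Suc i) (p i) ?d = join (F i (p i) (dem i (p i))) (join (F i (v i) (dem i (v i))) (ec i (dem i (v i))))"
    using m(2) dm by simp
  then have eq: "F (Suc i) (p i) ?d - 1 =
      (F i (p i) (dem i (p i)) - 1) + (F i (v i) (dem i (v i)) - 1) + (ec i (dem i (v i)) - 1)"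
    using pos by (simp add: join_def)
  have lt: "dem i (p i) < R" "dem i (v i) < R" using m(1) R[OF d(2)] dm by auto
  have less: "v i < N" "p i < N" "i \<le> N - 1" using i v_less p_less by auto
  have val: "valid (dem i (p i))" "valid (dem i (v i))"
    using tables_valid[OF T nc less(3,2) lt(1) pos(1)] tables_valid[OF T nc less(3,1) lt(2) pos(2)] by auto
  have same: "dem i u = dem (Suc i) u" "F (Suc i) u (dem (Suc i) u) = F i u (dem i u)"
    if "u \<in> remaining (Suc i)" "u \<noteq> p i" for u
  proof -
    have u: "u < N" "u \<noteq> v i" using that RS(2) remaining_less by auto
    then show "dem i u = dem (Suc i) u" using dm that by simp
    moreover have "dem (Suc i) u < R" using step.IH that R by simp
    ultimately show "F (Suc i) u (dem (Suc i) u) = F i u (dem i u)" using T i that u by (simp add: tables_def)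
  qed
  have 1: "0 < F i u (dem i u) \<and> valid (dem i u)" if u: "u \<in> remaining i" for u
  proof -
    consider "u = v i" | "u = p i" | "u \<in> remaining (Suc i)" "u \<noteq> p i" using u unfolding RS(1) by blast
    then show ?thesis
    proof cases
      case 3
      then have "0 < F (Suc i) u (dem (Suc i) u) \<and> valid (dem (Suc i) u)" using step.IH by blast
      then show ?thesis using same[OF 3] by simp
    qed (use pos val in auto)
  qed
  have ivl: "{i..<N - 1} = insert i {Suc i..<N - 1}" using i by auto
  have "(\<Sum>u\<in>remaining (Suc i) - {p i}. F (Suc i) u (dem (Suc i) u) - 1)
     = (\<Sum>u\<in>remaining (Suc i) - {p i}. F i u (dem i u) - 1)"
    using same(2) by (intro sum.cong) auto
  then have 2: "(\<Sum>u\<in>remaining i. F i u (dem i u) - 1) + (\<Sum>j\<in>{i..<N - 1}. ec j (dem j (v j)) - 1)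
      = F (N - 1) (v (N - 1)) D - 1"
    using step.IH eq unfolding sum_remaining_Suc[OF i] ivl by simp
  have 3: "?d = dem i (p i) + dem i (v i)" using m(1) dm by simp
  show ?case using 1 2 3 pos(3) step.IH unfolding ivl by simp
qed

text \<open>A property that each merge passes on to exactly one node singles out a node and then follows its
  representatives.\<close>

lemma unique_holder:
  assumes step: "\<And>i u. Suc i < N \<Longrightarrow> u \<in> remaining (Suc i) \<Longrightarrow> H (Suc i) u \<longleftrightarrow> H i u \<or> u = p i \<and> H i (v i)"
    and disj: "\<And>i. Suc i < N \<Longrightarrow> \<not> (H i (p i) \<and> H i (v i))"
    and top: "H (N - 1) (v (N - 1))" and "i \<le> N - 1"
  shows "\<exists>!u. u \<in> remaining i \<and> H i u"
  using \<open>i \<le> N - 1\<close>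
proof (induction rule: inc_induct)
  case base
  then show ?case using top remaining_last by auto
next
  case (step i)
  have i: "Suc i < N" using step by simp
  note RS = remaining_Suc[OF i] and st = assms(1)[OF i] and dj = disj[OF i]
  obtain u where u: "u \<in> remaining (Suc i)" "H (Suc i) u"
    and uniq: "\<And>u'. u' \<in> remaining (Suc i) \<Longrightarrow> H (Suc i) u' \<Longrightarrow> u' = u" using step.IH by blast
  show ?case
  proof (cases "H i (v i)")
    case True
    then have "u = p i" using uniq[OF RS(3)] st[OF RS(3)] by simp
    then have "u' = v i" if "u' \<in> remaining i" "H i u'" for u'
      using that uniq[of u'] st[of u'] RS(1) dj True by blast
    then show ?thesis using True RS(5) by blast
  next
    case False
    then have "H i u" using u st by blast
    moreover have "u' = u" if "u' \<in> remaining i" "H i u'" for u'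
      using that uniq[of u'] st[of u'] RS(1) False by (cases "u' = v i") auto
    ultimately show ?thesis using u RS(1) by blast
  qed
qed

lemma holder_rep:
  assumes step: "\<And>i u. Suc i < N \<Longrightarrow> u \<in> remaining (Suc i) \<Longrightarrow> H (Suc i) u \<longleftrightarrow> H i u \<or> u = p i \<and> H i (v i)"
    and disj: "\<And>i. Suc i < N \<Longrightarrow> \<not> (H i (p i) \<and> H i (v i))"
    and top: "H (N - 1) (v (N - 1))" and w: "w < N" "H 0 w" and "i < N" "u \<in> remaining i"
  shows "H i u \<longleftrightarrow> rep i w = u"
  using assms(6,7)
proof (induction i arbitrary: u)
  case 0
  have "\<exists>!u. u \<in> remaining 0 \<and> H 0 u" by (rule unique_holder[OF step disj top]) simp_all
  then show ?case using 0 w by (auto simp: remaining_0)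
next
  case (Suc i)
  note RS = remaining_Suc[OF Suc.prems(1)]
  have i: "i < N" using Suc.prems by simp
  have u: "u \<noteq> v i" "u \<in> remaining i" using Suc.prems(2) RS(1,2) by auto
  have "H (Suc i) u \<longleftrightarrow> H i u \<or> u = p i \<and> H i (v i)" using step Suc.prems by blast
  also have "\<dots> \<longleftrightarrow> rep i w = u \<or> u = p i \<and> rep i w = v i"
    using Suc.IH[OF i u(2)] Suc.IH[OF i RS(5)] by simp
  also have "\<dots> \<longleftrightarrow> rep (Suc i) w = u" using u(1) by auto
  finally show ?case .
qed

end


section \<open>Embedding a wheel into a tree\<close>

text \<open>A demand \<open>d\<close> stands for \<open>count n d\<close> rim nodes, together with the centre if \<open>centred n d\<close>.
  The centre weighs \<open>2 * Suc n\<close>, so that sums of two rim counts never look like a demand with centre.\<close>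

definition centred :: "nat \<Rightarrow> nat \<Rightarrow> bool" where "centred n d \<longleftrightarrow> 2 * Suc n \<le> d"
definition count :: "nat \<Rightarrow> nat \<Rightarrow> nat" where "count n d = (if centred n d then d - 2 * Suc n else d)"
definition valid :: "nat \<Rightarrow> nat \<Rightarrow> bool" where "valid n d \<longleftrightarrow> count n d \<le> n"
definition load :: "nat \<Rightarrow> nat \<Rightarrow> nat" where "load n d = (if centred n d then Suc (count n d) else count n d)"
definition far :: "nat \<Rightarrow> nat \<Rightarrow> nat" where "far n d = (if centred n d then n - count n d else count n d)"

text \<open>A weight of \<open>Suc n\<close> would be too small: two rim counts may exceed
  \<open>n\<close>, and their sum could pass for a demand with the centre. With
  \<open>2 * Suc n\<close> such sums fall into the invalid gap, and two centres give a sum that is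
  too large to be valid.\<close>

lemma valid_add:
  assumes "valid n a" "valid n b" "valid n (a + b)"
  shows "count n (a + b) = count n a + count n b" "centred n (a + b) \<longleftrightarrow> centred n a \<or> centred n b"
    "\<not> (centred n a \<and> centred n b)"
  using assms by (auto simp: valid_def count_def centred_def split: if_splits)

lemma valid_demand:
  assumes "k \<le> n"
  shows "valid n k" "count n k = k" "\<not> centred n k"
    "valid n (k + 2 * Suc n)" "count n (k + 2 * Suc n) = k" "centred n (k + 2 * Suc n)"
  using assms by (auto simp: valid_def count_def centred_def)

lemma valid_less: "valid n d \<Longrightarrow> d < 3 * Suc n"
  by (auto simp: valid_def count_def centred_def split: if_splits)

lemma demand_eq: "d = count n d + (if centred n d then 2 * Suc n else 0)"
  by (auto simp: count_def centred_def)

locale wheel_on_tree = elimination N v p + wheel n c r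
  for N :: nat and v p :: "nat \<Rightarrow> nat" and n c :: nat and r :: "nat \<Rightarrow> nat" +
  fixes I :: "(nat, nat) univne"
  assumes virtual_I: "verts (virtual I) = V" "edges (virtual I) = E"
    and substrate_I: "verts (substrate I) = {..<N}" "edges (substrate I) = tree_edges"
begin

definition ecap where "ecap i = edge_cap I {v i, p i}"
definition ecost where "ecost i = edge_cost I {v i, p i}"

definition node_entry :: "nat \<Rightarrow> nat \<Rightarrow> nat" where
  "node_entry u d = (if valid n d \<and> load n d \<le> node_cap I u then load n d * node_cost I u + 1 else 0)"

definition edge_entry :: "nat \<Rightarrow> nat \<Rightarrow> nat" where
  "edge_entry i d = (if arc_cut n (far n d) \<le> ecap i then arc_cut n (far n d) * ecost i + 1 else 0)"

abbreviation "wtables \<equiv> tables (3 * Suc n) (valid n) node_entry edge_entry"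
abbreviation "full \<equiv> n + 2 * Suc n"

definition demand :: "(nat \<Rightarrow> nat) \<Rightarrow> nat \<Rightarrow> nat" where
  "demand mV u = card {j. j < n \<and> mV (r j) = u} + (if mV c = u then 2 * Suc n else 0)"

definition side :: "(nat \<Rightarrow> nat) \<Rightarrow> nat \<Rightarrow> nat set" where
  "side mV i = {y. mV y \<in> cut i}"

lemma sum_demand:
  assumes "finite A"
  shows "(\<Sum>u\<in>A. demand mV u) = card {j. j < n \<and> mV (r j) \<in> A} + (if mV c \<in> A then 2 * Suc n else 0)"
proof -
  have "{j. j < n \<and> mV (r j) \<in> A} = (\<Union>u\<in>A. {j. j < n \<and> mV (r j) = u})" by auto
  moreover have "card (\<Union>u\<in>A. {j. j < n \<and> mV (r j) = u}) = (\<Sum>u\<in>A. card {j. j < n \<and> mV (r j) = u})"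
    using assms by (intro card_UN_disjoint) auto
  ultimately show ?thesis using assms by (simp add: demand_def sum.distrib sum.delta)
qed

lemma card_rim_le: "card {j. j < n \<and> P j} \<le> n"
  using card_mono[of "{..<n}" "{j. j < n \<and> P j}"] by auto

lemma acc_demand:
  assumes "mV ` V \<subseteq> {..<N}" "i < N" "u \<in> remaining i"
  shows "acc (demand mV) i u = card {j. j < n \<and> rep i (mV (r j)) = u} + (if rep i (mV c) = u then 2 * Suc n else 0)"
proof -
  have "mV (r j) < N" if "j < n" for j using assms(1) r_V[of j] that by auto
  then have "{j. j < n \<and> mV (r j) < N \<and> rep i (mV (r j)) = u} = {j. j < n \<and> rep i (mV (r j)) = u}" by auto
  moreover have "mV c < N" using assms(1) c_V by auto
  ultimately show ?thesis by (simp add: acc_sum[OF assms(2,3)] sum_demand)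
qed

lemma acc_demand_valid:
  assumes "mV ` V \<subseteq> {..<N}" "i < N" "u \<in> remaining i"
  shows "valid n (acc (demand mV) i u)" "count n (acc (demand mV) i u) = card {j. j < n \<and> rep i (mV (r j)) = u}"
    "centred n (acc (demand mV) i u) \<longleftrightarrow> rep i (mV c) = u"
  using valid_demand[OF card_rim_le[of "\<lambda>j. rep i (mV (r j)) = u"]] unfolding acc_demand[OF assms] by auto

text \<open>The demand gathered at \<open>v i\<close> contains all that the cost of the cut depends
  on, so the cost splits into terms that the tables can evaluate locally.\<close>

lemma far_side_demand:
  assumes "mV ` V \<subseteq> {..<N}" "Suc i < N"
  shows "far_side (side mV i) = far n (acc (demand mV) i (v i))"
proof -
  have "mV (r j) < N" if "j < n" for j using assms(1) r_V[of j] that by auto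
  then have "{j. j < n \<and> r j \<in> side mV i} = {j. j < n \<and> rep i (mV (r j)) = v i}"
    by (auto simp: side_def cut_def)
  moreover have "mV c < N" using assms(1) c_V by auto
  then have "c \<in> side mV i \<longleftrightarrow> rep i (mV c) = v i" by (simp add: side_def cut_def)
  moreover have "v i \<in> remaining i" using remaining_Suc[OF assms(2)] by simp
  ultimately show ?thesis
    using acc_demand_valid[OF assms(1), of i "v i"] assms(2) by (simp add: far_side far_def)
qed

lemma load_demand:
  assumes "mV ` V \<subseteq> {..<N}" "u < N"
  shows "load n (demand mV u) = card {y \<in> V. mV y = u}"
proof -
  have V: "{y \<in> V. mV y = u} = r ` {j. j < n \<and> mV (r j) = u} \<union> (if mV c = u then {c} else {})"
    by (auto simp: V_def)
  have "card (r ` {j. j < n \<and> mV (r j) = u}) = card {j. j < n \<and> mV (r j) = u}"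
    using r_inj by (intro card_image) (auto simp: inj_on_def)
  moreover have "c \<notin> r ` {j. j < n \<and> mV (r j) = u}" using c_r by auto
  ultimately have "card {y \<in> V. mV y = u} = card {j. j < n \<and> mV (r j) = u} + (if mV c = u then 1 else 0)"
    unfolding V by simp
  then show ?thesis using acc_demand_valid[OF assms(1) N_pos, of u] assms(2)
    by (simp add: load_def remaining_0)
qed

text \<open>Tree paths are forced by their ends; the traffic on a tree edge is a cut of the
  wheel.\<close>

lemma uses_edge:
  assumes "is_mapping I (mV, mE)" "d \<in> E" "Suc i < N"
  shows "{v i, p i} \<in> path_edges (mE d) \<longleftrightarrow> d \<in> crossing (side mV i)"
proof -
  have path: "is_path (substrate I) (mE d)" and ends: "{hd (mE d), last (mE d)} = mV ` d"
    using assms(1,2) virtual_I by (auto simp: is_mapping_def)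
  have "{v i, p i} \<in> path_edges (mE d) \<longleftrightarrow> (hd (mE d) \<in> cut i) \<noteq> (last (mE d) \<in> cut i)"
    using path path_uses_edge[of "mE d" i] assms(3) substrate_I by (simp add: is_path_def)
  also have "\<dots> \<longleftrightarrow> mV ` d \<inter> cut i \<noteq> {} \<and> \<not> mV ` d \<subseteq> cut i"
    unfolding ends[symmetric] by auto
  also have "\<dots> \<longleftrightarrow> d \<in> crossing (side mV i)"
    using assms(2) by (auto simp: crossing_def side_def)
  finally show ?thesis .
qed

text \<open>The paths disappear here: what remains is a condition on the node mapping alone, one for
  each node and one for each cut.\<close>

lemma feasible_iff:
  assumes m: "is_mapping I (mV, mE)"
  shows "feasible I (mV, mE) \<longleftrightarrow> (\<forall>u<N. load n (demand mV u) \<le> node_cap I u) \<and>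
    (\<forall>i. Suc i < N \<longrightarrow> card (crossing (side mV i)) \<le> ecap i)"
proof -
  have mV: "mV ` V \<subseteq> {..<N}" using m virtual_I substrate_I by (simp add: is_mapping_def)
  have "{d \<in> E. {v i, p i} \<in> path_edges (mE d)} = crossing (side mV i)" if "Suc i < N" for i
    using uses_edge[OF m _ that] by (auto simp: crossing_def)
  moreover have "(\<forall>e\<in>tree_edges. P e) \<longleftrightarrow> (\<forall>i. Suc i < N \<longrightarrow> P {v i, p i})" for P
    unfolding tree_edges_def by blast
  ultimately have "(\<forall>e\<in>tree_edges. card {d \<in> E. e \<in> path_edges (mE d)} \<le> edge_cap I e) \<longleftrightarrow>
      (\<forall>i. Suc i < N \<longrightarrow> card (crossing (side mV i)) \<le> ecap i)"
    by (simp add: ecap_def)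
  then show ?thesis using m load_demand[OF mV] virtual_I substrate_I by (simp add: feasible_def Ball_def)
qed

lemma mapping_cost_eq:
  assumes m: "is_mapping I (mV, mE)"
  shows "mapping_cost I (mV, mE) = (\<Sum>u<N. load n (demand mV u) * node_cost I u) +
    (\<Sum>i<N - 1. card (crossing (side mV i)) * ecost i)"
proof -
  have mV: "mV ` V \<subseteq> {..<N}" using m virtual_I substrate_I by (simp add: is_mapping_def)
  have "(\<Sum>y\<in>V. node_cost I (mV y)) = (\<Sum>u<N. \<Sum>y | y \<in> V \<and> mV y = u. node_cost I (mV y))"
    using mV by (intro sum.group[symmetric]) auto
  also have "\<dots> = (\<Sum>u<N. load n (demand mV u) * node_cost I u)"
    using load_demand[OF mV] by (intro sum.cong) auto
  finally have nodes: "(\<Sum>y\<in>V. node_cost I (mV y)) = (\<Sum>u<N. load n (demand mV u) * node_cost I u)" .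
  have path: "(\<Sum>e\<in>path_edges (mE d). edge_cost I e) =
      (\<Sum>i<N - 1. if d \<in> crossing (side mV i) then ecost i else 0)" if d: "d \<in> E" for d
  proof -
    have sub: "path_edges (mE d) \<subseteq> tree_edges"
      using m d virtual_I substrate_I by (auto simp: is_mapping_def is_path_def)
    have "path_edges (mE d) = (\<lambda>i. {v i, p i}) ` {i. i < N - 1 \<and> d \<in> crossing (side mV i)}" (is "_ = _ ` ?J")
      using sub uses_edge[OF m d] unfolding tree_edges_def by force
    moreover have "inj_on (\<lambda>i. {v i, p i}) ?J" using tree_edge_inj by (intro inj_onI) auto
    ultimately have "(\<Sum>e\<in>path_edges (mE d). edge_cost I e) = (\<Sum>i\<in>?J. ecost i)"
      by (simp add: sum.reindex ecost_def)
    also have "?J = {..<N - 1} \<inter> {i. d \<in> crossing (side mV i)}" by auto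
    finally show ?thesis by (simp add: sum.inter_restrict)
  qed
  have "(\<Sum>d\<in>E. \<Sum>e\<in>path_edges (mE d). edge_cost I e) =
      (\<Sum>d\<in>E. \<Sum>i<N - 1. if d \<in> crossing (side mV i) then ecost i else 0)"
    using path by (rule sum.cong[OF refl])
  also have "\<dots> = (\<Sum>i<N - 1. \<Sum>d\<in>E. if d \<in> crossing (side mV i) then ecost i else 0)"
    by (rule sum.swap)
  also have "\<dots> = (\<Sum>i<N - 1. card (crossing (side mV i)) * ecost i)"
  proof (rule sum.cong[OF refl])
    fix i
    have "E \<inter> {d. d \<in> crossing (side mV i)} = crossing (side mV i)" by (auto simp: crossing_def)
    then show "(\<Sum>d\<in>E. if d \<in> crossing (side mV i) then ecost i else 0) = card (crossing (side mV i)) * ecost i"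
      by (simp add: sum.If_cases)
  qed
  finally show ?thesis using nodes virtual_I by (simp add: mapping_cost_def)
qed

theorem lower_bound:
  assumes T: "wtables F ch (N - 1)" and m: "feasible I (mV, mE)"
  shows "0 < F (N - 1) (v (N - 1)) full" "F (N - 1) (v (N - 1)) full - 1 \<le> mapping_cost I (mV, mE)"
proof -
  have im: "is_mapping I (mV, mE)" using m by (simp add: feasible_def)
  then have mV: "mV ` V \<subseteq> {..<N}" using virtual_I substrate_I by (simp add: is_mapping_def)
  let ?x = "demand mV"
  note feas = m[unfolded feasible_iff[OF im]]
  have x0: "valid n (?x u)" if "u < N" for u using acc_demand_valid(1)[OF mV N_pos, of u] that by (simp add: remaining_0)
  have cross: "arc_cut n (far n (acc ?x i (v i))) \<le> card (crossing (side mV i))" if "Suc i < N" for i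
    using crossing_ge[of "side mV i"] far_side_demand[OF mV that] by simp
  have *: "(\<forall>u\<in>remaining (N - 1). 0 < F (N - 1) u (acc ?x (N - 1) u)) \<and>
    (\<Sum>u\<in>remaining (N - 1). F (N - 1) u (acc ?x (N - 1) u) - 1) \<le>
    (\<Sum>u<N. node_entry u (?x u) - 1) + (\<Sum>j<N - 1. edge_entry j (acc ?x j (v j)) - 1)"
  proof (rule tables_lower[OF T])
    show "0 < node_entry u (?x u)" if "u < N" for u using x0[OF that] feas that by (simp add: node_entry_def)
    show "0 < edge_entry i (acc ?x i (v i))" if "Suc i < N" for i
    proof -
      have "card (crossing (side mV i)) \<le> ecap i" using feas that by blast
      then show ?thesis using cross[OF that] by (simp add: edge_entry_def)
    qed
    show "valid n (acc ?x i u)" if "i < N" "u \<in> remaining i" for i u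
      by (rule acc_demand_valid(1)[OF mV that])
    show "N - 1 < N" using N_pos by simp
  qed (rule valid_less)
  have "rep (N - 1) w = v (N - 1)" if "w < N" for w
    using rep_remaining[OF that, of "N - 1"] N_pos remaining_last by simp
  moreover have "mV (r j) < N" if "j < n" for j using mV r_V[of j] that by auto
  moreover have "mV c < N" using mV c_V by auto
  ultimately have "{j. j < n \<and> rep (N - 1) (mV (r j)) = v (N - 1)} = {..<n}" "rep (N - 1) (mV c) = v (N - 1)"
    by auto
  then have top: "acc ?x (N - 1) (v (N - 1)) = full"
    using acc_demand[OF mV, of "N - 1" "v (N - 1)"] N_pos remaining_last by simp
  show "0 < F (N - 1) (v (N - 1)) full" using * top remaining_last by simp
  have "F (N - 1) (v (N - 1)) full - 1 \<le> (\<Sum>u<N. node_entry u (?x u) - 1) + (\<Sum>j<N - 1. edge_entry j (acc ?x j (v j)) - 1)"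
    using * top remaining_last by simp
  also have "\<dots> \<le> mapping_cost I (mV, mE)"
    unfolding mapping_cost_eq[OF im]
  proof (intro add_mono sum_mono)
    fix u show "node_entry u (?x u) - 1 \<le> load n (?x u) * node_cost I u" by (simp add: node_entry_def)
  next
    fix i assume "i \<in> {..<N - 1}"
    then show "edge_entry i (acc ?x i (v i)) - 1 \<le> card (crossing (side mV i)) * ecost i"
      using cross[of i] by (simp add: edge_entry_def)
  qed
  finally show "F (N - 1) (v (N - 1)) full - 1 \<le> mapping_cost I (mV, mE)" .
qed

text \<open>\<open>st u\<close> is the first rim position given to \<open>u\<close>. The leaf starts
  right behind what its parent keeps, so undoing a merge cuts an interval into two adjacent ones.
  Every node thus owns an interval at every stage, and \<open>unique_holder\<close> applies both to
  the owner of a position and to the owner of the centre.\<close>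

lemma trace_facts:
  assumes T: "wtables F ch (N - 1)" and dem: "traced ch full dem 0"
    and pos: "0 < F (N - 1) (v (N - 1)) full"
    and start: "st (v (N - 1)) = 0" "\<And>i. Suc i < N \<Longrightarrow> st (v i) = st (p i) + count n (dem i (p i))"
  shows "i < N \<Longrightarrow> u \<in> remaining i \<Longrightarrow> valid n (dem i u)"
    and "Suc i < N \<Longrightarrow> count n (dem (Suc i) (p i)) = count n (dem i (p i)) + count n (dem i (v i))"
    and "Suc i < N \<Longrightarrow> centred n (dem (Suc i) (p i)) \<longleftrightarrow> centred n (dem i (p i)) \<or> centred n (dem i (v i))"
    and "Suc i < N \<Longrightarrow> \<not> (centred n (dem i (p i)) \<and> centred n (dem i (v i)))"
    and "(\<forall>u\<in>remaining 0. 0 < F 0 u (dem 0 u)) \<and>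
      (\<forall>j<N - 1. 0 < edge_entry j (dem j (v j)) \<and> dem (Suc j) (p j) = dem j (p j) + dem j (v j)) \<and>
      (\<Sum>u\<in>remaining 0. F 0 u (dem 0 u) - 1) + (\<Sum>j<N - 1. edge_entry j (dem j (v j)) - 1)
        = F (N - 1) (v (N - 1)) full - 1"
    and "i \<le> N - 1 \<Longrightarrow> u \<in> remaining i \<Longrightarrow> st u + count n (dem i u) \<le> n"
    and "i \<le> N - 1 \<Longrightarrow> j < n \<Longrightarrow> \<exists>!u. u \<in> remaining i \<and> st u \<le> j \<and> j < st u + count n (dem i u)"
    and "i \<le> N - 1 \<Longrightarrow> \<exists>!u. u \<in> remaining i \<and> centred n (dem i u)"
    and "w < N \<Longrightarrow> j < n \<Longrightarrow> st w \<le> j \<Longrightarrow> j < st w + count n (dem 0 w) \<Longrightarrow> i < N \<Longrightarrow> u \<in> remaining i \<Longrightarrow>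
      st u \<le> j \<and> j < st u + count n (dem i u) \<longleftrightarrow> rep i w = u"
    and "w < N \<Longrightarrow> centred n (dem 0 w) \<Longrightarrow> i < N \<Longrightarrow> u \<in> remaining i \<Longrightarrow> centred n (dem i u) \<longleftrightarrow> rep i w = u"
proof -
  have tot: "valid n full" "count n full = n" "centred n full" using valid_demand[of n n] by simp_all
  have U: "(\<forall>u\<in>remaining i. 0 < F i u (dem i u) \<and> valid n (dem i u)) \<and>
    (\<forall>j\<in>{i..<N - 1}. 0 < edge_entry j (dem j (v j)) \<and> dem (Suc j) (p j) = dem j (p j) + dem j (v j)) \<and>
    (\<Sum>u\<in>remaining i. F i u (dem i u) - 1) + (\<Sum>j\<in>{i..<N - 1}. edge_entry j (dem j (v j)) - 1)
      = F (N - 1) (v (N - 1)) full - 1" if "i \<le> N - 1" for i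
  proof (rule tables_upper[OF T _ _ dem _ pos that])
    show "valid n d \<Longrightarrow> d < 3 * Suc n" for d by (rule valid_less)
    show "full < 3 * Suc n" by simp
  qed (simp add: node_entry_def split: if_splits)
  show "(\<forall>u\<in>remaining 0. 0 < F 0 u (dem 0 u)) \<and>
      (\<forall>j<N - 1. 0 < edge_entry j (dem j (v j)) \<and> dem (Suc j) (p j) = dem j (p j) + dem j (v j)) \<and>
      (\<Sum>u\<in>remaining 0. F 0 u (dem 0 u) - 1) + (\<Sum>j<N - 1. edge_entry j (dem j (v j)) - 1)
        = F (N - 1) (v (N - 1)) full - 1"
    using U[of 0] by (simp add: lessThan_atLeast0)
  have dm: "dem (Suc i) (p i) = dem i (p i) + dem i (v i)" if "Suc i < N" for i
    using U[of 0] that by auto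
  have same: "dem i u = dem (Suc i) u" if "Suc i < N" "u < N" "u \<noteq> v i" "u \<noteq> p i" for i u
    using dem that by (simp add: traced_def)
  have val: "valid n (dem i u)" if "i < N" "u \<in> remaining i" for i u using U[of i] that by auto
  have split: "count n (dem (Suc i) (p i)) = count n (dem i (p i)) + count n (dem i (v i))"
    "centred n (dem (Suc i) (p i)) \<longleftrightarrow> centred n (dem i (p i)) \<or> centred n (dem i (v i))"
    "\<not> (centred n (dem i (p i)) \<and> centred n (dem i (v i)))" if "Suc i < N" for i
    using valid_add[OF val[of i "p i"] val[of i "v i"]] val[of "Suc i" "p i"] dm[OF that] remaining_Suc[OF that] that
    by auto
  \<comment> \<open>Position \<open>j\<close> lies in the interval that \<open>u\<close> owns before
    stage \<open>i\<close>.\<close>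
  define H where "H j i u \<longleftrightarrow> st u \<le> j \<and> j < st u + count n (dem i u)" for j i u
  have top: "dem (N - 1) (v (N - 1)) = full" using dem by (simp add: traced_def)
  have H_step: "H j (Suc i) u \<longleftrightarrow> H j i u \<or> u = p i \<and> H j i (v i)" if "Suc i < N" "u \<in> remaining (Suc i)" for j i u
  proof (cases "u = p i")
    case True
    then show ?thesis using split(1)[OF that(1)] start(2)[OF that(1)] by (auto simp: H_def)
  next
    case False
    have "u < N" "u \<noteq> v i" using that remaining_Suc(2)[OF that(1)] remaining_less by auto
    then show ?thesis using same[OF that(1)] False by (simp add: H_def)
  qed
  have H_disj: "\<not> (H j i (p i) \<and> H j i (v i))" if "Suc i < N" for j i
    using start(2)[OF that] by (auto simp: H_def)
  have H_top: "H j (N - 1) (v (N - 1))" if "j < n" for j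
    using that start(1) top tot by (simp add: H_def)
  have C_step: "centred n (dem (Suc i) u) \<longleftrightarrow> centred n (dem i u) \<or> u = p i \<and> centred n (dem i (v i))"
    if "Suc i < N" "u \<in> remaining (Suc i)" for i u
  proof (cases "u = p i")
    case True then show ?thesis using split(2)[OF that(1)] by simp
  next
    case False
    have "u < N" "u \<noteq> v i" using that remaining_Suc(2)[OF that(1)] remaining_less by auto
    then show ?thesis using same[OF that(1)] False by simp
  qed
  have C_disj: "\<not> (centred n (dem i (p i)) \<and> centred n (dem i (v i)))" if "Suc i < N" for i
    by (rule split(3)[OF that])
  have C_top: "centred n (dem (N - 1) (v (N - 1)))" using top tot by simp
  have bound: "\<forall>u\<in>remaining i. st u + count n (dem i u) \<le> n" if "i \<le> N - 1" for i
    using that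
  proof (induction rule: inc_induct)
    case base then show ?case using start(1) top tot remaining_last by simp
  next
    case (step i)
    have i: "Suc i < N" using step by simp
    note RS = remaining_Suc[OF i]
    have p: "st (p i) + count n (dem i (p i)) + count n (dem i (v i)) \<le> n"
      using step.IH RS(3) split(1)[OF i] by (metis add.assoc)
    show ?case
    proof
      fix u assume "u \<in> remaining i"
      then consider "u = v i" | "u = p i" | "u \<in> remaining (Suc i)" "u \<noteq> p i" "u \<noteq> v i" "u < N"
        using RS(1) remaining_less[of u i] by auto
      then show "st u + count n (dem i u) \<le> n"
      proof cases
        case 3 then show ?thesis using step.IH same[OF i] by simp
      qed (use p start(2)[OF i] in auto)
    qed
  qed
  show "i < N \<Longrightarrow> u \<in> remaining i \<Longrightarrow> valid n (dem i u)" by (rule val)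
  show "Suc i < N \<Longrightarrow> count n (dem (Suc i) (p i)) = count n (dem i (p i)) + count n (dem i (v i))" by (rule split(1))
  show "Suc i < N \<Longrightarrow> centred n (dem (Suc i) (p i)) \<longleftrightarrow> centred n (dem i (p i)) \<or> centred n (dem i (v i))"
    by (rule split(2))
  show "Suc i < N \<Longrightarrow> \<not> (centred n (dem i (p i)) \<and> centred n (dem i (v i)))" by (rule split(3))
  show "i \<le> N - 1 \<Longrightarrow> u \<in> remaining i \<Longrightarrow> st u + count n (dem i u) \<le> n" using bound by blast
  show "i \<le> N - 1 \<Longrightarrow> j < n \<Longrightarrow> \<exists>!u. u \<in> remaining i \<and> st u \<le> j \<and> j < st u + count n (dem i u)"
    using unique_holder[OF H_step H_disj H_top] unfolding H_def .
  show "i \<le> N - 1 \<Longrightarrow> \<exists>!u. u \<in> remaining i \<and> centred n (dem i u)"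
    by (rule unique_holder[where H = "\<lambda>i u. centred n (dem i u)", OF C_step C_disj C_top])
  show "w < N \<Longrightarrow> j < n \<Longrightarrow> st w \<le> j \<Longrightarrow> j < st w + count n (dem 0 w) \<Longrightarrow> i < N \<Longrightarrow> u \<in> remaining i \<Longrightarrow>
      st u \<le> j \<and> j < st u + count n (dem i u) \<longleftrightarrow> rep i w = u"
    using holder_rep[where H = "H j" and w = w and i = i and u = u, OF H_step H_disj H_top] unfolding H_def by blast
  show "w < N \<Longrightarrow> centred n (dem 0 w) \<Longrightarrow> i < N \<Longrightarrow> u \<in> remaining i \<Longrightarrow> centred n (dem i u) \<longleftrightarrow> rep i w = u"
    by (rule holder_rep[where H = "\<lambda>i u. centred n (dem i u)", OF C_step C_disj C_top])
qed

text \<open>Each side of each tree edge receives an interval of the rim, so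
  \<open>crossing_interval\<close> gives equality at all cuts at once. It holds for any choice of
  connecting paths because these are forced in a tree.\<close>

theorem upper_bound:
  assumes T: "wtables F ch (N - 1)" and dem: "traced ch full dem 0"
    and pos: "0 < F (N - 1) (v (N - 1)) full"
    and start: "st (v (N - 1)) = 0" "\<And>i. Suc i < N \<Longrightarrow> st (v i) = st (p i) + count n (dem i (p i))"
    and mV: "\<And>u j. u < N \<Longrightarrow> st u \<le> j \<Longrightarrow> j < st u + count n (dem 0 u) \<Longrightarrow> mV (r j) = u"
      "\<And>u. u < N \<Longrightarrow> centred n (dem 0 u) \<Longrightarrow> mV c = u"
  shows "mV ` V \<subseteq> {..<N}"
    and "is_mapping I (mV, mE) \<Longrightarrow> feasible I (mV, mE) \<and> mapping_cost I (mV, mE) = F (N - 1) (v (N - 1)) full - 1"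
proof -
  note TF = trace_facts[OF T dem pos start]
  have dm: "dem (Suc i) (p i) = dem i (p i) + dem i (v i)" if "Suc i < N" for i
    using TF(5) that by auto
  have rim: "mV (r j) < N \<and> st (mV (r j)) \<le> j \<and> j < st (mV (r j)) + count n (dem 0 (mV (r j)))" if j: "j < n" for j
  proof -
    obtain u where "u < N" "st u \<le> j" "j < st u + count n (dem 0 u)"
      using TF(7)[of 0 j] j by (auto simp: remaining_0)
    moreover from this have "mV (r j) = u" by (rule mV(1))
    ultimately show ?thesis by simp
  qed
  have centre: "mV c < N \<and> centred n (dem 0 (mV c))"
  proof -
    obtain u where "u < N" "centred n (dem 0 u)" using TF(8)[of 0] by (auto simp: remaining_0)
    moreover from this have "mV c = u" using mV(2) by simp
    ultimately show ?thesis by simp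
  qed
  show mVV: "mV ` V \<subseteq> {..<N}" using rim centre by (auto simp: V_def)
  have rep_rim: "st u \<le> j \<and> j < st u + count n (dem i u) \<longleftrightarrow> rep i (mV (r j)) = u" if "j < n" "i < N" "u \<in> remaining i" for j i u
    using rim[OF that(1)] by (intro TF(9) that) auto
  have rep_centre: "centred n (dem i u) \<longleftrightarrow> rep i (mV c) = u" if "i < N" "u \<in> remaining i" for i u
    using centre by (intro TF(10) that) auto
  have card_H: "card {j. j < n \<and> rep i (mV (r j)) = u} = count n (dem i u)" if "i < N" "u \<in> remaining i" for i u
  proof -
    have b: "st u + count n (dem i u) \<le> n" using TF(6)[of i u] that by simp
    have "j < n \<and> rep i (mV (r j)) = u \<longleftrightarrow> st u \<le> j \<and> j < st u + count n (dem i u)" for j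
      using rep_rim[of j i u] that b by auto
    then have "{j. j < n \<and> rep i (mV (r j)) = u} = {st u..<st u + count n (dem i u)}"
      unfolding set_eq_iff mem_Collect_eq atLeastLessThan_iff by blast
    then show ?thesis by simp
  qed
  \<comment> \<open>The node mapping realises the traced demands at every stage, not merely at stage
    0; hence the cuts carry exactly what the tables charged.\<close>
  have acc: "acc (demand mV) i u = dem i u" if "i < N" "u \<in> remaining i" for i u
    unfolding acc_demand[OF mVV that] card_H[OF that] using rep_centre[OF that] demand_eq[of "dem i u" n] by auto
  assume im: "is_mapping I (mV, mE)"
  have cross: "card (crossing (side mV i)) = arc_cut n (far n (dem i (v i)))" if "Suc i < N" for i
  proof -
    have vi: "v i \<in> remaining i" "i < N" using remaining_Suc[OF that] that by auto
    have "card (crossing (side mV i)) = arc_cut n (far_side (side mV i))"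
    proof (rule crossing_interval)
      show "st (v i) + count n (dem i (v i)) \<le> n" using TF(6)[of i] vi by simp
      show "r j \<in> side mV i \<longleftrightarrow> st (v i) \<le> j \<and> j < st (v i) + count n (dem i (v i))" if "j < n" for j
        using rep_rim[OF that vi(2,1)] rim[OF that] by (simp add: side_def cut_def)
    qed
    then show ?thesis using far_side_demand[OF mVV that] acc[OF vi(2,1)] by simp
  qed
  have d0: "demand mV u = dem 0 u" "0 < node_entry u (dem 0 u)" "F 0 u (dem 0 u) = node_entry u (dem 0 u)" if "u < N" for u
  proof -
    show "demand mV u = dem 0 u" using acc[of 0 u] N_pos that by (simp add: remaining_0)
    have "valid n (dem 0 u)" using TF(1)[of 0 u] N_pos that by (simp add: remaining_0)
    then show F: "F 0 u (dem 0 u) = node_entry u (dem 0 u)" using T that valid_less by (simp add: tables_def)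
    have "0 < F 0 u (dem 0 u)" using TF(5) that by (simp add: remaining_0)
    then show "0 < node_entry u (dem 0 u)" unfolding F .
  qed
  have e0: "0 < edge_entry i (dem i (v i))" if "Suc i < N" for i using TF(5) that by auto
  have node: "load n (demand mV u) \<le> node_cap I u" "node_entry u (dem 0 u) - 1 = load n (demand mV u) * node_cost I u" if "u < N" for u
    using d0[OF that] by (auto simp: node_entry_def split: if_splits)
  have edge: "card (crossing (side mV i)) \<le> ecap i" "edge_entry i (dem i (v i)) - 1 = card (crossing (side mV i)) * ecost i" if "Suc i < N" for i
    using e0[OF that] cross[OF that] by (auto simp: edge_entry_def split: if_splits)
  have "F (N - 1) (v (N - 1)) full - 1 = (\<Sum>u<N. node_entry u (dem 0 u) - 1) + (\<Sum>i<N - 1. edge_entry i (dem i (v i)) - 1)"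
    using TF(5) d0(3) by (simp add: remaining_0)
  also have "\<dots> = mapping_cost I (mV, mE)"
    unfolding mapping_cost_eq[OF im]
    by (intro arg_cong2[where f = "(+)"] sum.cong refl) (use node edge in auto)
  finally show "feasible I (mV, mE) \<and> mapping_cost I (mV, mE) = F (N - 1) (v (N - 1)) full - 1"
    unfolding feasible_iff[OF im] using node edge by auto
qed

end

section \<open>The program\<close>

text \<open>The loop rule for invariants that ignore the counter. The body may then assume that the
  counter equals the number of completed passes.\<close>

lemma run_For_inv:
  assumes "P 0 s"
    and "\<And>k t a. P k t \<Longrightarrow> P k (upd v 0 a t)"
    and "\<And>k t. k < s b 0 \<Longrightarrow> P k t \<Longrightarrow> t v 0 = k \<Longrightarrow>
      (\<And>x. x \<notin> insert v (writes p) \<Longrightarrow> t x = s x) \<Longrightarrow> P (Suc k) (run p t)"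
  shows "P (s b 0) (run (For v b p) s)"
proof (rule run_For_rule[where P = P])
  show "P 0 s" by (rule assms(1))
  show "P (s b 0) t \<Longrightarrow> P (s b 0) (upd v 0 (s b 0) t)" for t by (rule assms(2))
  show "P (Suc k) (run p (upd v 0 k t))" if "k < s b 0" "P k t" "\<And>x. x \<notin> insert v (writes p) \<Longrightarrow> t x = s x" for k t
    using that by (intro assms(3) assms(2)) auto
qed

notation Plus (infixl "\<oplus>" 65) and Minus (infixl "\<ominus>" 65)
notation scalar ("\<langle>_\<rangle>")

abbreviation assign :: "nat \<Rightarrow> aexp \<Rightarrow> prog" (infix "::=" 62) where "x ::= a \<equiv> Asg x (Const 0) a"
abbreviation assign_at :: "nat \<Rightarrow> aexp \<Rightarrow> aexp \<Rightarrow> prog" ("_\<lbrakk>_\<rbrakk> ::= _" [63, 0, 63] 62) where "x\<lbrakk>i\<rbrakk> ::= a \<equiv> Asg x i a"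
abbreviation cell_at ("_\<lbrakk>_\<rbrakk>" [1000, 0] 1000) where "x\<lbrakk>i\<rbrakk> \<equiv> Cell x i"

definition Eq :: "aexp \<Rightarrow> aexp \<Rightarrow> bexp" where "Eq a b = And (Not (Less a b)) (Not (Less b a))"
definition Or :: "bexp \<Rightarrow> bexp \<Rightarrow> bexp" where "Or b c = Not (And (Not b) (Not c))"
definition Leq :: "aexp \<Rightarrow> aexp \<Rightarrow> bexp" where "Leq a b = Not (Less b a)"

lemma bval_derived [simp]:
  "bval (Eq a b) s \<longleftrightarrow> aval a s = aval b s"
  "bval (Or c d) s \<longleftrightarrow> bval c s \<or> bval d s"
  "bval (Leq a b) s \<longleftrightarrow> aval a s \<le> aval b s"
  by (auto simp: Eq_def Or_def Leq_def)

text \<open>Arrays and scalars of the program: \<open>NR\<close>, \<open>MR\<close>, \<open>NS\<close>, \<open>MS\<close> are the numbers of virtual nodes and edges and of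
  substrate nodes and edges; \<open>N = NR - 1\<close> is the rim length, \<open>M = 2 * NR\<close> the weight of the centre and
  \<open>R = 3 * NR\<close> the row length of the tables. \<open>EU\<close>, \<open>EV\<close> and \<open>SU\<close>, \<open>SV\<close> hold the ends of the virtual and substrate
  edges, \<open>SC\<close>, \<open>SW\<close>, \<open>NC\<close>, \<open>NW\<close> capacities and costs. \<open>CC\<close> is the centre, \<open>US\<close> the rim. \<open>OR i\<close> is the node
  eliminated at stage \<open>i\<close>, \<open>PA i\<close> its parent and \<open>PE i\<close> the index of the edge between them.\<close>

abbreviation (input) xNR :: nat where "xNR \<equiv> 2"
abbreviation (input) xMR :: nat where "xMR \<equiv> 3"
abbreviation (input) xNS :: nat where "xNS \<equiv> 4"
abbreviation (input) xMS :: nat where "xMS \<equiv> 5"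
abbreviation (input) xR :: nat where "xR \<equiv> 6"
abbreviation (input) xM :: nat where "xM \<equiv> 7"
abbreviation (input) xN :: nat where "xN \<equiv> 8"
abbreviation (input) xNS1 :: nat where "xNS1 \<equiv> 9"
abbreviation (input) xEU :: nat where "xEU \<equiv> 11"
abbreviation (input) xEV :: nat where "xEV \<equiv> 12"
abbreviation (input) xSU :: nat where "xSU \<equiv> 13"
abbreviation (input) xSV :: nat where "xSV \<equiv> 14"
abbreviation (input) xSC :: nat where "xSC \<equiv> 15"
abbreviation (input) xSW :: nat where "xSW \<equiv> 16"
abbreviation (input) xNC :: nat where "xNC \<equiv> 17"
abbreviation (input) xNW :: nat where "xNW \<equiv> 18"
abbreviation (input) xDG :: nat where "xDG \<equiv> 20"
abbreviation (input) xSN :: nat where "xSN \<equiv> 21"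
abbreviation (input) xCC :: nat where "xCC \<equiv> 22"
abbreviation (input) xUS :: nat where "xUS \<equiv> 23"
abbreviation (input) xSD :: nat where "xSD \<equiv> 24"
abbreviation (input) xSJ :: nat where "xSJ \<equiv> 25"
abbreviation (input) xOR :: nat where "xOR \<equiv> 26"
abbreviation (input) xTL :: nat where "xTL \<equiv> 27"
abbreviation (input) xPV :: nat where "xPV \<equiv> 28"
abbreviation (input) xPJ :: nat where "xPJ \<equiv> 29"
abbreviation (input) xPP :: nat where "xPP \<equiv> 30"
abbreviation (input) xPA :: nat where "xPA \<equiv> 31"
abbreviation (input) xPE :: nat where "xPE \<equiv> 32"
abbreviation (input) xT :: nat where "xT \<equiv> 35"
abbreviation (input) xI :: nat where "xI \<equiv> 60"
abbreviation (input) xJ :: nat where "xJ \<equiv> 61"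
abbreviation (input) xK :: nat where "xK \<equiv> 62"

text \<open>Separate from the rest because it writes the scalars that serve as loop bounds, whereas
  \<open>exec_compile\<close> applies to programs that leave their loop bounds alone.\<close>

definition header :: prog where
  "header =
     xNR ::= 0\<lbrakk>Const 0\<rbrakk> ;; xMR ::= 0\<lbrakk>Const 1\<rbrakk> ;;
     xNS ::= 0\<lbrakk>Const 2 \<oplus> \<langle>xMR\<rangle> \<oplus> \<langle>xMR\<rangle>\<rbrakk> ;; xMS ::= 0\<lbrakk>Const 3 \<oplus> \<langle>xMR\<rangle> \<oplus> \<langle>xMR\<rangle>\<rbrakk> ;;
     xM ::= \<langle>xNR\<rangle> \<oplus> \<langle>xNR\<rangle> ;; xR ::= \<langle>xM\<rangle> \<oplus> \<langle>xNR\<rangle> ;;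
     xN ::= \<langle>xNR\<rangle> \<ominus> Const 1 ;; xNS1 ::= \<langle>xNS\<rangle> \<ominus> Const 1"

definition parse1 :: prog where
  "parse1 = For xJ xMR (
     xEU\<lbrakk>\<langle>xJ\<rangle>\<rbrakk> ::= 0\<lbrakk>Const 2 \<oplus> \<langle>xJ\<rangle> \<oplus> \<langle>xJ\<rangle>\<rbrakk> ;; xEV\<lbrakk>\<langle>xJ\<rangle>\<rbrakk> ::= 0\<lbrakk>Const 3 \<oplus> \<langle>xJ\<rangle> \<oplus> \<langle>xJ\<rangle>\<rbrakk>)"

definition parse2 :: prog where
  "parse2 = For xJ xNS (
     xNC\<lbrakk>\<langle>xJ\<rangle>\<rbrakk> ::= 0\<lbrakk>Const 4 \<oplus> \<langle>xMR\<rangle> \<oplus> \<langle>xMR\<rangle> \<oplus> \<langle>xJ\<rangle> \<oplus> \<langle>xJ\<rangle>\<rbrakk> ;;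
     xNW\<lbrakk>\<langle>xJ\<rangle>\<rbrakk> ::= 0\<lbrakk>Const 5 \<oplus> \<langle>xMR\<rangle> \<oplus> \<langle>xMR\<rangle> \<oplus> \<langle>xJ\<rangle> \<oplus> \<langle>xJ\<rangle>\<rbrakk>)"

definition parse3 :: prog where
  "parse3 = For xJ xMS (
     xT ::= \<langle>xMR\<rangle> \<oplus> \<langle>xMR\<rangle> \<oplus> \<langle>xNS\<rangle> \<oplus> \<langle>xNS\<rangle> \<oplus> \<langle>xJ\<rangle> \<oplus> \<langle>xJ\<rangle> \<oplus> \<langle>xJ\<rangle> \<oplus> \<langle>xJ\<rangle> ;;
     xSU\<lbrakk>\<langle>xJ\<rangle>\<rbrakk> ::= 0\<lbrakk>Const 4 \<oplus> \<langle>xT\<rangle>\<rbrakk> ;; xSV\<lbrakk>\<langle>xJ\<rangle>\<rbrakk> ::= 0\<lbrakk>Const 5 \<oplus> \<langle>xT\<rangle>\<rbrakk> ;;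
     xSC\<lbrakk>\<langle>xJ\<rangle>\<rbrakk> ::= 0\<lbrakk>Const 6 \<oplus> \<langle>xT\<rangle>\<rbrakk> ;; xSW\<lbrakk>\<langle>xJ\<rangle>\<rbrakk> ::= 0\<lbrakk>Const 7 \<oplus> \<langle>xT\<rangle>\<rbrakk>)"

definition parse :: prog where "parse = parse1 ;; parse2 ;; parse3"

lemma run_header:
  fixes s :: memory
  defines "mr \<equiv> s 0 1"
  shows "run header s xNR 0 = s 0 0" "run header s xMR 0 = mr" "run header s xNS 0 = s 0 (2 + mr + mr)"
    "run header s xMS 0 = s 0 (3 + mr + mr)" "run header s xM 0 = s 0 0 + s 0 0" "run header s xR 0 = s 0 0 + s 0 0 + s 0 0"
    "run header s xN 0 = s 0 0 - 1" "run header s xNS1 0 = s 0 (2 + mr + mr) - 1"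
  by (simp_all add: header_def mr_def)

lemma run_parse1: "j < s xMR 0 \<Longrightarrow> run parse1 s xEU j = s 0 (2 + j + j) \<and> run parse1 s xEV j = s 0 (3 + j + j)"
proof -
  have "\<forall>j<s xMR 0. run parse1 s xEU j = s 0 (2 + j + j) \<and> run parse1 s xEV j = s 0 (3 + j + j)"
    unfolding parse1_def
  proof (rule run_For_inv[where P = "\<lambda>k t. \<forall>j<k. t xEU j = s 0 (2 + j + j) \<and> t xEV j = s 0 (3 + j + j)"], goal_cases)
    case (3 k t)
    have "t 0 = s 0" by (rule 3(4)) simp
    then show ?case using 3(2,3) by (auto simp: less_Suc_eq)
  qed simp_all
  then show "j < s xMR 0 \<Longrightarrow> run parse1 s xEU j = s 0 (2 + j + j) \<and> run parse1 s xEV j = s 0 (3 + j + j)" by blast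
qed

lemma run_parse2:
  defines "b s \<equiv> s xMR 0 + s xMR 0"
  shows "j < s xNS 0 \<Longrightarrow> run parse2 s xNC j = s 0 (4 + b s + j + j) \<and> run parse2 s xNW j = s 0 (5 + b s + j + j)"
proof -
  have "\<forall>j<s xNS 0. run parse2 s xNC j = s 0 (4 + b s + j + j) \<and> run parse2 s xNW j = s 0 (5 + b s + j + j)"
    unfolding parse2_def
  proof (rule run_For_inv[where P = "\<lambda>k t. \<forall>j<k. t xNC j = s 0 (4 + b s + j + j) \<and> t xNW j = s 0 (5 + b s + j + j)"], goal_cases)
    case (3 k t)
    have "t 0 = s 0" "t xMR = s xMR" by (rule 3(4), simp)+
    then show ?case using 3(2,3) by (auto simp: less_Suc_eq b_def add.assoc)
  qed simp_all
  then show "j < s xNS 0 \<Longrightarrow> run parse2 s xNC j = s 0 (4 + b s + j + j) \<and> run parse2 s xNW j = s 0 (5 + b s + j + j)" by blast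
qed

lemma run_parse3:
  defines "b s \<equiv> s xMR 0 + s xMR 0 + s xNS 0 + s xNS 0"
  shows "j < s xMS 0 \<Longrightarrow> run parse3 s xSU j = s 0 (4 + (b s + j + j + j + j)) \<and> run parse3 s xSV j = s 0 (5 + (b s + j + j + j + j)) \<and>
    run parse3 s xSC j = s 0 (6 + (b s + j + j + j + j)) \<and> run parse3 s xSW j = s 0 (7 + (b s + j + j + j + j))"
    (is "_ \<Longrightarrow> ?P (run parse3 s) j")
proof -
  have "\<forall>j<s xMS 0. ?P (run parse3 s) j"
    unfolding parse3_def
  proof (rule run_For_inv[where P = "\<lambda>k t. \<forall>j<k. ?P t j"], goal_cases)
    case (3 k t)
    have fr: "t 0 = s 0" "t xMR = s xMR" "t xNS = s xNS" by (rule 3(4), simp)+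
    then show ?case using 3(2,3) fr by (auto simp: less_Suc_eq b_def add.assoc)
  qed simp_all
  then show "j < s xMS 0 \<Longrightarrow> ?P (run parse3 s) j" by blast
qed

lemma writes_parse [simp]:
  "writes header = {xNR, xMR, xNS, xMS, xM, xR, xN, xNS1}"
  "writes parse1 = {xJ, xEU, xEV}" "writes parse2 = {xJ, xNC, xNW}" "writes parse3 = {xJ, xT, xSU, xSV, xSC, xSW}"
  by (auto simp: header_def parse1_def parse2_def parse3_def)

text \<open>The content \<open>f\<close> of the input array is arbitrary, since parsing also takes
  place on lists that encode no instance.\<close>

definition parsed :: "(nat \<Rightarrow> nat) \<Rightarrow> memory \<Rightarrow> bool" where
  "parsed f s \<longleftrightarrow> (let mr = f 1; ns = f (2 + mr + mr); ms = f (3 + mr + mr) in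
     s xNR 0 = f 0 \<and> s xMR 0 = mr \<and> s xNS 0 = ns \<and> s xMS 0 = ms \<and>
     s xM 0 = f 0 + f 0 \<and> s xR 0 = f 0 + f 0 + f 0 \<and> s xN 0 = f 0 - 1 \<and> s xNS1 0 = ns - 1 \<and>
     (\<forall>j<mr. s xEU j = f (2 + j + j) \<and> s xEV j = f (3 + j + j)) \<and>
     (\<forall>j<ns. s xNC j = f (4 + (mr + mr) + j + j) \<and> s xNW j = f (5 + (mr + mr) + j + j)) \<and>
     (\<forall>j<ms. s xSU j = f (4 + (mr + mr + ns + ns + j + j + j + j)) \<and> s xSV j = f (5 + (mr + mr + ns + ns + j + j + j + j)) \<and>
       s xSC j = f (6 + (mr + mr + ns + ns + j + j + j + j)) \<and> s xSW j = f (7 + (mr + mr + ns + ns + j + j + j + j))))"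

lemma run_parse:
  fixes s :: memory
  shows "parsed (s 0) (run parse (run header s))"
proof -
  let ?h = "run header s"
  let ?a = "run parse1 ?h"
  let ?b = "run parse2 ?a"
  have fr: "?h 0 = s 0" "?a 0 = s 0" "?b 0 = s 0" by (simp_all add: run_frame)
  have sc: "?a x = ?h x" "?b x = ?h x" if "x \<in> {xMR, xNS, xMS}" for x using that by (auto simp: run_frame)
  show ?thesis
    using run_header[of s] run_parse1[of _ ?h] run_parse2[of _ ?a] run_parse3[of _ ?b]
    unfolding parsed_def Let_def parse_def by (simp add: run_frame fr sc)
qed


section \<open>Finding the rim of the wheel\<close>

lemma card_Suc_filter: "card {j. j < Suc k \<and> P j} = card {j. j < k \<and> P j} + (if P k then 1 else 0)"
proof -
  have "{j. j < Suc k \<and> P j} = {j. j < k \<and> P j} \<union> (if P k then {k} else {})" by (auto simp: less_Suc_eq)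
  then show ?thesis by simp
qed

lemma sum_Suc_filter:
  "(\<Sum>j | j < Suc k \<and> P j. f j) = (\<Sum>j | j < k \<and> P j. f j) + (if P k then f k else (0::nat))"
proof -
  have "{j. j < Suc k \<and> P j} = {j. j < k \<and> P j} \<union> (if P k then {k} else {})" by (auto simp: less_Suc_eq)
  then show ?thesis by simp
qed

definition rim_degrees :: prog where
  "rim_degrees = For xJ xMR (
     xDG\<lbrakk>xEU\<lbrakk>\<langle>xJ\<rangle>\<rbrakk>\<rbrakk> ::= xDG\<lbrakk>xEU\<lbrakk>\<langle>xJ\<rangle>\<rbrakk>\<rbrakk> \<oplus> Const 1 ;; xDG\<lbrakk>xEV\<lbrakk>\<langle>xJ\<rangle>\<rbrakk>\<rbrakk> ::= xDG\<lbrakk>xEV\<lbrakk>\<langle>xJ\<rangle>\<rbrakk>\<rbrakk> \<oplus> Const 1 ;;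
     xSN\<lbrakk>xEU\<lbrakk>\<langle>xJ\<rangle>\<rbrakk>\<rbrakk> ::= xSN\<lbrakk>xEU\<lbrakk>\<langle>xJ\<rangle>\<rbrakk>\<rbrakk> \<oplus> xEV\<lbrakk>\<langle>xJ\<rangle>\<rbrakk> ;; xSN\<lbrakk>xEV\<lbrakk>\<langle>xJ\<rangle>\<rbrakk>\<rbrakk> ::= xSN\<lbrakk>xEV\<lbrakk>\<langle>xJ\<rangle>\<rbrakk>\<rbrakk> \<oplus> xEU\<lbrakk>\<langle>xJ\<rangle>\<rbrakk>)"

definition find_centre :: prog where
  "find_centre = xCC ::= Const 0 ;; For xJ xNR (Cond (Eq (xDG\<lbrakk>\<langle>xJ\<rangle>\<rbrakk>) \<langle>xN\<rangle>) (xCC ::= \<langle>xJ\<rangle>) Nop)"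

definition find_rim_edge :: prog where
  "find_rim_edge = For xJ xMR (
     Cond (And (Not (Eq (xEU\<lbrakk>\<langle>xJ\<rangle>\<rbrakk>) \<langle>xCC\<rangle>)) (Not (Eq (xEV\<lbrakk>\<langle>xJ\<rangle>\<rbrakk>) \<langle>xCC\<rangle>)))
       (xUS\<lbrakk>Const 0\<rbrakk> ::= xEU\<lbrakk>\<langle>xJ\<rangle>\<rbrakk> ;; xUS\<lbrakk>Const 1\<rbrakk> ::= xEV\<lbrakk>\<langle>xJ\<rangle>\<rbrakk>) Nop)"

text \<open>The neighbours of a rim node sum up to the centre plus its two neighbours on the rim, so that
  the next rim node is obtained by subtraction.\<close>

definition walk_rim :: prog where
  "walk_rim = For xJ xNR (
     xUS\<lbrakk>\<langle>xJ\<rangle> \<oplus> Const 2\<rbrakk> ::= xSN\<lbrakk>xUS\<lbrakk>\<langle>xJ\<rangle> \<oplus> Const 1\<rbrakk>\<rbrakk> \<ominus> \<langle>xCC\<rangle> \<ominus> xUS\<lbrakk>\<langle>xJ\<rangle>\<rbrakk>)"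

definition find_wheel :: prog where
  "find_wheel = rim_degrees ;; find_centre ;; find_rim_edge ;; walk_rim"

lemma writes_wheel [simp]:
  "writes rim_degrees = {xJ, xDG, xSN}" "writes find_centre = {xJ, xCC}" "writes find_rim_edge = {xJ, xUS}"
  "writes walk_rim = {xJ, xUS}"
  by (auto simp: rim_degrees_def find_centre_def find_rim_edge_def walk_rim_def)

lemma run_rim_degrees:
  fixes s :: memory
  assumes "s xDG = (\<lambda>_. 0)" "s xSN = (\<lambda>_. 0)" "\<And>j. j < s xMR 0 \<Longrightarrow> s xEU j \<noteq> s xEV j"
  defines "inc k x \<equiv> {j. j < k \<and> (s xEU j = x \<or> s xEV j = x)}"
  shows "run rim_degrees s xDG x = card (inc (s xMR 0) x) \<and>
    run rim_degrees s xSN x = (\<Sum>j\<in>inc (s xMR 0) x. if s xEU j = x then s xEV j else s xEU j)"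
proof -
  have "\<forall>x. run rim_degrees s xDG x = card (inc (s xMR 0) x) \<and>
    run rim_degrees s xSN x = (\<Sum>j\<in>inc (s xMR 0) x. if s xEU j = x then s xEV j else s xEU j)"
    unfolding rim_degrees_def
  proof (rule run_For_inv[where P = "\<lambda>k t. \<forall>x. t xDG x = card (inc k x) \<and>
      t xSN x = (\<Sum>j\<in>inc k x. if s xEU j = x then s xEV j else s xEU j)"], goal_cases)
    case (3 k t)
    have fr: "t xEU = s xEU" "t xEV = s xEV" by (rule 3(4), simp)+
    have ne: "s xEU k \<noteq> s xEV k" "s xEV k \<noteq> s xEU k" using assms(3)[OF 3(1)] by auto
    show ?case using 3(2,3) fr ne unfolding inc_def card_Suc_filter sum_Suc_filter by simp
  qed (simp_all add: assms(1,2) inc_def)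
  then show ?thesis by blast
qed

lemma run_find_centre:
  assumes "j < s xNR 0" "s xDG j = s xN 0"
  shows "run find_centre s xCC 0 < s xNR 0 \<and> s xDG (run find_centre s xCC 0) = s xN 0"
proof -
  let ?s = "upd xCC 0 0 s"
  have "(\<exists>j<?s xNR 0. s xDG j = s xN 0) \<longrightarrow>
      run find_centre s xCC 0 < ?s xNR 0 \<and> s xDG (run find_centre s xCC 0) = s xN 0"
    unfolding find_centre_def run.simps(2,3) aval.simps
  proof (rule run_For_inv[where P = "\<lambda>k t. (\<exists>j<k. s xDG j = s xN 0) \<longrightarrow> t xCC 0 < k \<and> s xDG (t xCC 0) = s xN 0"], goal_cases)
    case (3 k t)
    have "t xDG = ?s xDG" "t xN = ?s xN" by (rule 3(4), simp)+
    then show ?case using 3(2,3) by (auto simp: less_Suc_eq)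
  qed simp_all
  then show ?thesis using assms by auto
qed

lemma run_find_rim_edge:
  fixes s :: memory
  defines "rim j \<equiv> s xEU j \<noteq> s xCC 0 \<and> s xEV j \<noteq> s xCC 0"
  assumes "j < s xMR 0" "rim j"
  shows "\<exists>j<s xMR 0. rim j \<and> run find_rim_edge s xUS 0 = s xEU j \<and> run find_rim_edge s xUS 1 = s xEV j"
proof -
  have "(\<exists>j<s xMR 0. rim j) \<longrightarrow>
      (\<exists>j<s xMR 0. rim j \<and> run find_rim_edge s xUS 0 = s xEU j \<and> run find_rim_edge s xUS 1 = s xEV j)"
    unfolding find_rim_edge_def
  proof (rule run_For_inv[where P = "\<lambda>k t. (\<exists>j<k. rim j) \<longrightarrow> (\<exists>j<k. rim j \<and> t xUS 0 = s xEU j \<and> t xUS 1 = s xEV j)"], goal_cases)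
    case (3 k t)
    have fr: "t xEU = s xEU" "t xEV = s xEV" "t xCC = s xCC" by (rule 3(4), simp)+
    show ?case
    proof (cases "rim k")
      case True
      then show ?thesis using 3(3) fr by (auto simp: rim_def)
    next
      case False
      then show ?thesis using 3(2,3) fr by (auto simp: rim_def less_Suc_eq)
    qed
  qed simp_all
  then show ?thesis using assms by blast
qed

text \<open>The walk goes a little beyond one turn, so that position \<open>n\<close>, where the
  first rim node recurs, is filled as well.\<close>

lemma run_walk_rim:
  fixes s :: memory and \<rho> :: "int \<Rightarrow> nat"
  assumes "s xUS 0 = \<rho> 0" "s xUS 1 = \<rho> 1" "\<And>i. s xSN (\<rho> i) = s xCC 0 + \<rho> (i - 1) + \<rho> (i + 1)"
  shows "j < s xNR 0 + 2 \<Longrightarrow> run walk_rim s xUS j = \<rho> (int j)"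
proof -
  have "\<forall>j<s xNR 0 + 2. run walk_rim s xUS j = \<rho> (int j)"
    unfolding walk_rim_def
  proof (rule run_For_inv[where P = "\<lambda>k t. \<forall>j<k + 2. t xUS j = \<rho> (int j)"], goal_cases)
    case 1
    then show ?case using assms(1,2) by (auto simp: less_Suc_eq numeral_2_eq_2)
  next
    case (3 k t)
    have fr: "t xSN = s xSN" "t xCC = s xCC" by (rule 3(4), simp)+
    have "t xUS (Suc k) = \<rho> (int k + 1)" "t xUS k = \<rho> (int k)" using 3(2)[rule_format, of "Suc k"] 3(2) by (auto simp: add.commute)
    then have "t xSN (t xUS (Suc k)) - t xCC 0 - t xUS k = \<rho> (int (k + 2))"
      unfolding fr using assms(3)[of "int k + 1"] by (simp add: add.commute)
    then show ?case using 3(2,3) by (auto simp: less_Suc_eq)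
  qed simp_all
  then show "j < s xNR 0 + 2 \<Longrightarrow> run walk_rim s xUS j = \<rho> (int j)" by blast
qed

text \<open>In the complete graph on four nodes every node has full degree, so the centre found need
  not be the one from which the wheel was described. The symmetries of the wheel supply a
  description with this centre and with the rim edge found as its start.\<close>

lemma run_find_wheel:
  fixes s :: memory
  assumes G: "is_wheel G" "verts G = {..<s xNR 0}" "edge_list (s xMR 0) (s xEU) (s xEV) (edges G)"
    and s: "s xN 0 = s xNR 0 - 1" "s xDG = (\<lambda>_. 0)" "s xSN = (\<lambda>_. 0)"
  defines "n \<equiv> s xNR 0 - 1" and "t \<equiv> run find_wheel s"
  shows "wheel n (t xCC 0) (t xUS)" "wheel.V n (t xCC 0) (t xUS) = verts G" "wheel.E n (t xCC 0) (t xUS) = edges G"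
    "s xNR 0 = Suc n"
proof -
  obtain n' c0 \<rho>0 where pw0: "periodic_wheel n' c0 \<rho>0 (verts G) (edges G)" using is_wheel_periodic[OF G(1)] by blast
  note W0 = periodic_wheel_wheel[OF pw0 refl]
  have "card (verts G) = Suc n'" using wheel.card_V[OF W0(1)] W0(2) by simp
  then have nr: "s xNR 0 = Suc n'" and n': "n' = n" using G(2) by (simp_all add: n_def)
  then show "s xNR 0 = Suc n" by simp
  have e2: "card e = 2" if "e \<in> edges G" for e using wheel.E_edges[OF W0(1)] W0(3) that by simp
  have loop: "s xEU j \<noteq> s xEV j" if "j < s xMR 0" for j
  proof -
    have "card {s xEU j, s xEV j} = 2" using that G(3) e2 by (auto simp: edge_list_def)
    then show ?thesis by auto
  qed
  define a where "a = run rim_degrees s"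
  define b where "b = run find_centre a"
  define d where "d = run find_rim_edge b"
  have t: "t = run walk_rim d" by (simp add: t_def find_wheel_def a_def b_def d_def)
  have fa: "a x = s x" if "x \<notin> {xJ, xDG, xSN}" for x using that by (simp add: a_def run_frame)
  have fb: "b x = a x" if "x \<notin> {xJ, xCC}" for x using that by (simp add: b_def run_frame)
  have fd: "d x = b x" if "x \<notin> {xJ, xUS}" for x using that by (simp add: d_def run_frame)
  have ft: "t x = d x" if "x \<notin> {xJ, xUS}" for x using that by (simp add: t run_frame)
  have deg: "a xDG x = card (neighbours (edges G) x)" and nsum: "a xSN x = \<Sum>(neighbours (edges G) x)" for x
    using run_rim_degrees[OF s(2,3) loop, of x] edge_list_degree[OF G(3) e2, of x] edge_list_neighbour_sum[OF G(3) e2, of x]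
    by (auto simp: a_def)
  have N: "a xN 0 = n" "a xNR 0 = Suc n" using s(1) nr n' by (simp_all add: fa)
  define c where "c = b xCC 0"
  have "c0 \<in> verts G" using pw0 by (simp add: periodic_wheel_def)
  moreover have "a xDG c0 = n" using deg periodic_wheel_neighbours(1,4)[OF pw0] n' by simp
  ultimately have c: "c < Suc n" "a xDG c = n"
    using run_find_centre[of c0 a] N G(2) nr n' by (auto simp: b_def c_def)
  then obtain \<rho>1 where pw1: "periodic_wheel n c \<rho>1 (verts G) (edges G)"
    using periodic_wheel_centre[OF pw0, of c] deg G(2) nr n' by auto
  have "{\<rho>1 0, \<rho>1 1} \<in> edges G"
  proof -
    have "{\<rho>1 0, \<rho>1 (0 + 1)} \<in> edges G" using pw1 unfolding periodic_wheel_def by blast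
    then show ?thesis by simp
  qed
  then have "{\<rho>1 0, \<rho>1 1} \<in> (\<lambda>j. {s xEU j, s xEV j}) ` {..<s xMR 0}" using G(3) by (simp add: edge_list_def)
  then obtain j where "j < s xMR 0" "{s xEU j, s xEV j} = {\<rho>1 0, \<rho>1 1}" by auto
  moreover have "\<rho>1 0 \<noteq> c" "\<rho>1 1 \<noteq> c" using pw1 by (auto simp: periodic_wheel_def)
  ultimately have "\<exists>j<b xMR 0. b xEU j \<noteq> b xCC 0 \<and> b xEV j \<noteq> b xCC 0"
    by (intro exI[of _ j]) (auto simp: fb fa c_def doubleton_eq_iff)
  then obtain j where j: "j < s xMR 0" "s xEU j \<noteq> c" "s xEV j \<noteq> c" "d xUS 0 = s xEU j" "d xUS 1 = s xEV j"
    using run_find_rim_edge[of _ b] by (auto simp: d_def fb fa c_def)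
  have "{s xEU j, s xEV j} \<in> edges G" using j(1) G(3) by (auto simp: edge_list_def)
  then obtain \<rho> where \<rho>: "periodic_wheel n c \<rho> (verts G) (edges G)" "\<rho> 0 = s xEU j" "\<rho> 1 = s xEV j"
    using periodic_wheel_start[OF pw1] j by blast
  have "d xSN (\<rho> i) = d xCC 0 + \<rho> (i - 1) + \<rho> (i + 1)" for i
    using nsum[of "\<rho> i"] periodic_wheel_neighbours(2,3)[OF \<rho>(1), of i] by (simp add: fd fb c_def)
  then have "t xUS i = \<rho> (int i)" if "i \<le> n" for i
    unfolding t using that \<rho> j nr n' by (intro run_walk_rim) (auto simp: fd fb fa)
  moreover have "t xCC 0 = c" by (simp add: ft fd c_def)
  ultimately show "wheel n (t xCC 0) (t xUS)" "wheel.V n (t xCC 0) (t xUS) = verts G" "wheel.E n (t xCC 0) (t xUS) = edges G"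
    using periodic_wheel_wheel[OF \<rho>(1), of "t xUS"] by auto
qed


section \<open>Finding an elimination order of the tree\<close>

definition tree_degrees :: prog where
  "tree_degrees = For xJ xMS (
     xSD\<lbrakk>xSU\<lbrakk>\<langle>xJ\<rangle>\<rbrakk>\<rbrakk> ::= xSD\<lbrakk>xSU\<lbrakk>\<langle>xJ\<rangle>\<rbrakk>\<rbrakk> \<oplus> Const 1 ;; xSD\<lbrakk>xSV\<lbrakk>\<langle>xJ\<rangle>\<rbrakk>\<rbrakk> ::= xSD\<lbrakk>xSV\<lbrakk>\<langle>xJ\<rangle>\<rbrakk>\<rbrakk> \<oplus> Const 1 ;;
     xSJ\<lbrakk>xSU\<lbrakk>\<langle>xJ\<rangle>\<rbrakk>\<rbrakk> ::= xSJ\<lbrakk>xSU\<lbrakk>\<langle>xJ\<rangle>\<rbrakk>\<rbrakk> \<oplus> \<langle>xJ\<rangle> ;; xSJ\<lbrakk>xSV\<lbrakk>\<langle>xJ\<rangle>\<rbrakk>\<rbrakk> ::= xSJ\<lbrakk>xSV\<lbrakk>\<langle>xJ\<rangle>\<rbrakk>\<rbrakk> \<oplus> \<langle>xJ\<rangle>)"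

definition leaf_step :: prog where
  "leaf_step = Cond (Less (xSD\<lbrakk>\<langle>xJ\<rangle>\<rbrakk>) (Const 2)) (xOR\<lbrakk>\<langle>xTL\<rangle>\<rbrakk> ::= \<langle>xJ\<rangle> ;; xTL ::= \<langle>xTL\<rangle> \<oplus> Const 1) Nop"

definition find_leaves :: prog where
  "find_leaves = xTL ::= Const 0 ;; For xJ xNS leaf_step"

text \<open>The indices of the edges at a leaf sum up to the index of its only edge. Keeping these sums
  replaces adjacency lists.\<close>

definition peel_step :: prog where
  "peel_step = (
     xPV ::= xOR\<lbrakk>\<langle>xI\<rangle>\<rbrakk> ;; xPJ ::= xSJ\<lbrakk>\<langle>xPV\<rangle>\<rbrakk> ;; xPP ::= xSU\<lbrakk>\<langle>xPJ\<rangle>\<rbrakk> \<oplus> xSV\<lbrakk>\<langle>xPJ\<rangle>\<rbrakk> \<ominus> \<langle>xPV\<rangle> ;;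
     xPA\<lbrakk>\<langle>xI\<rangle>\<rbrakk> ::= \<langle>xPP\<rangle> ;; xPE\<lbrakk>\<langle>xI\<rangle>\<rbrakk> ::= \<langle>xPJ\<rangle> ;;
     xSD\<lbrakk>\<langle>xPV\<rangle>\<rbrakk> ::= xSD\<lbrakk>\<langle>xPV\<rangle>\<rbrakk> \<ominus> Const 1 ;; xSD\<lbrakk>\<langle>xPP\<rangle>\<rbrakk> ::= xSD\<lbrakk>\<langle>xPP\<rangle>\<rbrakk> \<ominus> Const 1 ;;
     xSJ\<lbrakk>\<langle>xPV\<rangle>\<rbrakk> ::= xSJ\<lbrakk>\<langle>xPV\<rangle>\<rbrakk> \<ominus> \<langle>xPJ\<rangle> ;; xSJ\<lbrakk>\<langle>xPP\<rangle>\<rbrakk> ::= xSJ\<lbrakk>\<langle>xPP\<rangle>\<rbrakk> \<ominus> \<langle>xPJ\<rangle> ;;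
     Cond (Eq (xSD\<lbrakk>\<langle>xPP\<rangle>\<rbrakk>) (Const 1)) (xOR\<lbrakk>\<langle>xTL\<rangle>\<rbrakk> ::= \<langle>xPP\<rangle> ;; xTL ::= \<langle>xTL\<rangle> \<oplus> Const 1) Nop)"

definition peel :: prog where
  "peel = For xI xNS1 peel_step"

definition find_order :: prog where
  "find_order = tree_degrees ;; find_leaves ;; peel"

lemma writes_tree [simp]:
  "writes tree_degrees = {xJ, xSD, xSJ}" "writes find_leaves = {xJ, xTL, xOR}"
  "writes peel = {xI, xPV, xPJ, xPP, xPA, xPE, xSD, xSJ, xOR, xTL}"
  "writes leaf_step = {xOR, xTL}" "writes peel_step = {xPV, xPJ, xPP, xPA, xPE, xSD, xSJ, xOR, xTL}"
  by (auto simp: tree_degrees_def find_leaves_def peel_def leaf_step_def peel_step_def)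

lemma run_tree_degrees:
  fixes s :: memory
  assumes "s xSD = (\<lambda>_. 0)" "s xSJ = (\<lambda>_. 0)" "\<And>j. j < s xMS 0 \<Longrightarrow> s xSU j \<noteq> s xSV j"
  defines "inc k x \<equiv> {j. j < k \<and> (s xSU j = x \<or> s xSV j = x)}"
  shows "run tree_degrees s xSD x = card (inc (s xMS 0) x) \<and> run tree_degrees s xSJ x = \<Sum>(inc (s xMS 0) x)"
proof -
  have "\<forall>x. run tree_degrees s xSD x = card (inc (s xMS 0) x) \<and> run tree_degrees s xSJ x = \<Sum>(inc (s xMS 0) x)"
    unfolding tree_degrees_def
  proof (rule run_For_inv[where P = "\<lambda>k t. \<forall>x. t xSD x = card (inc k x) \<and> t xSJ x = \<Sum>(inc k x)"], goal_cases)
    case (3 k t)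
    have fr: "t xSU = s xSU" "t xSV = s xSV" by (rule 3(4), simp)+
    have ne: "s xSU k \<noteq> s xSV k" "s xSV k \<noteq> s xSU k" using assms(3)[OF 3(1)] by auto
    show ?case using 3(2,3) fr ne unfolding inc_def card_Suc_filter sum_Suc_filter by simp
  qed (simp_all add: assms(1,2) inc_def)
  then show ?thesis by blast
qed

lemma run_find_leaves:
  fixes s :: memory
  defines "t \<equiv> run find_leaves s"
  shows "inj_on (t xOR) {..<t xTL 0}" "t xOR ` {..<t xTL 0} = {u. u < s xNS 0 \<and> s xSD u \<le> 1}"
proof -
  let ?s = "upd xTL 0 0 s"
  have "inj_on (t xOR) {..<t xTL 0} \<and> t xOR ` {..<t xTL 0} = {u. u < ?s xNS 0 \<and> s xSD u \<le> 1}"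
    unfolding t_def find_leaves_def run.simps(2,3) aval.simps
  proof (rule run_For_inv[where P = "\<lambda>k t. inj_on (t xOR) {..<t xTL 0} \<and> t xOR ` {..<t xTL 0} = {u. u < k \<and> s xSD u \<le> 1}"], goal_cases)
    case (3 k t)
    have fr: "t xSD = ?s xSD" by (rule 3(4)) simp
    show ?case
    proof (cases "s xSD k \<le> 1")
      case False
      then have "{u. u < Suc k \<and> s xSD u \<le> 1} = {u. u < k \<and> s xSD u \<le> 1}" by (auto simp: less_Suc_eq)
      moreover have "run leaf_step t = t" using fr False 3(3) by (simp add: leaf_step_def)
      ultimately show ?thesis using 3(2) by simp
    next
      case True
      have "{u. u < Suc k \<and> s xSD u \<le> 1} = insert k {u. u < k \<and> s xSD u \<le> 1}" using True by (auto simp: less_Suc_eq)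
      moreover have "k \<notin> t xOR ` {..<t xTL 0}" using 3(2) by auto
      then have "inj_on ((t xOR)(t xTL 0 := k)) {..<Suc (t xTL 0)}"
        using 3(2) by (auto simp: inj_on_def less_Suc_eq)
      moreover have "((t xOR)(t xTL 0 := k)) ` {..<Suc (t xTL 0)} = insert k (t xOR ` {..<t xTL 0})"
        by (auto simp: lessThan_Suc)
      moreover have "run leaf_step t xOR = (t xOR)(t xTL 0 := k)" "run leaf_step t xTL 0 = Suc (t xTL 0)"
        using fr True 3(3) by (simp_all add: leaf_step_def fun_eq_iff)
      ultimately show ?thesis using 3(2) by simp
    qed
  qed simp_all
  then show "inj_on (t xOR) {..<t xTL 0}" "t xOR ` {..<t xTL 0} = {u. u < s xNS 0 \<and> s xSD u \<le> 1}" by simp_all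
qed

text \<open>\<open>OR\<close> doubles as the queue of the peeling loop: nodes are eliminated in the
  order in which they become leaves.\<close>

lemma run_find_order:
  fixes s :: memory
  assumes G: "is_tree G" "verts G = {..<s xNS 0}" "edge_list (s xMS 0) (s xSU) (s xSV) (edges G)"
    and s: "s xNS1 0 = s xNS 0 - 1" "s xSD = (\<lambda>_. 0)" "s xSJ = (\<lambda>_. 0)"
  defines "N \<equiv> s xNS 0" and "t \<equiv> run find_order s"
  shows "elimination N (t xOR) (t xPA)" "bij_betw (t xPE) {..<N - 1} {..<s xMS 0}"
    "\<And>i. Suc i < N \<Longrightarrow> {s xSU (t xPE i), s xSV (t xPE i)} = {t xOR i, t xPA i}"
proof -
  have loop: "s xSU j \<noteq> s xSV j" if "j < s xMS 0" for j
  proof -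
    have "card {s xSU j, s xSV j} = 2" using that G by (auto simp: is_tree_def simple_graph_def edge_list_def)
    then show ?thesis by auto
  qed
  define a where "a = run tree_degrees s"
  define b where "b = run find_leaves a"
  have t: "t = run peel b" by (simp add: t_def find_order_def a_def b_def)
  have fa: "a x = s x" if "x \<notin> {xJ, xSD, xSJ}" for x using that by (simp add: a_def run_frame)
  have fb: "b x = a x" if "x \<notin> {xJ, xTL, xOR}" for x using that by (simp add: b_def run_frame)
  have deg: "a xSD u = card {j. j < s xMS 0 \<and> (s xSU j = u \<or> s xSV j = u)}"
    "a xSJ u = \<Sum>{j. j < s xMS 0 \<and> (s xSU j = u \<or> s xSV j = u)}" for u
    using run_tree_degrees[OF s(2,3) loop, of u] by (auto simp: a_def)
  let ?P = "\<lambda>i t. peeling N (s xMS 0) (s xSU) (s xSV) i (t xOR) (t xTL 0) (t xSD) (t xSJ) (t xPA) (t xPE)"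
  have b0: "?P 0 b"
    using run_find_leaves[of a] unfolding b_def[symmetric]
    by (intro peeling_start[OF G(1) G(2)[folded N_def] G(3)]) (simp_all add: fb fa deg N_def)
  have "?P (b xNS1 0) t"
    unfolding t peel_def
  proof (rule run_For_inv[where P = ?P], goal_cases)
    case 1 show ?case by (rule b0)
  next
    case (3 k t)
    have "t xSU = b xSU" "t xSV = b xSV" by (rule 3(4), simp)+
    then have fr: "t xSU = s xSU" "t xSV = s xSV" by (simp_all add: fb fa)
    have "Suc k < N" using 3(1) s(1) by (simp add: fb fa N_def)
    note st = peeling_step[OF G(1) G(2)[folded N_def] G(3) 3(2) this]
    let ?x = "t xOR k"
    let ?j = "t xSJ ?x"
    let ?q = "s xSU ?j + s xSV ?j - ?x"
    have ne: "?x \<noteq> ?q" by (rule st(1))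
    let ?D = "(t xSD)(?x := t xSD ?x - 1, ?q := t xSD ?q - 1)"
    let ?t = "run peel_step t"
    have eqs: "?t xOR = (if ?D ?q = 1 then (t xOR)(t xTL 0 := ?q) else t xOR)"
      "?t xTL 0 = (if ?D ?q = 1 then Suc (t xTL 0) else t xTL 0)" "?t xSD = ?D"
      "?t xSJ = (t xSJ)(?x := t xSJ ?x - ?j, ?q := t xSJ ?q - ?j)"
      "?t xPA = (t xPA)(k := ?q)" "?t xPE = (t xPE)(k := ?j)"
      using 3(3) fr ne by (simp_all add: peel_step_def fun_eq_iff)
    show ?case unfolding eqs by (rule st(2))
  qed simp
  then have "?P (N - 1) t" using s(1) by (simp add: fb fa N_def)
  from peeling_end[OF this loop] G(3)
  show "elimination N (t xOR) (t xPA)" "bij_betw (t xPE) {..<N - 1} {..<s xMS 0}"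
    "\<And>i. Suc i < N \<Longrightarrow> {s xSU (t xPE i), s xSV (t xPE i)} = {t xOR i, t xPA i}"
    by (auto simp: edge_list_def)
qed

text \<open>\<open>F\<close> holds the current tables row by row with row offsets \<open>OF\<close>, \<open>CR\<close> the cut size of each demand, and \<open>CH\<close>
  for each stage the part of a demand that an optimal split gives to the leaf. \<open>DE\<close> is the demand finally
  assigned to a node, \<open>ST\<close> the first rim position it receives, \<open>MV\<close> the node mapping.\<close>

abbreviation (input) xOF :: nat where "xOF \<equiv> 33"
abbreviation (input) xCR :: nat where "xCR \<equiv> 34"
abbreviation (input) xA :: nat where "xA \<equiv> 36"
abbreviation (input) xF :: nat where "xF \<equiv> 37"
abbreviation (input) xW :: nat where "xW \<equiv> 38"
abbreviation (input) xG :: nat where "xG \<equiv> 39"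
abbreviation (input) xH :: nat where "xH \<equiv> 40"
abbreviation (input) xCH :: nat where "xCH \<equiv> 41"
abbreviation (input) xOV :: nat where "xOV \<equiv> 42"
abbreviation (input) xOP :: nat where "xOP \<equiv> 43"
abbreviation (input) xDE :: nat where "xDE \<equiv> 44"
abbreviation (input) xST :: nat where "xST \<equiv> 45"
abbreviation (input) xMV :: nat where "xMV \<equiv> 46"
abbreviation (input) xOI :: nat where "xOI \<equiv> 47"

section \<open>Filling the tables\<close>

definition row_offsets :: prog where
  "row_offsets = xOF\<lbrakk>Const 0\<rbrakk> ::= Const 0 ;; For xJ xNS (xOF\<lbrakk>\<langle>xJ\<rangle> \<oplus> Const 1\<rbrakk> ::= xOF\<lbrakk>\<langle>xJ\<rangle>\<rbrakk> \<oplus> \<langle>xR\<rangle>)"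

text \<open>With the centre, \<open>far n d\<close> is \<open>n - (d - 2 * Suc n)\<close>, here
  computed as \<open>n + 2 * Suc n - d\<close>.\<close>

definition arc_step :: prog where
  "arc_step =
     (xT ::= \<langle>xJ\<rangle> ;; Cond (Leq \<langle>xM\<rangle> \<langle>xJ\<rangle>) (xT ::= \<langle>xN\<rangle> \<oplus> \<langle>xM\<rangle> \<ominus> \<langle>xJ\<rangle>) Nop ;;
      Cond (Or (Eq \<langle>xT\<rangle> (Const 0)) (Eq \<langle>xT\<rangle> \<langle>xN\<rangle>)) (xCR\<lbrakk>\<langle>xJ\<rangle>\<rbrakk> ::= \<langle>xT\<rangle>) (xCR\<lbrakk>\<langle>xJ\<rangle>\<rbrakk> ::= \<langle>xT\<rangle> \<oplus> Const 2))"

definition arc_table :: prog where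
  "arc_table = For xJ xR arc_step"

text \<open>\<open>A\<close> is one plus the cost of \<open>J\<close> items. Once another item has
  been added, it belongs to \<open>J\<close> rim nodes together with the centre; these have load
  \<open>J + 1\<close>, hence the strict comparison with the capacity.\<close>

definition node_step :: prog where
  "node_step =
     (Cond (Leq \<langle>xJ\<rangle> (xNC\<lbrakk>\<langle>xI\<rangle>\<rbrakk>)) (xF\<lbrakk>xOF\<lbrakk>\<langle>xI\<rangle>\<rbrakk> \<oplus> \<langle>xJ\<rangle>\<rbrakk> ::= \<langle>xA\<rangle>) Nop ;;
      xA ::= \<langle>xA\<rangle> \<oplus> xNW\<lbrakk>\<langle>xI\<rangle>\<rbrakk> ;;
      Cond (Less \<langle>xJ\<rangle> (xNC\<lbrakk>\<langle>xI\<rangle>\<rbrakk>)) (xF\<lbrakk>xOF\<lbrakk>\<langle>xI\<rangle>\<rbrakk> \<oplus> (\<langle>xJ\<rangle> \<oplus> \<langle>xM\<rangle>)\<rbrakk> ::= \<langle>xA\<rangle>) Nop)"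

definition node_row :: prog where
  "node_row = xA ::= Const 1 ;; For xJ xNR node_step"

definition node_tables :: prog where
  "node_tables = For xI xNS node_row"

text \<open>Arc cuts of valid demands do not exceed \<open>Suc n\<close>, the last index filled
  here.\<close>

definition multiples :: prog where
  "multiples = xW\<lbrakk>Const 0\<rbrakk> ::= Const 0 ;; For xJ xNR (xW\<lbrakk>\<langle>xJ\<rangle> \<oplus> Const 1\<rbrakk> ::= xW\<lbrakk>\<langle>xJ\<rangle>\<rbrakk> \<oplus> xSW\<lbrakk>\<langle>xPJ\<rangle>\<rbrakk>)"

definition edge_step :: prog where
  "edge_step =
     (xG\<lbrakk>\<langle>xJ\<rangle>\<rbrakk> ::= Const 0 ;;
      Cond (And (Less (Const 0) (xF\<lbrakk>\<langle>xOV\<rangle> \<oplus> \<langle>xJ\<rangle>\<rbrakk>)) (Leq (xCR\<lbrakk>\<langle>xJ\<rangle>\<rbrakk>) (xSC\<lbrakk>\<langle>xPJ\<rangle>\<rbrakk>)))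
        (xG\<lbrakk>\<langle>xJ\<rangle>\<rbrakk> ::= xF\<lbrakk>\<langle>xOV\<rangle> \<oplus> \<langle>xJ\<rangle>\<rbrakk> \<oplus> xW\<lbrakk>xCR\<lbrakk>\<langle>xJ\<rangle>\<rbrakk>\<rbrakk>) Nop)"

text \<open>The loop over \<open>K\<close> always makes \<open>R\<close> passes, as its bound must
  be a scalar that is never written; the guard skips splits with \<open>K\<close> beyond
  \<open>J\<close>.\<close>

definition try_split :: prog where
  "try_split =
     Cond (And (Leq \<langle>xK\<rangle> \<langle>xJ\<rangle>) (And (Less (Const 0) (xF\<lbrakk>\<langle>xOP\<rangle> \<oplus> (\<langle>xJ\<rangle> \<ominus> \<langle>xK\<rangle>)\<rbrakk>)) (Less (Const 0) (xG\<lbrakk>\<langle>xK\<rangle>\<rbrakk>))))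
       (xA ::= xF\<lbrakk>\<langle>xOP\<rangle> \<oplus> (\<langle>xJ\<rangle> \<ominus> \<langle>xK\<rangle>)\<rbrakk> \<oplus> xG\<lbrakk>\<langle>xK\<rangle>\<rbrakk> \<ominus> Const 1 ;;
        Cond (Or (Eq (xH\<lbrakk>\<langle>xJ\<rangle>\<rbrakk>) (Const 0)) (Less \<langle>xA\<rangle> (xH\<lbrakk>\<langle>xJ\<rangle>\<rbrakk>)))
          (xH\<lbrakk>\<langle>xJ\<rangle>\<rbrakk> ::= \<langle>xA\<rangle> ;; xCH\<lbrakk>\<langle>xOI\<rangle> \<oplus> \<langle>xJ\<rangle>\<rbrakk> ::= \<langle>xK\<rangle>) Nop) Nop"

text \<open>Inside a row a demand is valid exactly if it is at most \<open>n\<close> or at least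
  \<open>2 * Suc n\<close>.\<close>

definition convolve_step :: prog where
  "convolve_step =
     (xH\<lbrakk>\<langle>xJ\<rangle>\<rbrakk> ::= Const 0 ;; Cond (Or (Less \<langle>xJ\<rangle> \<langle>xNR\<rangle>) (Leq \<langle>xM\<rangle> \<langle>xJ\<rangle>)) (For xK xR try_split) Nop)"

definition convolve :: prog where
  "convolve = For xJ xR convolve_step"

definition edge_row :: prog where
  "edge_row = For xJ xR edge_step"

text \<open>The convolution reads the old row of the parent at all demands up to the current one, so
  new entries are buffered in \<open>H\<close>.\<close>

definition copy_row :: prog where
  "copy_row = For xJ xR (xF\<lbrakk>\<langle>xOP\<rangle> \<oplus> \<langle>xJ\<rangle>\<rbrakk> ::= xH\<lbrakk>\<langle>xJ\<rangle>\<rbrakk>)"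

definition load_stage :: prog where
  "load_stage =
     xPJ ::= xPE\<lbrakk>\<langle>xI\<rangle>\<rbrakk> ;; xOV ::= xOF\<lbrakk>xOR\<lbrakk>\<langle>xI\<rangle>\<rbrakk>\<rbrakk> ;; xOP ::= xOF\<lbrakk>xPA\<lbrakk>\<langle>xI\<rangle>\<rbrakk>\<rbrakk> ;; xOI ::= xOF\<lbrakk>\<langle>xI\<rangle>\<rbrakk>"

definition merge_step :: prog where
  "merge_step = load_stage ;; multiples ;; edge_row ;; convolve ;; copy_row"

definition merge_all :: prog where
  "merge_all = For xI xNS1 merge_step"

definition fill_tables :: prog where
  "fill_tables = row_offsets ;; arc_table ;; node_tables ;; merge_all"

lemma writes_tables [simp]:
  "writes row_offsets = {xOF, xJ}" "writes arc_step = {xT, xCR}" "writes arc_table = {xJ, xT, xCR}"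
  "writes node_step = {xF, xA}" "writes node_row = {xJ, xF, xA}" "writes node_tables = {xI, xJ, xF, xA}"
  "writes multiples = {xJ, xW}" "writes edge_step = {xG}" "writes edge_row = {xJ, xG}"
  "writes try_split = {xA, xH, xCH}" "writes convolve_step = {xA, xH, xCH, xK}" "writes convolve = {xJ, xA, xH, xCH, xK}"
  "writes copy_row = {xJ, xF}" "writes load_stage = {xPJ, xOV, xOP, xOI}"
  "writes merge_step = {xPJ, xOV, xOP, xOI, xJ, xW, xG, xA, xH, xCH, xK, xF}"
  "writes merge_all = {xI, xPJ, xOV, xOP, xOI, xJ, xW, xG, xA, xH, xCH, xK, xF}"
  "writes fill_tables = {xOF, xT, xCR, xI, xPJ, xOV, xOP, xOI, xJ, xW, xG, xA, xH, xCH, xK, xF}"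
  by (auto simp: row_offsets_def arc_step_def arc_table_def node_step_def node_row_def node_tables_def multiples_def
      edge_step_def edge_row_def try_split_def convolve_step_def convolve_def copy_row_def load_stage_def
      merge_step_def merge_all_def fill_tables_def)

definition sized :: "nat \<Rightarrow> nat \<Rightarrow> memory \<Rightarrow> bool" where
  "sized n N s \<longleftrightarrow> s xNR 0 = Suc n \<and> s xR 0 = 3 * Suc n \<and> s xM 0 = 2 * Suc n \<and> s xN 0 = n \<and> s xNS 0 = N \<and> s xNS1 0 = N - 1"

lemma sized_cong: "sized n N s \<Longrightarrow> (\<And>x. x \<in> {xNR, xR, xM, xN, xNS, xNS1} \<Longrightarrow> t x = s x) \<Longrightarrow> sized n N t"
  by (simp add: sized_def)

lemma row_eq: "d < R \<Longrightarrow> d' < R \<Longrightarrow> u * R + d = u' * R + d' \<longleftrightarrow> u = u' \<and> d = d'" for d R :: nat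
  by (metis add.commute add_left_cancel div_mult_self3 div_less gr_implies_not0 add_cancel_right_right mult.commute)

lemma run_row_offsets: "j \<le> s xNS 0 \<Longrightarrow> run row_offsets s xOF j = j * s xR 0"
proof -
  let ?s = "upd xOF 0 0 s"
  have "\<forall>j\<le>?s xNS 0. run row_offsets s xOF j = j * s xR 0"
    unfolding row_offsets_def run.simps(2,3) aval.simps
  proof (rule run_For_inv[where P = "\<lambda>k t. \<forall>j\<le>k. t xOF j = j * s xR 0"], goal_cases)
    case (3 k t)
    have "t xR = ?s xR" by (rule 3(4)) simp
    then show ?case using 3(2,3) by (auto simp: le_Suc_eq)
  qed simp_all
  then show "j \<le> s xNS 0 \<Longrightarrow> run row_offsets s xOF j = j * s xR 0" by simp
qed

lemma run_arc_table:
  assumes "sized n N s" "d < 3 * Suc n"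
  shows "run arc_table s xCR d = arc_cut n (far n d)"
proof -
  have "\<forall>d<s xR 0. run arc_table s xCR d = arc_cut n (far n d)"
    unfolding arc_table_def
  proof (rule run_For_inv[where P = "\<lambda>k t. \<forall>d<k. t xCR d = arc_cut n (far n d)"], goal_cases)
    case (3 k t)
    have fr: "t xM = s xM" "t xN = s xN" by (rule 3(4), simp)+
    have far: "far n k = (if 2 * Suc n \<le> k then n + 2 * Suc n - k else k)"
      by (auto simp: far_def centred_def count_def)
    have "run arc_step t xCR d = (if d = k then arc_cut n (far n k) else t xCR d)" for d
      using assms(1) fr 3(3) unfolding far by (simp add: arc_step_def sized_def arc_cut_def)
    then show ?case using 3(2) by (auto simp: less_Suc_eq)
  qed simp_all
  then show ?thesis using assms by (simp add: sized_def)
qed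

text \<open>\<open>node_value\<close> and \<open>edge_value\<close> restate the entries of
  \<open>wheel_on_tree\<close> with capacity and cost as parameters, so that the table program can
  be verified before any instance is at hand.\<close>

definition node_value :: "nat \<Rightarrow> nat \<Rightarrow> nat \<Rightarrow> nat \<Rightarrow> nat" where
  "node_value n cap w d = (if valid n d \<and> load n d \<le> cap then load n d * w + 1 else 0)"

definition edge_value :: "nat \<Rightarrow> nat \<Rightarrow> nat \<Rightarrow> nat \<Rightarrow> nat" where
  "edge_value n cap w d = (if arc_cut n (far n d) \<le> cap then arc_cut n (far n d) * w + 1 else 0)"

lemma run_node_row:
  assumes "sized n N s" "s xI 0 = u" "u < N" "\<And>j. j \<le> N \<Longrightarrow> s xOF j = j * (3 * Suc n)"
    and zero: "\<And>d. d < 3 * Suc n \<Longrightarrow> s xF (u * (3 * Suc n) + d) = 0"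
    and "u' < N" "d < 3 * Suc n"
  shows "run node_row s xF (u' * (3 * Suc n) + d) =
    (if u' = u then node_value n (s xNC u) (s xNW u) d else s xF (u' * (3 * Suc n) + d))"
proof -
  let ?R = "3 * Suc n"
  let ?s = "upd xA 0 1 s"
  let ?e = "node_value n (s xNC u) (s xNW u)"
  \<comment> \<open>Each pass settles the two demands with count \<open>k\<close>, without and with
    the centre. Infeasible ones are not written and keep the initial 0.\<close>
  let ?P = "\<lambda>k t. t xA 0 = 1 + k * s xNW u \<and>
    (\<forall>u'<N. \<forall>d<?R. t xF (u' * ?R + d) = (if u' = u \<and> count n d < k then ?e d else s xF (u' * ?R + d)))"
  have "?P (?s xNR 0) (run node_row s)"
    unfolding node_row_def run.simps(2,3) aval.simps
  proof (rule run_For_inv[where P = ?P], goal_cases)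
    case (3 k t)
    have fr: "t xNC = s xNC" "t xNW = s xNW" "t xOF = s xOF" "t xI = s xI" "t xM = s xM" using 3(4) by simp_all
    have k: "k \<le> n" using 3(1) assms(1) by (simp add: sized_def)
    have oF: "s xOF u = u * ?R" using assms(3,4) by simp
    let ?t = "run node_step t"
    have A: "?t xA 0 = 1 + Suc k * s xNW u" using 3(2,3) fr assms(2) by (simp add: node_step_def)
    have F: "?t xF x = (if x = u * ?R + k \<and> k \<le> s xNC u then 1 + k * s xNW u else
      if x = u * ?R + (k + 2 * Suc n) \<and> k < s xNC u then 1 + Suc k * s xNW u else t xF x)" for x
      using 3(2,3) fr assms(1,2) oF by (simp add: node_step_def sized_def)
    have "?t xF (u' * ?R + d) = (if u' = u \<and> count n d < Suc k then ?e d else s xF (u' * ?R + d))"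
      if "u' < N" "d < ?R" for u' d
    proof -
      have x: "u' * ?R + d = u * ?R + k \<longleftrightarrow> u' = u \<and> d = k" "u' * ?R + d = u * ?R + (k + 2 * Suc n) \<longleftrightarrow> u' = u \<and> d = k + 2 * Suc n"
        using k that by (intro row_eq; simp)+
      have old: "t xF (u' * ?R + d) = (if u' = u \<and> count n d < k then ?e d else s xF (u' * ?R + d))" using 3(2) that by blast
      have "count n d = k \<longleftrightarrow> d = k \<or> d = k + 2 * Suc n" using k by (auto simp: count_def centred_def)
      moreover have "?e k = (if k \<le> s xNC u then 1 + k * s xNW u else 0)"
        "?e (k + 2 * Suc n) = (if k < s xNC u then 1 + Suc k * s xNW u else 0)"
        using valid_demand[OF k] by (auto simp: node_value_def load_def)
      moreover have "d = k \<Longrightarrow> s xF (u * ?R + k) = 0" "d = k + 2 * Suc n \<Longrightarrow> s xF (u * ?R + (k + 2 * Suc n)) = 0"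
        using zero that by blast+
      moreover have "count n k = k" "count n (k + 2 * Suc n) = k" using valid_demand[OF k] by auto
      ultimately show ?thesis unfolding F x old less_Suc_eq by (auto simp del: mult_Suc mult_Suc_right)
    qed
    then show ?case using A by blast
  qed simp_all
  moreover have "?e d = 0" if "\<not> count n d < Suc n" using that by (auto simp: node_value_def valid_def)
  ultimately show ?thesis using assms(1,6,7) zero[OF assms(7)] by (auto simp: sized_def simp del: mult_Suc mult_Suc_right)
qed

lemma run_node_tables:
  assumes "sized n N s" "\<And>j. j \<le> N \<Longrightarrow> s xOF j = j * (3 * Suc n)" "s xF = (\<lambda>_. 0)" "u < N" "d < 3 * Suc n"
  shows "run node_tables s xF (u * (3 * Suc n) + d) = node_value n (s xNC u) (s xNW u) d"
proof -
  let ?R = "3 * Suc n"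
  have "\<forall>u<N. \<forall>d<?R. run node_tables s xF (u * ?R + d) = (if u < s xNS 0 then node_value n (s xNC u) (s xNW u) d else 0)"
    unfolding node_tables_def
  proof (rule run_For_inv[where P = "\<lambda>k t. \<forall>u<N. \<forall>d<?R. t xF (u * ?R + d) = (if u < k then node_value n (s xNC u) (s xNW u) d else 0)"], goal_cases)
    case (3 k t)
    have fr: "t xNC = s xNC" "t xNW = s xNW" "t xOF = s xOF" by (rule 3(4), simp)+
    have sz: "sized n N t" by (rule sized_cong[OF assms(1)], rule 3(4)) auto
    have k: "k < N" using 3(1) assms(1) by (simp add: sized_def)
    show ?case
    proof (intro allI impI)
      fix u d assume "u < N" "d < ?R"
      then have "run node_row t xF (u * ?R + d) = (if u = k then node_value n (t xNC k) (t xNW k) d else t xF (u * ?R + d))"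
        using 3(2) k assms(2) fr by (intro run_node_row[OF sz 3(3)]) auto
      then show "run node_row t xF (u * ?R + d) = (if u < Suc k then node_value n (s xNC u) (s xNW u) d else 0)"
        using 3(2) \<open>u < N\<close> \<open>d < ?R\<close> fr by (simp add: less_Suc_eq)
    qed
  qed (simp_all add: assms(3))
  then show ?thesis using assms(1,4,5) by (simp add: sized_def)
qed

lemma run_multiples: "j \<le> s xNR 0 \<Longrightarrow> run multiples s xW j = j * s xSW (s xPJ 0)"
proof -
  let ?s = "upd xW 0 0 s"
  have "\<forall>j\<le>?s xNR 0. run multiples s xW j = j * s xSW (s xPJ 0)"
    unfolding multiples_def run.simps(2,3) aval.simps
  proof (rule run_For_inv[where P = "\<lambda>k t. \<forall>j\<le>k. t xW j = j * s xSW (s xPJ 0)"], goal_cases)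
    case (3 k t)
    have "t xSW = ?s xSW" "t xPJ = ?s xPJ" by (rule 3(4), simp)+
    then show ?case using 3(2,3) by (auto simp: le_Suc_eq)
  qed simp_all
  then show "j \<le> s xNR 0 \<Longrightarrow> run multiples s xW j = j * s xSW (s xPJ 0)" by simp
qed

text \<open>The two additional rim edges occur only with fewer than \<open>n\<close> far
  nodes.\<close>

lemma arc_cut_far_le: "valid n d \<Longrightarrow> 1 \<le> n \<Longrightarrow> arc_cut n (far n d) \<le> Suc n"
  by (auto simp: arc_cut_def far_def valid_def)

lemma run_edge_row:
  assumes "sized n N s" "1 \<le> n" "\<And>d. d < 3 * Suc n \<Longrightarrow> s xCR d = arc_cut n (far n d)"
    and W: "\<And>j. j \<le> Suc n \<Longrightarrow> s xW j = j * s xSW (s xPJ 0)"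
    and val: "\<And>d. d < 3 * Suc n \<Longrightarrow> 0 < s xF (s xOV 0 + d) \<Longrightarrow> valid n d" and "d < 3 * Suc n"
  shows "run edge_row s xG d = join (s xF (s xOV 0 + d)) (edge_value n (s xSC (s xPJ 0)) (s xSW (s xPJ 0)) d)"
proof -
  let ?g = "\<lambda>d. join (s xF (s xOV 0 + d)) (edge_value n (s xSC (s xPJ 0)) (s xSW (s xPJ 0)) d)"
  have "\<forall>d<s xR 0. run edge_row s xG d = ?g d"
    unfolding edge_row_def
  proof (rule run_For_inv[where P = "\<lambda>k t. \<forall>d<k. t xG d = ?g d"], goal_cases)
    case (3 k t)
    have fr: "t xF = s xF" "t xCR = s xCR" "t xSC = s xSC" "t xPJ = s xPJ" "t xW = s xW" "t xOV = s xOV" by (rule 3(4), simp)+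
    have k: "k < 3 * Suc n" using 3(1) assms(1) by (simp add: sized_def)
    have "run edge_step t xG d = (if d = k then ?g k else t xG d)" for d
    proof (cases "0 < s xF (s xOV 0 + k)")
      case True
      then have "arc_cut n (far n k) \<le> Suc n" using val k assms(2) arc_cut_far_le by blast
      then have w: "s xW (s xCR k) = arc_cut n (far n k) * s xSW (s xPJ 0)" using W assms(3) k by simp
      then show ?thesis using True 3(3) fr assms(3)[OF k] by (simp add: edge_step_def edge_value_def join_def)
    next
      case False
      then show ?thesis using 3(3) fr by (simp add: edge_step_def join_def)
    qed
    then show ?case using 3(2) by (auto simp: less_Suc_eq)
  qed simp_all
  then show ?thesis using assms(1,6) by (simp add: sized_def)
qed

lemma run_convolve_step:
  assumes "sized n N s" "s xJ 0 = d" "d < 3 * Suc n"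
  defines "f \<equiv> \<lambda>d. s xF (s xOP 0 + d)" and "t \<equiv> run convolve_step s"
  shows "merged (valid n) f (s xG) (t xH) (\<lambda>d. t xCH (s xOI 0 + d)) d" "\<And>x. x \<noteq> d \<Longrightarrow> t xH x = s xH x"
    "\<And>x. x \<noteq> s xOI 0 + d \<Longrightarrow> t xCH x = s xCH x"
proof -
  let ?s = "upd xH d 0 s"
  let ?g = "s xG"
  \<comment> \<open>After \<open>k\<close> passes the entry is the minimum over the splits with
    \<open>q < k\<close>, and 0 if none of them is feasible. Other cells of both arrays keep their
    values.\<close>
  let ?P = "\<lambda>k t. (0 < t xH d \<longrightarrow> t xCH (s xOI 0 + d) \<le> d \<and> t xH d = join (f (d - t xCH (s xOI 0 + d))) (?g (t xCH (s xOI 0 + d)))) \<and>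
    (\<forall>q<k. q \<le> d \<longrightarrow> 0 < join (f (d - q)) (?g q) \<longrightarrow> 0 < t xH d \<and> t xH d \<le> join (f (d - q)) (?g q)) \<and>
    (\<forall>x. x \<noteq> d \<longrightarrow> t xH x = s xH x) \<and> (\<forall>x. x \<noteq> s xOI 0 + d \<longrightarrow> t xCH x = s xCH x)"
  have valid: "valid n d \<longleftrightarrow> d < Suc n \<or> 2 * Suc n \<le> d"
    using assms(3) by (auto simp: valid_def count_def centred_def)
  have guard: "t = (if valid n d then run (For xK xR try_split) ?s else ?s)"
    using assms(1,2) unfolding t_def valid by (simp add: convolve_step_def sized_def)
  have loop: "?P (?s xR 0) (run (For xK xR try_split) ?s)"
  proof (rule run_For_inv[where P = ?P], goal_cases)
    case (3 k t)
    have fr: "t xF = s xF" "t xG = s xG" "t xOP = s xOP" "t xOI = s xOI" "t xJ = s xJ" using 3(4) by simp_all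
    define j where "j = join (f (d - k)) (?g k)"
    let ?t = "run try_split t"
    define better where "better \<longleftrightarrow> k \<le> d \<and> 0 < j \<and> (t xH d = 0 \<or> j < t xH d)"
    have j: "0 < j \<longleftrightarrow> 0 < f (d - k) \<and> 0 < ?g k" "0 < f (d - k) \<Longrightarrow> 0 < ?g k \<Longrightarrow> j = f (d - k) + ?g k - 1"
      unfolding j_def by (auto simp: join_def)
    have H: "?t xH x = (if better \<and> x = d then j else t xH x)" for x
      using fr 3(3) assms(2) j by (auto simp: try_split_def better_def f_def)
    have C: "?t xCH x = (if better \<and> x = s xOI 0 + d then k else t xCH x)" for x
      using fr 3(3) assms(2) j by (auto simp: try_split_def better_def f_def)
    show ?case
    proof (cases better)
      case True
      then have b: "k \<le> d" "0 < j" "t xH d = 0 \<or> j < t xH d" by (auto simp: better_def)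
      have "j \<le> join (f (d - q)) (?g q)" if "q < Suc k" "q \<le> d" "0 < join (f (d - q)) (?g q)" for q
      proof (cases "q = k")
        case False
        then have "q < k" using that by simp
        then have "0 < t xH d" "t xH d \<le> join (f (d - q)) (?g q)" using 3(2) that(2,3) by blast+
        then show ?thesis using b(3) by linarith
      qed (simp add: j_def)
      then show ?thesis using 3(2) True b unfolding H C by (simp add: j_def)
    next
      case False
      have "0 < t xH d \<and> t xH d \<le> join (f (d - q)) (?g q)" if "q < Suc k" "q \<le> d" "0 < join (f (d - q)) (?g q)" for q
      proof (cases "q = k")
        case True
        then show ?thesis using False that by (auto simp: better_def j_def)
      next
        case False
        then have "q < k" using that by simp
        then show ?thesis using 3(2) that(2,3) by blast
      qed
      then show ?thesis using 3(2) False unfolding H C by simp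
    qed
  qed simp_all
  have R: "?s xR 0 = 3 * Suc n" using assms(1) by (simp add: sized_def)
  show "merged (valid n) f (s xG) (t xH) (\<lambda>d. t xCH (s xOI 0 + d)) d"
  proof (cases "valid n d")
    case True
    then have P: "?P (3 * Suc n) t" using loop guard R by simp
    have "0 < t xH d \<and> t xH d \<le> join (f (d - q)) (?g q)" if "q \<le> d" "0 < join (f (d - q)) (?g q)" for q
    proof -
      have "q < 3 * Suc n" using that(1) assms(3) by linarith
      then show ?thesis using P that by blast
    qed
    then show ?thesis unfolding merged_def using P True by blast
  next
    case False
    then show ?thesis using guard by (simp add: merged_def)
  qed
  show "\<And>x. x \<noteq> d \<Longrightarrow> t xH x = s xH x" "\<And>x. x \<noteq> s xOI 0 + d \<Longrightarrow> t xCH x = s xCH x"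
    using loop unfolding guard by (auto split: if_splits)
qed

lemma run_convolve:
  assumes "sized n N s"
  defines "f \<equiv> \<lambda>d. s xF (s xOP 0 + d)" and "t \<equiv> run convolve s"
  shows "\<And>d. d < 3 * Suc n \<Longrightarrow> merged (valid n) f (s xG) (t xH) (\<lambda>d. t xCH (s xOI 0 + d)) d"
    "\<And>x. (\<And>d. d < 3 * Suc n \<Longrightarrow> x \<noteq> s xOI 0 + d) \<Longrightarrow> t xCH x = s xCH x"
proof -
  let ?P = "\<lambda>k t. (\<forall>d<k. merged (valid n) f (s xG) (t xH) (\<lambda>d. t xCH (s xOI 0 + d)) d) \<and>
    (\<forall>x. (\<forall>d<k. x \<noteq> s xOI 0 + d) \<longrightarrow> t xCH x = s xCH x)"
  have "?P (s xR 0) t"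
    unfolding t_def convolve_def
  proof (rule run_For_inv[where P = ?P], goal_cases)
    case (3 k t)
    have fr: "t xF = s xF" "t xG = s xG" "t xOP = s xOP" "t xOI = s xOI" by (rule 3(4), simp)+
    have sz: "sized n N t" by (rule sized_cong[OF assms(1)], rule 3(4)) auto
    have k: "k < 3 * Suc n" using 3(1) assms(1) by (simp add: sized_def)
    note st = run_convolve_step[OF sz 3(3) k, unfolded fr, folded f_def]
    let ?t = "run convolve_step t"
    have "merged (valid n) f (s xG) (?t xH) (\<lambda>d. ?t xCH (s xOI 0 + d)) d" if "d < Suc k" for d
    proof (cases "d = k")
      case False
      then have "merged (valid n) f (s xG) (t xH) (\<lambda>d. t xCH (s xOI 0 + d)) d" using 3(2) that by simp
      moreover have "?t xH d = t xH d" "?t xCH (s xOI 0 + d) = t xCH (s xOI 0 + d)" using st(2,3) False by auto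
      ultimately show ?thesis by (simp add: merged_def)
    qed (use st(1) in simp)
    moreover have "?t xCH x = s xCH x" if "\<forall>d<Suc k. x \<noteq> s xOI 0 + d" for x
      using that 3(2) st(3)[of x] by simp
    ultimately show ?case by blast
  qed simp_all
  then show "\<And>d. d < 3 * Suc n \<Longrightarrow> merged (valid n) f (s xG) (t xH) (\<lambda>d. t xCH (s xOI 0 + d)) d"
    "\<And>x. (\<And>d. d < 3 * Suc n \<Longrightarrow> x \<noteq> s xOI 0 + d) \<Longrightarrow> t xCH x = s xCH x"
    using assms(1) by (auto simp: sized_def)
qed

lemma run_copy_row:
  "run copy_row s xF x = (if s xOP 0 \<le> x \<and> x < s xOP 0 + s xR 0 then s xH (x - s xOP 0) else s xF x)"
proof -
  have "\<forall>x. run copy_row s xF x = (if s xOP 0 \<le> x \<and> x < s xOP 0 + s xR 0 then s xH (x - s xOP 0) else s xF x)"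
    unfolding copy_row_def
  proof (rule run_For_inv[where P = "\<lambda>k t. \<forall>x. t xF x = (if s xOP 0 \<le> x \<and> x < s xOP 0 + k then s xH (x - s xOP 0) else s xF x)"], goal_cases)
    case (3 k t)
    have "t xH = s xH" "t xOP = s xOP" by (rule 3(4), simp)+
    then show ?case using 3(2,3) by auto
  qed simp_all
  then show ?thesis by blast
qed

lemma run_merge_step:
  assumes sz: "sized n N s" and n: "1 \<le> n" and CR': "\<forall>d<3 * Suc n. s xCR d = arc_cut n (far n d)"
    and OF': "\<forall>j\<le>N. s xOF j = j * (3 * Suc n)"
    and i: "s xI 0 = i" "i < N" and v: "s xOR i < N" and p: "s xPA i < N"
    and val': "\<forall>d<3 * Suc n. 0 < s xF (s xOR i * (3 * Suc n) + d) \<longrightarrow> valid n d"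
  defines "t \<equiv> run merge_step s" and "R \<equiv> 3 * Suc n"
  shows "\<And>d. d < R \<Longrightarrow> merged (valid n) (\<lambda>d. s xF (s xPA i * R + d))
      (\<lambda>q. join (s xF (s xOR i * R + q)) (edge_value n (s xSC (s xPE i)) (s xSW (s xPE i)) q))
      (\<lambda>d. t xF (s xPA i * R + d)) (\<lambda>d. t xCH (i * R + d)) d"
    and "\<And>u d. u < N \<Longrightarrow> d < R \<Longrightarrow> u \<noteq> s xPA i \<Longrightarrow> t xF (u * R + d) = s xF (u * R + d)"
    and "\<And>j d. j < N \<Longrightarrow> d < R \<Longrightarrow> j \<noteq> i \<Longrightarrow> t xCH (j * R + d) = s xCH (j * R + d)"
proof -
  note CR = CR'[rule_format] and OF = OF'[rule_format] and val = val'[rule_format]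
  define a where "a = run load_stage s"
  define b where "b = run multiples a"
  define c where "c = run edge_row b"
  define e where "e = run convolve c"
  have t: "t = run copy_row e" by (simp add: t_def merge_step_def a_def b_def c_def e_def)
  have fa: "a x = s x" if "x \<notin> {xPJ, xOV, xOP, xOI}" for x using that by (simp add: a_def run_frame)
  have fb: "b x = a x" if "x \<notin> {xJ, xW}" for x using that by (simp add: b_def run_frame)
  have fc: "c x = b x" if "x \<notin> {xJ, xG}" for x using that by (simp add: c_def run_frame)
  have fe: "e x = c x" if "x \<notin> {xJ, xA, xH, xCH, xK}" for x using that by (simp add: e_def run_frame)
  have ft: "t x = e x" if "x \<notin> {xJ, xF}" for x using that by (simp add: t run_frame)
  have ld: "a xPJ 0 = s xPE i" "a xOV 0 = s xOR i * R" "a xOP 0 = s xPA i * R" "a xOI 0 = i * R"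
    using i OF[of "s xOR i"] OF[of "s xPA i"] OF[of i] v p unfolding R_def[symmetric]
    by (simp_all add: a_def load_stage_def)
  have szb: "sized n N b" by (rule sized_cong[OF sz]) (auto simp: fb fa)
  have szc: "sized n N c" by (rule sized_cong[OF sz]) (auto simp: fc fb fa)
  have W: "b xW j = j * s xSW (s xPE i)" if "j \<le> Suc n" for j
    using run_multiples[of j a] that sz ld by (simp add: b_def[symmetric] fa sized_def)
  have G: "c xG d = join (s xF (s xOR i * R + d)) (edge_value n (s xSC (s xPE i)) (s xSW (s xPE i)) d)" if "d < R" for d
  proof -
    have "c xG d = join (b xF (b xOV 0 + d)) (edge_value n (b xSC (b xPJ 0)) (b xSW (b xPJ 0)) d)"
      unfolding c_def
    proof (rule run_edge_row[OF szb n])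
      show "b xCR d = arc_cut n (far n d)" if "d < 3 * Suc n" for d using CR[OF that] by (simp add: fb fa)
      show "b xW j = j * b xSW (b xPJ 0)" if "j \<le> Suc n" for j using W[OF that] ld by (simp add: fb fa)
      show "valid n d" if "d < 3 * Suc n" "0 < b xF (b xOV 0 + d)" for d
        using val[OF that(1)] that(2) ld by (simp add: fb fa R_def)
      show "d < 3 * Suc n" using that by (simp add: R_def)
    qed
    then show ?thesis using ld by (simp add: fb fa)
  qed
  have M: "merged (valid n) (\<lambda>d. s xF (s xPA i * R + d)) (c xG) (e xH) (\<lambda>d. e xCH (i * R + d)) d" if "d < R" for d
    using run_convolve(1)[OF szc, of d, folded e_def R_def] that ld by (simp add: fc fb fa)
  have R0: "e xR 0 = R" using sz by (simp add: fe fc fb fa sized_def R_def)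
  have F: "t xF x = (if s xPA i * R \<le> x \<and> x < s xPA i * R + R then e xH (x - s xPA i * R) else s xF x)" for x
    using run_copy_row[of e x, folded t] ld R0 by (simp add: fe fc fb fa)
  show "merged (valid n) (\<lambda>d. s xF (s xPA i * R + d))
      (\<lambda>q. join (s xF (s xOR i * R + q)) (edge_value n (s xSC (s xPE i)) (s xSW (s xPE i)) q))
      (\<lambda>d. t xF (s xPA i * R + d)) (\<lambda>d. t xCH (i * R + d)) d" if "d < R" for d
  proof -
    have "t xF (s xPA i * R + d) = e xH d" using that by (simp add: F)
    moreover have "t xCH = e xCH" by (simp add: ft)
    ultimately show ?thesis using M[OF that] that unfolding merged_def
      by (auto simp: G)
  qed
  show "t xF (u * R + d) = s xF (u * R + d)" if "u < N" "d < R" "u \<noteq> s xPA i" for u d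
  proof -
    have "\<not> (s xPA i * R \<le> u * R + d \<and> u * R + d < s xPA i * R + R)"
    proof
      assume "s xPA i * R \<le> u * R + d \<and> u * R + d < s xPA i * R + R"
      then have "u * R + d = s xPA i * R + (u * R + d - s xPA i * R)" "u * R + d - s xPA i * R < R" by auto
      then show False using row_eq[OF that(2), of "u * R + d - s xPA i * R" u "s xPA i"] that(3) by simp
    qed
    then show ?thesis by (simp only: F if_False)
  qed
  show "t xCH (j * R + d) = s xCH (j * R + d)" if "j < N" "d < R" "j \<noteq> i" for j d
  proof -
    have "e xCH (j * R + d) = c xCH (j * R + d)"
      using row_eq[OF that(2), of _ j i] that(3) ld
      by (intro run_convolve(2)[OF szc, folded e_def R_def]) (simp add: fc fb)
    then show ?thesis by (simp add: ft fc fb fa)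
  qed
qed

abbreviation (input) xX :: nat where "xX \<equiv> 50"
abbreviation (input) xY :: nat where "xY \<equiv> 51"
abbreviation (input) xNA :: nat where "xNA \<equiv> 52"
abbreviation (input) xNB :: nat where "xNB \<equiv> 53"
abbreviation (input) xPX :: nat where "xPX \<equiv> 54"
abbreviation (input) xPB :: nat where "xPB \<equiv> 55"
abbreviation (input) xVAL :: nat where "xVAL \<equiv> 56"

context elimination
begin

lemma run_merge_all:
  fixes s :: memory and n :: nat
  defines "R \<equiv> 3 * Suc n"
  assumes sz: "sized n N s" and n: "1 \<le> n" and CR: "\<And>d. d < R \<Longrightarrow> s xCR d = arc_cut n (far n d)"
    and OF: "\<And>j. j \<le> N \<Longrightarrow> s xOF j = j * R" and v: "s xOR = v" and p: "s xPA = p"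
    and F: "\<And>u d. u < N \<Longrightarrow> d < R \<Longrightarrow> s xF (u * R + d) = nc u d" and nc: "\<And>u d. 0 < nc u d \<Longrightarrow> valid n d"
  defines "ec i \<equiv> edge_value n (s xSC (s xPE i)) (s xSW (s xPE i))" and "t \<equiv> run merge_all s"
  shows "\<exists>F. tables R (valid n) nc ec F (\<lambda>i d. t xCH (i * R + d)) (N - 1) \<and>
    (\<forall>u<N. \<forall>d<R. t xF (u * R + d) = F (N - 1) u d)"
proof -
  let ?P = "\<lambda>k t. \<exists>F. tables R (valid n) nc ec F (\<lambda>i d. t xCH (i * R + d)) k \<and> (\<forall>u<N. \<forall>d<R. t xF (u * R + d) = F k u d)"
  have "?P (s xNS1 0) t"
    unfolding t_def merge_all_def
  proof (rule run_For_inv[where P = ?P], goal_cases)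
    case 1
    show ?case using F by (intro exI[of _ "\<lambda>_. nc"]) (simp add: tables_def)
  next
    case (2 k t a)
    then show ?case by simp
  next
    case (3 k t)
    have k: "Suc k < N" using 3(1) sz by (simp add: sized_def)
    have fr: "t x = s x" if "x \<in> {xCR, xOF, xOR, xPA, xSC, xSW, xPE, xNR, xR, xM, xN, xNS, xNS1}" for x
      using that by (intro 3(4)) auto
    have szt: "sized n N t" by (rule sized_cong[OF sz]) (auto intro: fr)
    obtain F where F: "tables R (valid n) nc ec F (\<lambda>i d. t xCH (i * R + d)) k" and tF: "\<And>u d. u < N \<Longrightarrow> d < R \<Longrightarrow> t xF (u * R + d) = F k u d"
      using 3(2) by blast
    have vk: "t xOR k < N" "t xPA k < N" using k v p v_less[of k] p_less[of k] fr by auto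
    have kN: "k < N" using k by simp
    have CRt: "\<forall>d<3 * Suc n. t xCR d = arc_cut n (far n d)" using CR fr by (simp add: R_def)
    have OFt: "\<forall>j\<le>N. t xOF j = j * (3 * Suc n)" using OF fr by (simp add: R_def)
    have val: "\<forall>d<3 * Suc n. 0 < t xF (t xOR k * (3 * Suc n) + d) \<longrightarrow> valid n d"
    proof (intro allI impI)
      fix d assume d: "d < 3 * Suc n" "0 < t xF (t xOR k * (3 * Suc n) + d)"
      note d = d[folded R_def]
      then have "0 < F k (t xOR k) d" using tF[OF vk(1) d(1)] by simp
      then show "valid n d" using tables_valid[OF F _ order_refl vk(1) d(1)] nc by blast
    qed
    note st = run_merge_step[OF szt n CRt OFt 3(3) kN vk val, folded R_def]
    let ?t = "run merge_step t"
    \<comment> \<open>Memory holds only the latest rows, so the history is prolonged at each stage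
      by what the memory contains after the merge.\<close>
    define F' where "F' i = (if i \<le> k then F i else (\<lambda>u d. ?t xF (u * R + d)))" for i
    have "tables R (valid n) nc ec F' (\<lambda>i d. ?t xCH (i * R + d)) (Suc k)"
      unfolding tables_def
    proof (intro conjI allI impI)
      show "F' 0 u d = nc u d" if "u < N" "d < R" for u d using F that by (simp add: tables_def F'_def)
    next
      fix i u d assume i: "i < Suc k" and u: "u < N" "d < R" "u \<noteq> p i"
      show "F' (Suc i) u d = F' i u d"
      proof (cases "i = k")
        case True
        then show ?thesis using st(2)[of u d] u tF fr p by (simp add: F'_def)
      next
        case False
        then show ?thesis using F i u by (simp add: tables_def F'_def)
      qed
    next
      fix i d assume i: "i < Suc k" and d: "d < R"
      show "merged (valid n) (F' i (p i)) (\<lambda>q. join (F' i (v i) q) (ec i q)) (F' (Suc i) (p i)) (\<lambda>d. ?t xCH (i * R + d)) d"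
      proof (cases "i = k")
        case True
        have "merged (valid n) (\<lambda>d. t xF (t xPA k * R + d)) (\<lambda>q. join (t xF (t xOR k * R + q)) (edge_value n (t xSC (t xPE k)) (t xSW (t xPE k)) q))
          (\<lambda>d. ?t xF (t xPA k * R + d)) (\<lambda>d. ?t xCH (k * R + d)) d" by (rule st(1)[OF d])
        then show ?thesis
          by (rule merged_cong) (use True d tF vk fr v p in \<open>auto simp: F'_def ec_def\<close>)
      next
        case False
        then have "merged (valid n) (F i (p i)) (\<lambda>q. join (F i (v i) q) (ec i q)) (F (Suc i) (p i)) (\<lambda>d. t xCH (i * R + d)) d"
          using F i d by (simp add: tables_def)
        then show ?thesis
          by (rule merged_cong) (use False i d k st(3)[of i d] in \<open>auto simp: F'_def\<close>)
      qed
    qed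
    then show ?case by (intro exI[of _ F']) (simp add: F'_def)
  qed
  then show ?thesis using sz by (simp add: sized_def)
qed

lemma run_fill_tables:
  fixes s :: memory and n :: nat
  defines "R \<equiv> 3 * Suc n"
  assumes sz: "sized n N s" and n: "1 \<le> n" and v: "s xOR = v" and p: "s xPA = p" and zero: "s xF = (\<lambda>_. 0)"
  defines "nc u \<equiv> node_value n (s xNC u) (s xNW u)"
    and "ec i \<equiv> edge_value n (s xSC (s xPE i)) (s xSW (s xPE i))" and "t \<equiv> run fill_tables s"
  shows "\<exists>F. tables R (valid n) nc ec F (\<lambda>i d. t xCH (i * R + d)) (N - 1) \<and>
    (\<forall>u<N. \<forall>d<R. t xF (u * R + d) = F (N - 1) u d)" "\<And>j. j \<le> N \<Longrightarrow> t xOF j = j * R"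
proof -
  define a where "a = run row_offsets s"
  define b where "b = run arc_table a"
  define c where "c = run node_tables b"
  have t: "t = run merge_all c" by (simp add: t_def fill_tables_def a_def b_def c_def)
  have fa: "a x = s x" if "x \<notin> {xOF, xJ}" for x using that by (simp add: a_def run_frame)
  have fb: "b x = a x" if "x \<notin> {xJ, xT, xCR}" for x using that by (simp add: b_def run_frame)
  have fc: "c x = b x" if "x \<notin> {xI, xJ, xF, xA}" for x using that by (simp add: c_def run_frame)
  have sza: "sized n N a" by (rule sized_cong[OF sz]) (auto simp: fa)
  have szb: "sized n N b" by (rule sized_cong[OF sz]) (auto simp: fa fb)
  have szc: "sized n N c" by (rule sized_cong[OF sz]) (auto simp: fa fb fc)
  have OF: "a xOF j = j * R" if "j \<le> N" for j
    using run_row_offsets[of j s] that sz by (simp add: a_def sized_def R_def)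
  have CR: "b xCR d = arc_cut n (far n d)" if "d < R" for d
    using run_arc_table[OF sza, of d] that by (simp add: b_def R_def)
  have F: "c xF (u * R + d) = nc u d" if "u < N" "d < R" for u d
    using run_node_tables[OF szb _ _ that(1), of d] that(2) OF zero unfolding R_def c_def nc_def by (simp add: fb fa)
  have ec: "ec i = edge_value n (c xSC (c xPE i)) (c xSW (c xPE i))" for i by (simp add: ec_def fc fb fa)
  show "\<exists>F. tables R (valid n) nc ec F (\<lambda>i d. t xCH (i * R + d)) (N - 1) \<and>
    (\<forall>u<N. \<forall>d<R. t xF (u * R + d) = F (N - 1) u d)"
    unfolding t R_def ec[abs_def]
  proof (rule run_merge_all[OF szc n])
    show "c xCR d = arc_cut n (far n d)" if "d < 3 * Suc n" for d using CR that by (simp add: fc R_def)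
    show "c xOF j = j * (3 * Suc n)" if "j \<le> N" for j using OF[OF that] by (simp add: fc fb R_def)
    show "c xOR = v" "c xPA = p" using v p by (simp_all add: fc fb fa)
    show "c xF (u * (3 * Suc n) + d) = nc u d" if "u < N" "d < 3 * Suc n" for u d using F that unfolding R_def by blast
    show "valid n d" if "0 < nc u d" for u d using that by (simp add: nc_def node_value_def split: if_splits)
  qed
  show "t xOF j = j * R" if "j \<le> N" for j using OF[OF that] unfolding t by (simp add: run_frame fc fb)
qed

end


section \<open>Reading off an optimal placement\<close>

text \<open>Loops count upwards while the merges are undone downwards: pass \<open>I\<close> treats
  stage \<open>N - 2 - I\<close>. The second value of \<open>A\<close> is the number of rim nodes
  kept by the parent, behind which the interval of the leaf begins.\<close>

definition trace_step :: prog where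
  "trace_step =
     (xT ::= \<langle>xNS1\<rangle> \<ominus> Const 1 \<ominus> \<langle>xI\<rangle> ;; xPV ::= xOR\<lbrakk>\<langle>xT\<rangle>\<rbrakk> ;; xPP ::= xPA\<lbrakk>\<langle>xT\<rangle>\<rbrakk> ;;
      xA ::= xCH\<lbrakk>xOF\<lbrakk>\<langle>xT\<rangle>\<rbrakk> \<oplus> xDE\<lbrakk>\<langle>xPP\<rangle>\<rbrakk>\<rbrakk> ;;
      xDE\<lbrakk>\<langle>xPV\<rangle>\<rbrakk> ::= \<langle>xA\<rangle> ;; xDE\<lbrakk>\<langle>xPP\<rangle>\<rbrakk> ::= xDE\<lbrakk>\<langle>xPP\<rangle>\<rbrakk> \<ominus> \<langle>xA\<rangle> ;;
      xA ::= xDE\<lbrakk>\<langle>xPP\<rangle>\<rbrakk> ;; Cond (Leq \<langle>xM\<rangle> \<langle>xA\<rangle>) (xA ::= \<langle>xA\<rangle> \<ominus> \<langle>xM\<rangle>) Nop ;;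
      xST\<lbrakk>\<langle>xPV\<rangle>\<rbrakk> ::= xST\<lbrakk>\<langle>xPP\<rangle>\<rbrakk> \<oplus> \<langle>xA\<rangle>)"

definition trace :: prog where
  "trace = xDE\<lbrakk>xOR\<lbrakk>\<langle>xNS1\<rangle>\<rbrakk>\<rbrakk> ::= \<langle>xN\<rangle> \<oplus> \<langle>xM\<rangle> ;; xST\<lbrakk>xOR\<lbrakk>\<langle>xNS1\<rangle>\<rbrakk>\<rbrakk> ::= Const 0 ;; For xI xNS1 trace_step"

definition place_rim :: prog where
  "place_rim = Cond (Less \<langle>xJ\<rangle> \<langle>xT\<rangle>) (xMV\<lbrakk>xUS\<lbrakk>xST\<lbrakk>\<langle>xI\<rangle>\<rbrakk> \<oplus> \<langle>xJ\<rangle>\<rbrakk>\<rbrakk> ::= \<langle>xI\<rangle>) Nop"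

definition place_centre :: prog where
  "place_centre = xT ::= xDE\<lbrakk>\<langle>xI\<rangle>\<rbrakk> ;; Cond (Leq \<langle>xM\<rangle> \<langle>xT\<rangle>) (xT ::= \<langle>xT\<rangle> \<ominus> \<langle>xM\<rangle> ;; xMV\<lbrakk>\<langle>xCC\<rangle>\<rbrakk> ::= \<langle>xI\<rangle>) Nop"

definition place_node :: prog where
  "place_node = place_centre ;; For xJ xNR place_rim"

definition place :: prog where
  "place = For xI xNS place_node"

lemma writes_place [simp]:
  "writes trace_step = {xT, xPV, xPP, xA, xDE, xST}" "writes trace = {xI, xT, xPV, xPP, xA, xDE, xST}"
  "writes place_rim = {xMV}" "writes place_centre = {xT, xMV}" "writes place_node = {xT, xMV, xJ}"
  "writes place = {xI, xT, xMV, xJ}"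
  by (auto simp: trace_step_def trace_def place_rim_def place_centre_def place_node_def place_def)

lemma (in elimination) run_trace:
  fixes s :: memory and n :: nat
  defines "R \<equiv> 3 * Suc n" and "full \<equiv> n + 2 * Suc n"
  assumes sz: "sized n N s" and v: "s xOR = v" and p: "s xPA = p" and OF: "\<And>j. j \<le> N \<Longrightarrow> s xOF j = j * R"
  defines "t \<equiv> run trace s"
  shows "\<exists>dem. traced (\<lambda>i d. s xCH (i * R + d)) full dem 0 \<and> (\<forall>u<N. t xDE u = dem 0 u) \<and> t xST (v (N - 1)) = 0 \<and>
    (\<forall>i. Suc i < N \<longrightarrow> t xST (v i) = t xST (p i) + count n (dem i (p i)))"
proof -
  let ?s = "upd xST (v (N - 1)) 0 (upd xDE (v (N - 1)) full s)"
  let ?ch = "\<lambda>i d. s xCH (i * R + d)"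
  let ?P = "\<lambda>k t. \<exists>dem. traced ?ch full dem (N - 1 - k) \<and> (\<forall>u<N. t xDE u = dem (N - 1 - k) u) \<and> t xST (v (N - 1)) = 0 \<and>
    (\<forall>i. N - 1 - k \<le> i \<longrightarrow> Suc i < N \<longrightarrow> t xST (v i) = t xST (p i) + count n (dem i (p i)))"
  have start: "run trace s = run (For xI xNS1 trace_step) ?s"
    using sz v by (simp add: trace_def sized_def full_def)
  have "?P (?s xNS1 0) t"
    unfolding t_def start
  proof (rule run_For_inv[where P = ?P], goal_cases)
    case 1
    show ?case by (intro exI[of _ "\<lambda>_. ?s xDE"]) (auto simp: traced_def)
  next
    case (2 k t a)
    then show ?case by simp
  next
    case (3 k t)
    have k: "k < N - 1" using 3(1) sz by (simp add: sized_def)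
    define i where "i = N - 1 - Suc k"
    have i: "N - 1 - k = Suc i" "Suc i < N" "N - 1 - 1 - k = i" using k by (auto simp: i_def)
    have fr: "t x = s x" if "x \<in> {xNS1, xOR, xPA, xCH, xOF, xM}" for x using 3(4)[of x] that by auto
    obtain dem where dem: "traced ?ch full dem (Suc i)" "\<And>u. u < N \<Longrightarrow> t xDE u = dem (Suc i) u" "t xST (v (N - 1)) = 0"
      "\<And>j. Suc i \<le> j \<Longrightarrow> Suc j < N \<Longrightarrow> t xST (v j) = t xST (p j) + count n (dem j (p j))"
      using 3(2) unfolding i(1) by blast
    let ?t = "run trace_step t"
    let ?q = "?ch i (dem (Suc i) (p i))"
    have pv: "p i \<noteq> v i" "v i < N" "p i < N" using i p_neq_v v_less p_less by auto
    have sc: "t xNS1 0 = N - 1" "t xM 0 = 2 * Suc n" using sz fr by (auto simp: sized_def)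
    have oFi: "t xOF i = i * R" using OF[of i] i fr by simp
    have DE: "?t xDE = (t xDE)(v i := ?q, p i := dem (Suc i) (p i) - ?q)"
      using 3(3) sc i(3) fr v p pv oFi dem(2)[OF pv(3)] by (simp add: trace_step_def fun_eq_iff)
    have ST: "?t xST = (t xST)(v i := t xST (p i) + count n (dem (Suc i) (p i) - ?q))"
      using 3(3) sc i(3) fr v p pv oFi dem(2)[OF pv(3)] by (simp add: trace_step_def fun_eq_iff count_def centred_def)
    define dem' where "dem' = dem(i := ?t xDE)"
    have dS: "dem' j = dem j" if "Suc i \<le> j" for j using that by (simp add: dem'_def)
    have "traced ?ch full dem' i"
      unfolding traced_def
    proof (intro conjI allI impI)
      show "dem' (N - 1) (v (N - 1)) = full" using dem(1) dS[of "N - 1"] i by (simp add: traced_def)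
      fix j assume j: "i \<le> j" "Suc j < N"
      have "dem' j (v j) = ?ch j (dem' (Suc j) (p j)) \<and> dem' j (p j) = dem' (Suc j) (p j) - ?ch j (dem' (Suc j) (p j)) \<and>
        (\<forall>u<N. u \<noteq> v j \<longrightarrow> u \<noteq> p j \<longrightarrow> dem' j u = dem' (Suc j) u)"
      proof (cases "j = i")
        case True
        have "dem' i = ?t xDE" "dem' (Suc i) = dem (Suc i)" by (simp_all add: dem'_def)
        then show ?thesis unfolding True DE using pv dem(2) by simp
      next
        case False
        then have "Suc i \<le> j" "dem' j = dem j" "dem' (Suc j) = dem (Suc j)" using j dS[of j] dS[of "Suc j"] by auto
        then show ?thesis using dem(1) j(2) unfolding traced_def by simp
      qed
      then show "dem' j (v j) = ?ch j (dem' (Suc j) (p j))" "dem' j (p j) = dem' (Suc j) (p j) - ?ch j (dem' (Suc j) (p j))"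
        "\<And>u. u < N \<Longrightarrow> u \<noteq> v j \<Longrightarrow> u \<noteq> p j \<Longrightarrow> dem' j u = dem' (Suc j) u" by blast+
    qed
    moreover have "?t xDE u = dem' i u" for u by (simp add: dem'_def)
    moreover have "?t xST (v (N - 1)) = 0"
    proof -
      have "N - 1 \<noteq> i" using i(2) by simp
      then have "v (N - 1) \<noteq> v i" using v_inj[of "N - 1" i] i(2) by simp
      then show ?thesis using dem(3) by (simp add: ST)
    qed
    moreover have "?t xST (v j) = ?t xST (p j) + count n (dem' j (p j))" if j: "i \<le> j" "Suc j < N" for j
    proof (cases "j = i")
      case True
      then show ?thesis using pv by (simp add: ST dem'_def DE)
    next
      case False
      then have "Suc i \<le> j" using j by simp
      then have "v j \<noteq> v i" using v_inj[of j i] j by simp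
      moreover have "p j \<noteq> v i"
      proof -
        obtain l where "j < l" "l < N" "p j = v l" using later[OF j(2)] by blast
        then show ?thesis using v_inj[of l i] j i by simp
      qed
      ultimately show ?thesis using dem(4)[OF \<open>Suc i \<le> j\<close> j(2)] dS[OF \<open>Suc i \<le> j\<close>] by (simp add: ST)
    qed
    ultimately show ?case unfolding i_def[symmetric] by blast
  qed
  then show ?thesis using sz by (simp add: sized_def)
qed

lemma run_place_node:
  fixes s :: memory
  assumes w: "wheel n (s xCC 0) (s xUS)" and sz: "sized n N s" and I: "s xI 0 = k"
    and bound: "s xST k + count n (s xDE k) \<le> n"
  defines "t \<equiv> run place_node s"
  shows "\<And>j. s xST k \<le> j \<Longrightarrow> j < s xST k + count n (s xDE k) \<Longrightarrow> t xMV (s xUS j) = k"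
    and "centred n (s xDE k) \<Longrightarrow> t xMV (s xCC 0) = k"
    and "\<not> centred n (s xDE k) \<Longrightarrow> t xMV (s xCC 0) = s xMV (s xCC 0)"
    and "\<And>j. j < n \<Longrightarrow> \<not> (s xST k \<le> j \<and> j < s xST k + count n (s xDE k)) \<Longrightarrow> t xMV (s xUS j) = s xMV (s xUS j)"
proof -
  interpret wheel n "s xCC 0" "s xUS" by (rule w)
  let ?c = "count n (s xDE k)"
  let ?s = "run place_centre s"
  have T: "?s xT 0 = ?c" and MV: "?s xMV = (if centred n (s xDE k) then (s xMV)(s xCC 0 := k) else s xMV)"
    using I sz by (simp_all add: place_centre_def count_def centred_def sized_def)
  \<comment> \<open>The minimum reflects the guard of \<open>place_rim\<close>: the loop makes
    \<open>NR\<close> passes, but only the first \<open>?c\<close> of them place a rim node.\<close>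
  let ?f = "\<lambda>m x. if \<exists>j. s xST k \<le> j \<and> j < s xST k + min m ?c \<and> x = s xUS j then k else ?s xMV x"
  have "t xMV = ?f (?s xNR 0)"
    unfolding t_def place_node_def run.simps(3)
  proof (rule run_For_inv[where P = "\<lambda>m t. t xMV = ?f m"], goal_cases)
    case (3 m t)
    have fr: "t xT = ?s xT" "t xUS = s xUS" "t xST = s xST" "t xI = s xI" using 3(4) by (simp_all add: run_frame)
    show ?case
    proof (cases "m < ?c")
      case True
      have "run place_rim t xMV x = (if x = s xUS (s xST k + m) then k else t xMV x)" for x
        using True fr 3(3) T I by (simp add: place_rim_def)
      moreover have "(\<exists>j. s xST k \<le> j \<and> j < s xST k + min (Suc m) ?c \<and> x = s xUS j) \<longleftrightarrow>
          x = s xUS (s xST k + m) \<or> (\<exists>j. s xST k \<le> j \<and> j < s xST k + min m ?c \<and> x = s xUS j)" for x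
      proof -
        have "min (Suc m) ?c = Suc m" "min m ?c = m" using True by auto
        then show ?thesis by (auto simp: less_Suc_eq) (intro exI[of _ "s xST k + m"], simp)
      qed
      ultimately show ?thesis using 3(2) by (auto simp: fun_eq_iff)
    next
      case False
      then have "min (Suc m) ?c = min m ?c" by simp
      moreover have "run place_rim t = t" using False fr 3(3) T by (simp add: place_rim_def)
      ultimately show ?thesis using 3(2) by simp
    qed
  qed (auto simp: fun_eq_iff)
  moreover have "min (?s xNR 0) ?c = ?c" using sz bound by (simp add: sized_def run_frame)
  ultimately have t: "t xMV x = (if \<exists>j. s xST k \<le> j \<and> j < s xST k + ?c \<and> x = s xUS j then k else ?s xMV x)" for x
    by simp
  show "t xMV (s xUS j) = k" if "s xST k \<le> j" "j < s xST k + ?c" for j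
    unfolding t using that by auto
  have c: "\<not> (\<exists>j. s xST k \<le> j \<and> j < s xST k + ?c \<and> s xCC 0 = s xUS j)" using r_c bound by auto
  show "centred n (s xDE k) \<Longrightarrow> t xMV (s xCC 0) = k" "\<not> centred n (s xDE k) \<Longrightarrow> t xMV (s xCC 0) = s xMV (s xCC 0)"
    unfolding t using c MV by auto
  show "t xMV (s xUS j) = s xMV (s xUS j)" if j: "j < n" "\<not> (s xST k \<le> j \<and> j < s xST k + ?c)" for j
  proof -
    have "\<not> (\<exists>i. s xST k \<le> i \<and> i < s xST k + ?c \<and> s xUS j = s xUS i)"
      using j r_eq bound by auto
    then have "t xMV (s xUS j) = ?s xMV (s xUS j)" unfolding t by (simp only: if_False)
    then show ?thesis using MV r_c[of j] j(1) by simp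
  qed
qed

text \<open>Since every position and the centre have one owner only, later passes never overwrite an
  earlier placement.\<close>

lemma run_place:
  fixes s :: memory
  assumes w: "wheel n (s xCC 0) (s xUS)" and sz: "sized n N s"
    and bound: "\<And>u. u < N \<Longrightarrow> s xST u + count n (s xDE u) \<le> n"
    and once: "\<And>u u' j. u < N \<Longrightarrow> u' < N \<Longrightarrow> s xST u \<le> j \<Longrightarrow> j < s xST u + count n (s xDE u) \<Longrightarrow>
      s xST u' \<le> j \<Longrightarrow> j < s xST u' + count n (s xDE u') \<Longrightarrow> u = u'"
    and centre: "\<And>u u'. u < N \<Longrightarrow> u' < N \<Longrightarrow> centred n (s xDE u) \<Longrightarrow> centred n (s xDE u') \<Longrightarrow> u = u'"
  defines "t \<equiv> run place s"
  shows "\<And>u j. u < N \<Longrightarrow> s xST u \<le> j \<Longrightarrow> j < s xST u + count n (s xDE u) \<Longrightarrow> t xMV (s xUS j) = u"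
    and "\<And>u. u < N \<Longrightarrow> centred n (s xDE u) \<Longrightarrow> t xMV (s xCC 0) = u"
proof -
  let ?P = "\<lambda>k t. \<forall>u<k. (\<forall>j. s xST u \<le> j \<longrightarrow> j < s xST u + count n (s xDE u) \<longrightarrow> t xMV (s xUS j) = u) \<and>
    (centred n (s xDE u) \<longrightarrow> t xMV (s xCC 0) = u)"
  have "?P (s xNS 0) t"
    unfolding t_def place_def
  proof (rule run_For_inv[where P = ?P], goal_cases)
    case (3 k t)
    have fr: "t x = s x" if "x \<in> {xCC, xUS, xST, xDE, xNR, xR, xM, xN, xNS, xNS1}" for x using 3(4)[of x] that by auto
    have k: "k < N" using 3(1) sz by (simp add: sized_def)
    have szt: "sized n N t" by (rule sized_cong[OF sz]) (auto intro: fr)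
    have wt: "wheel n (t xCC 0) (t xUS)" using w fr by simp
    have bt: "t xST k + count n (t xDE k) \<le> n" using bound[OF k] fr by simp
    note st = run_place_node[OF wt szt 3(3) bt]
    let ?t = "run place_node t"
    show ?case
    proof (intro allI impI conjI)
      fix u j assume u: "u < Suc k" and j: "s xST u \<le> j" "j < s xST u + count n (s xDE u)"
      show "?t xMV (s xUS j) = u"
      proof (cases "u = k")
        case True
        then show ?thesis using st(1)[of j] j fr by simp
      next
        case False
        then have "u < k" using u by simp
        then have "\<not> (s xST k \<le> j \<and> j < s xST k + count n (s xDE k))" "j < n"
          using once[of u k j] k j False bound[of u] by auto
        then have "?t xMV (s xUS j) = t xMV (s xUS j)" using st(4)[of j] fr by simp
        then show ?thesis using 3(2) \<open>u < k\<close> j by simp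
      qed
    next
      fix u assume u: "u < Suc k" and c: "centred n (s xDE u)"
      show "?t xMV (s xCC 0) = u"
      proof (cases "u = k")
        case True
        then show ?thesis using st(2) c fr by simp
      next
        case False
        then have "u < k" using u by simp
        then have "\<not> centred n (s xDE k)" using centre[of u k] k c False by auto
        then have "?t xMV (s xCC 0) = t xMV (s xCC 0)" using st(3) fr by simp
        then show ?thesis using 3(2) \<open>u < k\<close> c by simp
      qed
    qed
  qed simp_all
  then show "\<And>u j. u < N \<Longrightarrow> s xST u \<le> j \<Longrightarrow> j < s xST u + count n (s xDE u) \<Longrightarrow> t xMV (s xUS j) = u"
    "\<And>u. u < N \<Longrightarrow> centred n (s xDE u) \<Longrightarrow> t xMV (s xCC 0) = u"
    using sz by (auto simp: sized_def)
qed


section \<open>Writing the answer\<close>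

definition emit :: "aexp \<Rightarrow> prog" where
  "emit a = 0\<lbrakk>\<langle>1\<rangle>\<rbrakk> ::= a ;; 1 ::= \<langle>1\<rangle> \<oplus> Const 1"

lemma writes_emit [simp]: "writes (emit a) = {0, 1}"
  by (auto simp: emit_def)

lemma output_emit [simp]: "output_list (run (emit a) s) = output_list s @ [aval a s]"
  by (simp add: emit_def output_list_def)

lemma output_list_cong: "t 0 = s 0 \<Longrightarrow> t 1 = s 1 \<Longrightarrow> output_list t = output_list s"
  by (simp add: output_list_def)

lemma output_upd [simp]: "x \<noteq> 0 \<Longrightarrow> x \<noteq> 1 \<Longrightarrow> output_list (upd x i a s) = output_list s"
  by (rule output_list_cong) simp_all

lemma run_emit_loop:
  assumes v: "v \<noteq> 0" "v \<noteq> 1"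
    and e: "\<And>k t. k < s b 0 \<Longrightarrow> t v 0 = k \<Longrightarrow> (\<And>x. x \<notin> {v, 0, 1} \<Longrightarrow> t x = s x) \<Longrightarrow> aval e t = g k"
  shows "output_list (run (For v b (emit e)) s) = output_list s @ map g [0..<s b 0]"
proof (rule run_For_inv[where P = "\<lambda>k t. output_list t = output_list s @ map g [0..<k]"], goal_cases)
  case (3 k t)
  then have "aval e t = g k" by (intro e) auto
  then show ?case using 3(2) by simp
qed (use v in simp_all)

text \<open>The number of items to print is computed by the program and hence cannot bound a loop; a
  longer loop with a guard takes its place.\<close>

lemma run_emit_guarded:
  assumes v: "v \<notin> {0, 1, c}" "c \<notin> {0, 1}" and le: "s c 0 \<le> s b 0"
    and e: "\<And>k t. k < s c 0 \<Longrightarrow> t v 0 = k \<Longrightarrow> (\<And>x. x \<notin> {v, 0, 1} \<Longrightarrow> t x = s x) \<Longrightarrow> aval e t = g k"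
  shows "output_list (run (For v b (Cond (Less \<langle>v\<rangle> \<langle>c\<rangle>) (emit e) Nop)) s) = output_list s @ map g [0..<s c 0]"
proof -
  have "output_list (run (For v b (Cond (Less \<langle>v\<rangle> \<langle>c\<rangle>) (emit e) Nop)) s) = output_list s @ map g [0..<min (s b 0) (s c 0)]"
  proof (rule run_For_inv[where P = "\<lambda>k t. output_list t = output_list s @ map g [0..<min k (s c 0)]"], goal_cases)
    case (3 k t)
    have "t c = s c" using 3(4)[of c] v by auto
    show ?case
    proof (cases "k < s c 0")
      case True
      have "aval e t = g k" using True 3(3,4) by (intro e) auto
      moreover have "min (Suc k) (s c 0) = Suc k" "min k (s c 0) = k" using True by auto
      ultimately show ?thesis using 3(2,3) \<open>t c = s c\<close> True by simp
    next
      case False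
      then have "min (Suc k) (s c 0) = min k (s c 0)" by simp
      then show ?thesis using 3(2,3) \<open>t c = s c\<close> False by simp
    qed
  qed (use v in simp_all)
  then show ?thesis using le by (simp add: min_absorb2)
qed

text \<open>As the current ends move to their parents in the order of elimination, one pass over this order
  brings them together; \<open>PX\<close> and \<open>PB\<close> collect the two halves of the path.\<close>

definition path_step :: prog where
  "path_step =
     Cond (Eq \<langle>xX\<rangle> \<langle>xY\<rangle>) Nop
       (Cond (Eq \<langle>xX\<rangle> (xOR\<lbrakk>\<langle>xI\<rangle>\<rbrakk>)) (xPX\<lbrakk>\<langle>xNA\<rangle>\<rbrakk> ::= \<langle>xX\<rangle> ;; xNA ::= \<langle>xNA\<rangle> \<oplus> Const 1 ;; xX ::= xPA\<lbrakk>\<langle>xI\<rangle>\<rbrakk>)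
         (Cond (Eq \<langle>xY\<rangle> (xOR\<lbrakk>\<langle>xI\<rangle>\<rbrakk>)) (xPB\<lbrakk>\<langle>xNB\<rangle>\<rbrakk> ::= \<langle>xY\<rangle> ;; xNB ::= \<langle>xNB\<rangle> \<oplus> Const 1 ;; xY ::= xPA\<lbrakk>\<langle>xI\<rangle>\<rbrakk>) Nop))"

definition find_path :: prog where
  "find_path = xNA ::= Const 0 ;; xNB ::= Const 0 ;; For xI xNS1 path_step"

definition emit_path :: prog where
  "emit_path = emit (\<langle>xNA\<rangle> \<oplus> \<langle>xNB\<rangle> \<oplus> Const 1) ;;
     For xI xNS (Cond (Less \<langle>xI\<rangle> \<langle>xNA\<rangle>) (emit (xPX\<lbrakk>\<langle>xI\<rangle>\<rbrakk>)) Nop) ;; emit \<langle>xX\<rangle> ;;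
     For xI xNS (Cond (Less \<langle>xI\<rangle> \<langle>xNB\<rangle>) (emit (xPB\<lbrakk>\<langle>xNB\<rangle> \<ominus> Const 1 \<ominus> \<langle>xI\<rangle>\<rbrakk>)) Nop)"

definition edge_output :: prog where
  "edge_output = xX ::= xMV\<lbrakk>xEU\<lbrakk>\<langle>xJ\<rangle>\<rbrakk>\<rbrakk> ;; xY ::= xMV\<lbrakk>xEV\<lbrakk>\<langle>xJ\<rangle>\<rbrakk>\<rbrakk> ;; find_path ;; emit_path"

text \<open>The answer overwrites the input in array 0. By now all input data have been copied to
  arrays of their own.\<close>

definition output_mapping :: prog where
  "output_mapping = 1 ::= Const 0 ;; emit (Const 1) ;; For xJ xNR (emit (xMV\<lbrakk>\<langle>xJ\<rangle>\<rbrakk>)) ;; For xJ xMR edge_output"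

lemma writes_output [simp]:
  "writes path_step = {xPX, xNA, xX, xPB, xNB, xY}" "writes find_path = {xNA, xNB, xI, xPX, xX, xPB, xY}"
  "writes emit_path = {0, 1, xI}" "writes edge_output = {xX, xY, xNA, xNB, xI, xPX, xPB, 0, 1}"
  "writes output_mapping = {0, 1, xJ, xX, xY, xNA, xNB, xI, xPX, xPB}"
  by (auto simp: path_step_def find_path_def emit_path_def edge_output_def output_mapping_def)

context elimination
begin

text \<open>\<open>PB\<close> is filled from the target inwards, so the second half of the path is
  stored in reverse.\<close>

lemma run_find_path:
  fixes s :: memory
  assumes s: "s xOR = v" "s xPA = p" "s xNS1 0 = N - 1"
  defines "t \<equiv> run find_path s"
  shows "walk (N - 1) (s xX 0) (s xY 0) = (map (t xPX) [0..<t xNA 0], t xX 0, t xY 0, rev (map (t xPB) [0..<t xNB 0]))"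
proof -
  let ?s = "upd xNB 0 0 (upd xNA 0 0 s)"
  let ?v = "\<lambda>t. (map (t xPX) [0..<t xNA 0], t xX 0, t xY 0, rev (map (t xPB) [0..<t xNB 0]))"
  have "walk (?s xNS1 0) (s xX 0) (s xY 0) = ?v t"
    unfolding t_def find_path_def run.simps(2,3) aval.simps
  proof (rule run_For_inv[where P = "\<lambda>k t. walk k (s xX 0) (s xY 0) = ?v t"], goal_cases)
    case 1 show ?case by (simp add: walk_def)
  next
    case (3 k t)
    have fr: "t xOR = v" "t xPA = p" using 3(4)[of xOR] 3(4)[of xPA] s by simp_all
    show ?case
      unfolding walk_Suc 3(2) using 3(3) fr by (simp add: path_step_def)
  qed simp
  then show ?thesis using s by simp
qed

lemma run_edge_output:
  fixes s :: memory
  assumes s: "s xOR = v" "s xPA = p" "s xNS1 0 = N - 1" "s xNS 0 = N"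
  defines "a \<equiv> s xMV (s xEU (s xJ 0))" and "b \<equiv> s xMV (s xEV (s xJ 0))"
  assumes ab: "a < N" "b < N"
  shows "output_list (run edge_output s) = output_list s @ length (tree_path a b) # tree_path a b"
proof -
  let ?s = "upd xY 0 b (upd xX 0 a s)"
  define t where "t = run find_path ?s"
  have run: "run edge_output s = run emit_path t" by (simp add: edge_output_def t_def a_def b_def)
  have fr: "t x = s x" if "x \<notin> {xNA, xNB, xI, xPX, xX, xPB, xY}" for x using that by (simp add: t_def run_frame)
  have w: "walk (N - 1) a b = (map (t xPX) [0..<t xNA 0], t xX 0, t xY 0, rev (map (t xPB) [0..<t xNB 0]))"
    using run_find_path[of ?s, folded t_def] s by simp
  have len: "t xNA 0 + t xNB 0 < N" using walk_end(3)[OF ab w] by simp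
  have path: "tree_path a b = map (t xPX) [0..<t xNA 0] @ t xX 0 # rev (map (t xPB) [0..<t xNB 0])"
    using w by (simp add: tree_path_def)
  have rv: "rev (map f [0..<m]) = map (\<lambda>k. f (m - 1 - k)) [0..<m]" for f :: "nat \<Rightarrow> nat" and m
    by (rule nth_equalityI) (simp_all add: rev_nth)
  define t1 where "t1 = run (emit (\<langle>xNA\<rangle> \<oplus> \<langle>xNB\<rangle> \<oplus> Const 1)) t"
  define t2 where "t2 = run (For xI xNS (Cond (Less \<langle>xI\<rangle> \<langle>xNA\<rangle>) (emit (xPX\<lbrakk>\<langle>xI\<rangle>\<rbrakk>)) Nop)) t1"
  define t3 where "t3 = run (emit \<langle>xX\<rangle>) t2"
  have f1: "t1 x = t x" if "x \<notin> {0, 1}" for x using that by (simp add: t1_def run_frame)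
  have f2: "t2 x = t1 x" if "x \<notin> {0, 1, xI}" for x using that by (simp add: t2_def run_frame)
  have f3: "t3 x = t2 x" if "x \<notin> {0, 1}" for x using that by (simp add: t3_def run_frame)
  have NS: "t xNS 0 = N" using s by (simp add: fr)
  have o1: "output_list t1 = output_list t @ [length (tree_path a b)]" by (simp add: t1_def path)
  have o2: "output_list t2 = output_list t1 @ map (t xPX) [0..<t1 xNA 0]"
    unfolding t2_def
  proof (rule run_emit_guarded)
    fix k and u :: memory assume "u xI 0 = k" and fr: "\<And>x. x \<notin> {xI, 0, 1} \<Longrightarrow> u x = t1 x"
    then show "aval (xPX\<lbrakk>\<langle>xI\<rangle>\<rbrakk>) u = t xPX k" using fr[of xPX] by (simp add: f1)
  qed (use len NS in \<open>simp_all add: f1\<close>)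
  have o3: "output_list t3 = output_list t2 @ [t xX 0]" by (simp add: t3_def f2 f1)
  have "output_list (run emit_path t) = output_list t3 @ map (\<lambda>k. t xPB (t xNB 0 - 1 - k)) [0..<t3 xNB 0]"
    unfolding emit_path_def run.simps(3) t1_def[symmetric] t2_def[symmetric] t3_def[symmetric]
  proof (rule run_emit_guarded)
    fix k and u :: memory assume "u xI 0 = k" and fr: "\<And>x. x \<notin> {xI, 0, 1} \<Longrightarrow> u x = t3 x"
    then show "aval (xPB\<lbrakk>\<langle>xNB\<rangle> \<ominus> Const 1 \<ominus> \<langle>xI\<rangle>\<rbrakk>) u = t xPB (t xNB 0 - 1 - k)"
      using fr[of xPB] fr[of xNB] by (simp add: f1 f2 f3)
  qed (use len NS in \<open>simp_all add: f1 f2 f3\<close>)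
  moreover have "output_list t = output_list s" by (rule output_list_cong) (simp_all add: fr)
  ultimately show ?thesis
    unfolding run using o1 o2 o3 by (simp add: path rv f1 f2 f3)
qed

lemma run_output_mapping:
  fixes s :: memory
  assumes s: "s xOR = v" "s xPA = p" "s xNS1 0 = N - 1" "s xNS 0 = N"
    and mV: "\<And>j. j < s xMR 0 \<Longrightarrow> s xMV (s xEU j) < N \<and> s xMV (s xEV j) < N"
  defines "path j \<equiv> tree_path (s xMV (s xEU j)) (s xMV (s xEV j))"
  shows "output_list (run output_mapping s) =
    1 # map (s xMV) [0..<s xNR 0] @ concat (map (\<lambda>j. length (path j) # path j) [0..<s xMR 0])"
proof -
  define a where "a = run (emit (Const 1)) (upd 1 0 0 s)"
  define b where "b = run (For xJ xNR (emit (xMV\<lbrakk>\<langle>xJ\<rangle>\<rbrakk>))) a"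
  have fa: "a x = s x" if "x \<notin> {0, 1}" for x using that by (simp add: a_def run_frame)
  have fb: "b x = a x" if "x \<notin> {0, 1, xJ}" for x using that by (simp add: b_def run_frame)
  have oa: "output_list a = [1]" unfolding a_def output_emit by (simp add: output_list_def)
  have "output_list b = output_list a @ map (s xMV) [0..<a xNR 0]"
    unfolding b_def
  proof (rule run_emit_loop)
    fix k and u :: memory assume "u xJ 0 = k" and fr: "\<And>x. x \<notin> {xJ, 0, 1} \<Longrightarrow> u x = a x"
    then show "aval (xMV\<lbrakk>\<langle>xJ\<rangle>\<rbrakk>) u = s xMV k" using fr[of xMV] by (simp add: fa)
  qed simp_all
  then have ob: "output_list b = 1 # map (s xMV) [0..<s xNR 0]" by (simp add: oa fa)
  have run: "run output_mapping s = run (For xJ xMR edge_output) b"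
    by (simp add: output_mapping_def a_def b_def)
  have "output_list (run (For xJ xMR edge_output) b) =
      output_list b @ concat (map (\<lambda>j. length (path j) # path j) [0..<b xMR 0])"
  proof (rule run_For_inv[where P = "\<lambda>k t. output_list t = output_list b @ concat (map (\<lambda>j. length (path j) # path j) [0..<k])"], goal_cases)
    case (3 k t)
    have fr: "t x = s x" if "x \<in> {xOR, xPA, xNS1, xNS, xMV, xEU, xEV}" for x
      using 3(4)[of x] that by (auto simp: fb fa)
    have k: "k < s xMR 0" using 3(1) by (simp add: fb fa)
    have "output_list (run edge_output t) = output_list t @ length (path k) # path k"
      using run_edge_output[of t] mV[OF k] s 3(3) fr by (simp add: path_def)
    then show ?case using 3(2) by simp
  qed simp_all
  then show ?thesis unfolding run ob by (simp add: fb fa)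
qed

end

section \<open>Instances in memory\<close>

lemma length_concat_const: "(\<And>x. length (f x) = k) \<Longrightarrow> length (concat (map f xs)) = k * length xs"
  by (induction xs) auto

lemma nth_concat_const:
  assumes "\<And>x. length (f x) = k" "i < length xs" "l < k"
  shows "concat (map f xs) ! (k * i + l) = f (xs ! i) ! l"
  using assms(2)
proof (induction xs arbitrary: i)
  case (Cons x xs)
  then show ?case using assms(1,3) by (cases i) (auto simp: nth_append)
qed simp

text \<open>A position-wise account of an encoding. It relates an encoding to the parsed arrays in
  both directions: reading a given instance, and recognising a list as the encoding of an instance
  built from the arrays.\<close>

definition layout :: "(nat \<Rightarrow> nat) \<Rightarrow> nat \<Rightarrow> nat \<Rightarrow> nat \<Rightarrow> nat \<Rightarrow> (nat \<Rightarrow> nat) \<Rightarrow> (nat \<Rightarrow> nat) \<Rightarrow> (nat \<Rightarrow> nat) \<Rightarrow> (nat \<Rightarrow> nat) \<Rightarrow>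
    (nat \<Rightarrow> nat) \<Rightarrow> (nat \<Rightarrow> nat) \<Rightarrow> (nat \<Rightarrow> nat) \<Rightarrow> (nat \<Rightarrow> nat) \<Rightarrow> bool" where
  "layout f nr mr ns ms eu ev nc nw su sv sc sw \<longleftrightarrow>
     f 0 = nr \<and> f 1 = mr \<and> (\<forall>j<mr. f (2 + 2 * j) = eu j \<and> f (3 + 2 * j) = ev j) \<and>
     f (2 + 2 * mr) = ns \<and> f (3 + 2 * mr) = ms \<and>
     (\<forall>j<ns. f (4 + 2 * mr + 2 * j) = nc j \<and> f (5 + 2 * mr + 2 * j) = nw j) \<and>
     (\<forall>j<ms. f (4 + 2 * mr + 2 * ns + 4 * j) = su j \<and> f (5 + 2 * mr + 2 * ns + 4 * j) = sv j \<and>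
       f (6 + 2 * mr + 2 * ns + 4 * j) = sc j \<and> f (7 + 2 * mr + 2 * ns + 4 * j) = sw j)"

lemma encode_layout:
  fixes I :: "(nat, nat) univne" and er es :: "(nat \<times> nat) list"
  defines "mr \<equiv> length er" and "ms \<equiv> length es" and "ns \<equiv> card (verts (substrate I))"
  shows "length (encode_univne I er es) = 4 + 2 * mr + 2 * ns + 4 * ms"
    and "layout ((!) (encode_univne I er es @ ts)) (card (verts (virtual I))) mr ns ms
      (\<lambda>j. fst (er ! j)) (\<lambda>j. snd (er ! j)) (node_cap I) (node_cost I)
      (\<lambda>j. fst (es ! j)) (\<lambda>j. snd (es ! j))
      (\<lambda>j. edge_cap I {fst (es ! j), snd (es ! j)}) (\<lambda>j. edge_cost I {fst (es ! j), snd (es ! j)})"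
proof -
  let ?f = "\<lambda>(u::nat, v::nat). [u, v]" and ?g = "\<lambda>u. [node_cap I u, node_cost I u]"
    and ?h = "\<lambda>(u, v). [u, v, edge_cap I {u, v}, edge_cost I {u, v}]"
  have len: "length (?f x) = 2" "length (?g u) = 2" "length (?h x) = 4" for x u by (simp_all split: prod.splits)
  define A where "A = concat (map ?f er)"
  define B where "B = concat (map ?g [0..<ns])"
  define C where "C = concat (map ?h es)"
  have lA: "length A = 2 * mr" unfolding A_def mr_def by (rule length_concat_const) (rule len)
  have lB: "length B = 2 * ns" unfolding B_def by (subst length_concat_const[where k = 2]) simp_all
  have lC: "length C = 4 * ms" unfolding C_def ms_def by (rule length_concat_const) (rule len)
  have e: "encode_univne I er es = [card (verts (virtual I)), mr] @ A @ [ns, ms] @ B @ C"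
    by (simp add: encode_univne_def A_def B_def C_def mr_def ms_def ns_def)
  show "length (encode_univne I er es) = 4 + 2 * mr + 2 * ns + 4 * ms" by (simp add: e lA lB lC)
  let ?x = "encode_univne I er es @ ts"
  have head: "?x ! 0 = card (verts (virtual I))" "?x ! 1 = mr" by (simp_all add: e)
  have a: "?x ! (2 + i) = A ! i" if "i < 2 * mr" for i using that lA by (simp add: e nth_append)
  have mid: "?x ! (2 + 2 * mr) = ns" "?x ! (3 + 2 * mr) = ms"
    using lA by (simp_all add: e nth_append numeral_3_eq_3)
  have b: "?x ! (4 + 2 * mr + i) = B ! i" if "i < 2 * ns" for i
  proof -
    have "4 + 2 * mr + i = Suc (Suc (2 * mr + Suc (Suc i)))" by simp
    then show ?thesis using that lA lB by (simp only: e) (simp add: nth_append)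
  qed
  have c: "?x ! (4 + 2 * mr + 2 * ns + i) = C ! i" if "i < 4 * ms" for i
  proof -
    have "4 + 2 * mr + 2 * ns + i = Suc (Suc (2 * mr + Suc (Suc (2 * ns + i))))" by simp
    then show ?thesis using that lA lB lC by (simp only: e) (simp add: nth_append)
  qed
  have A: "A ! (2 * j + l) = [fst (er ! j), snd (er ! j)] ! l" if "j < mr" "l < 2" for j l
    using nth_concat_const[of ?f 2 j er l] that len unfolding A_def mr_def by (simp add: case_prod_beta)
  have B: "B ! (2 * j + l) = [node_cap I j, node_cost I j] ! l" if "j < ns" "l < 2" for j l
    using nth_concat_const[of ?g 2 j "[0..<ns]" l] that unfolding B_def by simp
  have C: "C ! (4 * j + l) = [fst (es ! j), snd (es ! j), edge_cap I {fst (es ! j), snd (es ! j)}, edge_cost I {fst (es ! j), snd (es ! j)}] ! l"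
    if "j < ms" "l < 4" for j l
    using nth_concat_const[of ?h 4 j es l] that len unfolding C_def ms_def by (simp add: case_prod_beta)
  have "?x ! (2 + 2 * j) = fst (er ! j)" "?x ! (3 + 2 * j) = snd (er ! j)" if "j < mr" for j
    using a[of "2 * j"] a[of "2 * j + 1"] A[OF that, of 0] A[OF that, of 1] that by (simp_all add: numeral_eq_Suc)
  moreover have "?x ! (4 + 2 * mr + 2 * j) = node_cap I j" "?x ! (5 + 2 * mr + 2 * j) = node_cost I j" if "j < ns" for j
    using b[of "2 * j"] b[of "2 * j + 1"] B[OF that, of 0] B[OF that, of 1] that by (simp_all add: numeral_eq_Suc)
  moreover have "?x ! (4 + 2 * mr + 2 * ns + 4 * j) = fst (es ! j)" "?x ! (5 + 2 * mr + 2 * ns + 4 * j) = snd (es ! j)"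
    "?x ! (6 + 2 * mr + 2 * ns + 4 * j) = edge_cap I {fst (es ! j), snd (es ! j)}"
    "?x ! (7 + 2 * mr + 2 * ns + 4 * j) = edge_cost I {fst (es ! j), snd (es ! j)}" if "j < ms" for j
  proof -
    have lt: "4 * j + l < 4 * ms" if "l < 4" for l using that \<open>j < ms\<close> by linarith
    show "?x ! (4 + 2 * mr + 2 * ns + 4 * j) = fst (es ! j)" "?x ! (5 + 2 * mr + 2 * ns + 4 * j) = snd (es ! j)"
      "?x ! (6 + 2 * mr + 2 * ns + 4 * j) = edge_cap I {fst (es ! j), snd (es ! j)}"
      "?x ! (7 + 2 * mr + 2 * ns + 4 * j) = edge_cost I {fst (es ! j), snd (es ! j)}"
      using c[OF lt, of 0] c[OF lt, of 1] c[OF lt, of 2] c[OF lt, of 3] C[OF that, of 0] C[OF that, of 1] C[OF that, of 2] C[OF that, of 3]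
      by (simp_all add: numeral_eq_Suc)
  qed
  ultimately show "layout ((!) ?x) (card (verts (virtual I))) mr ns ms
      (\<lambda>j. fst (er ! j)) (\<lambda>j. snd (er ! j)) (node_cap I) (node_cost I)
      (\<lambda>j. fst (es ! j)) (\<lambda>j. snd (es ! j))
      (\<lambda>j. edge_cap I {fst (es ! j), snd (es ! j)}) (\<lambda>j. edge_cost I {fst (es ! j), snd (es ! j)})"
    unfolding layout_def using head mid by blast
qed

lemma parsed_layout:
  "parsed f s \<Longrightarrow> layout f (s xNR 0) (s xMR 0) (s xNS 0) (s xMS 0) (s xEU) (s xEV) (s xNC) (s xNW) (s xSU) (s xSV) (s xSC) (s xSW)"
proof -
  have "j + j = 2 * j" "a + j + j = a + 2 * j" "j + j + j + j = 4 * j" "a + a + b + b + j + j + j + j = 2 * a + 2 * b + 4 * j" for a b j :: nat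
    by simp_all
  note ar = this
  assume "parsed f s"
  then show ?thesis unfolding parsed_def layout_def Let_def ar by (simp add: add.assoc)
qed

text \<open>The interface between preprocessing and optimisation. It is established either because
  the input is a genuine encoding or because the checks have succeeded on an arbitrary list. The
  tables must be blank, as 0 means infeasible.\<close>

definition structured :: "(nat, nat) univne \<Rightarrow> (nat \<times> nat) list \<Rightarrow> nat \<Rightarrow> nat \<Rightarrow> memory \<Rightarrow> bool" where
  "structured I er n N s \<longleftrightarrow>
     sized n N s \<and> verts (virtual I) = {..<Suc n} \<and> lists_edges er (edges (virtual I)) \<and>
     er = map (\<lambda>j. (s xEU j, s xEV j)) [0..<s xMR 0] \<and>
     wheel n (s xCC 0) (s xUS) \<and> wheel.V n (s xCC 0) (s xUS) = verts (virtual I) \<and>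
     wheel.E n (s xCC 0) (s xUS) = edges (virtual I) \<and>
     elimination N (s xOR) (s xPA) \<and> verts (substrate I) = {..<N} \<and>
     edges (substrate I) = elimination.tree_edges N (s xOR) (s xPA) \<and>
     (\<forall>u<N. s xNC u = node_cap I u \<and> s xNW u = node_cost I u) \<and>
     (\<forall>i. Suc i < N \<longrightarrow> s xSC (s xPE i) = edge_cap I {s xOR i, s xPA i} \<and> s xSW (s xPE i) = edge_cost I {s xOR i, s xPA i}) \<and>
     s xF = (\<lambda>_. 0)"

text \<open>All arrays written by the checks have numbers from 60 on, so the checks do not disturb
  the structure.\<close>

lemma structured_cong:
  assumes "structured I er n N s" "\<And>x. x < 60 \<Longrightarrow> t x = s x"
  shows "structured I er n N t"
proof -
  have e: "t xNR = s xNR" "t xR = s xR" "t xM = s xM" "t xN = s xN" "t xNS = s xNS" "t xNS1 = s xNS1" "t xMR = s xMR"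
    "t xEU = s xEU" "t xEV = s xEV" "t xCC = s xCC" "t xUS = s xUS" "t xOR = s xOR" "t xPA = s xPA" "t xPE = s xPE"
    "t xNC = s xNC" "t xNW = s xNW" "t xSC = s xSC" "t xSW = s xSW" "t xF = s xF"
    by (simp_all add: assms(2))
  show ?thesis using assms(1) unfolding structured_def sized_def e .
qed

definition preprocess :: prog where
  "preprocess = parse ;; find_wheel ;; find_order"

lemma lists_edges_edge_list:
  assumes "lists_edges es E" "\<And>j. j < length es \<Longrightarrow> es ! j = (eu j, ev j)"
  shows "edge_list (length es) eu ev E"
proof -
  have "map (\<lambda>(u, v). {u, v}) es = map (\<lambda>j. {eu j, ev j}) [0..<length es]"
    by (rule nth_equalityI) (simp_all add: assms(2))
  then show ?thesis using assms(1) by (simp add: lists_edges_def edge_list_def distinct_map lessThan_atLeast0)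
qed

lemma run_preprocess:
  fixes s :: memory
  assumes I: "valid_univne I" "is_wheel (virtual I)" "is_tree (substrate I)" "encodable I er es"
    and f: "\<forall>i<length (encode_univne I er es). s 0 i = encode_univne I er es ! i"
    and zero: "\<forall>x\<in>{xDG, xSN, xSD, xSJ, xF}. s x = (\<lambda>_. 0)"
  shows "structured I er (card (verts (virtual I)) - 1) (card (verts (substrate I))) (run preprocess (run header s))"
    "s 0 0 = card (verts (virtual I))" "s 0 1 = length er" "s 0 (2 + 2 * length er) = card (verts (substrate I))"
    "s 0 (3 + 2 * length er) = length es"
    "bij_betw (run preprocess (run header s) xPE) {..<card (verts (substrate I)) - 1} {..<length es}"
    "Suc i < card (verts (substrate I)) \<Longrightarrow>
      {run preprocess (run header s) xSU (run preprocess (run header s) xPE i), run preprocess (run header s) xSV (run preprocess (run header s) xPE i)} =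
      {run preprocess (run header s) xOR i, run preprocess (run header s) xPA i}"
proof -
  let ?N = "card (verts (substrate I))"
  define h where "h = run header s"
  define a where "a = run parse h"
  define b where "b = run find_wheel a"
  define d where "d = run find_order b"
  have d: "run preprocess (run header s) = d" by (simp add: preprocess_def h_def a_def b_def d_def)
  have fh: "h x = s x" if "x > 9 \<or> x < 2" for x using that by (auto simp: h_def run_frame)
  have fa: "a x = h x" if "x \<notin> {xJ, xT, xEU, xEV, xNC, xNW, xSU, xSV, xSC, xSW}" for x
    using that by (simp add: a_def parse_def run_frame)
  have fb: "b x = a x" if "x \<notin> {xJ, xDG, xSN, xCC, xUS}" for x
    using that by (simp add: b_def find_wheel_def run_frame)
  have fd: "d x = b x" if "x \<notin> {xJ, xSD, xSJ, xTL, xOR, xI, xPV, xPJ, xPP, xPA, xPE}" for x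
    using that by (simp add: d_def find_order_def run_frame)
  have P: "parsed (s 0) a" using run_parse[of s] by (simp add: a_def h_def)
  note L1 = parsed_layout[OF P]
  note len = encode_layout(1)[of I er es]
  have "layout (s 0) (card (verts (virtual I))) (length er) ?N (length es)
      (\<lambda>j. fst (er ! j)) (\<lambda>j. snd (er ! j)) (node_cap I) (node_cost I)
      (\<lambda>j. fst (es ! j)) (\<lambda>j. snd (es ! j))
      (\<lambda>j. edge_cap I {fst (es ! j), snd (es ! j)}) (\<lambda>j. edge_cost I {fst (es ! j), snd (es ! j)})"
    using encode_layout(2)[of I er es "[]"] unfolding layout_def by (simp add: f len)
  note L2 = this
  show "s 0 0 = card (verts (virtual I))" "s 0 1 = length er" "s 0 (2 + 2 * length er) = ?N" "s 0 (3 + 2 * length er) = length es"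
    using L2 by (auto simp: layout_def)
  have sc: "a xNR 0 = card (verts (virtual I))" "a xMR 0 = length er" "a xNS 0 = ?N" "a xMS 0 = length es"
    using L1 L2 by (auto simp: layout_def)
  have ar: "\<And>j. j < length er \<Longrightarrow> a xEU j = fst (er ! j) \<and> a xEV j = snd (er ! j)"
    "\<And>j. j < ?N \<Longrightarrow> a xNC j = node_cap I j \<and> a xNW j = node_cost I j"
    "\<And>j. j < length es \<Longrightarrow> a xSU j = fst (es ! j) \<and> a xSV j = snd (es ! j) \<and>
      a xSC j = edge_cap I {fst (es ! j), snd (es ! j)} \<and> a xSW j = edge_cost I {fst (es ! j), snd (es ! j)}"
    using L1 L2 unfolding layout_def by auto
  have enc: "verts (virtual I) = {..<card (verts (virtual I))}" "lists_edges er (edges (virtual I))"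
    "verts (substrate I) = {..<?N}" "lists_edges es (edges (substrate I))"
    using I(4) by (simp_all add: encodable_def)
  have elr: "edge_list (a xMR 0) (a xEU) (a xEV) (edges (virtual I))"
    unfolding sc by (rule lists_edges_edge_list[OF enc(2)]) (simp add: ar)
  have els: "edge_list (b xMS 0) (b xSU) (b xSV) (edges (substrate I))"
    unfolding fb[of xMS, simplified] fb[of xSU, simplified] fb[of xSV, simplified] sc
    by (rule lists_edges_edge_list[OF enc(4)]) (simp add: ar)
  have aN: "a xN 0 = a xNR 0 - 1" "a xNS1 0 = a xNS 0 - 1" "a xM 0 = 2 * a xNR 0" "a xR 0 = 3 * a xNR 0"
    using P by (simp_all add: parsed_def Let_def)
  have W: "wheel (a xNR 0 - 1) (b xCC 0) (b xUS)" "wheel.V (a xNR 0 - 1) (b xCC 0) (b xUS) = verts (virtual I)"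
    "wheel.E (a xNR 0 - 1) (b xCC 0) (b xUS) = edges (virtual I)" "a xNR 0 = Suc (a xNR 0 - 1)"
    using run_find_wheel[OF I(2) _ elr aN(1), folded b_def] enc(1) sc(1) zero by (simp_all add: fa fh)
  have T: "elimination ?N (d xOR) (d xPA)" "bij_betw (d xPE) {..<?N - 1} {..<b xMS 0}"
    "\<And>i. Suc i < ?N \<Longrightarrow> {b xSU (d xPE i), b xSV (d xPE i)} = {d xOR i, d xPA i}"
    using run_find_order[OF I(3) _ els, folded d_def] enc(3) sc zero aN by (simp_all add: fb fa fh)
  interpret elimination ?N "d xOR" "d xPA" by (rule T(1))
  have edge: "d xPE i < length es \<and> {fst (es ! d xPE i), snd (es ! d xPE i)} = {d xOR i, d xPA i}" if "Suc i < ?N" for i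
  proof -
    have "d xPE i < length es" using T(2) that sc by (auto simp: bij_betw_def fb)
    then show ?thesis using T(3)[OF that] ar(3) by (simp add: fb)
  qed
  show "bij_betw (run preprocess (run header s) xPE) {..<?N - 1} {..<length es}"
    using T(2) sc(4) unfolding d by (simp add: fb)
  show "{run preprocess (run header s) xSU (run preprocess (run header s) xPE i), run preprocess (run header s) xSV (run preprocess (run header s) xPE i)} =
      {run preprocess (run header s) xOR i, run preprocess (run header s) xPA i}" if "Suc i < ?N"
    using T(3)[OF that] unfolding d by (simp add: fd)
  have "edges (substrate I) = tree_edges"
  proof -
    have "edges (substrate I) = (\<lambda>j. {b xSU j, b xSV j}) ` {..<b xMS 0}" using els by (simp add: edge_list_def)
    also have "{..<b xMS 0} = d xPE ` {..<?N - 1}" using T(2) by (simp add: bij_betw_def)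
    also have "(\<lambda>j. {b xSU j, b xSV j}) ` d xPE ` {..<?N - 1} = (\<lambda>i. {d xOR i, d xPA i}) ` {..<?N - 1}"
      unfolding image_image using T(3) by (intro image_cong) auto
    also have "\<dots> = tree_edges" by (auto simp: tree_edges_def)
    finally show ?thesis .
  qed
  moreover have "er = map (\<lambda>j. (d xEU j, d xEV j)) [0..<d xMR 0]"
    by (rule nth_equalityI) (simp_all add: fd fb sc ar)
  moreover have "sized (card (verts (virtual I)) - 1) ?N d"
    using aN sc W(4) by (simp add: sized_def fd fb)
  moreover have "\<forall>i. Suc i < ?N \<longrightarrow> d xSC (d xPE i) = edge_cap I {d xOR i, d xPA i} \<and> d xSW (d xPE i) = edge_cost I {d xOR i, d xPA i}"
  proof (intro allI impI)
    fix i assume "Suc i < ?N"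
    from edge[OF this] ar(3)[of "d xPE i"]
    show "d xSC (d xPE i) = edge_cap I {d xOR i, d xPA i} \<and> d xSW (d xPE i) = edge_cost I {d xOR i, d xPA i}"
      by (simp add: fd fb)
  qed
  moreover have "verts (virtual I) = {..<Suc (card (verts (virtual I)) - 1)}" using enc(1) W(4) sc(1) by simp
  moreover have "wheel (card (verts (virtual I)) - 1) (d xCC 0) (d xUS)"
    "wheel.V (card (verts (virtual I)) - 1) (d xCC 0) (d xUS) = verts (virtual I)"
    "wheel.E (card (verts (virtual I)) - 1) (d xCC 0) (d xUS) = edges (virtual I)"
    using W(1-3) unfolding sc(1) by (simp_all add: fd)
  moreover have "\<forall>u<?N. d xNC u = node_cap I u \<and> d xNW u = node_cost I u" using ar(2) by (simp add: fd fb)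
  moreover have "d xF = (\<lambda>_. 0)" using zero by (simp add: fd fb fa fh)
  ultimately show "structured I er (card (verts (virtual I)) - 1) ?N (run preprocess (run header s))"
    unfolding d structured_def using T(1) enc(2,3) by blast
qed

section \<open>Computing an optimal mapping\<close>

definition evaluate :: prog where
  "evaluate = fill_tables ;; xVAL ::= xF\<lbrakk>xOF\<lbrakk>xOR\<lbrakk>\<langle>xNS1\<rangle>\<rbrakk>\<rbrakk> \<oplus> (\<langle>xN\<rangle> \<oplus> \<langle>xM\<rangle>)\<rbrakk>"

definition answer :: prog where
  "answer = Cond (Eq \<langle>xVAL\<rangle> (Const 0)) (0\<lbrakk>Const 0\<rbrakk> ::= Const 0 ;; 1 ::= Const 1) (trace ;; place ;; output_mapping)"

definition solve :: prog where
  "solve = preprocess ;; evaluate ;; answer"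

text \<open>\<open>VAL\<close> is the table entry of the last node for the demand of the whole
  wheel. Every feasible mapping shows that it is positive and bounds it from above; if it is
  positive, tracing it back yields a mapping of exactly this cost.\<close>

lemma run_evaluate:
  fixes s :: memory
  assumes s: "structured I er n N s"
  defines "t \<equiv> run evaluate s"
  shows "\<And>m. feasible I m \<Longrightarrow> 0 < t xVAL 0 \<and> t xVAL 0 - 1 \<le> mapping_cost I m"
    and "0 < t xVAL 0 \<Longrightarrow> \<exists>m. feasible I m \<and> mapping_cost I m = t xVAL 0 - 1 \<and>
      output_list (run answer t) = 1 # encode_mapping I er m"
    and "t xVAL 0 = 0 \<Longrightarrow> output_list (run answer t) = [0]"
proof -
  let ?v = "s xOR" and ?p = "s xPA" and ?c = "s xCC 0" and ?r = "s xUS"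
  note S = s[unfolded structured_def]
  have sz: "sized n N s" and zero: "s xF = (\<lambda>_. 0)" using S by blast+
  interpret wheel_on_tree N ?v ?p n ?c ?r I
    using S by (simp add: wheel_on_tree_def wheel_on_tree_axioms_def)
  define a where "a = run fill_tables s"
  have fa: "a x = s x" if "x \<notin> {xOF, xT, xCR, xI, xPJ, xOV, xOP, xOI, xJ, xW, xG, xA, xH, xCH, xK, xF}" for x
    using that by (simp add: a_def run_frame)
  have t: "t = upd xVAL 0 (a xF (a xOF (a xOR (a xNS1 0)) + (a xN 0 + a xM 0))) a"
    by (simp add: t_def evaluate_def a_def)
  have ft: "t x = a x" if "x \<noteq> xVAL" for x using that by (simp add: t)
  let ?R = "3 * Suc n"
  let ?ch = "\<lambda>i d. a xCH (i * ?R + d)"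
  have n1: "1 \<le> n" using n3 by simp
  obtain F where F: "tables ?R (valid n) (\<lambda>u. node_value n (s xNC u) (s xNW u)) (\<lambda>i. edge_value n (s xSC (s xPE i)) (s xSW (s xPE i))) F ?ch (N - 1)"
    and aF: "\<And>u d. u < N \<Longrightarrow> d < ?R \<Longrightarrow> a xF (u * ?R + d) = F (N - 1) u d"
    using run_fill_tables(1)[OF sz n1 refl refl zero, folded a_def] by blast
  have OF: "a xOF j = j * ?R" if "j \<le> N" for j
    using run_fill_tables(2)[OF sz n1 refl refl zero that, folded a_def] .
  have W: "wtables F ?ch (N - 1)"
    unfolding tables_def
  proof (intro conjI allI impI)
    show "F 0 u d = node_entry u d" if "u < N" "d < ?R" for u d
      using F S that by (simp add: tables_def node_entry_def node_value_def)
    show "F (Suc i) u d = F i u d" if "i < N - 1" "u < N" "d < ?R" "u \<noteq> ?p i" for i u d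
      using F that unfolding tables_def by blast
    fix i d assume i: "i < N - 1" "d < ?R"
    then have "merged (valid n) (F i (?p i)) (\<lambda>q. join (F i (?v i) q) (edge_value n (s xSC (s xPE i)) (s xSW (s xPE i)) q)) (F (Suc i) (?p i)) (?ch i) d"
      using F unfolding tables_def by blast
    moreover have "edge_value n (s xSC (s xPE i)) (s xSW (s xPE i)) q = edge_entry i q" for q
      using S i by (simp add: edge_value_def edge_entry_def ecap_def ecost_def)
    ultimately show "merged (valid n) (F i (?p i)) (\<lambda>q. join (F i (?v i) q) (edge_entry i q)) (F (Suc i) (?p i)) (?ch i) d"
      by simp
  qed
  have root: "?v (N - 1) < N" using v_less[of "N - 1"] N_pos by simp
  have sc: "a xOR = ?v" "a xNS1 0 = N - 1" "a xN 0 = n" "a xM 0 = 2 * Suc n" using sz by (simp_all add: fa sized_def)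
  have val: "t xVAL 0 = F (N - 1) (?v (N - 1)) full"
    unfolding t using aF[OF root, of full] OF[of "?v (N - 1)"] root sc by simp
  show "0 < t xVAL 0 \<and> t xVAL 0 - 1 \<le> mapping_cost I m" if "feasible I m" for m
    using lower_bound[OF W, of "fst m" "snd m"] that unfolding val by simp
  show "output_list (run answer t) = [0]" if "t xVAL 0 = 0"
    using that by (simp add: answer_def output_list_def)
  assume pos: "0 < t xVAL 0"
  define b where "b = run trace t"
  define c where "c = run place b"
  have fb: "b x = t x" if "x \<notin> {xI, xT, xPV, xPP, xA, xDE, xST}" for x using that by (simp add: b_def run_frame)
  have fc: "c x = b x" if "x \<notin> {xI, xT, xMV, xJ}" for x using that by (simp add: c_def run_frame)
  have szt: "sized n N t" by (rule sized_cong[OF sz]) (auto simp: ft fa)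
  have szb: "sized n N b" by (rule sized_cong[OF sz]) (auto simp: fb ft fa)
  have "\<exists>dem. traced (\<lambda>i d. t xCH (i * ?R + d)) full dem 0 \<and> (\<forall>u<N. b xDE u = dem 0 u) \<and> b xST (?v (N - 1)) = 0 \<and>
    (\<forall>i. Suc i < N \<longrightarrow> b xST (?v i) = b xST (?p i) + count n (dem i (?p i)))"
    unfolding b_def by (rule run_trace[OF szt]) (simp_all add: ft fa OF)
  then obtain dem where dem: "traced ?ch full dem 0" "\<And>u. u < N \<Longrightarrow> b xDE u = dem 0 u" "b xST (?v (N - 1)) = 0"
    "\<And>i. Suc i < N \<Longrightarrow> b xST (?v i) = b xST (?p i) + count n (dem i (?p i))"
    by (auto simp: ft)
  note TF = trace_facts[OF W dem(1) pos[unfolded val] dem(3,4)]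
  have ws: "wheel n (b xCC 0) (b xUS)" using wheel_axioms by (simp add: fb ft fa)
  have once: "u = u'" if "u < N" "u' < N" "b xST u \<le> j" "j < b xST u + count n (b xDE u)"
    "b xST u' \<le> j" "j < b xST u' + count n (b xDE u')" for u u' j
  proof -
    have "j < n" using TF(6)[of 0 u] that(1,4) dem(2) by (simp add: remaining_0)
    then show ?thesis using TF(7)[of 0 j] that dem(2) by (auto simp: remaining_0)
  qed
  have bound: "b xST u + count n (b xDE u) \<le> n" if "u < N" for u using TF(6)[of 0 u] that dem(2) by (simp add: remaining_0)
  have cen: "u = u'" if "u < N" "u' < N" "centred n (b xDE u)" "centred n (b xDE u')" for u u'
    using TF(8)[of 0] that dem(2) by (auto simp: remaining_0)
  have P1: "c xMV (?r j) = u" if "u < N" "b xST u \<le> j" "j < b xST u + count n (dem 0 u)" for u j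
  proof -
    have "c xMV (b xUS j) = u"
      unfolding c_def by (rule run_place(1)[OF ws szb bound once cen]) (use that dem(2) in simp_all)
    then show ?thesis by (simp add: fb ft fa)
  qed
  have P2: "c xMV ?c = u" if "u < N" "centred n (dem 0 u)" for u
  proof -
    have "c xMV (b xCC 0) = u"
      unfolding c_def by (rule run_place(2)[OF ws szb bound once cen]) (use that dem(2) in simp_all)
    then show ?thesis by (simp add: fb ft fa)
  qed
  note UB = upper_bound[where mV = "c xMV", OF W dem(1) pos[unfolded val] dem(3,4) P1 P2]
  have mV: "c xMV ` V \<subseteq> {..<N}" using UB(1) by blast
  define eu where "eu = s xEU"
  define ev where "ev = s xEV"
  define mr where "mr = s xMR 0"
  have er: "er = map (\<lambda>j. (eu j, ev j)) [0..<mr]" using S unfolding eu_def ev_def mr_def by blast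
  have ler: "length er = mr" "\<And>j. j < length er \<Longrightarrow> er ! j = (eu j, ev j)" unfolding er by simp_all
  have "lists_edges er (edges (virtual I))" using S by blast
  then have el: "edge_list mr eu ev E"
    using lists_edges_edge_list[OF _ ler(2)] unfolding ler(1) virtual_I(2) by blast
  have ends: "eu j \<in> V \<and> ev j \<in> V" if "j < mr" for j
    using E_edges[of "{eu j, ev j}"] el that by (auto simp: edge_list_def)
  define path where "path j = tree_path (c xMV (eu j)) (c xMV (ev j))" for j
  \<comment> \<open>A mapping assigns paths to edges as sets, the program to edge indices; inverting
    the enumeration of the edges connects the two.\<close>
  define mE where "mE d = path (inv_into {..<mr} (\<lambda>j. {eu j, ev j}) d)" for d
  have mEj: "mE {eu j, ev j} = path j" if "j < mr" for j
    using el that inv_into_f_f[of "\<lambda>j. {eu j, ev j}" "{..<mr}" j] by (simp add: mE_def edge_list_def)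
  have im: "is_mapping I (c xMV, mE)"
    unfolding is_mapping_def prod.case
  proof (intro conjI ballI)
    show "c xMV ` verts (virtual I) \<subseteq> verts (substrate I)" using mV virtual_I substrate_I by simp
    fix d assume "d \<in> edges (virtual I)"
    then have "d \<in> (\<lambda>j. {eu j, ev j}) ` {..<mr}" using el virtual_I by (simp add: edge_list_def)
    then obtain j where j: "j < mr" "d = {eu j, ev j}" by blast
    have lt: "c xMV (eu j) < N" "c xMV (ev j) < N" using mV ends[OF j(1)] by auto
    note TP = tree_path[OF lt]
    show "is_path (substrate I) (mE d)"
      unfolding j(2) mEj[OF j(1)] path_def is_path_def using TP substrate_I by simp
    show "{hd (mE d), last (mE d)} = c xMV ` d"
      unfolding j(2) mEj[OF j(1)] path_def using TP by simp
  qed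
  then have feas: "feasible I (c xMV, mE)" "mapping_cost I (c xMV, mE) = t xVAL 0 - 1"
    using UB(2) unfolding val by blast+
  have fcs: "c x = s x" if "x \<in> {xOR, xPA, xNS1, xNS, xEU, xEV, xMR, xNR}" for x
    using that by (auto simp: fc fb ft fa)
  have "output_list (run output_mapping c) =
    1 # map (c xMV) [0..<c xNR 0] @ concat (map (\<lambda>j. length (path j) # path j) [0..<c xMR 0])"
  proof -
    have "c xMV (c xEU j) < N \<and> c xMV (c xEV j) < N" if "j < c xMR 0" for j
      using mV ends[of j] that by (auto simp: fcs eu_def ev_def mr_def)
    then show ?thesis
      using run_output_mapping[of c] sz by (simp add: fcs path_def eu_def ev_def sized_def)
  qed
  moreover have run_answer: "run answer t = run output_mapping c" using pos by (simp add: answer_def b_def c_def)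
  moreover have "map (\<lambda>(u, v). length (mE {u, v}) # mE {u, v}) er = map (\<lambda>j. length (path j) # path j) [0..<mr]"
    unfolding er by (simp add: mEj)
  moreover have "card (verts (virtual I)) = c xNR 0" using S sz by (simp add: fcs sized_def)
  ultimately have "output_list (run answer t) = 1 # encode_mapping I er (c xMV, mE)"
    unfolding run_answer by (simp add: encode_mapping_def fcs mr_def)
  then show "\<exists>m. feasible I m \<and> mapping_cost I m = t xVAL 0 - 1 \<and> output_list (run answer t) = 1 # encode_mapping I er m"
    using feas by blast
qed

lemma correct_answer_run_solve:
  fixes s :: memory
  assumes I: "valid_univne I" "is_wheel (virtual I)" "is_tree (substrate I)" "encodable I er es"
    and f: "\<forall>i<length (encode_univne I er es). s 0 i = encode_univne I er es ! i"
    and zero: "\<forall>x\<in>{xDG, xSN, xSD, xSJ, xF}. s x = (\<lambda>_. 0)"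
  shows "correct_answer I er (output_list (run solve (run header s)))"
proof -
  let ?s = "run preprocess (run header s)"
  let ?t = "run evaluate ?s"
  note E = run_evaluate[OF run_preprocess(1)[OF I f zero]]
  have run: "run solve (run header s) = run answer ?t" by (simp add: solve_def)
  show ?thesis
  proof (cases "0 < ?t xVAL 0")
    case True
    then obtain m where m: "feasible I m" "mapping_cost I m = ?t xVAL 0 - 1"
      "output_list (run answer ?t) = 1 # encode_mapping I er m" using E(2) by blast
    have min: "min_cost_feasible I m"
      unfolding min_cost_feasible_def m(2) using m(1) E(1) by blast
    have ex: "\<exists>m. feasible I m" using m(1) by blast
    show ?thesis unfolding correct_answer_def run if_P[OF ex] by (rule exI[of _ m], rule conjI[OF min m(3)])
  next
    case False
    then have none: "\<not> (\<exists>m. feasible I m)" using E(1) by (meson)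
    have "?t xVAL 0 = 0" using False by simp
    then show ?thesis unfolding correct_answer_def run if_not_P[OF none] by (rule E(3))
  qed
qed

section \<open>The optimisation problem in time \<open>O(n\<^sub>r\<^sup>2 n\<^sub>s)\<close>\<close>

lemma lists_edges_length: "lists_edges es E \<Longrightarrow> length es = card E"
  unfolding lists_edges_def by (metis distinct_card length_map)

text \<open>A wheel has \<open>2 * n\<close> edges and a tree \<open>N - 1\<close>, so loops over
  edges cost no more than loops over nodes, up to a constant.\<close>

lemma structured_sizes:
  assumes "structured I er n N s"
  shows "3 \<le> n" "0 < N" "card (edges (virtual I)) = 2 * n" "card (edges (substrate I)) = N - 1"
proof -
  note S = assms[unfolded structured_def]
  interpret wheel n "s xCC 0" "s xUS" using S by blast
  interpret elimination N "s xOR" "s xPA" using S by blast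
  show "3 \<le> n" by (rule n3)
  show "0 < N" by (rule N_pos)
  show "card (edges (virtual I)) = 2 * n" using S card_E by simp
  have "tree_edges = (\<lambda>i. {s xOR i, s xPA i}) ` {..<N - 1}" by (auto simp: tree_edges_def)
  moreover have "inj_on (\<lambda>i. {s xOR i, s xPA i}) {..<N - 1}" using tree_edge_inj by (intro inj_onI) auto
  ultimately have "card tree_edges = N - 1" by (simp add: card_image)
  then show "card (edges (substrate I)) = N - 1" using S by simp
qed

lemmas solve_defs = solve_def preprocess_def evaluate_def answer_def parse_def find_wheel_def find_order_def
  parse1_def parse2_def parse3_def rim_degrees_def find_centre_def find_rim_edge_def walk_rim_def
  tree_degrees_def find_leaves_def leaf_step_def peel_def peel_step_def fill_tables_def
  row_offsets_def arc_table_def arc_step_def node_tables_def node_row_def node_step_def merge_all_def merge_step_def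
  load_stage_def multiples_def edge_row_def edge_step_def convolve_def convolve_step_def try_split_def copy_row_def
  trace_def trace_step_def place_def place_node_def place_centre_def place_rim_def output_mapping_def edge_output_def
  find_path_def path_step_def emit_path_def emit_def

lemma solve_wf: "wf_prog solve" "loop_bounds solve \<inter> writes solve = {}"
  by (simp_all add: solve_defs)

text \<open>The decisive nest is the merge: one loop over the stages and, inside it, two over the
  entries of a row. Path output needs only one loop over virtual edges around one over the
  tree.\<close>

lemma solve_nest: "nest {xNR, xMR, xR} {xNS, xMS, xNS1} solve 2 1"
  by (simp add: solve_defs)

lemma header_wf: "wf_prog header" "loop_bounds header \<inter> writes header = {}" "time_bound header B = const_size header"
  by (simp_all add: header_def)

lemma input_memory_zero: "2 \<le> x \<Longrightarrow> input_memory xs x = (\<lambda>_. 0)"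
  by (auto simp: input_memory_def fun_eq_iff)

lemma solve_time:
  assumes I: "valid_univne I" "is_wheel (virtual I)" "is_tree (substrate I)" "encodable I er es"
  defines "xs \<equiv> encode_univne I er es"
  shows "\<exists>ys t. computes_in unit_cost (Seq (compile header) (compile solve)) xs ys t \<and>
    t \<le> (const_size header + const_size solve) * (card (verts (virtual I)))\<^sup>2 * card (verts (substrate I)) \<and>
    correct_answer I er ys"
proof -
  let ?s = "input_memory xs"
  let ?nr = "card (verts (virtual I))" and ?ns = "card (verts (substrate I))"
  have f: "\<forall>i<length (encode_univne I er es). ?s 0 i = encode_univne I er es ! i"
    by (simp add: input_memory_def xs_def)
  have zero: "\<forall>x\<in>{xDG, xSN, xSD, xSJ, xF}. ?s x = (\<lambda>_. 0)" by (simp add: input_memory_zero)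
  note P = run_preprocess[OF I f zero]
  note Z = structured_sizes[OF P(1)]
  have len: "length er = 2 * (?nr - 1)" "length es = ?ns - 1"
    using Z I(4) lists_edges_length by (auto simp: encodable_def)
  let ?h = "run header ?s"
  have B: "?h xNR 0 = ?nr" "?h xMR 0 = length er" "?h xNS 0 = ?ns" "?h xMS 0 = length es" "?h xR 0 = 3 * ?nr" "?h xNS1 0 = ?ns - 1"
    using run_header[of ?s] P(2-4) P(5)[unfolded add.commute[of 3]] by (simp_all add: mult_2 [symmetric])
  have tb: "time_bound solve (\<lambda>x. ?h x 0) \<le> const_size solve * (?nr ^ 2 * ?ns ^ 1)"
  proof (rule time_bound_nest[OF _ _ _ _ solve_nest])
    show "?h x 0 \<le> 3 * ?nr" if "x \<in> {xNR, xMR, xR}" for x using that B len by auto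
    show "?h x 0 \<le> 3 * ?ns" if "x \<in> {xNS, xMS, xNS1}" for x using that B len by auto
  qed (use Z in auto)
  obtain t1 where t1: "t1 \<le> const_size header" "exec unit_cost (compile header) ?s t1 ?h"
    using exec_compile[OF header_wf(1,2)] header_wf(3) by metis
  obtain t2 where t2: "t2 \<le> time_bound solve (\<lambda>x. ?h x 0)" "exec unit_cost (compile solve) ?h t2 (run solve ?h)"
    using exec_compile[OF solve_wf] by blast
  have "1 \<le> ?nr ^ 2 * ?ns" using Z by (simp add: Suc_le_eq)
  from mult_le_mono2[OF this, of "const_size header"]
  have "const_size header \<le> const_size header * (?nr ^ 2 * ?ns)" by (simp only: mult_1_right)
  moreover have "t2 \<le> const_size solve * (?nr ^ 2 * ?ns)" using tb t2(1) by simp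
  ultimately have "t1 + t2 \<le> const_size header * (?nr ^ 2 * ?ns) + const_size solve * (?nr ^ 2 * ?ns)" using t1(1) by linarith
  then have "t1 + t2 \<le> (const_size header + const_size solve) * ?nr\<^sup>2 * ?ns" by (simp add: algebra_simps)
  moreover have "computes_in unit_cost (Seq (compile header) (compile solve)) xs (output_list (run solve ?h)) (t1 + t2)"
    unfolding computes_in_def using exec.Seq[OF t1(2) t2(2)] by blast
  moreover have "correct_answer I er (output_list (run solve ?h))"
    by (rule correct_answer_run_solve[OF I f zero])
  ultimately show ?thesis by blast
qed


section \<open>Recognising well-formed instances\<close>

abbreviation (input) xBAD :: nat where "xBAD \<equiv> 70"
abbreviation (input) xFND :: nat where "xFND \<equiv> 71"

definition require :: "bexp \<Rightarrow> prog" where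
  "require b = Cond b Nop (xBAD ::= Const 1)"

definition search :: "nat \<Rightarrow> bexp \<Rightarrow> prog" where
  "search b c = xFND ::= Const 0 ;; For xK b (Cond c (xFND ::= Const 1) Nop)"

lemma writes_check [simp]: "writes (require b) = {xBAD}" "writes (search x c) = {xFND, xK}"
  by (auto simp: require_def search_def)

lemma run_require [simp]: "run (require b) s xBAD 0 = 0 \<longleftrightarrow> s xBAD 0 = 0 \<and> bval b s"
  by (simp add: require_def)

lemma run_require_other [simp]: "x \<noteq> xBAD \<Longrightarrow> run (require b) s x = s x"
  by (simp add: run_frame)

lemma run_search_other [simp]: "x \<noteq> xFND \<Longrightarrow> x \<noteq> xK \<Longrightarrow> run (search b c) s x = s x"
  by (simp add: run_frame)

lemma run_search:
  assumes "b \<noteq> xFND" "b \<noteq> xK"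
    and c: "\<And>k t. t xK 0 = k \<Longrightarrow> (\<And>x. x \<notin> {xFND, xK} \<Longrightarrow> t x = s x) \<Longrightarrow> bval c t \<longleftrightarrow> \<phi> k"
  shows "run (search b c) s xFND 0 = (if \<exists>k<s b 0. \<phi> k then 1 else 0)"
proof -
  let ?s = "upd xFND 0 0 s"
  let ?P = "\<lambda>k t. (\<forall>x. x \<notin> {xFND, xK} \<longrightarrow> t x = s x) \<and> t xFND 0 = (if \<exists>j<k. \<phi> j then 1 else 0)"
  have "?P (?s b 0) (run (For xK b (Cond c (xFND ::= Const 1) Nop)) ?s)"
  proof (rule run_For_inv[where P = ?P], goal_cases)
    case (3 k t)
    have "bval c t \<longleftrightarrow> \<phi> k" using 3(2,3) by (intro c) auto
    then show ?case using 3(2) by (auto simp: less_Suc_eq)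
  qed simp_all
  then show ?thesis using assms(1) by (simp add: search_def)
qed

lemma run_check_loop:
  assumes v: "v \<noteq> xBAD"
    and p: "\<And>k t. k < s b 0 \<Longrightarrow> t v 0 = k \<Longrightarrow> (\<And>x. x \<notin> insert v (writes p) \<Longrightarrow> t x = s x) \<Longrightarrow>
      run p t xBAD 0 = 0 \<longleftrightarrow> t xBAD 0 = 0 \<and> \<phi> k"
  shows "run (For v b p) s xBAD 0 = 0 \<longleftrightarrow> s xBAD 0 = 0 \<and> (\<forall>k<s b 0. \<phi> k)"
proof (rule run_For_inv[where P = "\<lambda>k t. t xBAD 0 = 0 \<longleftrightarrow> s xBAD 0 = 0 \<and> (\<forall>j<k. \<phi> j)"], goal_cases)
  case (3 k t)
  have "run p t xBAD 0 = 0 \<longleftrightarrow> t xBAD 0 = 0 \<and> \<phi> k" using 3 by (intro p)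
  then show ?case using 3(2) by (auto simp: less_Suc_eq)
qed (use v in simp_all)

definition same_edge :: "aexp \<Rightarrow> aexp \<Rightarrow> aexp \<Rightarrow> aexp \<Rightarrow> bexp" where
  "same_edge a b c d = Or (And (Eq a c) (Eq b d)) (And (Eq a d) (Eq b c))"

lemma bval_same_edge [simp]: "bval (same_edge a b c d) s \<longleftrightarrow> {aval a s, aval b s} = {aval c s, aval d s}"
  by (auto simp: same_edge_def doubleton_eq_iff)

text \<open>On arbitrary input the preprocessing terminates with some candidate for the wheel and the
  elimination order; it suffices to verify this candidate.\<close>

definition check_virtual :: prog where
  "check_virtual = For xJ xMR (
     require (Less (xEU\<lbrakk>\<langle>xJ\<rangle>\<rbrakk>) \<langle>xNR\<rangle>) ;; require (Less (xEV\<lbrakk>\<langle>xJ\<rangle>\<rbrakk>) \<langle>xNR\<rangle>) ;; require (Not (Eq (xEU\<lbrakk>\<langle>xJ\<rangle>\<rbrakk>) (xEV\<lbrakk>\<langle>xJ\<rangle>\<rbrakk>))) ;;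
     search xMR (And (Less \<langle>xK\<rangle> \<langle>xJ\<rangle>) (same_edge (xEU\<lbrakk>\<langle>xJ\<rangle>\<rbrakk>) (xEV\<lbrakk>\<langle>xJ\<rangle>\<rbrakk>) (xEU\<lbrakk>\<langle>xK\<rangle>\<rbrakk>) (xEV\<lbrakk>\<langle>xK\<rangle>\<rbrakk>))) ;;
     require (Eq \<langle>xFND\<rangle> (Const 0)) ;;
     search xN (same_edge (xEU\<lbrakk>\<langle>xJ\<rangle>\<rbrakk>) (xEV\<lbrakk>\<langle>xJ\<rangle>\<rbrakk>) (xUS\<lbrakk>\<langle>xK\<rangle>\<rbrakk>) (xUS\<lbrakk>\<langle>xK\<rangle> \<oplus> Const 1\<rbrakk>)) ;;
     require (Or (Eq (xEU\<lbrakk>\<langle>xJ\<rangle>\<rbrakk>) \<langle>xCC\<rangle>) (Or (Eq (xEV\<lbrakk>\<langle>xJ\<rangle>\<rbrakk>) \<langle>xCC\<rangle>) (Eq \<langle>xFND\<rangle> (Const 1)))))"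

definition check_rim :: prog where
  "check_rim = require (Less \<langle>xCC\<rangle> \<langle>xNR\<rangle>) ;; require (Eq (xUS\<lbrakk>\<langle>xN\<rangle>\<rbrakk>) (xUS\<lbrakk>Const 0\<rbrakk>)) ;;
     For xJ xNR (search xN (Eq (xUS\<lbrakk>\<langle>xK\<rangle>\<rbrakk>) \<langle>xJ\<rangle>) ;; require (Or (Eq \<langle>xJ\<rangle> \<langle>xCC\<rangle>) (Eq \<langle>xFND\<rangle> (Const 1))))"

definition check_nodes :: prog where
  "check_nodes = For xJ xNS (require (Less (Const 0) (xNC\<lbrakk>\<langle>xJ\<rangle>\<rbrakk>)) ;;
     search xNS (Eq (xOR\<lbrakk>\<langle>xK\<rangle>\<rbrakk>) \<langle>xJ\<rangle>) ;; require (Eq \<langle>xFND\<rangle> (Const 1)))"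

definition check_edges :: prog where
  "check_edges = For xJ xMS (require (Less (Const 0) (xSC\<lbrakk>\<langle>xJ\<rangle>\<rbrakk>)) ;;
     search xNS1 (Eq (xPE\<lbrakk>\<langle>xK\<rangle>\<rbrakk>) \<langle>xJ\<rangle>) ;; require (Eq \<langle>xFND\<rangle> (Const 1)))"

definition check_parents :: prog where
  "check_parents = For xJ xNS1 (
     search xNS (And (Less \<langle>xJ\<rangle> \<langle>xK\<rangle>) (Eq (xPA\<lbrakk>\<langle>xJ\<rangle>\<rbrakk>) (xOR\<lbrakk>\<langle>xK\<rangle>\<rbrakk>))) ;; require (Eq \<langle>xFND\<rangle> (Const 1)) ;;
     require (Less (xPE\<lbrakk>\<langle>xJ\<rangle>\<rbrakk>) \<langle>xMS\<rangle>) ;;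
     require (same_edge (xSU\<lbrakk>xPE\<lbrakk>\<langle>xJ\<rangle>\<rbrakk>\<rbrakk>) (xSV\<lbrakk>xPE\<lbrakk>\<langle>xJ\<rangle>\<rbrakk>\<rbrakk>) (xOR\<lbrakk>\<langle>xJ\<rangle>\<rbrakk>) (xPA\<lbrakk>\<langle>xJ\<rangle>\<rbrakk>)))"

definition checks :: prog where
  "checks = check_virtual ;; check_rim ;; check_nodes ;; check_edges ;; check_parents"

lemma writes_checks [simp]:
  "writes check_virtual = {xJ, xBAD, xFND, xK}" "writes check_rim = {xJ, xBAD, xFND, xK}" "writes check_nodes = {xJ, xBAD, xFND, xK}"
  "writes check_edges = {xJ, xBAD, xFND, xK}" "writes check_parents = {xJ, xBAD, xFND, xK}" "writes checks = {xJ, xBAD, xFND, xK}"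
  by (auto simp: check_virtual_def check_rim_def check_nodes_def check_edges_def check_parents_def checks_def)

definition good_virtual :: "memory \<Rightarrow> bool" where
  "good_virtual s \<longleftrightarrow> (\<forall>j<s xMR 0. s xEU j < s xNR 0 \<and> s xEV j < s xNR 0 \<and> s xEU j \<noteq> s xEV j \<and>
     \<not> (\<exists>k<s xMR 0. k < j \<and> {s xEU j, s xEV j} = {s xEU k, s xEV k}) \<and>
     (s xEU j = s xCC 0 \<or> s xEV j = s xCC 0 \<or> (\<exists>k<s xN 0. {s xEU j, s xEV j} = {s xUS k, s xUS (Suc k)})))"

definition good_rim :: "memory \<Rightarrow> bool" where
  "good_rim s \<longleftrightarrow> s xCC 0 < s xNR 0 \<and> s xUS (s xN 0) = s xUS 0 \<and> (\<forall>j<s xNR 0. j = s xCC 0 \<or> (\<exists>k<s xN 0. s xUS k = j))"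

definition good_nodes :: "memory \<Rightarrow> bool" where
  "good_nodes s \<longleftrightarrow> (\<forall>j<s xNS 0. 0 < s xNC j \<and> (\<exists>k<s xNS 0. s xOR k = j))"

definition good_edges :: "memory \<Rightarrow> bool" where
  "good_edges s \<longleftrightarrow> (\<forall>j<s xMS 0. 0 < s xSC j \<and> (\<exists>k<s xNS1 0. s xPE k = j))"

definition good_parents :: "memory \<Rightarrow> bool" where
  "good_parents s \<longleftrightarrow> (\<forall>j<s xNS1 0. (\<exists>k<s xNS 0. j < k \<and> s xPA j = s xOR k) \<and> s xPE j < s xMS 0 \<and>
     {s xSU (s xPE j), s xSV (s xPE j)} = {s xOR j, s xPA j})"

definition good :: "memory \<Rightarrow> bool" where
  "good s \<longleftrightarrow> good_virtual s \<and> good_rim s \<and> good_nodes s \<and> good_edges s \<and> good_parents s"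

lemma good_cong:
  assumes "\<And>x. x < 60 \<Longrightarrow> t x = s x"
  shows "good_virtual t = good_virtual s" "good_rim t = good_rim s" "good_nodes t = good_nodes s" "good_edges t = good_edges s"
    "good_parents t = good_parents s"
  by (simp_all add: good_virtual_def good_rim_def good_nodes_def good_edges_def good_parents_def assms)

lemma run_check_virtual: "run check_virtual s xBAD 0 = 0 \<longleftrightarrow> s xBAD 0 = 0 \<and> good_virtual s"
  unfolding check_virtual_def good_virtual_def
proof (rule run_check_loop, goal_cases)
  case (2 k t)
  have fr: "t x = s x" if "x < 60" for x using 2(3)[of x] that by simp
  define a where "a = run (require (Not (Eq (xEU\<lbrakk>\<langle>xJ\<rangle>\<rbrakk>) (xEV\<lbrakk>\<langle>xJ\<rangle>\<rbrakk>)))) (run (require (Less (xEV\<lbrakk>\<langle>xJ\<rangle>\<rbrakk>) \<langle>xNR\<rangle>)) (run (require (Less (xEU\<lbrakk>\<langle>xJ\<rangle>\<rbrakk>) \<langle>xNR\<rangle>)) t))"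
  let ?c1 = "And (Less \<langle>xK\<rangle> \<langle>xJ\<rangle>) (same_edge (xEU\<lbrakk>\<langle>xJ\<rangle>\<rbrakk>) (xEV\<lbrakk>\<langle>xJ\<rangle>\<rbrakk>) (xEU\<lbrakk>\<langle>xK\<rangle>\<rbrakk>) (xEV\<lbrakk>\<langle>xK\<rangle>\<rbrakk>))"
  let ?c2 = "same_edge (xEU\<lbrakk>\<langle>xJ\<rangle>\<rbrakk>) (xEV\<lbrakk>\<langle>xJ\<rangle>\<rbrakk>) (xUS\<lbrakk>\<langle>xK\<rangle>\<rbrakk>) (xUS\<lbrakk>\<langle>xK\<rangle> \<oplus> Const 1\<rbrakk>)"
  have ax: "a x = t x" if "x \<noteq> xBAD" for x using that by (simp add: a_def)
  have aB: "a xBAD 0 = 0 \<longleftrightarrow> t xBAD 0 = 0 \<and> s xEU k < s xNR 0 \<and> s xEV k < s xNR 0 \<and> s xEU k \<noteq> s xEV k"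
    using 2(2) by (simp add: a_def fr conj_assoc)
  define b where "b = run (require (Eq \<langle>xFND\<rangle> (Const 0))) (run (search xMR ?c1) a)"
  have bx: "b x = t x" if "x \<notin> {xBAD, xFND, xK}" for x using that by (simp add: b_def ax)
  have "run (search xMR ?c1) a xFND 0 = (if \<exists>i<a xMR 0. i < k \<and> {s xEU k, s xEV k} = {s xEU i, s xEV i} then 1 else 0)"
  proof (rule run_search)
    fix i and u :: memory assume u: "u xK 0 = i" "\<And>x. x \<notin> {xFND, xK} \<Longrightarrow> u x = a x"
    have ux: "u x = t x" if "x \<notin> {xFND, xK, xBAD}" for x using u(2)[of x] that ax by auto
    show "bval ?c1 u \<longleftrightarrow> i < k \<and> {s xEU k, s xEV k} = {s xEU i, s xEV i}" using u(1) 2(2) by (simp add: ux fr)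
  qed simp_all
  then have bB: "b xBAD 0 = 0 \<longleftrightarrow> a xBAD 0 = 0 \<and> \<not> (\<exists>i<s xMR 0. i < k \<and> {s xEU k, s xEV k} = {s xEU i, s xEV i})"
    by (auto simp: b_def ax fr)
  have "run (search xN ?c2) b xFND 0 = (if \<exists>i<b xN 0. {s xEU k, s xEV k} = {s xUS i, s xUS (Suc i)} then 1 else 0)"
  proof (rule run_search)
    fix i and u :: memory assume u: "u xK 0 = i" "\<And>x. x \<notin> {xFND, xK} \<Longrightarrow> u x = b x"
    have ux: "u x = t x" if "x \<notin> {xFND, xK, xBAD}" for x using u(2)[of x] that bx by auto
    show "bval ?c2 u \<longleftrightarrow> {s xEU k, s xEV k} = {s xUS i, s xUS (Suc i)}" using u(1) 2(2) by (simp add: ux fr)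
  qed simp_all
  then show ?case
    unfolding run.simps(3) a_def[symmetric] b_def[symmetric] run_require bB aB using 2(2)
    by (auto simp: bB aB bx fr)
qed simp

lemma run_check_rim: "run check_rim s xBAD 0 = 0 \<longleftrightarrow> s xBAD 0 = 0 \<and> good_rim s"
proof -
  let ?a = "run (require (Eq (xUS\<lbrakk>\<langle>xN\<rangle>\<rbrakk>) (xUS\<lbrakk>Const 0\<rbrakk>))) (run (require (Less \<langle>xCC\<rangle> \<langle>xNR\<rangle>)) s)"
  have "run check_rim s xBAD 0 = 0 \<longleftrightarrow> ?a xBAD 0 = 0 \<and> (\<forall>j<?a xNR 0. j = s xCC 0 \<or> (\<exists>k<s xN 0. s xUS k = j))"
    unfolding check_rim_def run.simps(3)
  proof (rule run_check_loop, goal_cases)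
    case (2 k t)
    have fr: "t x = s x" if "x < 60" for x using 2(3)[of x] that by simp
    have "run (search xN (Eq (xUS\<lbrakk>\<langle>xK\<rangle>\<rbrakk>) \<langle>xJ\<rangle>)) t xFND 0 = (if \<exists>i<t xN 0. s xUS i = k then 1 else 0)"
    proof (rule run_search)
      fix i and u :: memory assume u: "u xK 0 = i" "\<And>x. x \<notin> {xFND, xK} \<Longrightarrow> u x = t x"
      show "bval (Eq (xUS\<lbrakk>\<langle>xK\<rangle>\<rbrakk>) \<langle>xJ\<rangle>) u \<longleftrightarrow> s xUS i = k" using u(1) 2(2) by (simp add: u(2) fr)
    qed simp_all
    then show ?case using 2(2) by (auto simp: fr)
  qed simp
  then show ?thesis by (auto simp: good_rim_def)
qed

lemma run_check_nodes: "run check_nodes s xBAD 0 = 0 \<longleftrightarrow> s xBAD 0 = 0 \<and> good_nodes s"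
  unfolding check_nodes_def good_nodes_def
proof (rule run_check_loop, goal_cases)
  case (2 k t)
  have fr: "t x = s x" if "x < 60" for x using 2(3)[of x] that by simp
  let ?a = "run (require (Less (Const 0) (xNC\<lbrakk>\<langle>xJ\<rangle>\<rbrakk>))) t"
  have "run (search xNS (Eq (xOR\<lbrakk>\<langle>xK\<rangle>\<rbrakk>) \<langle>xJ\<rangle>)) ?a xFND 0 = (if \<exists>i<?a xNS 0. s xOR i = k then 1 else 0)"
  proof (rule run_search)
    fix i and u :: memory assume u: "u xK 0 = i" "\<And>x. x \<notin> {xFND, xK} \<Longrightarrow> u x = ?a x"
    show "bval (Eq (xOR\<lbrakk>\<langle>xK\<rangle>\<rbrakk>) \<langle>xJ\<rangle>) u \<longleftrightarrow> s xOR i = k" using u(1) 2(2) by (simp add: u(2) fr)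
  qed simp_all
  then show ?case using 2(2) by (simp add: fr)
qed simp

lemma run_check_edges: "run check_edges s xBAD 0 = 0 \<longleftrightarrow> s xBAD 0 = 0 \<and> good_edges s"
  unfolding check_edges_def good_edges_def
proof (rule run_check_loop, goal_cases)
  case (2 k t)
  have fr: "t x = s x" if "x < 60" for x using 2(3)[of x] that by simp
  let ?a = "run (require (Less (Const 0) (xSC\<lbrakk>\<langle>xJ\<rangle>\<rbrakk>))) t"
  have "run (search xNS1 (Eq (xPE\<lbrakk>\<langle>xK\<rangle>\<rbrakk>) \<langle>xJ\<rangle>)) ?a xFND 0 = (if \<exists>i<?a xNS1 0. s xPE i = k then 1 else 0)"
  proof (rule run_search)
    fix i and u :: memory assume u: "u xK 0 = i" "\<And>x. x \<notin> {xFND, xK} \<Longrightarrow> u x = ?a x"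
    show "bval (Eq (xPE\<lbrakk>\<langle>xK\<rangle>\<rbrakk>) \<langle>xJ\<rangle>) u \<longleftrightarrow> s xPE i = k" using u(1) 2(2) by (simp add: u(2) fr)
  qed simp_all
  then show ?case using 2(2) by (simp add: fr)
qed simp

lemma run_check_parents: "run check_parents s xBAD 0 = 0 \<longleftrightarrow> s xBAD 0 = 0 \<and> good_parents s"
  unfolding check_parents_def good_parents_def
proof (rule run_check_loop, goal_cases)
  case (2 k t)
  have fr: "t x = s x" if "x < 60" for x using 2(3)[of x] that by simp
  let ?c = "And (Less \<langle>xJ\<rangle> \<langle>xK\<rangle>) (Eq (xPA\<lbrakk>\<langle>xJ\<rangle>\<rbrakk>) (xOR\<lbrakk>\<langle>xK\<rangle>\<rbrakk>))"
  have "run (search xNS ?c) t xFND 0 = (if \<exists>i<t xNS 0. k < i \<and> s xPA k = s xOR i then 1 else 0)"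
  proof (rule run_search)
    fix i and u :: memory assume u: "u xK 0 = i" "\<And>x. x \<notin> {xFND, xK} \<Longrightarrow> u x = t x"
    show "bval ?c u \<longleftrightarrow> k < i \<and> s xPA k = s xOR i" using u(1) 2(2) by (simp add: u(2) fr)
  qed simp_all
  then show ?case using 2(2) by (simp add: fr conj_assoc)
qed simp

lemma run_checks: "run checks s xBAD 0 = 0 \<longleftrightarrow> s xBAD 0 = 0 \<and> good s"
proof -
  define a where "a = run check_virtual s"
  define b where "b = run check_rim a"
  define c where "c = run check_nodes b"
  define d where "d = run check_edges c"
  have f: "a x = s x" "b x = s x" "c x = s x" "d x = s x" if "x < 60" for x
    using that by (simp_all add: a_def b_def c_def d_def run_frame)
  have "run checks s xBAD 0 = 0 \<longleftrightarrow> run check_parents d xBAD 0 = 0"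
    by (simp add: checks_def a_def b_def c_def d_def)
  also have "\<dots> \<longleftrightarrow> s xBAD 0 = 0 \<and> good_virtual s \<and> good_rim a \<and> good_nodes b \<and> good_edges c \<and> good_parents d"
    using run_check_virtual[of s] run_check_rim[of a] run_check_nodes[of b] run_check_edges[of c] run_check_parents[of d]
    by (auto simp: a_def b_def c_def d_def)
  also have "\<dots> \<longleftrightarrow> s xBAD 0 = 0 \<and> good s"
    using good_cong(2)[of a s] good_cong(3)[of b s] good_cong(4)[of c s] good_cong(5)[of d s] f
    by (auto simp: good_def)
  finally show ?thesis .
qed


text \<open>Tested before any loop is entered. The length equation bounds all loop bounds linearly
  in the length of the list; otherwise a short list could announce enormous sizes. The other
  equations fix the numbers of edges, so that the later checks may count.\<close>

definition guard :: bexp where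
  "guard = And (Eq \<langle>1\<rangle> (Const 5 \<oplus> \<langle>xMR\<rangle> \<oplus> \<langle>xMR\<rangle> \<oplus> \<langle>xNS\<rangle> \<oplus> \<langle>xNS\<rangle> \<oplus> \<langle>xMS\<rangle> \<oplus> \<langle>xMS\<rangle> \<oplus> \<langle>xMS\<rangle> \<oplus> \<langle>xMS\<rangle>))
     (And (Leq (Const 4) \<langle>xNR\<rangle>) (And (Eq (\<langle>xMR\<rangle> \<oplus> Const 2) (\<langle>xNR\<rangle> \<oplus> \<langle>xNR\<rangle>)) (Eq (\<langle>xMS\<rangle> \<oplus> Const 1) \<langle>xNS\<rangle>)))"

abbreviation budget :: aexp where
  "budget \<equiv> 0\<lbrakk>Const 4 \<oplus> \<langle>xMR\<rangle> \<oplus> \<langle>xMR\<rangle> \<oplus> \<langle>xNS\<rangle> \<oplus> \<langle>xNS\<rangle> \<oplus> \<langle>xMS\<rangle> \<oplus> \<langle>xMS\<rangle> \<oplus> \<langle>xMS\<rangle> \<oplus> \<langle>xMS\<rangle>\<rbrakk>"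

text \<open>\<open>VAL\<close> is the optimal cost plus one, so the comparison with
  \<open>budget + 2\<close> says that the cost is at most the budget.\<close>

definition verdict :: prog where
  "verdict = Cond (And (Eq \<langle>xBAD\<rangle> (Const 0)) (And (Less (Const 0) \<langle>xVAL\<rangle>) (Less \<langle>xVAL\<rangle> (budget \<oplus> Const 2))))
     (0\<lbrakk>Const 0\<rbrakk> ::= Const 1) (0\<lbrakk>Const 0\<rbrakk> ::= Const 0) ;; 1 ::= Const 1"

definition reject :: prog where
  "reject = 0\<lbrakk>Const 0\<rbrakk> ::= Const 0 ;; 1 ::= Const 1"

definition judge :: prog where
  "judge = preprocess ;; checks ;; evaluate ;; verdict"

definition decide :: com where
  "decide = Seq (compile header) (If guard (compile judge) (compile reject))"

text \<open>Every position below the total length belongs to some field of the layout, so the layout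
  determines the list.\<close>

lemma layout_unique:
  assumes "layout f nr mr ns ms eu ev nc nw su sv sc sw" "layout g nr mr ns ms eu ev nc nw su sv sc sw"
    and "i < 4 + 2 * mr + 2 * ns + 4 * ms"
  shows "f i = g i"
proof -
  consider "i = 0" | "i = 1" | j where "j < mr" "i = 2 + 2 * j" | j where "j < mr" "i = 3 + 2 * j"
    | "i = 2 + 2 * mr" | "i = 3 + 2 * mr"
    | j where "j < ns" "i = 4 + 2 * mr + 2 * j" | j where "j < ns" "i = 5 + 2 * mr + 2 * j"
    | j where "j < ms" "i = 4 + 2 * mr + 2 * ns + 4 * j" | j where "j < ms" "i = 5 + 2 * mr + 2 * ns + 4 * j"
    | j where "j < ms" "i = 6 + 2 * mr + 2 * ns + 4 * j" | j where "j < ms" "i = 7 + 2 * mr + 2 * ns + 4 * j"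
  proof -
    have *: "\<exists>j. j < m \<and> (x = 2 * j \<or> x = Suc (2 * j))" if "x < 2 * m" for x m :: nat using that by presburger
    have **: "\<exists>j. j < m \<and> (x = 4 * j \<or> x = Suc (4 * j) \<or> x = 4 * j + 2 \<or> x = 4 * j + 3)" if "x < 4 * m" for x m :: nat
      using that by presburger
    consider "i < 2" | "2 \<le> i" "i < 2 + 2 * mr" | "i = 2 + 2 * mr \<or> i = 3 + 2 * mr"
      | "4 + 2 * mr \<le> i" "i < 4 + 2 * mr + 2 * ns" | "4 + 2 * mr + 2 * ns \<le> i" by linarith
    then show thesis
    proof cases
      case 1 then show thesis using that(1,2) by linarith
    next
      case 2
      then have "i - 2 < 2 * mr" by linarith
      from *[OF this] obtain j where "j < mr" "i - 2 = 2 * j \<or> i - 2 = Suc (2 * j)" by blast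
      then show thesis using that(3)[of j] that(4)[of j] 2 by linarith
    next
      case 3 then show thesis using that(5,6) by blast
    next
      case 4
      then have "i - (4 + 2 * mr) < 2 * ns" by linarith
      from *[OF this] obtain j where "j < ns" "i - (4 + 2 * mr) = 2 * j \<or> i - (4 + 2 * mr) = Suc (2 * j)" by blast
      then show thesis using that(7)[of j] that(8)[of j] 4 by linarith
    next
      case 5
      then have "i - (4 + 2 * mr + 2 * ns) < 4 * ms" using assms(3) by linarith
      from **[OF this] obtain j where "j < ms" "i - (4 + 2 * mr + 2 * ns) = 4 * j \<or> i - (4 + 2 * mr + 2 * ns) = Suc (4 * j) \<or>
          i - (4 + 2 * mr + 2 * ns) = 4 * j + 2 \<or> i - (4 + 2 * mr + 2 * ns) = 4 * j + 3" by blast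
      then show thesis using that(9)[of j] that(10)[of j] that(11)[of j] that(12)[of j] 5 by linarith
    qed
  qed
  then show ?thesis using assms(1,2) unfolding layout_def by cases simp_all
qed

lemma surj_bij:
  assumes "\<And>j. j < m \<Longrightarrow> \<exists>k<m. f k = j"
  shows "bij_betw f {..<m::nat} {..<m}"
proof -
  have "{..<m} \<subseteq> f ` {..<m}" using assms by force
  moreover have "card (f ` {..<m}) \<le> card {..<m}" by (rule card_image_le) simp
  ultimately have "f ` {..<m} = {..<m}" using card_seteq[of "f ` {..<m}" "{..<m}"] by simp
  then show ?thesis by (simp add: bij_betw_def eq_card_imp_inj_on)
qed

lemma judge_complete:
  assumes I: "valid_univne I" "is_wheel (virtual I)" "is_tree (substrate I)" "encodable I er es"
    and xs: "xs = encode_univne I er es @ [\<Gamma>]"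
  defines "s \<equiv> input_memory xs" and "h \<equiv> run header (input_memory xs)" and "c \<equiv> run preprocess (run header (input_memory xs))"
  shows "bval guard h" "good c" "structured I er (card (verts (virtual I)) - 1) (card (verts (substrate I))) c" "aval budget c = \<Gamma>"
proof -
  let ?nr = "card (verts (virtual I))" and ?N = "card (verts (substrate I))"
  define n where "n = ?nr - 1"
  have f: "\<forall>i<length (encode_univne I er es). s 0 i = encode_univne I er es ! i"
    by (simp add: input_memory_def xs s_def nth_append)
  have zero: "\<forall>x\<in>{xDG, xSN, xSD, xSJ, xF}. s x = (\<lambda>_. 0)" by (simp add: input_memory_zero s_def)
  note P = run_preprocess[OF I f zero, unfolded s_def, folded h_def, folded c_def[folded h_def]]
  have c: "c = run preprocess h" by (simp add: c_def h_def)
  show st: "structured I er (?nr - 1) ?N c" using P(1) by (simp add: c)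
  note S = st[folded n_def, unfolded structured_def]
  note Z = structured_sizes[OF st, folded n_def]
  have len: "length er = 2 * n" "length es = ?N - 1"
    using Z I(4) lists_edges_length by (auto simp: encodable_def)
  have nr: "?nr = Suc n" using Z by (auto simp: n_def)
  have hd: "h xNR 0 = Suc n" "h xMR 0 = 2 * n" "h xNS 0 = ?N" "h xMS 0 = ?N - 1"
    using run_header[of "input_memory xs", folded h_def] P(2-4) P(5)[unfolded add.commute[of 3]] len nr
    by (simp_all add: mult_2 [symmetric])
  have L: "input_memory xs 1 0 = 5 + 4 * n + 2 * ?N + 4 * (?N - 1)"
    using encode_layout(1)[of I er es] len by (simp add: input_memory_def xs)
  have h1: "h x = input_memory xs x" if "x < 2" for x using that by (auto simp: h_def run_frame)
  show "bval guard h" using hd L h1[of 1] Z by (simp add: guard_def)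
  have ch: "c x = h x" if "x \<in> {0, xNR, xMR, xNS, xMS, xN, xNS1}" for x
    using that by (auto simp: c preprocess_def parse_def find_wheel_def find_order_def run_frame)
  have "4 + 2 * n + 2 * n + ?N + ?N + (?N - 1) + (?N - 1) + (?N - 1) + (?N - 1) = length (encode_univne I er es)"
    using encode_layout(1)[of I er es] len by simp
  then have "aval budget c = input_memory xs 0 (length (encode_univne I er es))"
    using ch hd h1[of 0] by (simp add: ac_simps)
  then show "aval budget c = \<Gamma>" by (simp add: input_memory_def xs)
  interpret wheel n "c xCC 0" "c xUS" using S by blast
  interpret elimination ?N "c xOR" "c xPA" using S by blast
  have er_map: "er = map (\<lambda>j. (c xEU j, c xEV j)) [0..<c xMR 0]" using S by blast
  have SS: "sized n ?N c" "verts (virtual I) = {..<Suc n}" "lists_edges er (edges (virtual I))"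
    "wheel.V n (c xCC 0) (c xUS) = verts (virtual I)" "wheel.E n (c xCC 0) (c xUS) = edges (virtual I)"
    "verts (substrate I) = {..<?N}" "edges (substrate I) = elimination.tree_edges ?N (c xOR) (c xPA)"
    "\<forall>u<?N. c xNC u = node_cap I u \<and> c xNW u = node_cost I u"
    "\<forall>i. Suc i < ?N \<longrightarrow> c xSC (c xPE i) = edge_cap I {c xOR i, c xPA i} \<and> c xSW (c xPE i) = edge_cost I {c xOR i, c xPA i}"
    using S by blast+
  have VE: "V = {..<Suc n}" "E = edges (virtual I)" using SS(2,4,5) by simp_all
  have sz: "c xNR 0 = Suc n" "c xMR 0 = 2 * n" "c xNS 0 = ?N" "c xMS 0 = ?N - 1" "c xN 0 = n" "c xNS1 0 = ?N - 1"
    using ch hd SS(1) by (simp_all add: sized_def)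
  have er: "er = map (\<lambda>j. (c xEU j, c xEV j)) [0..<2 * n]" using er_map unfolding sz(2) .
  have nth_er: "er ! j = (c xEU j, c xEV j)" if "j < length er" for j using that len(1) by (subst er) simp
  have le: "lists_edges er E" using SS(3) unfolding VE(2) .
  have el: "edge_list (2 * n) (c xEU) (c xEV) E"
    using lists_edges_edge_list[OF le, of "c xEU" "c xEV"] nth_er len(1) by simp
  have inE: "{c xEU j, c xEV j} \<in> E" if "j < 2 * n" for j using el that by (auto simp: edge_list_def)
  have gv: "good_virtual c"
    unfolding good_virtual_def sz
  proof (intro allI impI conjI)
    fix j assume j: "j < 2 * n"
    have "{c xEU j, c xEV j} \<subseteq> {..<Suc n} \<and> card {c xEU j, c xEV j} = 2" using E_edges[OF inE[OF j]] VE by simp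
    then show "c xEU j < Suc n" "c xEV j < Suc n" "c xEU j \<noteq> c xEV j" by auto
    show "\<not> (\<exists>k<2 * n. k < j \<and> {c xEU j, c xEV j} = {c xEU k, c xEV k})"
    proof
      assume "\<exists>k<2 * n. k < j \<and> {c xEU j, c xEV j} = {c xEU k, c xEV k}"
      then obtain k where k: "k < j" "{c xEU j, c xEV j} = {c xEU k, c xEV k}" by blast
      moreover have "inj_on (\<lambda>j. {c xEU j, c xEV j}) {..<2 * n}" using el by (simp add: edge_list_def)
      ultimately have "j = k" using j by (auto dest: inj_onD)
      then show False using k by simp
    qed
    consider i where "i < n" "{c xEU j, c xEV j} = {c xUS i, c xUS (Suc i)}" | i where "i < n" "{c xEU j, c xEV j} = {c xCC 0, c xUS i}"
      using inE[OF j] unfolding E_def by blast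
    then show "c xEU j = c xCC 0 \<or> c xEV j = c xCC 0 \<or> (\<exists>k<n. {c xEU j, c xEV j} = {c xUS k, c xUS (Suc k)})"
    proof cases
      case 1 then show ?thesis by blast
    next
      case 2 then show ?thesis by (auto simp: doubleton_eq_iff)
    qed
  qed
  have gr: "good_rim c"
    unfolding good_rim_def sz using c_V VE(1) r_period by (auto simp: V_def)
  have gn: "good_nodes c"
    unfolding good_nodes_def sz
  proof (intro allI impI conjI)
    fix j assume j: "j < ?N"
    have "j \<in> verts (substrate I)" by (subst SS(6)) (simp add: j)
    then have "1 \<le> node_cap I j" using I(1) by (simp add: valid_univne_def)
    then show "0 < c xNC j" using SS(8) j by simp
    show "\<exists>k<?N. c xOR k = j" using v_surj[OF j] by blast
  qed
  have bij: "bij_betw (c xPE) {..<?N - 1} {..<?N - 1}" using P(6) len(2) by (simp add: c)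
  have ge: "good_edges c"
    unfolding good_edges_def sz
  proof (intro allI impI conjI)
    fix j assume j: "j < ?N - 1"
    have "j \<in> c xPE ` {..<?N - 1}" using bij j by (simp add: bij_betw_def)
    then obtain k where k: "k < ?N - 1" "c xPE k = j" by auto
    then show "\<exists>k<?N - 1. c xPE k = j" by blast
    have "{c xOR k, c xPA k} \<in> edges (substrate I)" using SS(7) k(1) by (auto simp: tree_edges_def)
    then have "1 \<le> edge_cap I {c xOR k, c xPA k}" using I(1) by (simp add: valid_univne_def)
    moreover have "c xSC (c xPE k) = edge_cap I {c xOR k, c xPA k}" using SS(9) k(1) by simp
    ultimately show "0 < c xSC j" using k(2) by simp
  qed
  have gp: "good_parents c"
    unfolding good_parents_def sz
  proof (intro allI impI conjI)
    fix j assume j: "j < ?N - 1"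
    then have "Suc j < ?N" by simp
    then show "\<exists>k<?N. j < k \<and> c xPA j = c xOR k" using later by blast
    show "c xPE j < ?N - 1" using bij j by (auto simp: bij_betw_def)
    show "{c xSU (c xPE j), c xSV (c xPE j)} = {c xOR j, c xPA j}" using P(7)[OF \<open>Suc j < ?N\<close>] by (simp add: c)
  qed
  show "good c" unfolding good_def using gv gr gn ge gp by blast
qed

text \<open>Counting replaces most tests. A rim array of length \<open>n\<close> that covers
  \<open>n\<close> nodes has no repetition; \<open>2 * n\<close> different edges inside a wheel with
  \<open>2 * n\<close> edges are all of its edges; an order of length \<open>N\<close> that reaches
  every node is a bijection. The instance is then read off from the arrays.\<close>

lemma judge_sound:
  fixes xs :: "nat list"
  defines "h \<equiv> run header (input_memory xs)" and "c \<equiv> run preprocess (run header (input_memory xs))"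
  assumes g: "bval guard h" "good c"
  shows "\<exists>I er es n N. valid_univne I \<and> is_wheel (virtual I) \<and> is_tree (substrate I) \<and> encodable I er es \<and>
    xs = encode_univne I er es @ [aval budget c] \<and> structured I er n N c"
proof -
  let ?f = "input_memory xs 0"
  define a where "a = run parse h"
  have c: "c = run find_order (run find_wheel a)" by (simp add: c_def h_def a_def preprocess_def)
  have ca: "c x = a x" if "x \<in> {0, xNR, xMR, xNS, xMS, xR, xM, xN, xNS1, xEU, xEV, xSU, xSV, xSC, xSW, xNC, xNW, xF}" for x
    using that by (auto simp: c find_order_def find_wheel_def run_frame)
  have ah: "a x = h x" if "x \<in> {0, xNR, xMR, xNS, xMS, xN, xNS1, xF}" for x
    using that by (auto simp: a_def parse_def run_frame)
  have hs: "h x = input_memory xs x" if "x < 2 \<or> 9 < x" for x using that by (auto simp: h_def run_frame)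
  have P: "parsed ?f a" unfolding a_def h_def by (rule run_parse)
  define n where "n = c xNR 0 - 1"
  define N where "N = c xNS 0"
  define mr where "mr = c xMR 0"
  define ms where "ms = c xMS 0"
  have G: "4 \<le> c xNR 0" "mr + 2 = c xNR 0 + c xNR 0" "ms + 1 = N" "length xs = 5 + mr + mr + N + N + ms + ms + ms + ms"
    using g(1) hs[of 1] ca ah by (simp_all add: guard_def mr_def ms_def N_def input_memory_def)
  have nr: "c xNR 0 = Suc n" and n3: "3 \<le> n" and mr2: "mr = 2 * n" and N: "0 < N" "ms = N - 1" using G by (auto simp: n_def)
  have sc: "c xM 0 = 2 * c xNR 0" "c xR 0 = 3 * c xNR 0" "c xN 0 = n" "c xNS1 0 = N - 1"
    using P ca by (simp_all add: parsed_def Let_def n_def N_def)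
  have sz: "sized n N c" using sc nr by (simp add: sized_def N_def)
  have lay: "layout ?f (Suc n) mr N ms (c xEU) (c xEV) (c xNC) (c xNW) (c xSU) (c xSV) (c xSC) (c xSW)"
    using parsed_layout[OF P] ca nr by (simp add: mr_def N_def ms_def)
  note good = g(2)[unfolded good_def good_virtual_def good_rim_def good_nodes_def good_edges_def good_parents_def nr sc
      mr_def[symmetric] N_def[symmetric] ms_def[symmetric]]
  let ?cc = "c xCC 0" and ?us = "c xUS"
  have cc: "?cc < Suc n" and period: "?us n = ?us 0" and cover: "\<And>j. j < Suc n \<Longrightarrow> j \<noteq> ?cc \<Longrightarrow> j \<in> ?us ` {..<n}"
    using good by auto
  have sub: "{..<Suc n} - {?cc} \<subseteq> ?us ` {..<n}" using cover by auto
  have cd: "card ({..<Suc n} - {?cc}) = n" using cc by simp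
  have "card (?us ` {..<n}) \<le> n" by (metis card_image_le card_lessThan finite_lessThan)
  \<comment> \<open>\<open>n\<close> positions cover the \<open>n\<close> nodes other than the
    centre, so they hit nothing else; in particular they miss the centre.\<close>
  then have im: "{..<Suc n} - {?cc} = ?us ` {..<n}" using card_seteq[OF _ sub] cd by simp
  have w: "wheel n ?cc ?us"
  proof
    show "3 \<le> n" by (rule n3)
    show "inj_on ?us {..<n}" by (rule eq_card_imp_inj_on) (use im cd in simp_all)
    show "?us n = ?us 0" by (rule period)
    show "?cc \<notin> ?us ` {..<n}" using im by blast
  qed
  then interpret W: wheel n ?cc ?us .
  have V: "W.V = {..<Suc n}" unfolding W.V_def using im cc by auto
  have inE: "{c xEU j, c xEV j} \<in> W.E" if "j < mr" for j
  proof -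
    have j: "c xEU j < Suc n" "c xEV j < Suc n" "c xEU j \<noteq> c xEV j"
      "c xEU j = ?cc \<or> c xEV j = ?cc \<or> (\<exists>k<n. {c xEU j, c xEV j} = {?us k, ?us (Suc k)})"
      using good that by auto
    then consider "c xEU j = ?cc" "c xEV j \<in> ?us ` {..<n}" | "c xEV j = ?cc" "c xEU j \<in> ?us ` {..<n}"
      | k where "k < n" "{c xEU j, c xEV j} = {?us k, ?us (Suc k)}" using cover by metis
    then show ?thesis by cases (auto simp: W.E_def insert_commute)
  qed
  have injE: "inj_on (\<lambda>j. {c xEU j, c xEV j}) {..<mr}"
  proof (rule inj_onI)
    fix j k assume jk: "j \<in> {..<mr}" "k \<in> {..<mr}" "{c xEU j, c xEV j} = {c xEU k, c xEV k}"
    have no: "\<not> (\<exists>k<mr. k < j \<and> {c xEU j, c xEV j} = {c xEU k, c xEV k})" if "j < mr" for j using good that by blast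
    show "j = k" using no[of j] no[of k] jk by (metis lessThan_iff linorder_neqE_nat)
  qed
  have imE: "(\<lambda>j. {c xEU j, c xEV j}) ` {..<mr} = W.E"
  proof (rule card_seteq)
    show "(\<lambda>j. {c xEU j, c xEV j}) ` {..<mr} \<subseteq> W.E" using inE by auto
    show "card W.E \<le> card ((\<lambda>j. {c xEU j, c xEV j}) ` {..<mr})" using injE W.card_E mr2 by (simp add: card_image)
  qed simp
  have par: "(\<exists>k<N. i < k \<and> c xPA i = c xOR k) \<and> c xPE i < ms \<and> {c xSU (c xPE i), c xSV (c xPE i)} = {c xOR i, c xPA i}" if "Suc i < N" for i
    using good that N by simp
  have el: "elimination N (c xOR) (c xPA)"
  proof
    show "0 < N" by (rule N(1))
    show "bij_betw (c xOR) {..<N} {..<N}" by (rule surj_bij) (use good in blast)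
    show "\<exists>k. i < k \<and> k < N \<and> c xPA i = c xOR k" if "Suc i < N" for i using par[OF that] by blast
  qed
  then interpret T: elimination N "c xOR" "c xPA" .
  let ?g = "\<lambda>j. {c xSU j, c xSV j}"
  have PE: "\<exists>k. Suc k < N \<and> c xPE k = j" if "j < ms" for j using good that N(2) by (metis Suc_eq_plus1 less_diff_conv)
  have imT: "?g ` {..<ms} = T.tree_edges"
  proof (intro equalityI subsetI)
    fix e assume "e \<in> ?g ` {..<ms}"
    then obtain j where "j < ms" "e = ?g j" by auto
    then obtain k where "Suc k < N" "e = ?g (c xPE k)" using PE by blast
    then show "e \<in> T.tree_edges" using par by (auto simp: T.tree_edges_def)
  next
    fix e assume "e \<in> T.tree_edges"
    then obtain k where "Suc k < N" "e = {c xOR k, c xPA k}" by (auto simp: T.tree_edges_def)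
    then show "e \<in> ?g ` {..<ms}" using par[of k] by (intro image_eqI[of _ _ "c xPE k"]) auto
  qed
  have injT: "inj_on ?g {..<ms}"
  proof (rule inj_onI)
    fix j j' assume jj: "j \<in> {..<ms}" "j' \<in> {..<ms}" "?g j = ?g j'"
    then obtain k k' where k: "Suc k < N" "c xPE k = j" "Suc k' < N" "c xPE k' = j'" using PE by (meson lessThan_iff)
    then have "{c xOR k, c xPA k} = {c xOR k', c xPA k'}" using par[of k] par[of k'] jj(3) by simp
    then have "k = k'" by (rule T.tree_edge_inj[OF k(1,3)])
    then show "j = j'" using k by simp
  qed
  \<comment> \<open>Edge capacities and costs are functions of edges as sets, while the arrays are
    indexed by edge numbers.\<close>
  let ?inv = "inv_into {..<ms} ?g"
  have inv: "?inv (?g j) = j" if "j < ms" for j using inv_into_f_f[OF injT, of j] that by simp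
  define I where "I = \<lparr>virtual = \<lparr>verts = {..<Suc n}, edges = W.E\<rparr>, substrate = \<lparr>verts = {..<N}, edges = T.tree_edges\<rparr>,
    node_cap = c xNC, edge_cap = (\<lambda>e. c xSC (?inv e)), node_cost = c xNW, edge_cost = (\<lambda>e. c xSW (?inv e))\<rparr>"
  have I: "virtual I = \<lparr>verts = {..<Suc n}, edges = W.E\<rparr>" "substrate I = \<lparr>verts = {..<N}, edges = T.tree_edges\<rparr>"
    "node_cap I = c xNC" "node_cost I = c xNW" "edge_cap I e = c xSC (?inv e)" "edge_cost I e = c xSW (?inv e)" for e
    by (simp_all add: I_def)
  define er where "er = map (\<lambda>j. (c xEU j, c xEV j)) [0..<mr]"
  define es where "es = map (\<lambda>j. (c xSU j, c xSV j)) [0..<ms]"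
  have wheel: "is_wheel (virtual I)" by (rule W.is_wheel_VE) (simp_all add: I V)
  have tree: "is_tree (substrate I)" by (rule T.is_tree_elimination) (simp_all add: I)
  have "simple_graph (virtual I)" "connected_graph (virtual I)" by (rule W.connected_VE; simp add: I V)+
  moreover have "simple_graph (substrate I)" "connected_graph (substrate I)" using tree by (simp_all add: is_tree_def)
  moreover have "1 \<le> node_cap I u" if "u \<in> verts (substrate I)" for u using good that by (simp add: I Suc_le_eq)
  moreover have "1 \<le> edge_cap I e" if "e \<in> edges (substrate I)" for e
  proof -
    have "e \<in> ?g ` {..<ms}" using that imT by (simp add: I)
    then obtain j where "j < ms" "e = ?g j" by auto
    then show ?thesis using good inv by (simp add: I Suc_le_eq)
  qed
  ultimately have valid: "valid_univne I" by (simp add: valid_univne_def)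
  have ler: "lists_edges er W.E"
    using injE imE by (simp add: lists_edges_def er_def comp_def distinct_map lessThan_atLeast0 inj_on_def)
  have les: "lists_edges es T.tree_edges"
    using injT imT by (simp add: lists_edges_def es_def comp_def distinct_map lessThan_atLeast0 inj_on_def)
  have enc: "encodable I er es" using ler les by (simp add: encodable_def I)
  have struct: "structured I er n N c"
  proof -
    have "\<forall>i. Suc i < N \<longrightarrow> c xSC (c xPE i) = edge_cap I {c xOR i, c xPA i} \<and> c xSW (c xPE i) = edge_cost I {c xOR i, c xPA i}"
    proof (intro allI impI)
      fix i assume "Suc i < N"
      from par[OF this] have "?g (c xPE i) = {c xOR i, c xPA i}" "c xPE i < ms" by auto
      then have "?inv {c xOR i, c xPA i} = c xPE i" using inv by metis
      then show "c xSC (c xPE i) = edge_cap I {c xOR i, c xPA i} \<and> c xSW (c xPE i) = edge_cost I {c xOR i, c xPA i}"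
        by (simp add: I)
    qed
    moreover have "c xF = (\<lambda>_. 0)" using ca ah hs[of xF] input_memory_zero[of xF] by simp
    moreover have "er = map (\<lambda>j. (c xEU j, c xEV j)) [0..<c xMR 0]" by (simp add: er_def mr_def)
    ultimately show ?thesis unfolding structured_def using sz ler w V el I by simp
  qed
  have lens: "length er = mr" "length es = ms" by (simp_all add: er_def es_def)
  have "layout ((!) (encode_univne I er es @ [])) (Suc n) mr N ms (c xEU) (c xEV) (c xNC) (c xNW) (c xSU) (c xSV) (c xSC) (c xSW)"
    using encode_layout(2)[of I er es "[]"] inv unfolding layout_def lens by (simp add: I er_def es_def)
  then have eq: "?f i = encode_univne I er es ! i" if "i < 4 + 2 * mr + 2 * N + 4 * ms" for i
    using layout_unique[OF lay _ that] by simp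
  have len: "length (encode_univne I er es) = 4 + 2 * mr + 2 * N + 4 * ms" using encode_layout(1)[of I er es] lens by (simp add: I)
  have "4 + mr + mr + N + N + ms + ms + ms + ms = 4 + 2 * mr + 2 * N + 4 * ms" by simp
  then have b: "aval budget c = xs ! (4 + 2 * mr + 2 * N + 4 * ms)"
    using ca[of 0] ah[of 0] hs[of 0] G(4) by (simp add: mr_def[symmetric] N_def[symmetric] ms_def[symmetric] input_memory_def ac_simps)
  have "xs = encode_univne I er es @ [aval budget c]"
  proof (rule nth_equalityI)
    show "length xs = length (encode_univne I er es @ [aval budget c])" using len G(4) by simp
    fix i assume "i < length xs"
    show "xs ! i = (encode_univne I er es @ [aval budget c]) ! i"
    proof (cases "i < 4 + 2 * mr + 2 * N + 4 * ms")
      case True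
      then show ?thesis using eq[OF True] \<open>i < length xs\<close> by (simp add: nth_append len input_memory_def)
    next
      case False
      then have "i = 4 + 2 * mr + 2 * N + 4 * ms" using \<open>i < length xs\<close> G(4) by linarith
      then show ?thesis unfolding b by (simp add: nth_append len)
    qed
  qed
  then show ?thesis using valid wheel tree enc struct by blast
qed

section \<open>The decision problem is in P\<close>

text \<open>Evaluation takes place even after a failed check. It halts on any memory, and
  \<open>BAD\<close> overrides its result.\<close>

lemma judge_output:
  fixes h :: memory
  assumes bad: "h xBAD 0 = 0"
  defines "c \<equiv> run preprocess h"
  defines "t \<equiv> run evaluate (run checks c)"
  shows "output_list (run judge h) = [if good c \<and> 0 < t xVAL 0 \<and> t xVAL 0 < aval budget c + 2 then 1 else 0]"
proof -
  let ?d = "run checks c"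
  have "c xBAD 0 = 0" using bad by (simp add: c_def preprocess_def parse_def find_wheel_def find_order_def run_frame)
  then have "?d xBAD 0 = 0 \<longleftrightarrow> good c" by (simp add: run_checks)
  moreover have tx: "t x = ?d x" if "x \<in> {0, 1, xBAD, xMR, xNS, xMS}" for x
    using that by (auto simp: t_def evaluate_def run_frame)
  moreover have "?d x = c x" if "x \<in> {0, 1, xMR, xNS, xMS}" for x using that by (auto simp: run_frame)
  moreover have "run judge h = run verdict t" by (simp add: judge_def c_def t_def)
  ultimately show ?thesis by (auto simp: verdict_def output_list_def)
qed

lemma accept_iff:
  fixes xs :: "nat list"
  defines "h \<equiv> run header (input_memory xs)"
  shows "output_list (if bval guard h then run judge h else run reject h) = (if xs \<in> C_uniVNE is_wheel is_tree then [1] else [0])"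
proof -
  define c where "c = run preprocess h"
  define t where "t = run evaluate (run checks c)"
  have bad: "h xBAD 0 = 0" by (simp add: h_def run_frame input_memory_zero)
  have struct: "structured I er n N (run checks c)" if "structured I er n N c" for I er n N
    by (rule structured_cong[OF that]) (simp add: run_frame)
  let ?ok = "bval guard h \<and> good c \<and> 0 < t xVAL 0 \<and> t xVAL 0 < aval budget c + 2"
  have "?ok \<longleftrightarrow> xs \<in> C_uniVNE is_wheel is_tree"
  proof
    assume ok: ?ok
    then obtain I er es n N where I: "valid_univne I" "is_wheel (virtual I)" "is_tree (substrate I)" "encodable I er es"
      "xs = encode_univne I er es @ [aval budget c]" "structured I er n N c"
      using judge_sound[of xs] unfolding c_def h_def by blast
    have "0 < run evaluate (run checks c) xVAL 0" using ok by (simp add: t_def)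
    from run_evaluate(2)[OF struct[OF I(6)] this]
    obtain m where "feasible I m" "mapping_cost I m = t xVAL 0 - 1" unfolding t_def by blast
    then have "\<exists>m. feasible I m \<and> mapping_cost I m \<le> aval budget c" using ok by (intro exI[of _ m]) auto
    then show "xs \<in> C_uniVNE is_wheel is_tree" unfolding C_uniVNE_def using I by blast
  next
    assume "xs \<in> C_uniVNE is_wheel is_tree"
    then obtain I er es \<Gamma> m where I: "valid_univne I" "is_wheel (virtual I)" "is_tree (substrate I)" "encodable I er es"
      and xs: "xs = encode_univne I er es @ [\<Gamma>]" and m: "feasible I m" "mapping_cost I m \<le> \<Gamma>"
      unfolding C_uniVNE_def by blast
    note C = judge_complete[OF I xs, folded h_def, folded c_def]
    have "0 < t xVAL 0 \<and> t xVAL 0 - 1 \<le> mapping_cost I m"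
      unfolding t_def by (rule run_evaluate(1)[OF struct[OF C(3)] m(1)])
    then show ?ok using C m(2) by auto
  qed
  moreover have "output_list (run reject h) = [0]" by (simp add: reject_def output_list_def)
  ultimately show ?thesis using judge_output[of h, OF bad, folded c_def, folded t_def] by auto
qed

lemma judge_wf: "wf_prog judge" "loop_bounds judge \<inter> writes judge = {}"
  by (simp_all add: judge_def solve_defs checks_def check_virtual_def check_rim_def check_nodes_def check_edges_def
      check_parents_def require_def search_def verdict_def)

text \<open>All sizes are now measured by the length of the list alone, so only the depth 3 of the
  nesting counts; the checks contain loops that are quadratic in the size of the tree.\<close>

lemma judge_nest: "nest {xNR, xMR, xR, xN, xNS, xMS, xNS1} {} judge 3 0"
  by (simp add: judge_def solve_defs checks_def check_virtual_def check_rim_def check_nodes_def check_edges_def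
      check_parents_def require_def search_def verdict_def)

lemma reject_wf: "wf_prog reject" "loop_bounds reject \<inter> writes reject = {}" "time_bound reject B = const_size reject"
  by (simp_all add: reject_def)

lemma decide_unit_time:
  "\<exists>t s. exec unit_cost decide (input_memory xs) t s \<and>
    output_list s = (if xs \<in> C_uniVNE is_wheel is_tree then [1] else [0]) \<and>
    t \<le> (const_size header + bsize guard + const_size reject + const_size judge) * (length xs + 1) ^ 3"
proof -
  let ?s = "input_memory xs" and ?L = "length xs + 1"
  let ?h = "run header ?s"
  obtain t1 where t1: "t1 \<le> const_size header" "exec unit_cost (compile header) ?s t1 ?h"
    using exec_compile[OF header_wf(1,2)] header_wf(3) by metis
  define s where "s = (if bval guard ?h then run judge ?h else run reject ?h)"
  have one: "1 \<le> ?L ^ 3" by simp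
  have big: "k \<le> k * ?L ^ 3" for k using mult_le_mono2[OF one, of k] by simp
  have "\<exists>t2 \<le> (bsize guard + const_size reject + const_size judge) * ?L ^ 3.
      exec unit_cost (If guard (compile judge) (compile reject)) ?h t2 s"
  proof (cases "bval guard ?h")
    case True
    have l: "?h 1 0 = length xs" by (simp add: run_frame input_memory_def)
    have g: "length xs = 5 + ?h xMR 0 + ?h xMR 0 + ?h xNS 0 + ?h xNS 0 + ?h xMS 0 + ?h xMS 0 + ?h xMS 0 + ?h xMS 0"
      "?h xMR 0 + 2 = ?h xNR 0 + ?h xNR 0"
      using True l by (simp_all add: guard_def)
    have r: "?h xR 0 = 3 * ?h xNR 0" "?h xN 0 = ?h xNR 0 - 1" "?h xNS1 0 = ?h xNS 0 - 1"
      using run_header[of ?s] by simp_all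
    \<comment> \<open>This is where the guard pays off: the sizes announced in the list are bounded
      by its actual length.\<close>
    have "?h x 0 \<le> 3 * ?L" if "x \<in> {xNR, xMR, xR, xN, xNS, xMS, xNS1}" for x
      using that g r by auto
    then have "time_bound judge (\<lambda>x. ?h x 0) \<le> const_size judge * (?L ^ 3 * 1 ^ 0)"
      by (intro time_bound_nest[OF _ _ _ _ judge_nest]) auto
    then have tb: "time_bound judge (\<lambda>x. ?h x 0) \<le> const_size judge * ?L ^ 3" by simp
    obtain t where t: "t \<le> time_bound judge (\<lambda>x. ?h x 0)" "exec unit_cost (compile judge) ?h t (run judge ?h)"
      using exec_compile[OF judge_wf] by blast
    have "exec unit_cost (If guard (compile judge) (compile reject)) ?h (bsize guard + t) s"
      using exec.IfTrue[where \<mu> = unit_cost, OF True t(2)] True by (simp add: btime_unit s_def)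
    moreover have "bsize guard + t \<le> (bsize guard + const_size reject + const_size judge) * ?L ^ 3"
      using big[of "bsize guard"] tb t(1) unfolding add_mult_distrib by linarith
    ultimately show ?thesis by blast
  next
    case False
    obtain t where t: "t \<le> const_size reject" "exec unit_cost (compile reject) ?h t (run reject ?h)"
      using exec_compile[OF reject_wf(1,2)] reject_wf(3) by metis
    have "exec unit_cost (If guard (compile judge) (compile reject)) ?h (bsize guard + t) s"
      using exec.IfFalse[where \<mu> = unit_cost, OF False t(2)] False by (simp add: btime_unit s_def)
    moreover have "bsize guard + t \<le> (bsize guard + const_size reject + const_size judge) * ?L ^ 3"
      using big[of "bsize guard"] big[of "const_size reject"] t(1) unfolding add_mult_distrib by linarith
    ultimately show ?thesis by blast
  qed
  then obtain t2 where t2: "t2 \<le> (bsize guard + const_size reject + const_size judge) * ?L ^ 3"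
    "exec unit_cost (If guard (compile judge) (compile reject)) ?h t2 s" by blast
  have "t1 + t2 \<le> (const_size header + bsize guard + const_size reject + const_size judge) * ?L ^ 3"
    using big[of "const_size header"] t1(1) t2(1) unfolding add_mult_distrib by linarith
  moreover have "exec unit_cost decide ?s (t1 + t2) s"
    unfolding decide_def by (rule exec.Seq[OF t1(2) t2(2)])
  ultimately show ?thesis using accept_iff[of xs] unfolding s_def by blast
qed

lemma length_le_input_size: "length xs \<le> input_size xs"
  unfolding input_size_def by (induction xs) (auto simp: bit_length_def)

lemma nth_less_input_size: "i < length xs \<Longrightarrow> xs ! i < 2 ^ input_size xs"
proof -
  assume "i < length xs"
  then have "bit_length (xs ! i) \<le> input_size xs"
    unfolding input_size_def by (intro member_le_sum_list) auto
  then have "(2::nat) ^ bit_length (xs ! i) \<le> 2 ^ input_size xs" by simp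
  then show ?thesis using less_power_bit_length[of "xs ! i"] by linarith
qed

lemma input_memory_less: "input_memory xs x i < 2 ^ (input_size xs + k)"
proof -
  have "length xs < 2 ^ input_size xs"
    using length_le_input_size[of xs] less_exp[of "input_size xs"] by linarith
  then have "input_memory xs x i < 2 ^ input_size xs"
    using nth_less_input_size by (auto simp: input_memory_def)
  also have "(2::nat) ^ input_size xs \<le> 2 ^ (input_size xs + k)" by simp
  finally show ?thesis .
qed

text \<open>\<open>in_P\<close> asks for a single number as factor, exponent and additive
  constant.\<close>

lemma polynomial_dominated: "\<exists>k::nat. \<forall>S. D * (S + 1) ^ e \<le> k * S ^ k + k"
proof (intro exI allI)
  \<comment> \<open>\<open>2 ^ e\<close> comes from \<open>S + 1 \<le> 2 * S\<close> for positive
    \<open>S\<close>; for \<open>S = 0\<close> the additive constant does the work.\<close>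
  let ?k = "D * 2 ^ e + e + 1"
  fix S :: nat
  show "D * (S + 1) ^ e \<le> ?k * S ^ ?k + ?k"
  proof (cases "S = 0")
    case True
    have "D * (S + 1) ^ e = D" "D \<le> D * 2 ^ e" using True by simp_all
    then show ?thesis by linarith
  next
    case False
    have "(S + 1) ^ e \<le> (2 * S) ^ e" using False by (intro power_mono) auto
    also have "\<dots> = 2 ^ e * S ^ e" by (simp add: power_mult_distrib)
    also have "\<dots> \<le> 2 ^ e * S ^ ?k" using False by (intro mult_le_mono2 power_increasing) auto
    finally have "D * (S + 1) ^ e \<le> D * (2 ^ e * S ^ ?k)" by (rule mult_le_mono2)
    also have "\<dots> = D * 2 ^ e * S ^ ?k" by simp
    also have "\<dots> \<le> ?k * S ^ ?k" by (rule mult_le_mono1) simp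
    finally show ?thesis by simp
  qed
qed

text \<open>The unit-cost time \<open>t\<close> is cubic in the input size \<open>S\<close>. Numbers
  start with at most \<open>S + M\<close> bits and gain at most \<open>t\<close>, so the bit cost
  \<open>t * (S + M + t)\<close> has order \<open>S ^ 6\<close>.\<close>

lemma wheel_to_tree_in_P: "in_P (C_uniVNE is_wheel is_tree)"
proof -
  define C where "C = const_size header + bsize guard + const_size reject + const_size judge"
  define M where "M = cmax decide"
  obtain k where k: "\<And>S. (C * (1 + M + C)) * (S + 1) ^ 6 \<le> k * S ^ k + k"
    using polynomial_dominated by blast
  have "\<exists>t \<le> k * input_size xs ^ k + k.
     computes_in bit_length decide xs (if xs \<in> C_uniVNE is_wheel is_tree then [1] else [0]) t" for xs
  proof -
    let ?S = "input_size xs"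
    obtain t s where t: "exec unit_cost decide (input_memory xs) t s" "t \<le> C * (length xs + 1) ^ 3"
      and out: "output_list s = (if xs \<in> C_uniVNE is_wheel is_tree then [1] else [0])"
      using decide_unit_time[of xs] unfolding C_def by blast
    \<comment> \<open>\<open>M\<close> additional bits make room for the constants in the program
      text.\<close>
    have "M < 2 ^ M" by (rule less_exp)
    also have "(2::nat) ^ M \<le> 2 ^ (?S + M)" by simp
    finally obtain u where u: "u \<le> t * (?S + M + t)" "exec bit_length decide (input_memory xs) u s"
      using exec_bit[OF t(1) input_memory_less[of xs _ _ M]] unfolding M_def by blast
    have tS: "t \<le> C * (?S + 1) ^ 3"
      using t(2) length_le_input_size[of xs]
      by (meson add_le_mono1 le_trans mult_le_mono2 power_mono zero_le)
    have "?S + 1 \<le> (?S + 1) ^ 3" by (rule self_le_power) auto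
    moreover have "M \<le> M * (?S + 1) ^ 3" by simp
    ultimately have "?S + M + t \<le> (?S + 1) ^ 3 + M * (?S + 1) ^ 3 + C * (?S + 1) ^ 3" using tS by linarith
    also have "\<dots> = (1 + M + C) * (?S + 1) ^ 3" by (simp only: add_mult_distrib mult_1)
    finally have "t * (?S + M + t) \<le> (C * (?S + 1) ^ 3) * ((1 + M + C) * (?S + 1) ^ 3)"
      using tS by (intro mult_le_mono)
    also have "\<dots> = (C * (1 + M + C)) * ((?S + 1) ^ 3 * (?S + 1) ^ 3)" by (simp only: ac_simps)
    also have "(?S + 1) ^ 3 * (?S + 1) ^ 3 = (?S + 1) ^ 6" by (simp flip: power_add)
    finally have "u \<le> k * ?S ^ k + k" using u(1) k[of ?S] by linarith
    then show ?thesis using u(2) out unfolding computes_in_def by blast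
  qed
  then show ?thesis unfolding in_P_def by blast
qed

theorem theorem8:
  shows "in_P (C_uniVNE is_wheel is_tree) \<and>
    (\<exists>c K. \<forall>(I :: (nat, nat) univne) er es.
       valid_univne I \<and> is_wheel (virtual I) \<and> is_tree (substrate I) \<and> encodable I er es \<longrightarrow>
       (\<exists>ys t. computes_in unit_cost c (encode_univne I er es) ys t \<and>
          t \<le> K * (card (verts (virtual I)))\<^sup>2 * card (verts (substrate I)) \<and>
          correct_answer I er ys))"
proof (rule conjI[OF wheel_to_tree_in_P], rule exI[of _ "Seq (compile header) (compile solve)"],
    rule exI[of _ "const_size header + const_size solve"], intro allI impI)
  fix I :: "(nat, nat) univne" and er es
  assume "valid_univne I \<and> is_wheel (virtual I) \<and> is_tree (substrate I) \<and> encodable I er es"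
  then show "\<exists>ys t. computes_in unit_cost (Seq (compile header) (compile solve)) (encode_univne I er es) ys t \<and>
      t \<le> (const_size header + const_size solve) * (card (verts (virtual I)))\<^sup>2 * card (verts (substrate I)) \<and>
      correct_answer I er ys"
    using solve_time by blast
qed

end
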